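(* Let $\Delta_{00},\Delta_{10},\Delta_{01},\Delta_{11}$ be the coefficients of the Dulac map of the hyperbolic saddle of $X_{\hat\mu}$ from $\Sigma_1$ to $\Sigma_2$ (notation in the context). Recall that $D_{10}^0=\frac1{\mathbb N}=\{1/m:m\in\mathbb N\}$, $D_{01}^0=\mathbb N$ and $D_{11}^0=\mathbb N\cup\frac1{\mathbb N}$. The following assertions hold. (a) For any $\hat\mu_0=(\lambda_0,\mu_0)\in D_{10}^0\times W$, the function $\hat\mu\mapsto(\lambda-\lambda_0)\Delta_{10}(\hat\mu)$ extends $C^\infty$ at $\hat\mu=\hat\mu_0$, and if $\lambda_0=\frac1i$ with $i\in\mathbb N$ then $$\lim_{\hat\mu\to\hat\mu_0}(\lambda-\lambda_0)\Delta_{10}(\hat\mu)=-\frac{\Delta_{00}\sigma_{111}\sigma_{120}^i}{L_1(\sigma_{120})\,i^3}\frac{M_1^{(i)}(0)}{i!}\Big|_{\hat\mu=\hat\mu_0}.$$ (b) For any $\hat\mu_0=(\lambda_0,\mu_0)\in D_{01}^0\times W$, the function $\hat\mu\mapsto(\lambda-\lambda_0)\Delta_{01}(\hat\mu)$ extends $C^\infty$ at $\hat\mu=\hat\mu_0$, and if $\lambda_0=i\in\mathbb N$ then $$\lim_{\hat\mu\to\hat\mu_0}(\lambda-\lambda_0)\Delta_{01}(\hat\mu)=-\frac{\Delta_{00}^2\sigma_{221}\sigma_{210}^i}{L_2(\sigma_{210})}\frac{M_2^{(i)}(0)}{i!}\Big|_{\hat\mu=\hat\mu_0}.$$ (c)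 For any $\hat\mu_0=(\lambda_0,\mu_0)\in(D_{11}^0\setminus\{1\})\times W$, the function $\hat\mu\mapsto(\lambda-\lambda_0)\Delta_{11}(\hat\mu)$ extends $C^\infty$ at $\hat\mu=\hat\mu_0$ and (c1) if $\lambda_0=\frac1i$ with $i\in\mathbb N_{\ge2}$ then $\displaystyle\lim_{\hat\mu\to\hat\mu_0}(\lambda-\lambda_0)\Delta_{11}(\hat\mu)=\frac{2\Delta_{00}^2\sigma_{111}\sigma_{120}^i}{L_1(\sigma_{120})\,i^3}\frac{M_1^{(i)}(0)}{i!}S_2\Big|_{\hat\mu=\hat\mu_0}$, (c2) if $\lambda_0=i\in\mathbb N_{\ge2}$ then $\displaystyle\lim_{\hat\mu\to\hat\mu_0}(\lambda-\lambda_0)\Delta_{11}(\hat\mu)=-\frac{2i\Delta_{00}^2\sigma_{221}\sigma_{210}^i}{L_2(\sigma_{210})}\frac{M_2^{(i)}(0)}{i!}S_1\Big|_{\hat\mu=\hat\mu_0}$. Finally, for any $\hat\mu_0=(\lambda_0,\mu_0)\in\{1\}\times W$, the function $\hat\mu\mapsto(\lambda-\lambda_0)^2\Delta_{11}(\hat\mu)$ extends $C^\infty$ at $\hat\mu=\hat\mu_0$ and $$\lim_{\hat\mu\to\hat\mu_0}(\lambda-\lambda_0)^2\Delta_{11}(\hat\mu)=2\Delta_{00}^2\,\frac{\sigma_{111}\sigma_{120}M_1'(0)}{L_1(\sigma_{120})}\,\frac{\sigma_{221}\sigma_{210}M_2'(0)}{L_2(\sigma_{210})}\Big|_{\hat\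mu=\hat\mu_0}.$$
   Context: Setting. $\mathbb N=\{1,2,\dots\}$. $W\subset\mathbb R^N$ is open, $\hat W=(0,+\infty)\times W$, $\hat\mu=(\lambda,\mu)\in\hat W$, $n=(n_1,n_2)\in\mathbb Z_{\ge0}^2$ is fixed, and $$X_{\hat\mu}=\frac{1}{x_1^{n_1}x_2^{n_2}}\big(x_1P_1(x_1,x_2;\hat\mu)\partial_{x_1}+x_2P_2(x_1,x_2;\hat\mu)\partial_{x_2}\big),$$ where $P_1,P_2\in C^\infty(\mathcal U\times\hat W)$ for an open set $\mathcal U\subset\mathbb R^2$ containing the origin, $P_1(x_1,0;\hat\mu)>0$ and $P_2(0,x_2;\hat\mu)<0$ for all $(x_1,0),(0,x_2)\in\mathcal U$, $\hat\mu\in\hat W$, and $\lambda=-P_2(0,0;\hat\mu)/P_1(0,0;\hat\mu)$. For $i=1,2$, $\sigma_i(s;\hat\mu)=(\sigma_{i1}(s;\hat\mu),\sigma_{i2}(s;\hat\mu))$, $(s,\hat\mu)\in(-\varepsilon,\varepsilon)\times\hat W$, is a $C^\infty$ parametrization of a section $\Sigma_i$ transverse to $X_{\hat\mu}$ at the axis $\{x_i=0\}$, with $\sigma_1(0;\hat\mu)\in\{(0,x_2):x_2>0\}$ and $\sigma_2(0;\hat\mu)\in\{(x_1,0):x_1>0\}$, parametrized so that $s>0$ corresponds to the first quadrant, i.e. $\partial_s\sigma_{11}(0;\hat\mu)>0$ and $\partial_s\sigma_{22}(0;\hat\mu)>0$. For some small $\rho>0$, $\mathcal U$ contains $(\{0\}\times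 I_1)\cup(I_2\times\{0\})$ where $I_1=(-\rho,\sigma_{12}(0)+\rho)$ and $I_2=(-\rho,\sigma_{21}(0)+\rho)$. For small $s>0$, the Dulac map $D(s;\hat\mu)$ is defined by the condition that the orbit of $X_{\hat\mu}$ through $\sigma_1(s;\hat\mu)$ next meets $\Sigma_2$ (near the corner formed by the axes) at $\sigma_2(D(s;\hat\mu);\hat\mu)$. Index sets. $\Lambda_0=\mathbb Z_{\ge0}^2$; $D_{ij}^0=\{\lambda>0:\exists(i',j')\in\Lambda_0\setminus\{(i,j)\},\ i+\lambda j=i'+\lambda j'\}$; $\mathcal B_{\lambda,L}^0=\{(i,j)\in\Lambda_0:i+\lambda j\le L\}$; $D_L^0=\{\lambda>0:\exists(i,j)\in\mathcal B^0_{\lambda,L},\ \lambda\in D_{ij}^0\}$. Flat remainders. $\psi(s;\hat\mu)$, smooth for $s>0$ small, belongs to $\mathcal F_L^\infty(\hat\mu_0)$ if for every multi-index $\nu=(\nu_0,\dots,\nu_{N+1})$ there are a neighbourhood $V$ of $\hat\mu_0$ and $C,s_0>0$ with $|\partial_s^{\nu_0}\partial_{\hat\mu}^{(\nu_1,\dots,\nu_{N+1})}\psi(s;\hat\mu)|\le Cs^{L-\nu_0}$ for $s\in(0,s_0)$, $\hat\mu\in V$; $\mathcal F_L^\infty(A)=\bigcap_{\hat\mu_0\in A}\mathcal F_L^\infty(\hat\mu_0)$. Coefficients (known result, taken as given). There exist $\Delta_{ij}\in C^\infty(((0,+\infty)\setminus D_{ij}^0)\times W)$, $(i,j)\in\Lambda_0$,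 such that for all $L>0$, $\lambda_0>0$ with $\lambda_0\notin D^0_{L-\lambda_0}$, $D(s;\hat\mu)=s^\lambda\sum_{(i,j)\in\mathcal B^0_{\lambda_0,L-\lambda_0}}\Delta_{ij}(\hat\mu)s^{i+\lambda j}+\mathcal F_L^\infty(\{\lambda_0\}\times W)$. These expansions determine the coefficients. Moreover $\Delta_{00}>0$ on $\hat W$. Incomplete Mellin transform. For $f$ $C^\infty$ on an open interval $I\ni0$ and $\alpha\in\mathbb R\setminus\mathbb Z_{\ge0}$, $\hat f(\alpha,\cdot)$ is the unique $C^\infty$ function $y$ on $I$ satisfying $xy'(x)-\alpha y(x)=f(x)$. Functions (dependence on $\hat\mu$ omitted): $L_1(u)=\exp\int_0^u\big(\frac{P_1(0,z)}{P_2(0,z)}+\frac1\lambda\big)\frac{dz}{z}$ and $M_1(u)=L_1(u)\,\partial_1\!\big(\frac{P_1}{P_2}\big)(0,u)$ for $u\in I_1$; $L_2(u)=\exp\int_0^u\big(\frac{P_2(z,0)}{P_1(z,0)}+\lambda\big)\frac{dz}{z}$ and $M_2(u)=L_2(u)\,\partial_2\!\big(\frac{P_2}{P_1}\big)(u,0)$ for $u\in I_2$. $M_i^{(k)}$ is the $k$-th derivative in $u$. Also $\sigma_{ijk}(\hat\mu)=\partial_s^k\sigma_{ij}(0;\hat\mu)$ and $$S_1=\frac{\sigma_{112}}{2\sigma_{111}}-\frac{\sigma_{121}}{\sigma_{120}}\Big(\frac{P_1}{P_2}\Big)(0,\sigma_{120})-\frac{\sigma_{111}}{L_1(\sigma_{120})}\hat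 M_1(1/\lambda,\sigma_{120}),\qquad S_2=\frac{\sigma_{222}}{2\sigma_{221}}-\frac{\sigma_{211}}{\sigma_{210}}\Big(\frac{P_2}{P_1}\Big)(\sigma_{210},0)-\frac{\sigma_{221}}{L_2(\sigma_{210})}\hat M_2(\lambda,\sigma_{210}).$$ "Extends $C^\infty$ at $\hat\mu_0$" means that it extends to a $C^\infty$ function on a neighbourhood of $\hat\mu_0$. *)

theory Defs
  imports "HOL-Analysis.Analysis"
begin

text \<open>For open \<open>S\<close> and finite-dimensional domain, the following are the usual classes
  \<open>C\<^sup>k\<close> and \<open>C\<^sup>\<infinity>\<close>.\<close>

primrec Ck_on :: "nat \<Rightarrow> 'a set \<Rightarrow> ('a::real_normed_vector \<Rightarrow> 'b::real_normed_vector) \<Rightarrow> bool" where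
  "Ck_on 0 S f \<longleftrightarrow> continuous_on S f"
| "Ck_on (Suc k) S f \<longleftrightarrow> (\<forall>x\<in>S. f differentiable (at x)) \<and>
     (\<forall>v. Ck_on k S (\<lambda>x. frechet_derivative f (at x) v))"

definition smooth_on :: "'a set \<Rightarrow> ('a::real_normed_vector \<Rightarrow> 'b::real_normed_vector) \<Rightarrow> bool" where
  "smooth_on S f \<longleftrightarrow> (\<forall>k. Ck_on k S f)"

text \<open>The function \<open>f\<close> is only meaningful on \<open>A\<close>; it is compared with the extension there.\<close>

definition extends_smoothly_at ::
    "'a set \<Rightarrow> ('a::real_normed_vector \<Rightarrow> real) \<Rightarrow> 'a \<Rightarrow> bool" where
  "extends_smoothly_at A f p \<longleftrightarrow>
     (\<exists>V g. open V \<and> p \<in> V \<and> smooth_on V g \<and> (\<forall>x\<in>V \<inter> A. g x = f x))"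

primrec partials :: "'a list \<Rightarrow> ('a::real_normed_vector \<Rightarrow> real) \<Rightarrow> 'a \<Rightarrow> real" where
  "partials [] f = f"
| "partials (b # bs) f = (\<lambda>x. frechet_derivative (partials bs f) (at x) b)"

text \<open>Flat remainders. The multi-index in the parameter is given as a list \<open>bs\<close> of coordinate
  directions (with repetitions); the order is immaterial because \<open>\<psi>\<close> is smooth.\<close>

definition flat_at :: "real \<Rightarrow> (real \<times> 'p \<Rightarrow> real) \<Rightarrow> 'p::euclidean_space \<Rightarrow> bool" where
  "flat_at L \<psi> m\<^sub>0 \<longleftrightarrow>
     (\<exists>V s\<^sub>0. open V \<and> m\<^sub>0 \<in> V \<and> 0 < s\<^sub>0 \<and> smooth_on ({0<..<s\<^sub>0} \<times> V) \<psi>) \<and>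
     (\<forall>k bs. set bs \<subseteq> Basis \<longrightarrow>
        (\<exists>V C s\<^sub>0. open V \<and> m\<^sub>0 \<in> V \<and> 0 < C \<and> 0 < s\<^sub>0 \<and>
           (\<forall>s\<in>{0<..<s\<^sub>0}. \<forall>m\<in>V.
              \<bar>partials (replicate k (1, 0) @ map (Pair 0) bs) \<psi> (s, m)\<bar>
                \<le> C * s powr (L - real k))))"

definition flat_on :: "real \<Rightarrow> 'p set \<Rightarrow> (real \<times> 'p::euclidean_space \<Rightarrow> real) \<Rightarrow> bool" where
  "flat_on L A \<psi> \<longleftrightarrow> (\<forall>m\<^sub>0\<in>A. flat_at L \<psi> m\<^sub>0)"

text \<open>\<open>res i j\<close>, \<open>idx l L\<close> and \<open>res_upto L\<close> are the sets usually written
  \<open>D\<^sup>0\<close> (indexed by \<open>i j\<close>), \<open>B\<^sup>0\<close> (indexed by \<open>\<lambda> = l\<close> and \<open>L\<close>) and \<open>D\<^sup>0\<close> (indexed by \<open>L\<close>).\<close>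

definition res :: "nat \<Rightarrow> nat \<Rightarrow> real set" where
  "res i j = {l. 0 < l \<and> (\<exists>i' j'. (i', j') \<noteq> (i, j) \<and>
     real i + l * real j = real i' + l * real j')}"

definition idx :: "real \<Rightarrow> real \<Rightarrow> (nat \<times> nat) set" where
  "idx l L = {(i, j). real i + l * real j \<le> L}"

definition res_upto :: "real \<Rightarrow> real set" where
  "res_upto L = {l. 0 < l \<and> (\<exists>(i, j)\<in>idx l L. l \<in> res i j)}"

type_synonym 'n param = "real \<times> (real ^ 'n)"
type_synonym 'n coef = "real \<times> real \<Rightarrow> 'n param \<Rightarrow> real"
type_synonym 'n sect = "real \<Rightarrow> 'n param \<Rightarrow> real \<times> real"

text \<open>The field without its monomial prefactor; it is defined on the axes as well and spans the
  same direction field, so transversality at the axes refers to it.\<close>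

definition reg_field :: "'n::finite coef \<Rightarrow> 'n coef \<Rightarrow> 'n param \<Rightarrow> real \<times> real \<Rightarrow> real \<times> real" where
  "reg_field P\<^sub>1 P\<^sub>2 m x = (fst x * P\<^sub>1 x m, snd x * P\<^sub>2 x m)"

definition saddle_field ::
    "nat \<times> nat \<Rightarrow> 'n::finite coef \<Rightarrow> 'n coef \<Rightarrow> 'n param \<Rightarrow> real \<times> real \<Rightarrow> real \<times> real" where
  "saddle_field n P\<^sub>1 P\<^sub>2 m x =
     (1 / (fst x ^ fst n * snd x ^ snd n)) *\<^sub>R reg_field P\<^sub>1 P\<^sub>2 m x"

definition transverse_at_axis :: "'n::finite coef \<Rightarrow> 'n coef \<Rightarrow> 'n sect \<Rightarrow> 'n param \<Rightarrow> bool" where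
  "transverse_at_axis P\<^sub>1 P\<^sub>2 \<sigma> m \<longleftrightarrow>
     (let v = vector_derivative (\<lambda>s. \<sigma> s m) (at 0); X = reg_field P\<^sub>1 P\<^sub>2 m (\<sigma> 0 m)
      in fst v * snd X - snd v * fst X \<noteq> 0)"

text \<open>An orbit of the field \<open>X\<close> inside \<open>Q\<close> from \<open>p\<close> to \<open>q\<close> that avoids \<open>S\<close> at all
  intermediate times.\<close>

definition orbit_first_hit ::
    "(real \<times> real \<Rightarrow> real \<times> real) \<Rightarrow> (real \<times> real) set \<Rightarrow> (real \<times> real) set \<Rightarrow>
     real \<times> real \<Rightarrow> real \<times> real \<Rightarrow> bool" where
  "orbit_first_hit X Q S p q \<longleftrightarrow> q \<in> S \<and>
     (\<exists>T \<phi>. 0 < T \<and> \<phi> 0 = p \<and> \<phi> T = q \<and>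
        (\<forall>t\<in>{0..T}. \<phi> t \<in> Q \<and> (\<phi> has_vector_derivative X (\<phi> t)) (at t within {0..T})) \<and>
        (\<forall>t\<in>{0<..<T}. \<phi> t \<notin> S))"

text \<open>The Dulac map as a germ at \<open>s = 0\<close>, locally uniformly in the parameter. The second section
  is cut down to every sufficiently short arc \<open>\<bar>r\<bar> < \<delta>\<close>: a long piece of \<open>\<sigma>\<^sub>2\<close> might bend back and
  meet the orbit before the corner is passed.\<close>

definition is_dulac_map ::
    "(real ^ 'n::finite) set \<Rightarrow> (real \<times> real) set \<Rightarrow> nat \<times> nat \<Rightarrow> 'n coef \<Rightarrow> 'n coef \<Rightarrow>
     'n sect \<Rightarrow> 'n sect \<Rightarrow> (real \<Rightarrow> 'n param \<Rightarrow> real) \<Rightarrow> bool" where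
  "is_dulac_map W U n P\<^sub>1 P\<^sub>2 \<sigma>\<^sub>1 \<sigma>\<^sub>2 D \<longleftrightarrow>
     (\<forall>m\<^sub>0\<in>{0<..} \<times> W. \<forall>\<^sub>F \<delta> in at_right 0. \<forall>\<^sub>F (s, m) in at_right 0 \<times>\<^sub>F nhds m\<^sub>0.
        D s m \<in> {0<..<\<delta>} \<and>
        orbit_first_hit (saddle_field n P\<^sub>1 P\<^sub>2 m) (U \<inter> {0<..} \<times> {0<..})
          ((\<lambda>r. \<sigma>\<^sub>2 r m) ` {-\<delta><..<\<delta>}) (\<sigma>\<^sub>1 s m) (\<sigma>\<^sub>2 (D s m) m))"

text \<open>Incomplete Mellin transform of \<open>f\<close> on \<open>I\<close>, extended by zero outside \<open>I\<close>.\<close>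

definition mellin :: "real set \<Rightarrow> (real \<Rightarrow> real) \<Rightarrow> real \<Rightarrow> real \<Rightarrow> real" where
  "mellin I f \<alpha> = (THE y. smooth_on I y \<and> (\<forall>x\<in>I. x * deriv y x - \<alpha> * y x = f x) \<and>
     (\<forall>x. x \<notin> I \<longrightarrow> y x = 0))"

text \<open>The \<open>k\<close>-th \<open>s\<close>-derivative at \<open>0\<close> of a component (\<open>c = fst\<close> or \<open>c = snd\<close>) of a section;
  for instance \<open>\<sigma>\<^sub>1\<^sub>2\<^sub>0 = dsec snd 0 \<sigma>\<^sub>1\<close>.\<close>

definition dsec :: "(real \<times> real \<Rightarrow> real) \<Rightarrow> nat \<Rightarrow> 'n::finite sect \<Rightarrow> 'n param \<Rightarrow> real" where
  "dsec c k \<sigma> m = (deriv ^^ k) (\<lambda>s. c (\<sigma> s m)) 0"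

definition I\<^sub>1 :: "real \<Rightarrow> 'n::finite sect \<Rightarrow> 'n param \<Rightarrow> real set" where
  "I\<^sub>1 \<rho> \<sigma>\<^sub>1 m = {-\<rho><..<dsec snd 0 \<sigma>\<^sub>1 m + \<rho>}"

definition I\<^sub>2 :: "real \<Rightarrow> 'n::finite sect \<Rightarrow> 'n param \<Rightarrow> real set" where
  "I\<^sub>2 \<rho> \<sigma>\<^sub>2 m = {-\<rho><..<dsec fst 0 \<sigma>\<^sub>2 m + \<rho>}"

definition L\<^sub>1 :: "'n::finite coef \<Rightarrow> 'n coef \<Rightarrow> 'n param \<Rightarrow> real \<Rightarrow> real" where
  "L\<^sub>1 P\<^sub>1 P\<^sub>2 m u = exp (LBINT z=0..u. (P\<^sub>1 (0, z) m / P\<^sub>2 (0, z) m + 1 / fst m) / z)"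

definition M\<^sub>1 :: "'n::finite coef \<Rightarrow> 'n coef \<Rightarrow> 'n param \<Rightarrow> real \<Rightarrow> real" where
  "M\<^sub>1 P\<^sub>1 P\<^sub>2 m u = L\<^sub>1 P\<^sub>1 P\<^sub>2 m u * deriv (\<lambda>x. P\<^sub>1 (x, u) m / P\<^sub>2 (x, u) m) 0"

definition L\<^sub>2 :: "'n::finite coef \<Rightarrow> 'n coef \<Rightarrow> 'n param \<Rightarrow> real \<Rightarrow> real" where
  "L\<^sub>2 P\<^sub>1 P\<^sub>2 m u = exp (LBINT z=0..u. (P\<^sub>2 (z, 0) m / P\<^sub>1 (z, 0) m + fst m) / z)"

definition M\<^sub>2 :: "'n::finite coef \<Rightarrow> 'n coef \<Rightarrow> 'n param \<Rightarrow> real \<Rightarrow> real" where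
  "M\<^sub>2 P\<^sub>1 P\<^sub>2 m u = L\<^sub>2 P\<^sub>1 P\<^sub>2 m u * deriv (\<lambda>x. P\<^sub>2 (u, x) m / P\<^sub>1 (u, x) m) 0"

definition S\<^sub>1 :: "real \<Rightarrow> 'n::finite coef \<Rightarrow> 'n coef \<Rightarrow> 'n sect \<Rightarrow> 'n param \<Rightarrow> real" where
  "S\<^sub>1 \<rho> P\<^sub>1 P\<^sub>2 \<sigma>\<^sub>1 m =
     (let a = dsec snd 0 \<sigma>\<^sub>1 m in
        dsec fst 2 \<sigma>\<^sub>1 m / (2 * dsec fst 1 \<sigma>\<^sub>1 m)
        - dsec snd 1 \<sigma>\<^sub>1 m / a * (P\<^sub>1 (0, a) m / P\<^sub>2 (0, a) m)
        - dsec fst 1 \<sigma>\<^sub>1 m / L\<^sub>1 P\<^sub>1 P\<^sub>2 m a * mellin (I\<^sub>1 \<rho> \<sigma>\<^sub>1 m) (M\<^sub>1 P\<^sub>1 P\<^sub>2 m) (1 / fst m) a)"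

definition S\<^sub>2 :: "real \<Rightarrow> 'n::finite coef \<Rightarrow> 'n coef \<Rightarrow> 'n sect \<Rightarrow> 'n param \<Rightarrow> real" where
  "S\<^sub>2 \<rho> P\<^sub>1 P\<^sub>2 \<sigma>\<^sub>2 m =
     (let a = dsec fst 0 \<sigma>\<^sub>2 m in
        dsec snd 2 \<sigma>\<^sub>2 m / (2 * dsec snd 1 \<sigma>\<^sub>2 m)
        - dsec fst 1 \<sigma>\<^sub>2 m / a * (P\<^sub>2 (a, 0) m / P\<^sub>1 (a, 0) m)
        - dsec snd 1 \<sigma>\<^sub>2 m / L\<^sub>2 P\<^sub>1 P\<^sub>2 m a * mellin (I\<^sub>2 \<rho> \<sigma>\<^sub>2 m) (M\<^sub>2 P\<^sub>1 P\<^sub>2 m) (fst m) a)"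

end

theory Submission
  imports Defs
begin

text \<open>For irrational \<open>\<lambda>\<close> the field has approximate first integrals \<open>x powr \<lambda> * y * exp g\<close> of any order along
  the axes, since there are no resonances. Being almost conserved along
  the passage near the corner, such an integral gives \<open>ln D + G\<^sub>2 D = \<lambda> * ln s + G\<^sub>1 s\<close> up to any order,
  where \<open>G\<^sub>1\<close> and \<open>G\<^sub>2\<close> are smooth with derivatives \<open>\<lambda> S\<^sub>1\<close> and \<open>S\<^sub>2\<close> at \<open>0\<close>. Comparison with the
  expansion of \<open>D\<close> yields \<open>\<Delta>\<^sub>1\<^sub>0 = \<lambda> \<Delta>\<^sub>0\<^sub>0 S\<^sub>1\<close>, \<open>\<Delta>\<^sub>0\<^sub>1 = - \<Delta>\<^sub>0\<^sub>0\<^sup>2 S\<^sub>2\<close> and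
  \<open>\<Delta>\<^sub>1\<^sub>1 = - 2 \<lambda> \<Delta>\<^sub>0\<^sub>0\<^sup>2 S\<^sub>1 S\<^sub>2\<close>, by density for all nonresonant \<open>\<lambda>\<close>. The poles of \<open>S\<^sub>1\<close> and \<open>S\<^sub>2\<close> are
  those of the Mellin transforms: the Taylor coefficient of \<open>f\<close> of order \<open>i\<close> enters \<open>mellin I f \<alpha>\<close>
  divided by \<open>i - \<alpha>\<close>.\<close>

section \<open>Smooth functions\<close>

text \<open>The time an orbit spends near the corner is unbounded as s tends to 0, so bounding the
  error of an approximate integral pointwise and multiplying by the time is useless. Let z =
  \<theta> ln x + ln y + g with \<theta> = \<lambda>, and let the error be x^K y^J e. In the
  derivative of exp (- J z) the powers of y cancel and only x powr (K - \<theta> J) is left, up to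
  bounded factors and a change of time. If K > \<theta> J, this is dominated by the derivative of a
  function that stays bounded along the orbit, whatever the time. Hence z changes by O(exp (J z)),
  that is O(s powr (\<theta> J)), and J is free.

  The orbit defining the Dulac map is only known to run in \<open>U\<close> and to meet a short arc
  of the second section at its end. That it stays close to the axes must be proved together with the
  estimate that relies on it.

  The numbers \<open>S\<^sub>1\<close> and \<open>S\<^sub>2\<close> come from the derivative of g
  across an axis. It satisfies a linear equation along that axis, which multiplication by L turns
  into the Mellin equation, and a smooth solution of the latter is unique.\<close>

lemma frechet_derivative_eqI:
  "(f has_derivative f') (at x) \<Longrightarrow> frechet_derivative f (at x) = f'"
  by (metis frechet_derivative_at)

lemma differentiable_cong_open:
  assumes "open S" "x \<in> S" "\<And>y. y \<in> S \<Longrightarrow> f y = g y"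
  shows "f differentiable (at x) \<longleftrightarrow> g differentiable (at x)"
  by (metis assms differentiable_def has_derivative_transform_within_open)

lemma frechet_derivative_cong_open:
  assumes "open S" "x \<in> S" "\<And>y. y \<in> S \<Longrightarrow> f y = g y"
  shows "frechet_derivative f (at x) = frechet_derivative g (at x)"
proof -
  have "(f has_derivative f') (at x) \<longleftrightarrow> (g has_derivative f') (at x)" for f'
    by (metis assms has_derivative_transform_within_open)
  then show ?thesis by (simp add: frechet_derivative_def)
qed

lemma Ck_on_cong:
  assumes "open S" "\<And>x. x \<in> S \<Longrightarrow> f x = g x"
  shows "Ck_on k S f \<longleftrightarrow> Ck_on k S g"
  using assms(2)
proof (induction k arbitrary: f g)
  case 0
  then show ?case by (auto cong: continuous_on_cong)
next
  case (Suc k)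
  have "Ck_on k S (\<lambda>x. frechet_derivative f (at x) v) \<longleftrightarrow> Ck_on k S (\<lambda>x. frechet_derivative g (at x) v)" for v
    by (rule Suc.IH) (metis frechet_derivative_cong_open[OF assms(1)] Suc.prems)
  moreover have "(\<forall>x\<in>S. f differentiable (at x)) \<longleftrightarrow> (\<forall>x\<in>S. g differentiable (at x))"
    using differentiable_cong_open[OF assms(1)] Suc.prems by blast
  ultimately show ?case by simp
qed

lemma Ck_on_SucD: "Ck_on (Suc k) S f \<Longrightarrow> Ck_on k S f"
proof (induction k arbitrary: f)
  case 0
  then show ?case
    by (auto intro!: continuous_at_imp_continuous_on differentiable_imp_continuous_within)
next
  case (Suc k)
  then show ?case by (metis Ck_on.simps(2))
qed

lemma Ck_on_subset: "Ck_on k S f \<Longrightarrow> T \<subseteq> S \<Longrightarrow> Ck_on k T f"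
  by (induction k arbitrary: f) (auto intro: continuous_on_subset)

lemma smooth_on_cong:
  "open S \<Longrightarrow> (\<And>x. x \<in> S \<Longrightarrow> f x = g x) \<Longrightarrow> smooth_on S f \<longleftrightarrow> smooth_on S g"
  unfolding smooth_on_def using Ck_on_cong by blast

lemma smooth_on_subset: "smooth_on S f \<Longrightarrow> T \<subseteq> S \<Longrightarrow> smooth_on T f"
  unfolding smooth_on_def using Ck_on_subset by blast

lemma smooth_on_iff:
  "smooth_on S f \<longleftrightarrow> (\<forall>x\<in>S. f differentiable (at x)) \<and>
     (\<forall>v. smooth_on S (\<lambda>x. frechet_derivative f (at x) v))"
proof
  assume f: "smooth_on S f"
  then have "Ck_on (Suc k) S f" for k unfolding smooth_on_def by blast
  then show "(\<forall>x\<in>S. f differentiable (at x)) \<and>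
     (\<forall>v. smooth_on S (\<lambda>x. frechet_derivative f (at x) v))"
    unfolding smooth_on_def by simp
next
  assume "(\<forall>x\<in>S. f differentiable (at x)) \<and>
     (\<forall>v. smooth_on S (\<lambda>x. frechet_derivative f (at x) v))"
  then have "Ck_on (Suc k) S f" for k unfolding smooth_on_def by simp
  then show "smooth_on S f" unfolding smooth_on_def using Ck_on_SucD by blast
qed

text \<open>\<open>frechet_derivative\<close> is a choice, so concrete calculations use an explicit
  derivative instead; openness of \<open>S\<close> makes the two interchangeable at every
  order.\<close>

lemma Ck_on_SucI:
  assumes "open S" "\<And>x. x \<in> S \<Longrightarrow> (f has_derivative f' x) (at x)" "\<And>v. Ck_on k S (\<lambda>x. f' x v)"
  shows "Ck_on (Suc k) S f"
proof -
  have "Ck_on k S (\<lambda>x. frechet_derivative f (at x) v) \<longleftrightarrow> Ck_on k S (\<lambda>x. f' x v)" for v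
    by (rule Ck_on_cong[OF assms(1)]) (simp add: frechet_derivative_eqI[OF assms(2)])
  moreover have "f differentiable (at x)" if "x \<in> S" for x
    using assms(2)[OF that] differentiable_def by blast
  ultimately show ?thesis using assms(3) by simp
qed

lemma smooth_onI:
  assumes "open S" "\<And>x. x \<in> S \<Longrightarrow> (f has_derivative f' x) (at x)" "\<And>v. smooth_on S (\<lambda>x. f' x v)"
  shows "smooth_on S f"
proof -
  have "Ck_on k S f" for k
    using Ck_on_SucI[OF assms(1,2)] Ck_on_SucD assms(3) unfolding smooth_on_def by blast
  then show ?thesis unfolding smooth_on_def by blast
qed

lemma smooth_on_differentiable: "smooth_on S f \<Longrightarrow> x \<in> S \<Longrightarrow> f differentiable (at x)"
  by (subst (asm) smooth_on_iff) simp

lemma smooth_on_has_derivative: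
  "smooth_on S f \<Longrightarrow> x \<in> S \<Longrightarrow> (f has_derivative frechet_derivative f (at x)) (at x)"
  using smooth_on_differentiable frechet_derivative_works by blast

lemma smooth_on_dir: "smooth_on S f \<Longrightarrow> smooth_on S (\<lambda>x. frechet_derivative f (at x) v)"
  by (subst (asm) smooth_on_iff) simp

lemma smooth_on_continuous: "smooth_on S f \<Longrightarrow> continuous_on S f"
  unfolding smooth_on_def by (metis Ck_on.simps(1))

lemma smooth_on_isCont: "smooth_on S f \<Longrightarrow> x \<in> S \<Longrightarrow> isCont f x"
  using smooth_on_differentiable differentiable_imp_continuous_within by blast

text \<open>Coinductive in spirit: if all directional derivatives of members of \<open>F\<close>
  stay in \<open>F\<close>, the argument can be repeated forever. This avoids closed formulas for
  iterated derivatives of \<open>exp\<close> and \<open>inverse\<close>.\<close>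

lemma smooth_on_coinduct:
  assumes S: "open S" and f: "f \<in> F"
    and diff: "\<And>g x. g \<in> F \<Longrightarrow> x \<in> S \<Longrightarrow> g differentiable (at x)"
    and dir: "\<And>g v. g \<in> F \<Longrightarrow> \<exists>h\<in>F. \<forall>x\<in>S. frechet_derivative g (at x) v = h x"
  shows "smooth_on S f"
proof -
  have "\<forall>g\<in>F. Ck_on k S g" for k
  proof (induction k)
    case 0
    then show ?case
      using diff by (auto intro!: continuous_at_imp_continuous_on differentiable_imp_continuous_within)
  next
    case (Suc k)
    show ?case
    proof
      fix g assume g: "g \<in> F"
      have "Ck_on k S (\<lambda>x. frechet_derivative g (at x) v)" for v
        using dir[OF g, of v] Ck_on_cong[OF S, of "\<lambda>x. frechet_derivative g (at x) v"] Suc by metis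
      then show "Ck_on (Suc k) S g" using diff[OF g] by simp
    qed
  qed
  then show ?thesis using f unfolding smooth_on_def by blast
qed

section \<open>Closure properties of smooth functions\<close>

named_theorems smooth_intros

lemma smooth_on_const [smooth_intros]: "smooth_on S (\<lambda>x. c)"
proof -
  have "Ck_on k S (\<lambda>x. c)" for k c
    by (induction k arbitrary: c) (auto simp: frechet_derivative_const)
  then show ?thesis unfolding smooth_on_def by blast
qed

lemma smooth_on_bounded_linear:
  assumes "bounded_linear h"
  shows "smooth_on S h"
proof -
  have d: "(h has_derivative h) (at x)" for x
    using assms by (rule bounded_linear_imp_has_derivative)
  show ?thesis
    using d smooth_on_const
    by (subst smooth_on_iff) (simp add: frechet_derivative_eqI[OF d] differentiable_def, blast)
qed

lemma smooth_on_id [smooth_intros]: "smooth_on S (\<lambda>x. x)"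
  by (rule smooth_on_bounded_linear[OF bounded_linear_ident])

lemma Ck_on_bounded_linear_comp:
  assumes "open S" "bounded_linear h" "Ck_on k S f"
  shows "Ck_on k S (\<lambda>x. h (f x))"
  using assms(3)
proof (induction k arbitrary: f)
  case 0
  then show ?case
    using assms(2) by (auto intro: bounded_linear.continuous_on)
next
  case (Suc k)
  have d: "((\<lambda>x. h (f x)) has_derivative (\<lambda>v. h (frechet_derivative f (at x) v))) (at x)" if "x \<in> S" for x
    by (rule bounded_linear.has_derivative[OF assms(2)])
      (use Suc.prems that frechet_derivative_works in auto)
  show ?case
    by (rule Ck_on_SucI[OF assms(1) d]) (use Suc in auto)
qed

lemma smooth_on_bounded_linear_comp:
  "open S \<Longrightarrow> bounded_linear h \<Longrightarrow> smooth_on S f \<Longrightarrow> smooth_on S (\<lambda>x. h (f x))"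
  unfolding smooth_on_def using Ck_on_bounded_linear_comp by blast

lemma Ck_on_add:
  assumes "open S" "Ck_on k S f" "Ck_on k S g"
  shows "Ck_on k S (\<lambda>x. f x + g x)"
  using assms(2,3)
proof (induction k arbitrary: f g)
  case 0
  then show ?case by (auto intro: continuous_on_add)
next
  case (Suc k)
  have d: "((\<lambda>x. f x + g x) has_derivative
      (\<lambda>v. frechet_derivative f (at x) v + frechet_derivative g (at x) v)) (at x)" if "x \<in> S" for x
    by (rule has_derivative_add; rule frechet_derivative_works[THEN iffD1]) (use Suc.prems that in auto)
  show ?case
    by (rule Ck_on_SucI[OF assms(1) d]) (use Suc in auto)
qed

lemma Ck_on_mult:
  fixes f g :: "'a::real_normed_vector \<Rightarrow> real"
  assumes "open S" "Ck_on k S f" "Ck_on k S g"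
  shows "Ck_on k S (\<lambda>x. f x * g x)"
  using assms(2,3)
proof (induction k arbitrary: f g)
  case 0
  then show ?case by (auto intro: continuous_on_mult)
next
  case (Suc k)
  have d: "((\<lambda>x. f x * g x) has_derivative
      (\<lambda>v. f x * frechet_derivative g (at x) v + frechet_derivative f (at x) v * g x)) (at x)" if "x \<in> S" for x
    by (rule has_derivative_mult; rule frechet_derivative_works[THEN iffD1]) (use Suc.prems that in auto)
  have "Ck_on k S (\<lambda>x. f x * frechet_derivative g (at x) v + frechet_derivative f (at x) v * g x)" for v
  proof -
    have "Ck_on k S (\<lambda>x. f x * frechet_derivative g (at x) v)"
      by (rule Suc.IH) (use Suc.prems Ck_on_SucD in auto)
    moreover have "Ck_on k S (\<lambda>x. frechet_derivative f (at x) v * g x)"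
      by (rule Suc.IH) (use Suc.prems Ck_on_SucD in auto)
    ultimately show ?thesis
      using Ck_on_add[OF assms(1)] by blast
  qed
  then show ?case using Ck_on_SucI[OF assms(1) d] by blast
qed

lemma smooth_on_add [smooth_intros]:
  "open S \<Longrightarrow> smooth_on S f \<Longrightarrow> smooth_on S g \<Longrightarrow> smooth_on S (\<lambda>x. f x + g x)"
  unfolding smooth_on_def using Ck_on_add by blast

lemma smooth_on_mult [smooth_intros]:
  fixes f g :: "'a::real_normed_vector \<Rightarrow> real"
  shows "open S \<Longrightarrow> smooth_on S f \<Longrightarrow> smooth_on S g \<Longrightarrow> smooth_on S (\<lambda>x. f x * g x)"
  unfolding smooth_on_def using Ck_on_mult by blast

lemma smooth_on_uminus [smooth_intros]:
  "open S \<Longrightarrow> smooth_on S f \<Longrightarrow> smooth_on S (\<lambda>x. - f x)"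
  by (rule smooth_on_bounded_linear_comp[OF _ bounded_linear_minus[OF bounded_linear_ident]])

lemma smooth_on_diff [smooth_intros]:
  "open S \<Longrightarrow> smooth_on S f \<Longrightarrow> smooth_on S g \<Longrightarrow> smooth_on S (\<lambda>x. f x - g x)"
  using smooth_on_add[of S f "\<lambda>x. - g x"] smooth_on_uminus[of S g] by simp

lemma smooth_on_sum [smooth_intros]:
  "open S \<Longrightarrow> (\<And>i. i \<in> A \<Longrightarrow> smooth_on S (f i)) \<Longrightarrow> smooth_on S (\<lambda>x. \<Sum>i\<in>A. f i x)"
  by (induction A rule: infinite_finite_induct) (simp_all add: smooth_on_const smooth_on_add)

lemma smooth_on_power [smooth_intros]:
  fixes f :: "'a::real_normed_vector \<Rightarrow> real"
  shows "open S \<Longrightarrow> smooth_on S f \<Longrightarrow> smooth_on S (\<lambda>x. f x ^ k)"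
  by (induction k) (simp_all add: smooth_on_const smooth_on_mult)

lemma smooth_on_fst [smooth_intros]: "open S \<Longrightarrow> smooth_on S f \<Longrightarrow> smooth_on S (\<lambda>x. fst (f x))"
  by (rule smooth_on_bounded_linear_comp[OF _ bounded_linear_fst])

lemma smooth_on_snd [smooth_intros]: "open S \<Longrightarrow> smooth_on S f \<Longrightarrow> smooth_on S (\<lambda>x. snd (f x))"
  by (rule smooth_on_bounded_linear_comp[OF _ bounded_linear_snd])

lemma smooth_on_Pair [smooth_intros]:
  assumes "open S" "smooth_on S f" "smooth_on S g"
  shows "smooth_on S (\<lambda>x. (f x, g x))"
proof -
  have "smooth_on S (\<lambda>x. (f x, 0))"
    by (rule smooth_on_bounded_linear_comp[OF assms(1) _ assms(2)])
      (auto intro: bounded_linear_intros)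
  moreover have "smooth_on S (\<lambda>x. (0, g x))"
    by (rule smooth_on_bounded_linear_comp[OF assms(1) _ assms(3)])
      (auto intro: bounded_linear_intros)
  ultimately have "smooth_on S (\<lambda>x. (f x, 0) + (0, g x))"
    using smooth_on_add[OF assms(1)] by blast
  then show ?thesis by simp
qed

lemma Ck_on_compose:
  fixes f :: "'b::euclidean_space \<Rightarrow> real" and g :: "'a::real_normed_vector \<Rightarrow> 'b"
  assumes "open S" "open T" "\<And>x. x \<in> S \<Longrightarrow> g x \<in> T" "smooth_on S g" "Ck_on k T f"
  shows "Ck_on k S (\<lambda>x. f (g x))"
  using assms(5)
proof (induction k arbitrary: f)
  case 0
  then show ?case
    using continuous_on_compose2[of T f S g] smooth_on_continuous[OF assms(4)] assms(3) by auto
next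
  case (Suc k)
  let ?d = "\<lambda>x v. frechet_derivative f (at (g x)) (frechet_derivative g (at x) v)"
  have df: "(f has_derivative frechet_derivative f (at (g x))) (at (g x))" if "x \<in> S" for x
    using Suc.prems that assms(3) frechet_derivative_works by (metis Ck_on.simps(2))
  have d: "((\<lambda>x. f (g x)) has_derivative ?d x) (at x)" if "x \<in> S" for x
    using diff_chain_at[OF smooth_on_has_derivative[OF assms(4) that] df[OF that]]
    by (simp add: o_def)
  have "Ck_on k S (\<lambda>x. ?d x v)" for v
  proof -
    \<comment> \<open>The direction in which \<open>f\<close> is differentiated moves with
      \<open>x\<close>, whereas the induction hypothesis covers derivatives of \<open>f\<close> in
      fixed directions. Expanding in \<open>Basis\<close> separates the two into a sum of
      products.\<close>
    have eq: "?d x v = (\<Sum>b\<in>Basis. (frechet_derivative g (at x) v \<bullet> b) * frechet_derivative f (at (g x)) b)"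
      if "x \<in> S" for x
    proof -
      interpret linear "frechet_derivative f (at (g x))"
        using df[OF that] has_derivative_linear by blast
      have "?d x v = frechet_derivative f (at (g x)) (\<Sum>b\<in>Basis. (frechet_derivative g (at x) v \<bullet> b) *\<^sub>R b)"
        by (simp add: euclidean_representation)
      then show ?thesis by (simp add: sum scaleR)
    qed
    have "Ck_on k S (\<lambda>x. (frechet_derivative g (at x) v \<bullet> b) * frechet_derivative f (at (g x)) b)"
      for b
    proof (rule Ck_on_mult[OF assms(1)])
      show "Ck_on k S (\<lambda>x. frechet_derivative g (at x) v \<bullet> b)"
        using smooth_on_bounded_linear_comp[OF assms(1) bounded_linear_inner_left smooth_on_dir[OF assms(4)]]
        unfolding smooth_on_def by blast
      show "Ck_on k S (\<lambda>x. frechet_derivative f (at (g x)) b)"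
        by (rule Suc.IH) (use Suc.prems in auto)
    qed
    then have "Ck_on k S (\<lambda>x. \<Sum>b\<in>B. (frechet_derivative g (at x) v \<bullet> b) * frechet_derivative f (at (g x)) b)" for B
    proof (induction B rule: infinite_finite_induct)
      case (insert b B)
      then show ?case using Ck_on_add[OF assms(1)] by auto
    qed (use smooth_on_const smooth_on_def in fastforce)+
    then show ?thesis
      using Ck_on_cong[OF assms(1) eq] by simp
  qed
  then show ?case using Ck_on_SucI[OF assms(1) d] by blast
qed

lemma smooth_on_compose:
  fixes f :: "'b::euclidean_space \<Rightarrow> real" and g :: "'a::real_normed_vector \<Rightarrow> 'b"
  assumes "smooth_on T f" "open T" "open S" "smooth_on S g" "\<And>x. x \<in> S \<Longrightarrow> g x \<in> T"
  shows "smooth_on S (\<lambda>x. f (g x))"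
  using Ck_on_compose[OF assms(3,2,5,4)] assms(1) unfolding smooth_on_def by blast

section \<open>Exponential, reciprocal and logarithm\<close>

lemma smooth_on_exp_UNIV: "smooth_on UNIV (exp :: real \<Rightarrow> real)"
proof (rule smooth_on_coinduct[where F = "range (\<lambda>c x. c * exp x)"])
  show "exp \<in> range (\<lambda>c x::real. c * exp x)"
    by (rule range_eqI[of _ _ 1]) auto
next
  fix g x assume "g \<in> range (\<lambda>c x::real. c * exp x)"
  then show "g differentiable (at x)"
    unfolding image_iff real_differentiable_def by (auto intro: DERIV_cmult[OF DERIV_exp])
next
  fix g and v :: real assume "g \<in> range (\<lambda>c x::real. c * exp x)"
  then obtain c where g: "g = (\<lambda>x. c * exp x)" by auto
  have "(g has_derivative (\<lambda>v. (c * v) * exp x)) (at x)" for x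
    unfolding g by (auto intro!: derivative_eq_intros)
  then have "frechet_derivative g (at x) v = (c * v) * exp x" for x
    using frechet_derivative_eqI by metis
  then show "\<exists>h\<in>range (\<lambda>c x::real. c * exp x). \<forall>x\<in>UNIV. frechet_derivative g (at x) v = h x"
    by (intro bexI[of _ "\<lambda>x. (c * v) * exp x"]) auto
qed auto

lemma smooth_on_inverse_UNIV: "smooth_on (- {0}) (inverse :: real \<Rightarrow> real)"
proof (rule smooth_on_coinduct[where F = "range (\<lambda>(c, k) x. c * inverse x ^ k)"])
  show "inverse \<in> range (\<lambda>(c, k) x::real. c * inverse x ^ k)"
    by (rule range_eqI[of _ _ "(1, 1)"]) auto
next
  fix g x assume "g \<in> range (\<lambda>(c, k) x::real. c * inverse x ^ k)" "x \<in> - {0::real}"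
  then show "g differentiable (at x)" by (auto intro!: derivative_intros)
next
  fix g and v :: real assume "g \<in> range (\<lambda>(c, k) x::real. c * inverse x ^ k)"
  then obtain c k where g: "g = (\<lambda>x. c * inverse x ^ k)" by auto
  have *: "inverse x * (inverse x * inverse x ^ (k - Suc 0)) * real k = real k * inverse x ^ Suc k" for x :: real
    by (cases k) auto
  have d: "(g has_derivative (\<lambda>v. - (c * v * real k) * inverse x ^ Suc k)) (at x)" if "x \<noteq> 0" for x
    unfolding g
    by (rule derivative_eq_intros refl that)+ (use * in \<open>auto simp: algebra_simps\<close>)
  show "\<exists>h\<in>range (\<lambda>(c, k) x::real. c * inverse x ^ k). \<forall>x\<in>- {0}. frechet_derivative g (at x) v = h x"
    by (rule bexI[of _ "\<lambda>x. - (c * v * real k) * inverse x ^ Suc k"],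
        use frechet_derivative_eqI[OF d] in simp,
        rule range_eqI[of _ _ "(- (c * v * real k), Suc k)"], simp)
qed auto

lemma smooth_on_ln_UNIV: "smooth_on {0<..} (ln :: real \<Rightarrow> real)"
proof -
  have d: "(ln has_derivative (\<lambda>v. inverse x * v)) (at x)" if "x \<in> {0<..}" for x :: real
    using that by (auto intro!: derivative_eq_intros simp: field_simps)
  have "smooth_on {0<..} (\<lambda>x::real. inverse x * v)" for v
    by (intro smooth_intros smooth_on_subset[OF smooth_on_inverse_UNIV]) auto
  then show ?thesis
    using smooth_onI[OF open_greaterThan d] by blast
qed

lemma smooth_on_exp [smooth_intros]:
  fixes f :: "'a::real_normed_vector \<Rightarrow> real"
  shows "open S \<Longrightarrow> smooth_on S f \<Longrightarrow> smooth_on S (\<lambda>x. exp (f x))"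
  using smooth_on_compose[OF smooth_on_exp_UNIV] by auto

lemma smooth_on_divide [smooth_intros]:
  fixes f g :: "'a::real_normed_vector \<Rightarrow> real"
  assumes "open S" "smooth_on S f" "smooth_on S g" "\<And>x. x \<in> S \<Longrightarrow> g x \<noteq> 0"
  shows "smooth_on S (\<lambda>x. f x / g x)"
proof -
  have "smooth_on S (\<lambda>x. inverse (g x))"
    using smooth_on_compose[OF smooth_on_inverse_UNIV _ assms(1,3)] assms(4) by auto
  then show ?thesis
    using smooth_on_mult[OF assms(1,2)] by (simp add: divide_inverse)
qed

lemma smooth_on_ln [smooth_intros]:
  fixes f :: "'a::real_normed_vector \<Rightarrow> real"
  assumes "open S" "smooth_on S f" "\<And>x. x \<in> S \<Longrightarrow> f x > 0"
  shows "smooth_on S (\<lambda>x. ln (f x))"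
  using smooth_on_compose[OF smooth_on_ln_UNIV _ assms(1,2)] assms(3) by auto

section \<open>Ordinary derivatives along coordinate lines\<close>

lemma smooth_on_deriv:
  fixes f :: "real \<Rightarrow> real"
  assumes "smooth_on S f" "x \<in> S"
  shows "(f has_real_derivative deriv f x) (at x)" "frechet_derivative f (at x) v = deriv f x * v"
proof -
  show d: "(f has_real_derivative deriv f x) (at x)"
    using smooth_on_differentiable[OF assms] DERIV_deriv_iff_real_differentiable by blast
  show "frechet_derivative f (at x) v = deriv f x * v"
    using frechet_derivative_eqI[OF d[unfolded has_field_derivative_def]] by simp
qed

lemma smooth_on_deriv_smooth:
  fixes f :: "real \<Rightarrow> real"
  assumes "open S" "smooth_on S f"
  shows "smooth_on S (deriv f)"
  using smooth_on_cong[OF assms(1), of "\<lambda>x. frechet_derivative f (at x) 1" "deriv f"]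
    smooth_on_deriv(2)[OF assms(2)] smooth_on_dir[OF assms(2)] by auto

text \<open>The bridge between calculus in one variable and iterated directional derivatives:
  equations along axes and orbits are checked on slices, smoothness is proved jointly in all
  variables.\<close>

lemma has_derivative_slice_fst:
  fixes f :: "real \<times> 'p::real_normed_vector \<Rightarrow> real"
  assumes "smooth_on S f" "(u, m) \<in> S"
  shows "((\<lambda>x. f (x, m)) has_real_derivative frechet_derivative f (at (u, m)) (1, 0)) (at u)"
proof -
  have d: "(f has_derivative frechet_derivative f (at (u, m))) (at (u, m))"
    using smooth_on_has_derivative[OF assms] .
  have "((\<lambda>x. (x, m)) has_derivative (\<lambda>v. (v, 0))) (at u)"
    by (auto intro!: derivative_eq_intros)
  from diff_chain_at[OF this d]
  have "((\<lambda>x. f (x, m)) has_derivative (\<lambda>v. frechet_derivative f (at (u, m)) (v, 0))) (at u)"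
    by (simp add: o_def)
  moreover have "(\<lambda>v. frechet_derivative f (at (u, m)) (v, 0)) = (*) (frechet_derivative f (at (u, m)) (1, 0))" (is "?L = ?R")
  proof
    fix v
    show "?L v = ?R v"
      using linear_cmul[OF has_derivative_linear[OF d], of v "(1, 0)"]
      by (simp only: scaleR_Pair real_scaleR_def scaleR_zero_right mult_1_right mult_1_left mult.commute[of v])
  qed
  ultimately show ?thesis
    unfolding has_field_derivative_def by simp
qed

lemma has_derivative_slice_snd:
  fixes f :: "'p::real_normed_vector \<times> real \<Rightarrow> real"
  assumes "smooth_on S f" "(m, u) \<in> S"
  shows "((\<lambda>x. f (m, x)) has_real_derivative frechet_derivative f (at (m, u)) (0, 1)) (at u)"
proof -
  have d: "(f has_derivative frechet_derivative f (at (m, u))) (at (m, u))"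
    using smooth_on_has_derivative[OF assms] .
  have "((\<lambda>x. (m, x)) has_derivative (\<lambda>v. (0, v))) (at u)"
    by (auto intro!: derivative_eq_intros)
  from diff_chain_at[OF this d]
  have "((\<lambda>x. f (m, x)) has_derivative (\<lambda>v. frechet_derivative f (at (m, u)) (0, v))) (at u)"
    by (simp add: o_def)
  moreover have "(\<lambda>v. frechet_derivative f (at (m, u)) (0, v)) = (*) (frechet_derivative f (at (m, u)) (0, 1))" (is "?L = ?R")
  proof
    fix v
    show "?L v = ?R v"
      using linear_cmul[OF has_derivative_linear[OF d], of v "(0, 1)"]
      by (simp only: scaleR_Pair real_scaleR_def scaleR_zero_right mult_1_right mult_1_left mult.commute[of v])
  qed
  ultimately show ?thesis
    unfolding has_field_derivative_def by simp
qed

section \<open>Integrals depending on parameters\<close>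

text \<open>\<open>f m t\<close> is \<open>C\<^sup>k\<close> in the parameter \<open>m\<close>, with derivatives jointly continuous up to the end
  points of the integration interval; no differentiability in \<open>t\<close> is required.\<close>

primrec param_Ck :: "nat \<Rightarrow> 'a set \<Rightarrow> ('a::real_normed_vector \<Rightarrow> real \<Rightarrow> real) \<Rightarrow> bool" where
  "param_Ck 0 S f \<longleftrightarrow> continuous_on (S \<times> {0..1}) (\<lambda>(m, t). f m t)"
| "param_Ck (Suc k) S f \<longleftrightarrow> continuous_on (S \<times> {0..1}) (\<lambda>(m, t). f m t) \<and>
     (\<exists>f'. (\<forall>m\<in>S. \<forall>t\<in>{0..1}. ((\<lambda>m. f m t) has_derivative f' m t) (at m)) \<and>
       (\<forall>v. param_Ck k S (\<lambda>m t. f' m t v)))"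

lemma param_Ck_continuous: "param_Ck k S f \<Longrightarrow> continuous_on (S \<times> {0..1}) (\<lambda>(m, t). f m t)"
  by (cases k) auto

text \<open>\<open>leibniz_rule\<close> asks for a derivative that is continuous as a map into
  bounded linear functions. In finite dimension it is enough to have continuity on each basis
  vector, which is what \<open>param_Ck\<close> supplies.\<close>

lemma has_derivative_integral_param:
  fixes f :: "'a::euclidean_space \<Rightarrow> real \<Rightarrow> real"
  assumes S: "open S" "m \<in> S"
    and f: "continuous_on (S \<times> {0..1}) (\<lambda>(m, t). f m t)"
    and d: "\<And>m t. m \<in> S \<Longrightarrow> t \<in> {0..1} \<Longrightarrow> ((\<lambda>m. f m t) has_derivative f' m t) (at m)"
    and f': "\<And>v. continuous_on (S \<times> {0..1}) (\<lambda>(m, t). f' m t v)"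
  shows "((\<lambda>m. integral {0..1} (f m)) has_derivative (\<lambda>v. integral {0..1} (\<lambda>t. f' m t v))) (at m)"
proof -
  obtain e where e: "e > 0" "ball m e \<subseteq> S" using S open_contains_ball by blast
  define F where "F m t = Blinfun (f' m t)" for m t
  have F: "blinfun_apply (F m t) = f' m t" if "m \<in> S" "t \<in> {0..1}" for m t
    unfolding F_def using bounded_linear_Blinfun_apply has_derivative_bounded_linear[OF d[OF that]] by blast
  have cF: "continuous_on (ball m e \<times> cbox 0 1) (\<lambda>(m, t). F m t)"
  proof (rule continuous_on_blinfun_componentwise)
    fix i :: 'a assume "i \<in> Basis"
    have "continuous_on (ball m e \<times> cbox 0 1) (\<lambda>(m, t). f' m t i)"
      by (rule continuous_on_subset[OF f'[of i]]) (use e in auto)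
    then show "continuous_on (ball m e \<times> cbox 0 1) (\<lambda>x. blinfun_apply (case x of (m, t) \<Rightarrow> F m t) i)"
      by (rule continuous_on_eq) (use F e in auto)
  qed
  have int: "continuous_on {0..1} (f m)" if "m \<in> S" for m
  proof -
    have "continuous_on {0..1} (\<lambda>t::real. (m, t))"
      by (rule continuous_on_Pair[OF continuous_on_const continuous_on_id])
    from continuous_on_compose2[OF f this] that show ?thesis by auto
  qed
  have "((\<lambda>m. integral (cbox 0 1) (f m)) has_derivative integral (cbox 0 1) (F m)) (at m within ball m e)"
  proof (rule leibniz_rule[OF _ _ cF])
    fix m' t assume *: "m' \<in> ball m e" "t \<in> cbox 0 (1::real)"
    then have "m' \<in> S" "t \<in> {0..1}" using e by auto
    then show "((\<lambda>m. f m t) has_derivative blinfun_apply (F m' t)) (at m' within ball m e)"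
      using F[of m' t] d[of m' t] by (auto intro: has_derivative_at_withinI)
  next
    fix m' assume "m' \<in> ball m e"
    then show "f m' integrable_on cbox 0 1"
      using int[of m'] e integrable_continuous_interval by (auto simp: subset_eq)
  qed (use e in auto)
  moreover have "at m within ball m e = at m" 
    by (rule at_within_open) (use e in auto)
  moreover have "blinfun_apply (integral (cbox 0 1) (F m)) = (\<lambda>v. integral {0..1} (\<lambda>t. f' m t v))"
  proof
    fix v
    have "continuous_on (cbox 0 1) (F m)"
    proof -
      have "continuous_on (cbox 0 1) (\<lambda>t::real. (m, t))"
        by (rule continuous_on_Pair[OF continuous_on_const continuous_on_id])
      moreover have "Pair m ` cbox 0 (1::real) \<subseteq> ball m e \<times> cbox 0 1" using e by auto
      ultimately show ?thesis using continuous_on_compose2[OF cF] by fastforce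
    qed
    then have "blinfun_apply (integral (cbox 0 1) (F m)) v = integral (cbox 0 1) (\<lambda>t. blinfun_apply (F m t) v)"
      by (rule blinfun_apply_integral[OF integrable_continuous])
    also have "\<dots> = integral {0..1} (\<lambda>t. f' m t v)"
      using F[OF S(2)] by (auto intro!: integral_cong)
    finally show "blinfun_apply (integral (cbox 0 1) (F m)) v = integral {0..1} (\<lambda>t. f' m t v)" .
  qed
  ultimately show ?thesis by simp
qed

lemma Ck_on_integral_param:
  fixes f :: "'a::euclidean_space \<Rightarrow> real \<Rightarrow> real"
  assumes "open S" "param_Ck k S f"
  shows "Ck_on k S (\<lambda>m. integral {0..1} (f m))"
  using assms(2)
proof (induction k arbitrary: f)
  case 0
  then show ?case
    using integral_continuous_on_param[of S 0 1 f] by simp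
next
  case (Suc k)
  then obtain f' where d: "\<And>m t. m \<in> S \<Longrightarrow> t \<in> {0..1} \<Longrightarrow> ((\<lambda>m. f m t) has_derivative f' m t) (at m)"
    and f': "\<And>v. param_Ck k S (\<lambda>m t. f' m t v)" and c: "continuous_on (S \<times> {0..1}) (\<lambda>(m, t). f m t)"
    unfolding param_Ck.simps by blast
  show ?case
    by (rule Ck_on_SucI[OF assms(1) has_derivative_integral_param[OF assms(1) _ c d]])
      (use f' param_Ck_continuous Suc.IH in blast)+
qed

lemma param_Ck_add:
  assumes "param_Ck k S f" "param_Ck k S g"
  shows "param_Ck k S (\<lambda>m t. f m t + g m t)"
  using assms
proof (induction k arbitrary: f g)
  case 0
  then show ?case by (auto simp: split_beta intro!: continuous_intros)
next
  case (Suc k)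
  from Suc.prems obtain f' g' where
    d: "\<And>m t. m \<in> S \<Longrightarrow> t \<in> {0..1} \<Longrightarrow> ((\<lambda>m. f m t) has_derivative f' m t) (at m)"
      "\<And>m t. m \<in> S \<Longrightarrow> t \<in> {0..1} \<Longrightarrow> ((\<lambda>m. g m t) has_derivative g' m t) (at m)"
    and f': "\<And>v. param_Ck k S (\<lambda>m t. f' m t v)" "\<And>v. param_Ck k S (\<lambda>m t. g' m t v)"
    unfolding param_Ck.simps by blast
  have "\<exists>h. (\<forall>m\<in>S. \<forall>t\<in>{0..1}. ((\<lambda>m. f m t + g m t) has_derivative h m t) (at m)) \<and>
       (\<forall>v. param_Ck k S (\<lambda>m t. h m t v))"
    by (rule exI[of _ "\<lambda>m t v. f' m t v + g' m t v"]) (use d f' Suc.IH has_derivative_add in blast)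
  moreover have "continuous_on (S \<times> {0..1}) (\<lambda>(m, t). f m t + g m t)"
    using Suc.prems by (auto simp: split_beta intro!: continuous_intros)
  ultimately show ?case by simp
qed

lemma smooth_on_imp_param_Ck:
  fixes H :: "'a::euclidean_space \<times> real \<Rightarrow> real"
  assumes "S \<times> {0..1} \<subseteq> T" "smooth_on T H"
  shows "param_Ck k S (\<lambda>m t. H (m, t))"
  using assms(2)
proof (induction k arbitrary: H)
  case 0
  then show ?case
    using continuous_on_subset[OF smooth_on_continuous assms(1)] by auto
next
  case (Suc k)
  have c: "continuous_on (S \<times> {0..1}) (\<lambda>(m, t). H (m, t))"
    using continuous_on_subset[OF smooth_on_continuous assms(1)] Suc.prems by auto
  have d: "((\<lambda>m. H (m, t)) has_derivative (\<lambda>v. frechet_derivative H (at (m, t)) (v, 0))) (at m)"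
    if "m \<in> S" "t \<in> {0..1}" for m t
  proof -
    have d: "(H has_derivative frechet_derivative H (at (m, t))) (at (m, t))"
      by (rule smooth_on_has_derivative[OF Suc.prems]) (use that assms(1) in auto)
    have "((\<lambda>x. (x, t)) has_derivative (\<lambda>v. (v, 0))) (at m)"
      by (auto intro!: derivative_eq_intros)
    from diff_chain_at[OF this d] show ?thesis by (simp add: o_def)
  qed
  show ?case
    unfolding param_Ck.simps
    by (intro conjI c exI[of _ "\<lambda>m t v. frechet_derivative H (at (m, t)) (v, 0)"])
      (use d Suc.IH[OF smooth_on_dir[OF Suc.prems]] in auto)
qed

section \<open>Integrands with a weight t powr \<beta> and logarithms\<close>

lemma powr_mult_ln_power_le:
  fixes t c :: real
  assumes "0 < t" "t \<le> 1" "0 < c" "c \<le> b"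
  shows "\<bar>t powr b * ln t ^ j\<bar> \<le> (2 * (real j + 1) / c) ^ j * t powr (c / 2)"
proof -
  \<comment> \<open>Each of the \<open>j\<close> logarithms costs a power \<open>a\<close> of
    \<open>t\<close>; with this \<open>a\<close> at most half of the exponent \<open>c\<close> is
    spent. The summand 1 keeps the quotient meaningful for \<open>j = 0\<close>.\<close>
  define a where "a = c / (2 * (real j + 1))"
  have a: "a > 0" "c - a * j \<ge> c / 2" unfolding a_def using assms by (auto simp: field_simps)
  have "\<bar>ln t\<bar> = ln (1 / t)" using assms by (simp add: ln_div)
  also have "\<dots> \<le> (1 / t) powr a / a"
    using assms a by (intro ln_powr_bound) auto
  also have "\<dots> = t powr (- a) / a" using assms by (simp add: powr_divide powr_minus_divide)
  finally have "\<bar>ln t\<bar> ^ j \<le> (t powr (- a) / a) ^ j" by (intro power_mono) auto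
  also have "\<dots> = t powr (- (a * j)) * (1 / a) ^ j"
    using assms by (simp add: power_divide powr_realpow[symmetric] powr_powr)
  finally have 1: "\<bar>ln t\<bar> ^ j \<le> t powr (- (a * j)) * (1 / a) ^ j" .
  have "\<bar>t powr b * ln t ^ j\<bar> \<le> t powr c * (t powr (- (a * j)) * (1 / a) ^ j)"
    unfolding abs_mult power_abs using 1 assms
    by (intro mult_mono) (auto intro: powr_mono')
  also have "\<dots> = t powr (c - a * j) * (1 / a) ^ j"
    by (simp add: powr_add[symmetric])
  also have "\<dots> \<le> t powr (c / 2) * (1 / a) ^ j"
    using a assms by (intro mult_right_mono powr_mono') auto
  finally show ?thesis by (simp add: a_def mult.commute)
qed

lemma continuous_on_powr_mult_ln_power:
  "continuous_on ({0<..} \<times> {0..1}) (\<lambda>(b::real, t::real). t powr b * ln t ^ j)"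
proof -
  have "continuous (at (b, t) within {0<..} \<times> {0..1}) (\<lambda>(b, t). t powr b * ln t ^ j)"
    if b: "0 < b" and t: "0 \<le> t" "t \<le> 1" for b t :: real
  proof (cases "t = 0")
    case False
    then have "isCont (\<lambda>x. snd x powr fst x * ln (snd x) ^ j) (b, t)"
      using t by (intro continuous_intros) auto
    then have "isCont (\<lambda>(b, t). t powr b * ln t ^ j) (b, t)"
      by (simp add: case_prod_beta')
    then show ?thesis using continuous_at_imp_continuous_at_within by blast
  next
    case True
    \<comment> \<open>At \<open>t = 0\<close> the function is 0 because \<open>0 powr b = 0\<close>.
      The exponent varies too, so the bound must be uniform; it is taken for all exponents above
      \<open>b / 2\<close>.\<close>
    define K where "K = (2 * (real j + 1) / (b / 2)) ^ j"
    let ?F = "at (b, t) within {0<..} \<times> {0..1}"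
    have K: "K \<ge> 0" unfolding K_def using b by (intro zero_le_power) auto
    have "(fst \<longlongrightarrow> b) ?F" using tendsto_fst[OF tendsto_ident_at, of "(b, t)"] by simp
    then have ev: "\<forall>\<^sub>F x in ?F. b / 2 < fst x"
      by (rule order_tendstoD(1)) (use b in auto)
    have "\<forall>\<^sub>F x in ?F. x \<in> {0<..} \<times> {0..1}"
      by (simp add: eventually_at_filter)
    with ev have "\<forall>\<^sub>F x in ?F. norm (case x of (b, t) \<Rightarrow> t powr b * ln t ^ j) \<le> K * snd x powr (b / 2 / 2)"
    proof eventually_elim
      case (elim x)
      then show ?case
        using powr_mult_ln_power_le[of "snd x" "b / 2" "fst x" j] b K
        by (cases "snd x = 0") (auto simp: split_beta K_def)
    qed
    moreover have "((\<lambda>x. K * snd x powr (b / 2 / 2)) \<longlongrightarrow> 0) ?F"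
    proof -
      have "((\<lambda>x. K * snd x powr (b / 2 / 2)) \<longlongrightarrow> K * 0 powr (b / 2 / 2)) ?F"
      proof (intro tendsto_mult tendsto_const tendsto_powr')
        show "(snd \<longlongrightarrow> 0) ?F" using tendsto_snd[OF tendsto_ident_at, of "(b, t)"] True by simp
        have "\<forall>\<^sub>F x in ?F. x \<in> {0<..} \<times> {0..1}"
          by (simp add: eventually_at_filter)
        then have "\<forall>\<^sub>F x in ?F. 0 \<le> snd x"
          by (rule eventually_mono) auto
        then show "(0::real) \<noteq> 0 \<or> 0 < b / 2 / 2 \<and> (\<forall>\<^sub>F x in ?F. 0 \<le> snd x)"
          using b by simp
      qed
      then show ?thesis by simp
    qed
    ultimately have "((\<lambda>(b, t). t powr b * ln t ^ j) \<longlongrightarrow> 0) ?F"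
      by (rule Lim_null_comparison)
    then show ?thesis using True by (simp add: continuous_within)
  qed
  then show ?thesis
    by (auto simp: continuous_on_eq_continuous_within)
qed

text \<open>Differentiating the weight in the parameter produces one more logarithm and a factor
  from \<beta>, which is absorbed into \<open>H\<close>. So the induction must let \<open>j\<close>,
  \<open>H\<close> and its domain vary; at \<open>t = 0\<close> all these functions are 0 and
  nothing blows up.\<close>

lemma param_Ck_powr:
  fixes H :: "'a::euclidean_space \<times> real \<Rightarrow> real"
  assumes "open S" "open T" "S \<times> {0..1} \<subseteq> T" "smooth_on T H" "smooth_on S \<beta>" "\<And>m. m \<in> S \<Longrightarrow> \<beta> m > 0"
  shows "param_Ck k S (\<lambda>m t. t powr \<beta> m * ln t ^ j * H (m, t))"
proof -
  have cw: "continuous_on (S \<times> {0..1}) (\<lambda>x. snd x powr \<beta> (fst x) * ln (snd x) ^ j)" for j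
  proof -
    have "continuous_on (S \<times> {0..1}) (\<lambda>x. \<beta> (fst x))"
      by (rule continuous_on_compose2[OF smooth_on_continuous[OF assms(5)] continuous_on_fst[OF continuous_on_id]]) auto
    then have "continuous_on (S \<times> {0..1}) (\<lambda>x. (\<beta> (fst x), snd x))"
      by (intro continuous_on_Pair continuous_on_snd continuous_on_id)
    moreover have "(\<lambda>x. (\<beta> (fst x), snd x)) ` (S \<times> {0..1}) \<subseteq> {0<..} \<times> {0..1}"
      using assms(6) by auto
    ultimately show ?thesis
      using continuous_on_compose2[OF continuous_on_powr_mult_ln_power[of j]] by fastforce
  qed
  have cH: "continuous_on (S \<times> {0..1}) (\<lambda>(m, t). t powr \<beta> m * ln t ^ j * H (m, t))"
    if "S \<times> {0..1} \<subseteq> T" "smooth_on T H" for j H T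
    using continuous_on_mult[OF cw[of j] continuous_on_subset[OF smooth_on_continuous[OF that(2)] that(1)]]
    by (simp add: case_prod_beta')
  show ?thesis
    using assms(2-4)
  proof (induction k arbitrary: H j T)
    case 0
    then show ?case using cH by simp
  next
    case (Suc k)
    let ?h = "\<lambda>m t v. t powr \<beta> m * ln t ^ Suc j * (frechet_derivative \<beta> (at m) v * H (m, t)) +
      t powr \<beta> m * ln t ^ j * frechet_derivative H (at (m, t)) (v, 0)"
    have d: "((\<lambda>m. t powr \<beta> m * ln t ^ j * H (m, t)) has_derivative ?h m t) (at m)"
      if "m \<in> S" "t \<in> {0..1}" for m t
    proof -
      have "(m, t) \<in> T" using that Suc.prems(2) by auto
      then have dH: "(H has_derivative frechet_derivative H (at (m, t))) (at (m, t))"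
        by (rule smooth_on_has_derivative[OF Suc.prems(3)])
      have "((\<lambda>x. (x, t)) has_derivative (\<lambda>v. (v, 0))) (at m)"
        by (auto intro!: derivative_eq_intros)
      from diff_chain_at[OF this dH]
      have dH: "((\<lambda>m. H (m, t)) has_derivative (\<lambda>v. frechet_derivative H (at (m, t)) (v, 0))) (at m)"
        by (simp add: o_def)
      have db: "(\<beta> has_derivative frechet_derivative \<beta> (at m)) (at m)"
        by (rule smooth_on_has_derivative[OF assms(5) that(1)])
      show ?thesis
      proof (cases "t = 0")
        case True
        then show ?thesis by simp
      next
        case False
        then have t: "t > 0" using that by auto
        have "((\<lambda>m. exp (\<beta> m * ln t) * ln t ^ j * H (m, t)) has_derivative
          (\<lambda>v. exp (\<beta> m * ln t) * ln t ^ Suc j * (frechet_derivative \<beta> (at m) v * H (m, t)) +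
            exp (\<beta> m * ln t) * ln t ^ j * frechet_derivative H (at (m, t)) (v, 0))) (at m)"
          by (rule derivative_eq_intros db dH refl)+ (simp add: fun_eq_iff algebra_simps)
        then show ?thesis using t by (simp add: powr_def)
      qed
    qed
    have h: "param_Ck k S (\<lambda>m t. ?h m t v)" for v
    proof (rule param_Ck_add)
      let ?T = "T \<inter> (S \<times> UNIV)"
      have T: "open ?T" using assms(1) Suc.prems(1) by (auto intro: open_Times)
      have "smooth_on ?T (\<lambda>x. frechet_derivative \<beta> (at (fst x)) v)"
        by (rule smooth_on_compose[OF smooth_on_dir[OF assms(5)] assms(1) T smooth_on_fst[OF T smooth_on_id]]) auto
      then have "smooth_on ?T (\<lambda>x. frechet_derivative \<beta> (at (fst x)) v * H x)"
        by (rule smooth_on_mult[OF T _ smooth_on_subset[OF Suc.prems(3)]]) auto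
      from Suc.IH[OF T _ this, of "Suc j"] Suc.prems(2)
      show "param_Ck k S (\<lambda>m t. t powr \<beta> m * ln t ^ Suc j * (frechet_derivative \<beta> (at m) v * H (m, t)))"
        by auto
      show "param_Ck k S (\<lambda>m t. t powr \<beta> m * ln t ^ j * frechet_derivative H (at (m, t)) (v, 0))"
        by (rule Suc.IH[OF Suc.prems(1,2) smooth_on_dir[OF Suc.prems(3)]])
    qed
    have "\<exists>f'. (\<forall>m\<in>S. \<forall>t\<in>{0..1}. ((\<lambda>m. t powr \<beta> m * ln t ^ j * H (m, t)) has_derivative f' m t) (at m)) \<and>
       (\<forall>v. param_Ck k S (\<lambda>m t. f' m t v))"
      by (rule exI[of _ ?h]) (use d h in blast)
    then show ?case
      unfolding param_Ck.simps using cH[OF Suc.prems(2,3)] by blast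
  qed
qed

section \<open>Hadamard quotients and Mellin transforms with parameters\<close>

text \<open>The fibres must contain the segments to 0, since solutions are built as integrals of
  \<open>F (t * u, m)\<close> over \<open>t\<close> in the unit interval.\<close>

definition star_fst :: "(real \<times> 'p) set \<Rightarrow> bool" where
  "star_fst \<Omega> \<longleftrightarrow> (\<forall>u m t. (u, m) \<in> \<Omega> \<longrightarrow> t \<in> {0..1} \<longrightarrow> (t * u, m) \<in> \<Omega>)"

lemma star_fstD: "star_fst \<Omega> \<Longrightarrow> (u, m) \<in> \<Omega> \<Longrightarrow> 0 \<le> t \<Longrightarrow> t \<le> 1 \<Longrightarrow> (t * u, m) \<in> \<Omega>"
  unfolding star_fst_def by auto

lemma star_fst_zero: "star_fst \<Omega> \<Longrightarrow> (u, m) \<in> \<Omega> \<Longrightarrow> (0, m) \<in> \<Omega>"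
  using star_fstD[of \<Omega> u m 0] by simp

lemma open_slice_fst: "open \<Omega> \<Longrightarrow> open {u. (u, m) \<in> \<Omega>}"
  using open_vimage[of \<Omega>, OF _ continuous_on_Pair[OF continuous_on_id continuous_on_const[of UNIV m]]]
  by (simp add: vimage_def)

text \<open>Parameter derivatives are required up to \<open>t = 0\<close> and \<open>t = 1\<close>,
  hence an open \<open>T\<close> that reaches beyond both end points and on which the scaled
  function is still smooth.\<close>

lemma scale_domain:
  fixes \<Omega> :: "(real \<times> 'p::euclidean_space) set" and F :: "real \<times> 'p \<Rightarrow> real"
  assumes "open \<Omega>" "star_fst \<Omega>"
  defines "T \<equiv> (\<lambda>z. (snd z * fst (fst z), snd (fst z))) -` \<Omega>"
  shows "open T" "\<Omega> \<times> {0..1} \<subseteq> T"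
    "smooth_on \<Omega> F \<Longrightarrow> smooth_on T (\<lambda>z. F (snd z * fst (fst z), snd (fst z)))"
proof -
  show T: "open T"
    unfolding T_def by (rule open_vimage[OF assms(1)]) (intro continuous_intros)
  show "\<Omega> \<times> {0..1} \<subseteq> T"
    using assms(2) unfolding T_def star_fst_def by auto
  assume F: "smooth_on \<Omega> F"
  show "smooth_on T (\<lambda>z. F (snd z * fst (fst z), snd (fst z)))"
    by (rule smooth_on_compose[OF F assms(1) T])
      (intro smooth_on_Pair smooth_on_mult smooth_on_fst smooth_on_snd smooth_on_id T, simp add: T_def)
qed

lemma smooth_on_integral_scale:
  fixes F :: "real \<times> 'p::euclidean_space \<Rightarrow> real"
  assumes "open \<Omega>" "star_fst \<Omega>" "smooth_on \<Omega> F"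
  shows "smooth_on \<Omega> (\<lambda>x. integral {0..1} (\<lambda>t. F (t * fst x, snd x)))"
proof -
  have "param_Ck k \<Omega> (\<lambda>x t. F (t * fst x, snd x))" for k
    using smooth_on_imp_param_Ck[OF scale_domain(2)[OF assms(1,2)] scale_domain(3)[OF assms], of k] by simp
  then show ?thesis
    using Ck_on_integral_param[OF assms(1)] unfolding smooth_on_def by blast
qed

lemma smooth_on_integral_powr_scale:
  fixes F :: "real \<times> 'p::euclidean_space \<Rightarrow> real"
  assumes "open \<Omega>" "star_fst \<Omega>" "smooth_on \<Omega> F"
    and "open V" "\<Omega> \<subseteq> UNIV \<times> V" "smooth_on V \<kappa>" "\<And>m. m \<in> V \<Longrightarrow> \<kappa> m > 0"
  shows "smooth_on \<Omega> (\<lambda>x. integral {0..1} (\<lambda>t. t powr \<kappa> (snd x) * F (t * fst x, snd x)))"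
proof -
  have \<kappa>: "smooth_on \<Omega> (\<lambda>x. \<kappa> (snd x))"
    by (rule smooth_on_compose[OF assms(6,4,1) smooth_on_snd[OF assms(1) smooth_on_id]]) (use assms(5) in auto)
  have pos: "\<kappa> (snd x) > 0" if "x \<in> \<Omega>" for x using that assms(5,7) by auto
  have "param_Ck k \<Omega> (\<lambda>x t. t powr \<kappa> (snd x) * F (t * fst x, snd x))" for k
    using param_Ck_powr[OF assms(1) scale_domain(1,2)[OF assms(1,2)] scale_domain(3)[OF assms(1-3)] \<kappa> pos, of k 0]
    by simp
  then show ?thesis
    using Ck_on_integral_param[OF assms(1)] unfolding smooth_on_def by blast
qed

lemma has_real_derivative_scale:
  fixes F :: "real \<times> 'p::euclidean_space \<Rightarrow> real"
  assumes "star_fst \<Omega>" "smooth_on \<Omega> F" "(u, m) \<in> \<Omega>" "0 \<le> t" "t \<le> 1"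
  shows "((\<lambda>t. F (t * u, m)) has_real_derivative frechet_derivative F (at (t * u, m)) (1, 0) * u) (at t)"
proof -
  have "((\<lambda>t. t * u) has_real_derivative u) (at t)"
    by (auto intro!: derivative_eq_intros)
  from DERIV_chain2[OF has_derivative_slice_fst[OF assms(2) star_fstD[OF assms(1,3,4,5)]] this]
  show ?thesis .
qed

lemma continuous_on_scale:
  fixes F :: "real \<times> 'p::euclidean_space \<Rightarrow> real"
  assumes "star_fst \<Omega>" "smooth_on \<Omega> F" "(u, m) \<in> \<Omega>"
  shows "continuous_on {0..1} (\<lambda>t. F (t * u, m))"
  by (rule continuous_at_imp_continuous_on)
    (use DERIV_isCont[OF has_real_derivative_scale[OF assms]] in auto)

text \<open>The difference quotient \<open>(F (u, m) - F (0, m)) / u\<close>, written as an integral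
  so that it is visibly smooth across \<open>u = 0\<close>.\<close>

definition hadamard :: "(real \<times> 'p::euclidean_space \<Rightarrow> real) \<Rightarrow> real \<times> 'p \<Rightarrow> real" where
  "hadamard F x = integral {0..1} (\<lambda>t. frechet_derivative F (at (t * fst x, snd x)) (1, 0))"

lemma smooth_on_hadamard:
  "open \<Omega> \<Longrightarrow> star_fst \<Omega> \<Longrightarrow> smooth_on \<Omega> F \<Longrightarrow> smooth_on \<Omega> (hadamard F)"
  unfolding hadamard_def using smooth_on_integral_scale[OF _ _ smooth_on_dir] by blast

lemma hadamard:
  fixes F :: "real \<times> 'p::euclidean_space \<Rightarrow> real"
  assumes "star_fst \<Omega>" "smooth_on \<Omega> F" "(u, m) \<in> \<Omega>"
  shows "F (u, m) = F (0, m) + u * hadamard F (u, m)"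
proof -
  let ?d = "\<lambda>t. frechet_derivative F (at (t * u, m)) (1, 0)"
  have "((\<lambda>t. ?d t * u) has_integral F (1 * u, m) - F (0 * u, m)) {0..1}"
    by (rule fundamental_theorem_of_calculus)
      (use has_real_derivative_scale[OF assms] in
        \<open>auto simp flip: has_real_derivative_iff_has_vector_derivative intro: has_field_derivative_at_within\<close>)
  from integral_unique[OF this] show ?thesis by (simp add: hadamard_def mult.commute)
qed

lemma hadamard_zero:
  fixes F :: "real \<times> 'p::euclidean_space \<Rightarrow> real"
  shows "hadamard F (0, m) = frechet_derivative F (at (0, m)) (1, 0)"
  by (simp add: hadamard_def)

lemma smooth_on_hadamard_iter:
  "open \<Omega> \<Longrightarrow> star_fst \<Omega> \<Longrightarrow> smooth_on \<Omega> F \<Longrightarrow> smooth_on \<Omega> ((hadamard ^^ k) F)"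
  by (induction k) (auto intro: smooth_on_hadamard)

lemma hadamard_expansion:
  fixes F :: "real \<times> 'p::euclidean_space \<Rightarrow> real"
  assumes "open \<Omega>" "star_fst \<Omega>" "smooth_on \<Omega> F" "(u, m) \<in> \<Omega>"
  shows "F (u, m) = (\<Sum>j<k. (hadamard ^^ j) F (0, m) * u ^ j) + u ^ k * (hadamard ^^ k) F (u, m)"
proof (induction k)
  case (Suc k)
  then show ?case
    using hadamard[OF assms(2) smooth_on_hadamard_iter[OF assms(1-3), of k] assms(4)]
    by (simp add: algebra_simps)
qed simp

text \<open>The function \<open>t powr (\<kappa> + 1) * F (t * u, m)\<close> of \<open>t\<close> has
  as derivative exactly the integrand of the left-hand side. It vanishes at \<open>t = 0\<close> and
  equals \<open>F (u, m)\<close> at \<open>t = 1\<close>, so the fundamental theorem gives the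
  equation.\<close>

lemma euler_average:
  fixes F :: "real \<times> 'p::euclidean_space \<Rightarrow> real"
  assumes "open \<Omega>" "star_fst \<Omega>" "smooth_on \<Omega> F" "(u, m) \<in> \<Omega>" "\<kappa> > 0"
  defines "A \<equiv> \<lambda>u. integral {0..1} (\<lambda>t. t powr \<kappa> * F (t * u, m))"
  shows "\<exists>A'. (A has_real_derivative A') (at u) \<and> u * A' + (\<kappa> + 1) * A u = F (u, m)"
proof -
  let ?S = "{u. (u, m) \<in> \<Omega>}"
  let ?d = "\<lambda>u. frechet_derivative F (at (u, m)) (1, 0)"
  have S: "open ?S" "u \<in> ?S" using open_slice_fst[OF assms(1)] assms(4) by auto
  have cont: "continuous_on (?S \<times> {0..1}) (\<lambda>(u, t). t powr \<kappa> * G (t * u, m))"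
    if "smooth_on \<Omega> G" for G
  proof -
    have "continuous_on (?S \<times> {0..1}) (\<lambda>x. (snd x * fst x, m))"
      by (intro continuous_intros)
    moreover have "(\<lambda>x. (snd x * fst x, m)) ` (?S \<times> {0..1}) \<subseteq> \<Omega>"
      using star_fstD[OF assms(2)] by auto
    ultimately have "continuous_on (?S \<times> {0..1}) (\<lambda>x. G (snd x * fst x, m))"
      using continuous_on_compose2[OF smooth_on_continuous[OF that]] by blast
    moreover have "continuous_on (?S \<times> {0..1}) (\<lambda>x. snd x powr \<kappa>)"
      using assms(5) by (intro continuous_on_powr' continuous_intros) auto
    ultimately show ?thesis
      unfolding case_prod_beta' by (rule continuous_on_mult[rotated])
  qed
  have cs: "continuous_on {0..1} (\<lambda>t. t powr \<kappa> * G (t * u, m))" if "smooth_on \<Omega> G" for G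
  proof -
    have "continuous_on {0..1} (\<lambda>t::real. t powr \<kappa>)"
      using assms(5) by (intro continuous_on_powr' continuous_intros) auto
    then show ?thesis
      using continuous_on_scale[OF assms(2) that assms(4)] by (rule continuous_on_mult)
  qed
  let ?D = "integral {0..1} (\<lambda>t. t powr \<kappa> * (t * ?d (t * u)))"
  have "(A has_derivative (\<lambda>v. integral {0..1} (\<lambda>t. t powr \<kappa> * (t * ?d (t * u)) * v))) (at u)"
    unfolding A_def
  proof (rule has_derivative_integral_param[OF S cont[OF assms(3)]])
    fix u t :: real assume ut: "u \<in> ?S" "t \<in> {0..1}"
    have "((\<lambda>u. t * u) has_real_derivative t) (at u)"
      by (auto intro!: derivative_eq_intros)
    from DERIV_chain2[OF has_derivative_slice_fst[OF assms(3), of "t * u" m] this]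
    have "((\<lambda>u. F (t * u, m)) has_real_derivative ?d (t * u) * t) (at u)"
      using star_fstD[OF assms(2), of u m t] ut by auto
    from DERIV_cmult[OF this, of "t powr \<kappa>", unfolded has_field_derivative_def]
    show "((\<lambda>u. t powr \<kappa> * F (t * u, m)) has_derivative (\<lambda>v. t powr \<kappa> * (t * ?d (t * u)) * v)) (at u)"
      by (rule has_derivative_eq_rhs) (simp add: fun_eq_iff mult_ac)
  next
    fix v :: real
    have "continuous_on (?S \<times> {0..1}) (\<lambda>x. snd x * v * (case x of (u, t) \<Rightarrow> t powr \<kappa> * ?d (t * u)))"
      by (intro continuous_on_mult continuous_on_snd continuous_on_id continuous_on_const
          cont[OF smooth_on_dir[OF assms(3)]])
    then show "continuous_on (?S \<times> {0..1}) (\<lambda>(u, t). t powr \<kappa> * (t * ?d (t * u)) * v)"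
      by (simp add: case_prod_beta' mult_ac)
  qed
  then have A: "(A has_real_derivative ?D) (at u)"
    unfolding has_field_derivative_def by simp
  have "((\<lambda>t. (\<kappa> + 1) * (t powr \<kappa> * F (t * u, m)) + u * (t powr \<kappa> * (t * ?d (t * u)))) has_integral
      1 powr (\<kappa> + 1) * F (1 * u, m) - 0 powr (\<kappa> + 1) * F (0 * u, m)) {0..1}"
  proof (rule fundamental_theorem_of_calculus_interior)
    show "continuous_on {0..1} (\<lambda>t. t powr (\<kappa> + 1) * F (t * u, m))"
      using assms(5) continuous_on_scale[OF assms(2,3,4)]
      by (intro continuous_on_mult continuous_on_powr' continuous_intros) auto
    fix t :: real assume t: "t \<in> {0<..<1}"
    have "((\<lambda>t. t powr (\<kappa> + 1)) has_real_derivative (\<kappa> + 1) * t powr \<kappa>) (at t)"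
      using t has_real_derivative_powr[of t "\<kappa> + 1"] by simp
    from DERIV_mult[OF this has_real_derivative_scale[OF assms(2,3,4), of t]]
    have "((\<lambda>t. t powr (\<kappa> + 1) * F (t * u, m)) has_real_derivative
      (\<kappa> + 1) * t powr \<kappa> * F (t * u, m) + ?d (t * u) * u * t powr (\<kappa> + 1)) (at t)"
      using t by simp
    moreover have "t powr (\<kappa> + 1) = t powr \<kappa> * t" using t by (simp add: powr_add)
    ultimately show "((\<lambda>t. t powr (\<kappa> + 1) * F (t * u, m)) has_vector_derivative
      (\<kappa> + 1) * (t powr \<kappa> * F (t * u, m)) + u * (t powr \<kappa> * (t * ?d (t * u)))) (at t)"
      by (simp add: has_real_derivative_iff_has_vector_derivative mult_ac)
  qed simp
  then have "F (u, m) = integral {0..1} (\<lambda>t. (\<kappa> + 1) * (t powr \<kappa> * F (t * u, m)) + u * (t powr \<kappa> * (t * ?d (t * u))))"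
    by (simp add: integral_unique)
  also have "\<dots> = (\<kappa> + 1) * A u + u * ?D"
  proof -
    have "continuous_on {0..1} (\<lambda>t. t * (t powr \<kappa> * ?d (t * u)))"
      by (intro continuous_on_mult continuous_on_id cs[OF smooth_on_dir[OF assms(3)]])
    then have "continuous_on {0..1} (\<lambda>t. t powr \<kappa> * (t * ?d (t * u)))"
      by (simp add: mult_ac)
    then show ?thesis
      using cs[OF assms(3)] unfolding A_def
      by (subst integral_add) (auto intro!: integrable_continuous_interval continuous_on_mult continuous_on_const)
  qed
  finally show ?thesis using A by auto
qed

text \<open>The natural weight for the exponent \<kappa> would be
  \<open>t powr (\<kappa> - 1)\<close>, singular at 0 when \<kappa> < 1. Splitting off
  \<open>F (0, m)\<close>, which is solved by a constant, and writing the rest as \<open>u\<close>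
  times the Hadamard quotient shifts the exponent by one, where \<open>euler_average\<close>
  applies.\<close>

lemma euler_solution:
  fixes F :: "real \<times> 'p::euclidean_space \<Rightarrow> real"
  assumes \<Omega>: "open \<Omega>" "star_fst \<Omega>" and F: "smooth_on \<Omega> F"
    and V: "open V" "\<Omega> \<subseteq> UNIV \<times> V" and \<kappa>: "smooth_on V \<kappa>" "\<And>m. m \<in> V \<Longrightarrow> \<kappa> m > 0"
  obtains Y where "smooth_on \<Omega> Y"
    "\<And>u m. (u, m) \<in> \<Omega> \<Longrightarrow> \<exists>d. ((\<lambda>u. Y (u, m)) has_real_derivative d) (at u) \<and> u * d + \<kappa> m * Y (u, m) = F (u, m)"
proof -
  let ?H = "hadamard F"
  define A where "A x = integral {0..1} (\<lambda>t. t powr \<kappa> (snd x) * ?H (t * fst x, snd x))" for x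
  define Y where "Y x = F (0, snd x) / \<kappa> (snd x) + fst x * A x" for x
  have H: "smooth_on \<Omega> ?H" by (rule smooth_on_hadamard[OF \<Omega> F])
  have A: "smooth_on \<Omega> A"
    unfolding A_def by (rule smooth_on_integral_powr_scale[OF \<Omega> H V \<kappa>])
  have \<kappa>': "smooth_on \<Omega> (\<lambda>x. \<kappa> (snd x))"
    by (rule smooth_on_compose[OF \<kappa>(1) V(1) \<Omega>(1) smooth_on_snd[OF \<Omega>(1) smooth_on_id]]) (use V(2) in auto)
  have F0: "smooth_on \<Omega> (\<lambda>x. F (0, snd x))"
    by (rule smooth_on_compose[OF F \<Omega>(1) \<Omega>(1)])
      (use star_fst_zero[OF \<Omega>(2)] in \<open>auto intro!: smooth_on_Pair smooth_on_snd smooth_on_const smooth_on_id \<Omega>(1)\<close>)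
  have Y: "smooth_on \<Omega> Y"
    unfolding Y_def
    by (intro smooth_on_add smooth_on_divide smooth_on_mult smooth_on_fst smooth_on_id \<Omega>(1) F0 \<kappa>' A)
      (use V(2) \<kappa>(2) in fastforce)
  have "\<exists>d. ((\<lambda>u. Y (u, m)) has_real_derivative d) (at u) \<and> u * d + \<kappa> m * Y (u, m) = F (u, m)"
    if um: "(u, m) \<in> \<Omega>" for u m
  proof -
    have pos: "\<kappa> m > 0" using um V(2) \<kappa>(2) by auto
    obtain A' where A': "((\<lambda>u. A (u, m)) has_real_derivative A') (at u)"
      "u * A' + (\<kappa> m + 1) * A (u, m) = ?H (u, m)"
      using euler_average[OF \<Omega> H um pos] unfolding A_def by auto
    have "((\<lambda>u. Y (u, m)) has_real_derivative A (u, m) + u * A') (at u)"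
      unfolding Y_def by (auto intro!: derivative_eq_intros A'(1))
    moreover have "u * (A (u, m) + u * A') + \<kappa> m * Y (u, m) = F (u, m)"
    proof -
      have "F (u, m) = F (0, m) + u * (u * A' + (\<kappa> m + 1) * A (u, m))"
        unfolding A'(2) by (rule hadamard[OF \<Omega>(2) F um])
      then show ?thesis using pos by (simp add: Y_def field_simps)
    qed
    ultimately show ?thesis by blast
  qed
  then show ?thesis using that Y by blast
qed

lemma star_slice: "star_fst \<Omega> \<Longrightarrow> (u, m) \<in> \<Omega> \<Longrightarrow> 0 \<le> t \<Longrightarrow> t \<le> 1 \<Longrightarrow> t * u \<in> {u. (u, m) \<in> \<Omega>}"
  using star_fstD by auto

lemma smooth_on_slice_fst:
  fixes F :: "real \<times> 'p::euclidean_space \<Rightarrow> real"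
  assumes "open \<Omega>" "smooth_on \<Omega> F"
  shows "smooth_on {u. (u, m) \<in> \<Omega>} (\<lambda>u. F (u, m))"
  by (rule smooth_on_compose[OF assms(2,1) open_slice_fst[OF assms(1)]])
    (auto intro!: smooth_on_Pair smooth_on_id smooth_on_const open_slice_fst assms(1))

lemma deriv_iter_smooth: "open S \<Longrightarrow> smooth_on S f \<Longrightarrow> smooth_on S ((deriv ^^ k) f)" for f :: "real \<Rightarrow> real"
  by (induction k) (auto intro: smooth_on_deriv_smooth)

text \<open>With \<open>f\<close> equal to a constant plus \<open>u * g\<close>, Leibniz' rule
  leaves only \<open>Suc k\<close> times the \<open>k\<close>-th derivative of \<open>g\<close> at
  0. Iterated Hadamard quotients at 0 are therefore Taylor coefficients, but in a form that is
  smooth in the parameter.\<close>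

lemma deriv_iter_hadamard:
  fixes F :: "real \<times> 'p::euclidean_space \<Rightarrow> real"
  assumes "open \<Omega>" "star_fst \<Omega>" "smooth_on \<Omega> F" "(0, m) \<in> \<Omega>"
  shows "(deriv ^^ k) (\<lambda>u. F (u, m)) 0 = fact k * (hadamard ^^ k) F (0, m)"
  using assms(3)
proof (induction k arbitrary: F)
  case (Suc k)
  let ?S = "{u. (u, m) \<in> \<Omega>}"
  define f where "f = (\<lambda>u. F (u, m))"
  define g where "g = (\<lambda>u. hadamard F (u, m))"
  have S: "open ?S" by (rule open_slice_fst[OF assms(1)])
  have H: "smooth_on \<Omega> (hadamard F)" by (rule smooth_on_hadamard[OF assms(1,2) Suc.prems])
  have g: "smooth_on ?S g" unfolding g_def by (rule smooth_on_slice_fst[OF assms(1) H])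
  have dg: "((deriv ^^ j) g has_real_derivative (deriv ^^ Suc j) g u) (at u)" if "u \<in> ?S" for j u
    using smooth_on_deriv(1)[OF deriv_iter_smooth[OF S g] that] by simp
  have "(deriv ^^ Suc j) f u = u * (deriv ^^ Suc j) g u + real (Suc j) * (deriv ^^ j) g u"
    if "u \<in> ?S" for j u
    using that
  proof (induction j arbitrary: u)
    case 0
    have "((\<lambda>u. F (0, m) + u * g u) has_real_derivative u * deriv g u + g u) (at u)"
      by (rule derivative_eq_intros refl dg[OF 0, of 0, simplified])+ simp
    then have "(f has_real_derivative u * deriv g u + g u) (at u)"
      by (rule has_field_derivative_transform_within_open[OF _ S 0])
        (use hadamard[OF assms(2) Suc.prems] in \<open>auto simp: f_def g_def\<close>)
    then show ?case by (simp add: DERIV_imp_deriv)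
  next
    case (Suc j)
    have "((\<lambda>u. u * (deriv ^^ Suc j) g u + real (Suc j) * (deriv ^^ j) g u) has_real_derivative
      u * (deriv ^^ Suc (Suc j)) g u + real (Suc (Suc j)) * (deriv ^^ Suc j) g u) (at u)"
      by (rule derivative_eq_intros refl dg[OF Suc.prems])+ (simp add: algebra_simps)
    then have "((deriv ^^ Suc j) f has_real_derivative
      u * (deriv ^^ Suc (Suc j)) g u + real (Suc (Suc j)) * (deriv ^^ Suc j) g u) (at u)"
      by (rule has_field_derivative_transform_within_open[OF _ S Suc.prems])
        (use Suc.IH in auto)
    then show ?case using DERIV_imp_deriv by (simp only: funpow.simps o_def) 
  qed
  from this[of 0 k] assms(4) have "(deriv ^^ Suc k) f 0 = real (Suc k) * (deriv ^^ k) g 0" by simp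
  also have "(deriv ^^ k) g 0 = fact k * (hadamard ^^ k) (hadamard F) (0, m)"
    unfolding g_def by (rule Suc.IH[OF H])
  finally show ?case by (simp add: f_def funpow_swap1 algebra_simps del: funpow.simps(2)) (simp add: funpow_swap1)
qed simp

lemma hadamard_1D:
  fixes d :: "real \<Rightarrow> real"
  assumes "open I" "\<And>x t. x \<in> I \<Longrightarrow> 0 \<le> t \<Longrightarrow> t \<le> 1 \<Longrightarrow> t * x \<in> I" "smooth_on I d"
  obtains e where "smooth_on I e" "\<And>x. x \<in> I \<Longrightarrow> d x = d 0 + x * e x"
proof -
  let ?\<Omega> = "I \<times> (UNIV :: real set)"
  have \<Omega>: "open ?\<Omega>" "star_fst ?\<Omega>"
    using assms(1,2) by (auto simp: star_fst_def open_Times)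
  have D: "smooth_on ?\<Omega> (\<lambda>x. d (fst x))"
    by (rule smooth_on_compose[OF assms(3,1) \<Omega>(1) smooth_on_fst[OF \<Omega>(1) smooth_on_id]]) auto
  show ?thesis
  proof (rule that)
    show "smooth_on I (\<lambda>u. hadamard (\<lambda>x. d (fst x)) (u, 0::real))"
      using smooth_on_slice_fst[OF \<Omega>(1) smooth_on_hadamard[OF \<Omega> D], of 0] by simp
    show "d x = d 0 + x * hadamard (\<lambda>x. d (fst x)) (x, 0::real)" if "x \<in> I" for x
      using hadamard[OF \<Omega>(2) D, of x 0] that by simp
  qed
qed

section \<open>Uniqueness for the Mellin equation\<close>

lemma euler_homogeneous_zero:
  fixes d :: "real \<Rightarrow> real"
  assumes I: "open I" "0 \<in> I" and \<alpha>: "\<alpha> \<noteq> 0" and d: "smooth_on I d"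
    and ode: "\<And>x. x \<in> I \<Longrightarrow> x \<noteq> 0 \<Longrightarrow> x * deriv d x = \<alpha> * d x"
  shows "d 0 = 0"
proof -
  define h where "h = (\<lambda>x. x * deriv d x - \<alpha> * d x)"
  have "smooth_on I h"
    unfolding h_def
    by (intro smooth_intros I(1) d smooth_on_deriv_smooth)
  then have "(h \<longlongrightarrow> h 0) (at 0)"
    using smooth_on_isCont[OF _ I(2)] isCont_def by blast
  moreover have "\<forall>\<^sub>F x in at 0. h x = 0"
    using ode eventually_at_in_open'[OF I]
    by (intro eventually_mono[OF eventually_conj[OF eventually_at_in_open'[OF I] eventually_neq_at_within[of 0]]])
      (auto simp: h_def)
  then have "(h \<longlongrightarrow> 0) (at 0)" by (rule tendsto_eventually)
  ultimately have "h 0 = 0" using tendsto_unique[OF at_neq_bot] by blast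
  then show ?thesis using \<alpha> by (simp add: h_def)
qed

text \<open>The solutions behave like powers of order \<alpha>, which are not smooth at 0. Since
  \<alpha> is not 0, \<open>d\<close> vanishes at 0 and \<open>d x = x * e x\<close>, where
  \<open>e\<close> solves the equation for \<alpha> - 1; repeating this reaches a negative exponent.
  The equation is assumed off 0 only, because it is obtained for \<open>e\<close> by cancelling
  \<open>x\<close>.\<close>

lemma euler_homogeneous_unique:
  fixes d :: "real \<Rightarrow> real"
  assumes I: "open I" "\<And>x t. x \<in> I \<Longrightarrow> 0 \<le> t \<Longrightarrow> t \<le> 1 \<Longrightarrow> t * x \<in> I"
    and \<alpha>: "\<alpha> \<notin> range real"
    and d: "smooth_on I d" "\<And>x. x \<in> I \<Longrightarrow> x \<noteq> 0 \<Longrightarrow> x * deriv d x = \<alpha> * d x"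
    and x: "x \<in> I"
  shows "d x = 0"
proof -
  have "0 \<in> I" using I(2)[OF x, of 0] by simp
  obtain k where k: "\<alpha> < real k" using reals_Archimedean2 by blast
  then show ?thesis
    using \<alpha> d x
  proof (induction k arbitrary: \<alpha> d x)
    case 0
    then have \<alpha>: "\<alpha> < 0" by simp
    have d0: "d 0 = 0" by (rule euler_homogeneous_zero[where \<alpha> = \<alpha>, OF I(1) \<open>0 \<in> I\<close> _ 0(3)]) (use \<alpha> 0(4) in auto)
    \<comment> \<open>For \<alpha> < 0 the square of \<open>d\<close> satisfies
      \<open>x * q' = 2 * \<alpha> * q\<close>, so it decreases away from 0. As it vanishes at 0 and
      is nonnegative, it is 0.\<close>
    define q where "q = (\<lambda>z. d z * d z)"
    have dq: "(q has_real_derivative 2 * d z * deriv d z) (at z)" if "z \<in> I" for z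
      unfolding q_def using smooth_on_deriv(1)[OF 0(3) that] by (auto intro!: derivative_eq_intros)
    have e: "z * (2 * d z * deriv d z) = 2 * \<alpha> * (d z * d z)" if "z \<in> I" for z
      using 0(4)[OF that] d0 by (cases "z = 0") (auto simp: algebra_simps)
    have s: "2 * d z * deriv d z \<le> 0" if "z \<in> I" "z \<ge> 0" for z
    proof (cases "z = 0")
      case False
      have "z * (2 * d z * deriv d z) \<le> 0"
        unfolding e[OF that(1)] by (rule mult_nonpos_nonneg[OF _ zero_le_square]) (use \<alpha> in simp)
      then show ?thesis using False that mult_pos_pos[of z "2 * d z * deriv d z"] by linarith
    qed (use d0 in auto)
    have s': "2 * d z * deriv d z \<ge> 0" if "z \<in> I" "z \<le> 0" for z
    proof (cases "z = 0")
      case False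
      have "z * (2 * d z * deriv d z) \<le> 0"
        unfolding e[OF that(1)] by (rule mult_nonpos_nonneg[OF _ zero_le_square]) (use \<alpha> in simp)
      then show ?thesis using False that mult_neg_neg[of z "2 * d z * deriv d z"] by linarith
    qed (use d0 in auto)
    have "q x \<le> q 0"
    proof (cases "x \<ge> 0")
      case True
      have "z \<in> I" if "0 \<le> z" "z \<le> x" for z
        using I(2)[OF \<open>x \<in> I\<close>, of "z / x"] that \<open>0 \<in> I\<close> by (cases "x = 0") auto
      then have *: "\<exists>y. (q has_real_derivative y) (at z) \<and> y \<le> 0" if "0 \<le> z" "z \<le> x" for z
        using dq[of z] s[of z] that by blast
      show ?thesis by (rule DERIV_nonpos_imp_nonincreasing[OF True *])
    next
      case False
      have "z \<in> I" if "x \<le> z" "z \<le> 0" for z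
        using I(2)[OF \<open>x \<in> I\<close>, of "z / x"] that False by (auto simp: zero_le_divide_iff divide_le_eq_1)
      then have *: "\<exists>y. (q has_real_derivative y) (at z) \<and> y \<ge> 0" if "x \<le> z" "z \<le> 0" for z
        using dq[of z] s'[of z] that by blast
      show ?thesis by (rule DERIV_nonneg_imp_nondecreasing[OF _ *]) (use False in auto)
    qed
    then show ?case using d0 by (auto simp: q_def mult_le_0_iff)
  next
    case (Suc k)
    have "\<alpha> \<noteq> 0" using Suc.prems(2) by (metis of_nat_0 rangeI)
    have d0: "d 0 = 0" by (rule euler_homogeneous_zero[OF I(1) \<open>0 \<in> I\<close> \<open>\<alpha> \<noteq> 0\<close> Suc.prems(3,4)])
    obtain e where e: "smooth_on I e" "\<And>x. x \<in> I \<Longrightarrow> d x = d 0 + x * e x"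
      using hadamard_1D[OF I Suc.prems(3)] by blast
    have "e x = 0"
    proof (rule Suc.IH[of "\<alpha> - 1" e])
      show "\<alpha> - 1 < real k" using Suc.prems(1) by simp
      show "\<alpha> - 1 \<notin> range real"
      proof
        assume "\<alpha> - 1 \<in> range real"
        then obtain n where "\<alpha> - 1 = real n" by auto
        then have "\<alpha> = real (Suc n)" by simp
        then show False using Suc.prems(2) by blast
      qed
      fix y assume y: "y \<in> I" "y \<noteq> 0"
      have "((\<lambda>x. d 0 + x * e x) has_real_derivative e y + y * deriv e y) (at y)"
        by (rule derivative_eq_intros refl smooth_on_deriv(1)[OF e(1) y(1)])+ simp
      then have "(d has_real_derivative e y + y * deriv e y) (at y)"
        by (rule has_field_derivative_transform_within_open[OF _ I(1) y(1)]) (simp add: e(2))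
      then have "deriv d y = e y + y * deriv e y" by (rule DERIV_imp_deriv)
      then have "y * (e y + y * deriv e y) = y * (\<alpha> * e y)"
        using Suc.prems(4)[OF y] e(2)[OF y(1)] d0 by simp
      then have "e y + y * deriv e y = \<alpha> * e y" using mult_left_cancel[OF y(2)] by blast
      then show "y * deriv e y = (\<alpha> - 1) * e y" by (simp add: algebra_simps)
    qed (use e Suc.prems in auto)
    then show ?case using e(2)[OF Suc.prems(5)] d0 by simp
  qed
qed

lemma mellin_unique:
  assumes I: "open I" "\<And>x t. x \<in> I \<Longrightarrow> 0 \<le> t \<Longrightarrow> t \<le> 1 \<Longrightarrow> t * x \<in> I"
    and \<alpha>: "\<alpha> \<notin> range real"
    and y: "smooth_on I y" "\<And>x. x \<in> I \<Longrightarrow> x * deriv y x - \<alpha> * y x = f x"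
    and w: "smooth_on I w" "\<And>x. x \<in> I \<Longrightarrow> x * deriv w x - \<alpha> * w x = f x"
    and x: "x \<in> I"
  shows "w x = y x"
proof -
  have "w x - y x = 0"
  proof (rule euler_homogeneous_unique[OF I \<alpha> _ _ x])
    show "smooth_on I (\<lambda>x. w x - y x)" using w(1) y(1) I(1) by (intro smooth_intros) auto
    fix x assume x: "x \<in> I"
    have "deriv (\<lambda>x. w x - y x) x = deriv w x - deriv y x"
      by (rule DERIV_imp_deriv[OF DERIV_diff]) (use smooth_on_deriv(1)[OF _ x] w(1) y(1) in auto)
    then show "x * deriv (\<lambda>x. w x - y x) x = \<alpha> * (w x - y x)"
      using y(2)[OF x] w(2)[OF x] by (simp add: right_diff_distrib)
  qed
  then show ?thesis by simp
qed

text \<open>The description behind \<open>mellin\<close> fixes the value 0 outside the interval, so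
  a solution has to be cut off before it can be identified with the transform.\<close>

lemma mellin_eqI:
  assumes I: "open I" "\<And>x t. x \<in> I \<Longrightarrow> 0 \<le> t \<Longrightarrow> t \<le> 1 \<Longrightarrow> t * x \<in> I"
    and \<alpha>: "\<alpha> \<notin> range real"
    and y: "smooth_on I y" "\<And>x. x \<in> I \<Longrightarrow> x * deriv y x - \<alpha> * y x = f x"
    and x: "x \<in> I"
  shows "mellin I f \<alpha> x = y x"
proof -
  define z where "z = (\<lambda>x. if x \<in> I then y x else 0)"
  have "mellin I f \<alpha> = z"
    unfolding mellin_def
  proof (rule the_equality)
    have "smooth_on I z"
      using y(1) smooth_on_cong[OF I(1), of z y] by (simp add: z_def)
    moreover have "deriv z x = deriv y x" if "x \<in> I" for x
      by (rule deriv_cong_ev)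
        (use eventually_nhds_in_open[OF I(1) that] in \<open>auto simp: z_def elim: eventually_mono\<close>)
    ultimately show "smooth_on I z \<and> (\<forall>x\<in>I. x * deriv z x - \<alpha> * z x = f x) \<and> (\<forall>x. x \<notin> I \<longrightarrow> z x = 0)"
      using y(2) by (simp add: z_def)
  next
    fix w assume w: "smooth_on I w \<and> (\<forall>x\<in>I. x * deriv w x - \<alpha> * w x = f x) \<and> (\<forall>x. x \<notin> I \<longrightarrow> w x = 0)"
    have "w x = y x" if "x \<in> I" for x
      by (rule mellin_unique[OF I \<alpha> y _ _ that]) (use w in auto)
    then show "w = z" using w by (auto simp: z_def fun_eq_iff)
  qed
  then show ?thesis using x by (simp add: z_def)
qed

text \<open>The Hadamard coefficients carry the poles of the Mellin transform, whereas \<open>R\<close> is smooth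
  as long as \<open>\<alpha> < k\<close>.\<close>

lemma mellin_expansion:
  fixes F :: "real \<times> 'p::euclidean_space \<Rightarrow> real"
  assumes \<Omega>: "open \<Omega>" "star_fst \<Omega>" and F: "smooth_on \<Omega> F"
    and V: "open V" "\<Omega> \<subseteq> UNIV \<times> V" and \<alpha>: "smooth_on V \<alpha>" "\<And>m. m \<in> V \<Longrightarrow> \<alpha> m < real k"
  obtains R where "smooth_on \<Omega> R"
    "\<And>u m f. (u, m) \<in> \<Omega> \<Longrightarrow> (\<And>u. (u, m) \<in> \<Omega> \<Longrightarrow> f u = F (u, m)) \<Longrightarrow> (\<And>j. j < k \<Longrightarrow> \<alpha> m \<noteq> real j) \<Longrightarrow>
      mellin {u. (u, m) \<in> \<Omega>} f (\<alpha> m) u =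
        (\<Sum>j<k. (hadamard ^^ j) F (0, m) / (real j - \<alpha> m) * u ^ j) + u ^ k * R (u, m)"
    "\<And>m f. (\<And>u. (u, m) \<in> \<Omega> \<Longrightarrow> f u = F (u, m)) \<Longrightarrow> (\<And>j. j < k \<Longrightarrow> \<alpha> m \<noteq> real j) \<Longrightarrow>
      \<exists>y. smooth_on {u. (u, m) \<in> \<Omega>} y \<and> (\<forall>u. (u, m) \<in> \<Omega> \<longrightarrow> u * deriv y u - \<alpha> m * y u = f u)"
proof -
  \<comment> \<open>After subtracting the first \<open>k\<close> Taylor terms the right-hand side is
    \<open>u ^ k\<close> times a smooth function. The ansatz \<open>u ^ k * R\<close> leads to an
    equation for \<open>R\<close> with exponent \<open>k - \<alpha>\<close>, which is
    positive.\<close>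
  have "smooth_on V (\<lambda>m. real k - \<alpha> m)"
    by (intro smooth_on_diff smooth_on_const V(1) \<alpha>(1))
  moreover have "real k - \<alpha> m > 0" if "m \<in> V" for m using \<alpha>(2)[OF that] by simp
  ultimately obtain R where R: "smooth_on \<Omega> R"
    "\<And>u m. (u, m) \<in> \<Omega> \<Longrightarrow> \<exists>d. ((\<lambda>u. R (u, m)) has_real_derivative d) (at u) \<and>
      u * d + (real k - \<alpha> m) * R (u, m) = (hadamard ^^ k) F (u, m)"
    using euler_solution[OF \<Omega> smooth_on_hadamard_iter[OF \<Omega> F, of k] V] by blast
  define y where "y m u = (\<Sum>j<k. (hadamard ^^ j) F (0, m) / (real j - \<alpha> m) * u ^ j) + u ^ k * R (u, m)" for m u
  have y: "smooth_on {u. (u, m) \<in> \<Omega>} (y m)" for m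
  proof -
    let ?I = "{u. (u, m) \<in> \<Omega>}"
    have I: "open ?I" by (rule open_slice_fst[OF \<Omega>(1)])
    show "smooth_on ?I (y m)"
      unfolding y_def by (intro smooth_on_add smooth_on_sum smooth_on_mult smooth_on_power smooth_on_const smooth_on_id I
          smooth_on_slice_fst[OF \<Omega>(1) R(1)])
  qed
  have ode: "u * deriv (y m) u - \<alpha> m * y m u = f u"
    if u: "(u, m) \<in> \<Omega>" and f: "\<And>u. (u, m) \<in> \<Omega> \<Longrightarrow> f u = F (u, m)" and ne: "\<And>j. j < k \<Longrightarrow> \<alpha> m \<noteq> real j" for u m f
  proof -
    let ?c = "\<lambda>j. (hadamard ^^ j) F (0, m)"
    obtain d where d: "((\<lambda>u. R (u, m)) has_real_derivative d) (at u)"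
      "u * d + (real k - \<alpha> m) * R (u, m) = (hadamard ^^ k) F (u, m)" using R(2)[OF u] by blast
    have "((\<lambda>u. (\<Sum>j<k. ?c j / (real j - \<alpha> m) * u ^ j) + u ^ k * R (u, m)) has_real_derivative
        (\<Sum>j<k. ?c j / (real j - \<alpha> m) * (real j * u ^ (j - 1))) + (real k * u ^ (k - 1) * R (u, m) + u ^ k * d)) (at u)"
      by (rule derivative_eq_intros refl d(1) DERIV_sum)+ (auto simp: mult_ac)
    then have D: "deriv (\<lambda>u. (\<Sum>j<k. ?c j / (real j - \<alpha> m) * u ^ j) + u ^ k * R (u, m)) u =
        (\<Sum>j<k. ?c j / (real j - \<alpha> m) * (real j * u ^ (j - 1))) + (real k * u ^ (k - 1) * R (u, m) + u ^ k * d)"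
      by (rule DERIV_imp_deriv)
    have up: "u * (real j * u ^ (j - 1)) = real j * u ^ j" for j by (cases j) auto
    have "u * (\<Sum>j<k. ?c j / (real j - \<alpha> m) * (real j * u ^ (j - 1))) =
       (\<Sum>j<k. ?c j / (real j - \<alpha> m) * (real j * u ^ j))"
      unfolding sum_distrib_left up[symmetric] by (intro sum.cong) (auto simp: mult_ac)
    moreover have "(\<Sum>j<k. ?c j / (real j - \<alpha> m) * (real j * u ^ j)) - \<alpha> m * (\<Sum>j<k. ?c j / (real j - \<alpha> m) * u ^ j)
       = (\<Sum>j<k. ?c j * u ^ j)"
      unfolding sum_distrib_left sum_subtractf[symmetric]
    proof (intro sum.cong refl)
      fix j assume "j \<in> {..<k}"
      then have "real j - \<alpha> m \<noteq> 0" using ne[of j] by auto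
      then have "?c j = ?c j / (real j - \<alpha> m) * (real j - \<alpha> m)" by simp
      then show "?c j / (real j - \<alpha> m) * (real j * u ^ j) - \<alpha> m * (?c j / (real j - \<alpha> m) * u ^ j) = ?c j * u ^ j"
        by (metis (no_types, opaque_lifting) left_diff_distrib mult.assoc mult.commute)
    qed
    moreover have "u * (real k * u ^ (k - 1) * R (u, m) + u ^ k * d) - \<alpha> m * (u ^ k * R (u, m)) =
      u ^ k * (hadamard ^^ k) F (u, m)"
    proof -
      have "u * (real k * u ^ (k - 1) * R (u, m) + u ^ k * d) = real k * u ^ k * R (u, m) + u ^ k * (u * d)"
        using up[of k] by (auto simp: algebra_simps)
      then show ?thesis unfolding d(2)[symmetric] by (simp add: algebra_simps)
    qed
    ultimately show ?thesis
      unfolding y_def D f[OF u] hadamard_expansion[OF \<Omega> F u, of k] by (simp add: algebra_simps)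
  qed
  have "mellin {u. (u, m) \<in> \<Omega>} f (\<alpha> m) u = y m u"
    if um: "(u, m) \<in> \<Omega>" and f: "\<And>u. (u, m) \<in> \<Omega> \<Longrightarrow> f u = F (u, m)" and ne: "\<And>j. j < k \<Longrightarrow> \<alpha> m \<noteq> real j" for u m f
  proof (rule mellin_eqI[OF open_slice_fst[OF \<Omega>(1)] _ _ y])
    show "\<alpha> m \<notin> range real"
      using ne \<alpha>(2)[of m] um V(2) by force
    show "u * deriv (y m) u - \<alpha> m * y m u = f u" if "u \<in> {u. (u, m) \<in> \<Omega>}" for u
      by (rule ode) (use f ne that in auto)
  qed (use um star_fstD[OF \<Omega>(2)] in auto)
  moreover have "\<exists>y. smooth_on {u. (u, m) \<in> \<Omega>} y \<and> (\<forall>u. (u, m) \<in> \<Omega> \<longrightarrow> u * deriv y u - \<alpha> m * y u = f u)"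
    if "\<And>u. (u, m) \<in> \<Omega> \<Longrightarrow> f u = F (u, m)" "\<And>j. j < k \<Longrightarrow> \<alpha> m \<noteq> real j" for m f
    using y[of m] ode[of _ m f] that by blast
  ultimately show ?thesis using that[OF R(1)] unfolding y_def by blast
qed

section \<open>One-variable versions\<close>

lemma euler_solution_1D:
  fixes f :: "real \<Rightarrow> real"
  assumes "open I" "\<And>x t. x \<in> I \<Longrightarrow> 0 \<le> t \<Longrightarrow> t \<le> 1 \<Longrightarrow> t * x \<in> I" "smooth_on I f" "\<kappa> > 0"
  obtains w where "smooth_on I w" "\<And>x. x \<in> I \<Longrightarrow> x * deriv w x + \<kappa> * w x = f x"
proof -
  let ?\<Omega> = "I \<times> (UNIV :: real set)"
  have \<Omega>: "open ?\<Omega>" "star_fst ?\<Omega>"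
    using assms(1,2) by (auto simp: star_fst_def open_Times)
  have F: "smooth_on ?\<Omega> (\<lambda>x. f (fst x))"
    by (rule smooth_on_compose[OF assms(3,1) \<Omega>(1) smooth_on_fst[OF \<Omega>(1) smooth_on_id]]) auto
  obtain Y where Y: "smooth_on ?\<Omega> Y"
    "\<And>u m. (u, m) \<in> ?\<Omega> \<Longrightarrow> \<exists>d. ((\<lambda>u. Y (u, m)) has_real_derivative d) (at u) \<and> u * d + \<kappa> * Y (u, m) = f (fst (u, m))"
    by (rule euler_solution[OF \<Omega> F open_UNIV _ smooth_on_const]) (use assms(4) in auto)
  show ?thesis
  proof (rule that)
    show "smooth_on I (\<lambda>u. Y (u, 0))"
      using smooth_on_slice_fst[OF \<Omega>(1) Y(1), of 0] by simp
    fix x assume "x \<in> I"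
    then obtain d where "((\<lambda>u. Y (u, 0)) has_real_derivative d) (at x)" "x * d + \<kappa> * Y (x, 0) = f x"
      using Y(2)[of x 0] by auto
    then show "x * deriv (\<lambda>u. Y (u, 0)) x + \<kappa> * Y (x, 0) = f x"
      using DERIV_imp_deriv by metis
  qed
qed

text \<open>For \<kappa> = 1 the equation reads \<open>(x * w)' = f\<close>; taking the primitive in
  this form gives its smoothness for free.\<close>

lemma antiderivative_1D:
  fixes f :: "real \<Rightarrow> real"
  assumes "open I" "\<And>x t. x \<in> I \<Longrightarrow> 0 \<le> t \<Longrightarrow> t \<le> 1 \<Longrightarrow> t * x \<in> I" "smooth_on I f"
  obtains F where "smooth_on I F" "\<And>x. x \<in> I \<Longrightarrow> (F has_real_derivative f x) (at x)" "F 0 = 0"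
proof -
  obtain w where w: "smooth_on I w" "\<And>x. x \<in> I \<Longrightarrow> x * deriv w x + 1 * w x = f x"
    using euler_solution_1D[OF assms, of 1] by auto
  show ?thesis
  proof (rule that)
    show "smooth_on I (\<lambda>x. x * w x)" by (intro smooth_intros assms(1) w(1))
    show "((\<lambda>x. x * w x) has_real_derivative f x) (at x)" if "x \<in> I" for x
      using w(2)[OF that]
      by (auto intro!: derivative_eq_intros smooth_on_deriv(1)[OF w(1) that] simp: algebra_simps)
  qed simp
qed

section \<open>Approximate first integrals near the axes\<close>

text \<open>Hadamard quotients are taken in either coordinate, hence the domain must allow each
  coordinate to be contracted separately.\<close>

definition star_both :: "(real \<times> real) set \<Rightarrow> bool" where
  "star_both N \<longleftrightarrow> star_fst N \<and> star_fst (prod.swap -` N)"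

lemma star_both_swap: "star_both (prod.swap -` N) \<longleftrightarrow> star_both N"
  unfolding star_both_def by (auto simp: vimage_def)

lemma open_swap: "open N \<Longrightarrow> open (prod.swap -` N)" for N :: "('a::topological_space \<times> 'b::topological_space) set"
  by (rule open_vimage) (auto simp: prod.swap_def intro!: continuous_intros)

lemma smooth_on_swap:
  fixes f :: "real \<times> real \<Rightarrow> real"
  assumes "open N" "smooth_on N f"
  shows "smooth_on (prod.swap -` N) (\<lambda>z. f (snd z, fst z))"
  by (rule smooth_on_compose[OF assms(2,1) open_swap[OF assms(1)]])
    (auto intro!: smooth_on_Pair smooth_on_snd smooth_on_fst smooth_on_id open_swap assms(1) simp: prod.swap_def)

lemma star_both_axes:
  assumes "star_both N" "(x, y) \<in> N"
  shows "(x, 0) \<in> N" "(0, y) \<in> N" "(0, 0) \<in> N"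
proof -
  have st: "star_fst N" "star_fst (prod.swap -` N)" using assms(1) unfolding star_both_def by auto
  show x: "(x, 0) \<in> N" using star_fst_zero[OF st(2), of y x] assms(2) by simp
  show "(0, y) \<in> N" by (rule star_fst_zero[OF st(1) assms(2)])
  show "(0, 0) \<in> N" by (rule star_fst_zero[OF st(1) x])
qed

lemma frechet_derivative_swap:
  fixes f :: "real \<times> real \<Rightarrow> real"
  assumes "open N" "smooth_on N f" "(x, y) \<in> N"
  shows "frechet_derivative (\<lambda>z. f (snd z, fst z)) (at (y, x)) (1, 0) = frechet_derivative f (at (x, y)) (0, 1)"
    "frechet_derivative (\<lambda>z. f (snd z, fst z)) (at (y, x)) (0, 1) = frechet_derivative f (at (x, y)) (1, 0)"
proof -
  have m: "(y, x) \<in> prod.swap -` N" using assms(3) by simp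
  note s = smooth_on_swap[OF assms(1,2)]
  show "frechet_derivative (\<lambda>z. f (snd z, fst z)) (at (y, x)) (1, 0) = frechet_derivative f (at (x, y)) (0, 1)"
    using has_derivative_slice_fst[OF s m] has_derivative_slice_snd[OF assms(2,3)] DERIV_unique by fastforce
  show "frechet_derivative (\<lambda>z. f (snd z, fst z)) (at (y, x)) (0, 1) = frechet_derivative f (at (x, y)) (1, 0)"
    using has_derivative_slice_snd[OF s m] has_derivative_slice_fst[OF assms(2,3)] DERIV_unique by fastforce
qed

lemma hadamard_snd:
  fixes \<Phi> :: "real \<times> real \<Rightarrow> real"
  assumes N: "open N" "star_both N" and \<Phi>: "smooth_on N \<Phi>" "\<And>x. (x, 0) \<in> N \<Longrightarrow> \<Phi> (x, 0) = 0"
  obtains \<Psi> where "smooth_on N \<Psi>" "\<And>x y. (x, y) \<in> N \<Longrightarrow> \<Phi> (x, y) = y * \<Psi> (x, y)"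
proof -
  let ?N = "prod.swap -` N" and ?S = "\<lambda>z. \<Phi> (snd z, fst z)"
  have N': "open ?N" "star_fst ?N" using open_swap[OF N(1)] N(2) unfolding star_both_def by auto
  have S: "smooth_on ?N ?S" by (rule smooth_on_swap[OF N(1) \<Phi>(1)])
  have "smooth_on (prod.swap -` ?N) (\<lambda>z. hadamard ?S (snd z, fst z))"
    by (rule smooth_on_swap[OF N'(1) smooth_on_hadamard[OF N' S]])
  moreover have "prod.swap -` ?N = N" by auto
  moreover have "\<Phi> (x, y) = y * hadamard ?S (y, x)" if "(x, y) \<in> N" for x y
    using hadamard[OF N'(2) S, of y x] that \<Phi>(2)[of x] star_both_axes(1)[OF N(2) that] by simp
  ultimately show ?thesis using that[of "\<lambda>z. hadamard ?S (snd z, fst z)"] by simp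
qed

text \<open>\<open>x powr \<alpha> * y powr \<beta> * exp g\<close> is a first integral up to an error of order \<open>K\<close> in \<open>x\<close>
  and \<open>J\<close> in \<open>y\<close>: its logarithmic derivative along the field \<open>(x A, y B)\<close> is \<open>x ^ K * y ^ J * e\<close>.\<close>

definition integral_error ::
    "(real \<times> real \<Rightarrow> real) \<Rightarrow> (real \<times> real \<Rightarrow> real) \<Rightarrow> real \<Rightarrow> real \<Rightarrow> (real \<times> real \<Rightarrow> real) \<Rightarrow> real \<times> real \<Rightarrow> real" where
  "integral_error A B \<alpha> \<beta> g z = \<alpha> * A z + \<beta> * B z
     + fst z * A z * frechet_derivative g (at z) (1, 0) + snd z * B z * frechet_derivative g (at z) (0, 1)"

definition approx_integral ::
    "(real \<times> real) set \<Rightarrow> (real \<times> real \<Rightarrow> real) \<Rightarrow> (real \<times> real \<Rightarrow> real) \<Rightarrow> real \<Rightarrow> real \<Rightarrow> nat \<Rightarrow> nat \<Rightarrow>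
     (real \<times> real \<Rightarrow> real) \<Rightarrow> (real \<times> real \<Rightarrow> real) \<Rightarrow> bool" where
  "approx_integral N A B \<alpha> \<beta> K J g e \<longleftrightarrow> smooth_on N g \<and> smooth_on N e \<and>
     (\<forall>z\<in>N. integral_error A B \<alpha> \<beta> g z = fst z ^ K * snd z ^ J * e z)"

text \<open>The two axes play symmetric roles; all work is done at one of them and transported by
  exchanging the coordinates, the exponents and the orders.\<close>

lemma approx_integral_swap:
  assumes N: "open N" and a: "approx_integral N A B \<alpha> \<beta> K J g e"
  shows "approx_integral (prod.swap -` N) (\<lambda>z. B (snd z, fst z)) (\<lambda>z. A (snd z, fst z)) \<beta> \<alpha> J K
    (\<lambda>z. g (snd z, fst z)) (\<lambda>z. e (snd z, fst z))"
  unfolding approx_integral_def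
proof (intro conjI ballI)
  have g: "smooth_on N g" and e: "smooth_on N e"
    and eq: "\<And>z. z \<in> N \<Longrightarrow> integral_error A B \<alpha> \<beta> g z = fst z ^ K * snd z ^ J * e z"
    using a unfolding approx_integral_def by auto
  show "smooth_on (prod.swap -` N) (\<lambda>z. g (snd z, fst z))" by (rule smooth_on_swap[OF N g])
  show "smooth_on (prod.swap -` N) (\<lambda>z. e (snd z, fst z))" by (rule smooth_on_swap[OF N e])
  fix z assume "z \<in> prod.swap -` N"
  then obtain x y where z: "z = (y, x)" "(x, y) \<in> N" by (cases z) auto
  show "integral_error (\<lambda>z. B (snd z, fst z)) (\<lambda>z. A (snd z, fst z)) \<beta> \<alpha> (\<lambda>z. g (snd z, fst z)) z
    = fst z ^ J * snd z ^ K * e (snd z, fst z)"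
    using eq[OF z(2)] frechet_derivative_swap[OF N g z(2)] unfolding z(1) integral_error_def
    by (simp add: algebra_simps)
qed

text \<open>The ratio of the components on the axis is its value at the origin plus
  \<open>x * l x\<close>. Only the constant part contributes an exponent; the rest is removed by the
  smooth integrating factor built from \<Lambda>.\<close>

lemma axis_quotient:
  fixes A B :: "real \<times> real \<Rightarrow> real"
  assumes N: "open N" "star_both N" and A: "smooth_on N A" "\<And>x. (x, 0) \<in> N \<Longrightarrow> A (x, 0) \<noteq> 0"
    and B: "smooth_on N B"
  obtains \<Lambda> l where "smooth_on {x. (x, 0) \<in> N} \<Lambda>" "smooth_on {x. (x, 0) \<in> N} l"
    "\<And>x. (x, 0) \<in> N \<Longrightarrow> (\<Lambda> has_real_derivative l x) (at x)"
    "\<And>x. (x, 0) \<in> N \<Longrightarrow> B (x, 0) / A (x, 0) = B (0, 0) / A (0, 0) + x * l x"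
proof -
  let ?I = "{x. (x, 0) \<in> N}"
  have I: "open ?I" "\<And>x t. x \<in> ?I \<Longrightarrow> 0 \<le> t \<Longrightarrow> t \<le> 1 \<Longrightarrow> t * x \<in> ?I"
    using open_slice_fst[OF N(1)] star_slice[of N] N(2) unfolding star_both_def by auto
  have "smooth_on ?I (\<lambda>x. B (x, 0) / A (x, 0))"
    by (intro smooth_on_divide I(1) smooth_on_slice_fst N(1) A(1) B) (use A(2) in auto)
  then obtain l where l: "smooth_on ?I l" "\<And>x. x \<in> ?I \<Longrightarrow> B (x, 0) / A (x, 0) = B (0, 0) / A (0, 0) + x * l x"
    using hadamard_1D[OF I] by (metis (no_types, lifting))
  obtain \<Lambda> where \<Lambda>: "smooth_on ?I \<Lambda>" "\<And>x. x \<in> ?I \<Longrightarrow> (\<Lambda> has_real_derivative l x) (at x)"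
    using antiderivative_1D[OF I l(1)] by blast
  show ?thesis by (rule that[OF \<Lambda>(1) l(1)]) (use \<Lambda>(2) l(2) in auto)
qed

lemma smooth_on_fst_comp:
  fixes f :: "real \<Rightarrow> real"
  assumes "open N" "star_both N" "smooth_on {x. (x, 0) \<in> N} f"
  shows "smooth_on N (\<lambda>z. f (fst z))"
  by (rule smooth_on_compose[OF assms(3) open_slice_fst[OF assms(1)] assms(1) smooth_on_fst[OF assms(1) smooth_on_id]])
    (use star_both_axes(1)[OF assms(2)] in auto)

text \<open>The correction \<open>x ^ K * y ^ J * v x\<close> of \<open>g\<close> should cancel the
  value of the error coefficient on \<open>y = 0\<close>. This is a linear equation for
  \<open>v\<close>; the substitution \<open>v = exp (- J \<Lambda>) * w\<close> makes it an Euler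
  equation with exponent \<open>K + J * B (0, 0) / A (0, 0)\<close>, and the hypothesis
  \<open>pos\<close> says that its solution is given by a convergent integral.\<close>

lemma approx_integral_step:
  fixes A B :: "real \<times> real \<Rightarrow> real"
  assumes N: "open N" "star_both N" and A: "smooth_on N A" "\<And>x. (x, 0) \<in> N \<Longrightarrow> A (x, 0) \<noteq> 0"
    and B: "smooth_on N B"
    and a: "approx_integral N A B \<alpha> \<beta> K J g e"
    and pos: "real K + real J * (B (0, 0) / A (0, 0)) > 0"
  shows "\<exists>g e. approx_integral N A B \<alpha> \<beta> K (Suc J) g e"
proof -
  let ?I = "{x. (x, 0) \<in> N}"
  define \<kappa> where "\<kappa> = real K + real J * (B (0, 0) / A (0, 0))"
  have I: "open ?I" "\<And>x t. x \<in> ?I \<Longrightarrow> 0 \<le> t \<Longrightarrow> t \<le> 1 \<Longrightarrow> t * x \<in> ?I"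
    using open_slice_fst[OF N(1)] star_slice[of N] N(2) unfolding star_both_def by auto
  have g: "smooth_on N g" and e: "smooth_on N e"
    and eq: "\<And>z. z \<in> N \<Longrightarrow> integral_error A B \<alpha> \<beta> g z = fst z ^ K * snd z ^ J * e z"
    using a unfolding approx_integral_def by auto
  obtain \<Lambda> l where \<Lambda>: "smooth_on ?I \<Lambda>" "smooth_on ?I l"
    "\<And>x. (x, 0) \<in> N \<Longrightarrow> (\<Lambda> has_real_derivative l x) (at x)"
    "\<And>x. (x, 0) \<in> N \<Longrightarrow> B (x, 0) / A (x, 0) = B (0, 0) / A (0, 0) + x * l x"
    using axis_quotient[OF N A B] by blast
  have "smooth_on ?I (\<lambda>x. - (e (x, 0) / A (x, 0)) * exp (real J * \<Lambda> x))"
    by (intro smooth_on_mult smooth_on_uminus smooth_on_divide smooth_on_exp smooth_on_const I(1)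
        smooth_on_slice_fst N(1) e A(1) \<Lambda>(1)) (use A(2) in auto)
  then obtain w where w: "smooth_on ?I w"
    "\<And>x. x \<in> ?I \<Longrightarrow> x * deriv w x + \<kappa> * w x = - (e (x, 0) / A (x, 0)) * exp (real J * \<Lambda> x)"
    using euler_solution_1D[OF I _ pos[folded \<kappa>_def]] by blast
  define v where "v x = exp (- real J * \<Lambda> x) * w x" for x
  define v' where "v' x = exp (- real J * \<Lambda> x) * (deriv w x - real J * l x * w x)" for x
  have v: "smooth_on ?I v" and v's: "smooth_on ?I v'"
    unfolding v_def v'_def
    by (intro smooth_on_mult smooth_on_diff smooth_on_exp smooth_on_const smooth_on_deriv_smooth I(1) w(1) \<Lambda>(1,2))+
  have v': "(v has_real_derivative v' x) (at x)" if "(x, 0) \<in> N" for x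
    unfolding v_def v'_def
    by (rule derivative_eq_intros refl \<Lambda>(3)[OF that] smooth_on_deriv(1)[OF w(1)])+
      (use that in \<open>auto simp: algebra_simps\<close>)
  have v_ode: "e (x, 0) + A (x, 0) * (x * v' x + real K * v x) + real J * B (x, 0) * v x = 0"
    if x: "(x, 0) \<in> N" for x
  proof -
    have B': "B (x, 0) = A (x, 0) * (B (0, 0) / A (0, 0) + x * l x)"
      using \<Lambda>(4)[OF x] A(2)[OF x] by (simp add: field_simps)
    have "A (x, 0) * (x * v' x + real K * v x) + real J * B (x, 0) * v x
      = A (x, 0) * (exp (- real J * \<Lambda> x) * (x * deriv w x + \<kappa> * w x))"
      unfolding B' v_def v'_def \<kappa>_def by (simp add: algebra_simps)
    also have "\<dots> = - e (x, 0) * (exp (- real J * \<Lambda> x) * exp (real J * \<Lambda> x))"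
      using w(2)[of x] x A(2)[OF x] by simp
    also have "exp (- real J * \<Lambda> x) * exp (real J * \<Lambda> x) = 1" by (simp add: exp_minus)
    finally show ?thesis by simp
  qed
  define g' where "g' z = g z + snd z ^ J * (fst z ^ K * v (fst z))" for z
  \<comment> \<open>The new error is \<open>x ^ K * y ^ J * \<Phi>\<close>. The equation for
    \<open>v\<close> says that \<Phi> vanishes on \<open>y = 0\<close>, so another factor
    \<open>y\<close> can be taken out.\<close>
  define \<Phi> where "\<Phi> z = e z + A z * (fst z * v' (fst z) + real K * v (fst z)) + real J * B z * v (fst z)" for z
  have g': "smooth_on N g'"
    unfolding g'_def
    by (intro smooth_on_add smooth_on_mult smooth_on_power smooth_on_fst smooth_on_snd smooth_on_id N(1) g
        smooth_on_fst_comp[OF N v])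
  have \<Phi>: "smooth_on N \<Phi>"
    unfolding \<Phi>_def
    by (intro smooth_on_add smooth_on_mult smooth_on_fst smooth_on_const smooth_on_id N(1) e A(1) B
        smooth_on_fst_comp[OF N v] smooth_on_fst_comp[OF N v's])
  obtain \<Psi> where \<Psi>: "smooth_on N \<Psi>" "\<And>x y. (x, y) \<in> N \<Longrightarrow> \<Phi> (x, y) = y * \<Psi> (x, y)"
    using hadamard_snd[OF N \<Phi>] v_ode unfolding \<Phi>_def by auto
  have "integral_error A B \<alpha> \<beta> g' z = fst z ^ K * snd z ^ Suc J * \<Psi> z" if zN: "z \<in> N" for z
  proof -
    obtain x y where z: "z = (x, y)" "(x, y) \<in> N" using zN by (cases z) auto
    have x0: "(x, 0) \<in> N" using star_both_axes(1)[OF N(2) z(2)] .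
    have "((\<lambda>x. g' (x, y)) has_real_derivative frechet_derivative g (at (x, y)) (1, 0) +
        y ^ J * (real K * x ^ (K - 1) * v x + x ^ K * v' x)) (at x)"
      unfolding g'_def fst_conv snd_conv
      by (rule derivative_eq_intros refl has_derivative_slice_fst[OF g z(2)] v'[OF x0])+ (simp add: algebra_simps)
    then have d1: "frechet_derivative g' (at (x, y)) (1, 0) = frechet_derivative g (at (x, y)) (1, 0) +
        y ^ J * (real K * x ^ (K - 1) * v x + x ^ K * v' x)"
      using has_derivative_slice_fst[OF g' z(2)] DERIV_unique by blast
    have "((\<lambda>y. g' (x, y)) has_real_derivative frechet_derivative g (at (x, y)) (0, 1) +
        real J * y ^ (J - 1) * (x ^ K * v x)) (at y)"
      unfolding g'_def fst_conv snd_conv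
      by (rule derivative_eq_intros refl has_derivative_slice_snd[OF g z(2)])+ (simp add: algebra_simps)
    then have d2: "frechet_derivative g' (at (x, y)) (0, 1) = frechet_derivative g (at (x, y)) (0, 1) +
        real J * y ^ (J - 1) * (x ^ K * v x)"
      using has_derivative_slice_snd[OF g' z(2)] DERIV_unique by blast
    have pk: "x * (real K * x ^ (K - 1)) = real K * x ^ K" by (cases K) auto
    have pj: "y * (real J * y ^ (J - 1)) = real J * y ^ J" by (cases J) auto
    have "integral_error A B \<alpha> \<beta> g' (x, y) = integral_error A B \<alpha> \<beta> g (x, y)
       + A (x, y) * y ^ J * (x * (real K * x ^ (K - 1)) * v x + x * x ^ K * v' x)
       + B (x, y) * (y * (real J * y ^ (J - 1))) * (x ^ K * v x)"
      unfolding integral_error_def d1 d2 fst_conv snd_conv by (simp only: algebra_simps)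
    also have "\<dots> = x ^ K * y ^ J * \<Phi> (x, y)"
      unfolding pk pj eq[OF z(2)] \<Phi>_def fst_conv snd_conv by (simp add: algebra_simps)
    finally show ?thesis unfolding \<Psi>(2)[OF z(2)] z(1) by simp
  qed
  then show ?thesis unfolding approx_integral_def using g' \<Psi>(1) by blast
qed

text \<open>On \<open>y = 0\<close> the field is explicit, and
  \<open>g = - \<beta> * \<Lambda>\<close> removes everything except a multiple of the combination
  in \<open>ratio\<close>, which is 0.\<close>

lemma approx_integral_init:
  fixes A B :: "real \<times> real \<Rightarrow> real"
  assumes N: "open N" "star_both N" and A: "smooth_on N A" "\<And>x. (x, 0) \<in> N \<Longrightarrow> A (x, 0) \<noteq> 0"
    and B: "smooth_on N B" and ratio: "\<alpha> * A (0, 0) + \<beta> * B (0, 0) = 0"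
  shows "\<exists>g e. approx_integral N A B \<alpha> \<beta> 0 1 g e"
proof -
  let ?I = "{x. (x, 0) \<in> N}"
  obtain \<Lambda> l where \<Lambda>: "smooth_on ?I \<Lambda>" "smooth_on ?I l"
    "\<And>x. (x, 0) \<in> N \<Longrightarrow> (\<Lambda> has_real_derivative l x) (at x)"
    "\<And>x. (x, 0) \<in> N \<Longrightarrow> B (x, 0) / A (x, 0) = B (0, 0) / A (0, 0) + x * l x"
    using axis_quotient[OF N A B] by blast
  define g where "g z = - \<beta> * \<Lambda> (fst z)" for z :: "real \<times> real"
  define \<Phi> where "\<Phi> z = \<alpha> * A z + \<beta> * B z - fst z * A z * (\<beta> * l (fst z))" for z
  have g: "smooth_on N g"
    unfolding g_def by (intro smooth_on_mult smooth_on_const N(1) smooth_on_fst_comp[OF N \<Lambda>(1)])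
  have \<Phi>: "smooth_on N \<Phi>"
    unfolding \<Phi>_def
    by (intro smooth_on_add smooth_on_diff smooth_on_mult smooth_on_const smooth_on_fst smooth_on_id N(1) A(1) B
        smooth_on_fst_comp[OF N \<Lambda>(2)])
  have "\<Phi> (x, 0) = 0" if x: "(x, 0) \<in> N" for x
  proof -
    have 0: "A (0, 0) \<noteq> 0" using A(2)[OF star_both_axes(3)[OF N(2) x]] .
    have B': "B (x, 0) = A (x, 0) * (B (0, 0) / A (0, 0) + x * l x)"
      using \<Lambda>(4)[OF x] A(2)[OF x] by (simp add: field_simps)
    have "\<Phi> (x, 0) = A (x, 0) / A (0, 0) * (\<alpha> * A (0, 0) + \<beta> * B (0, 0))"
      unfolding \<Phi>_def fst_conv B' using 0 by (simp add: field_simps)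
    then show ?thesis using ratio by simp
  qed
  then obtain \<Psi> where \<Psi>: "smooth_on N \<Psi>" "\<And>x y. (x, y) \<in> N \<Longrightarrow> \<Phi> (x, y) = y * \<Psi> (x, y)"
    using hadamard_snd[OF N \<Phi>] by blast
  have "integral_error A B \<alpha> \<beta> g z = fst z ^ 0 * snd z ^ 1 * \<Psi> z" if zN: "z \<in> N" for z
  proof -
    obtain x y where z: "z = (x, y)" "(x, y) \<in> N" using zN by (cases z) auto
    have x0: "(x, 0) \<in> N" using star_both_axes(1)[OF N(2) z(2)] .
    have "((\<lambda>x. g (x, y)) has_real_derivative - \<beta> * l x) (at x)"
      unfolding g_def fst_conv by (rule DERIV_cmult[OF \<Lambda>(3)[OF x0]])
    then have d1: "frechet_derivative g (at (x, y)) (1, 0) = - \<beta> * l x"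
      using has_derivative_slice_fst[OF g z(2)] DERIV_unique by blast
    have "((\<lambda>y. g (x, y)) has_real_derivative 0) (at y)" unfolding g_def by simp
    then have d2: "frechet_derivative g (at (x, y)) (0, 1) = 0"
      using has_derivative_slice_snd[OF g z(2)] DERIV_unique by blast
    show ?thesis
      unfolding z(1) integral_error_def d1 d2 fst_conv snd_conv using \<Psi>(2)[OF z(2)]
      by (simp add: \<Phi>_def)
  qed
  then show ?thesis unfolding approx_integral_def using g \<Psi>(1) by blast
qed

lemma approx_integral_step_fst:
  fixes A B :: "real \<times> real \<Rightarrow> real"
  assumes N: "open N" "star_both N" and A: "smooth_on N A"
    and B: "smooth_on N B" "\<And>y. (0, y) \<in> N \<Longrightarrow> B (0, y) \<noteq> 0"
    and a: "approx_integral N A B \<alpha> \<beta> K J g e"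
    and pos: "real J + real K * (A (0, 0) / B (0, 0)) > 0"
  shows "\<exists>g e. approx_integral N A B \<alpha> \<beta> (Suc K) J g e"
proof -
  let ?N = "prod.swap -` N"
  obtain g' e' where 1: "approx_integral ?N (\<lambda>z. B (snd z, fst z)) (\<lambda>z. A (snd z, fst z)) \<beta> \<alpha> J (Suc K) g' e'"
    using approx_integral_step[OF open_swap[OF N(1)] _ smooth_on_swap[OF N(1) B(1)] _ smooth_on_swap[OF N(1) A]
        approx_integral_swap[OF N(1) a]] N(2) B(2) pos by (auto simp: star_both_swap)
  have "prod.swap -` ?N = N" by auto
  with approx_integral_swap[OF open_swap[OF N(1)] 1] show ?thesis by auto
qed

text \<open>Both steps are only solved by convergent integrals on one side of the line \<open>K = \<theta> J\<close>; for
  irrational \<open>\<theta>\<close> exactly one of them is available at every lattice point.\<close>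

lemma approx_integral_exists:
  fixes A B :: "real \<times> real \<Rightarrow> real"
  assumes N: "open N" "star_both N" "(0, 0) \<in> N"
    and A: "smooth_on N A" "\<And>x. (x, 0) \<in> N \<Longrightarrow> A (x, 0) \<noteq> 0"
    and B: "smooth_on N B" "\<And>y. (0, y) \<in> N \<Longrightarrow> B (0, y) \<noteq> 0"
    and \<theta>: "\<theta> = - B (0, 0) / A (0, 0)" "\<theta> > 0" "\<theta> \<notin> \<rat>"
    and J: "J \<ge> 1"
  shows "\<exists>K g e. real K > \<theta> * real J \<and> approx_integral N A B \<theta> 1 K J g e"
proof -
  have BA: "B (0, 0) / A (0, 0) = - \<theta>" "A (0, 0) / B (0, 0) = - (1 / \<theta>)"
    using \<theta>(1) by auto
  have ne: "real K \<noteq> \<theta> * real J" if "J \<ge> 1" for K J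
  proof
    assume "real K = \<theta> * real J"
    then have "\<theta> = real K / real J" using that by (simp add: field_simps)
    then show False using \<theta>(3) by simp
  qed
  \<comment> \<open>With \<open>J\<close> fixed, the order in \<open>x\<close> is raised one at a
    time until it passes \<theta> J; the distance to the ceiling of \<theta> J is the termination
    measure.\<close>
  have climb: "\<exists>K g e. real K > \<theta> * real J \<and> approx_integral N A B \<theta> 1 K J g e"
    if "approx_integral N A B \<theta> 1 K J g e" "J \<ge> 1" for K J g e
    using that
  proof (induction "nat \<lceil>\<theta> * real J\<rceil> - K" arbitrary: K g e rule: less_induct)
    case less
    show ?case
    proof (cases "real K > \<theta> * real J")
      case False
      then have lt: "real K < \<theta> * real J" using ne[OF less.prems(2), of K] by auto
      \<comment> \<open>The exponent is \<open>J - K / \<theta>\<close>: the step in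
        \<open>x\<close> is available precisely below the line.\<close>
      have "real J + real K * (A (0, 0) / B (0, 0)) > 0"
        unfolding BA using lt \<theta>(2) by (simp add: field_simps)
      then obtain g' e' where 1: "approx_integral N A B \<theta> 1 (Suc K) J g' e'"
        using approx_integral_step_fst[OF N(1,2) A(1) B less.prems(1)] by blast
      have "nat \<lceil>\<theta> * real J\<rceil> - Suc K < nat \<lceil>\<theta> * real J\<rceil> - K"
        using lt by linarith
      from less.hyps[OF this 1 less.prems(2)] show ?thesis .
    qed (use less.prems in blast)
  qed
  show ?thesis
    using J
  proof (induction J rule: dec_induct)
    case base
    have "A (0, 0) \<noteq> 0" using A(2) N(3) by auto
    then have "\<theta> * A (0, 0) + 1 * B (0, 0) = 0" using \<theta>(1) by simp
    from approx_integral_init[OF N(1,2) A B(1) this] climb[of 0 1] show ?case by auto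
  next
    case (step J)
    then obtain K g e where K: "real K > \<theta> * real J" "approx_integral N A B \<theta> 1 K J g e" by auto
    \<comment> \<open>Now the exponent is \<open>K - \<theta> * J\<close>: above the line the step
      in \<open>y\<close> takes over.\<close>
    have "real K + real J * (B (0, 0) / A (0, 0)) > 0" unfolding BA using K(1) by (simp add: algebra_simps)
    then show ?case using approx_integral_step[OF N(1,2) A B(1) K(2)] climb[of K "Suc J"] by auto
  qed
qed

section \<open>Taylor coefficients of an approximate integral at an axis\<close>

lemma DERIV_mult_self_zero:
  fixes Q :: "real \<Rightarrow> real"
  assumes "isCont Q 0"
  shows "((\<lambda>x. x * Q x) has_real_derivative Q 0) (at 0)"
  unfolding CARAT_DERIV using assms by (intro exI[of _ Q]) (simp add: mult.commute)

lemma smooth_on_slice_snd: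
  fixes F :: "'p::euclidean_space \<times> real \<Rightarrow> real"
  assumes "open N" "smooth_on N F"
  shows "open {y. (x, y) \<in> N}" "smooth_on {y. (x, y) \<in> N} (\<lambda>y. F (x, y))"
proof -
  show o: "open {y. (x, y) \<in> N}"
    using open_vimage[of N, OF assms(1) continuous_on_Pair[OF continuous_on_const[of UNIV x] continuous_on_id]]
    by (simp add: vimage_def)
  show "smooth_on {y. (x, y) \<in> N} (\<lambda>y. F (x, y))"
    by (rule smooth_on_compose[OF assms(2,1) o])
      (auto intro!: smooth_on_Pair smooth_on_id smooth_on_const o)
qed

lemma star_both_slice:
  assumes "star_both N" "y \<in> {y. (0, y) \<in> N}" "0 \<le> t" "t \<le> 1"
  shows "t * y \<in> {y. (0, y) \<in> N}"
  using star_fstD[of "prod.swap -` N" y 0 t] assms unfolding star_both_def by simp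

text \<open>The first two coefficients of \<open>g\<close> in \<open>x\<close> satisfy linear equations along the axis \<open>x = 0\<close>,
  read off from the coefficients of order 0 and 1 of the error.\<close>

lemma approx_integral_transport:
  fixes A B :: "real \<times> real \<Rightarrow> real"
  assumes N: "open N" "star_both N" and A: "smooth_on N A"
    and B: "smooth_on N B" "\<And>y. (0, y) \<in> N \<Longrightarrow> B (0, y) \<noteq> 0"
    and a: "approx_integral N A B \<alpha> \<beta> K J g e" and K: "K \<ge> 2"
    and y: "(0, y) \<in> N"
  shows "y * frechet_derivative g (at (0, y)) (0, 1) = - (\<alpha> * (A (0, y) / B (0, y)) + \<beta>)"
    "y * deriv (\<lambda>y. frechet_derivative g (at (0, y)) (1, 0)) y
      + A (0, y) / B (0, y) * frechet_derivative g (at (0, y)) (1, 0)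
      + \<alpha> * deriv (\<lambda>x. A (x, y) / B (x, y)) 0 = 0"
proof -
  have g: "smooth_on N g" and e: "smooth_on N e"
    and eq: "\<And>z. z \<in> N \<Longrightarrow> integral_error A B \<alpha> \<beta> g z = fst z ^ K * snd z ^ J * e z"
    using a unfolding approx_integral_def by auto
  define H where "H = hadamard g"
  have st: "star_fst N" using N(2) unfolding star_both_def by auto
  have H: "smooth_on N H" unfolding H_def by (rule smooth_on_hadamard[OF N(1) st g])
  have gH: "g (x, y) = g (0, y) + x * H (x, y)" if "(x, y) \<in> N" for x y
    unfolding H_def by (rule hadamard[OF st g that])
  let ?gy = "frechet_derivative g (at (0, y)) (0, 1)"
  have "\<alpha> * A (0, y) + \<beta> * B (0, y) + y * B (0, y) * ?gy = 0"
    using eq[OF y] K by (simp add: integral_error_def power_0_left)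
  then show 1: "y * ?gy = - (\<alpha> * (A (0, y) / B (0, y)) + \<beta>)"
    using B(2)[OF y] by (simp add: field_simps)
  define Hx where "Hx z = frechet_derivative H (at z) (1, 0)" for z
  define Hy where "Hy z = frechet_derivative H (at z) (0, 1)" for z
  have Hxy: "smooth_on N Hx" "smooth_on N Hy"
    unfolding Hx_def Hy_def by (rule smooth_on_dir[OF H])+
  let ?S = "{x. (x, y) \<in> N}"
  have S: "open ?S" "0 \<in> ?S" using open_slice_fst[OF N(1)] y by auto
  \<comment> \<open>With \<open>g (x, y) = g (0, y) + x * H (x, y)\<close>, all terms of the error
    that carry a factor \<open>x\<close> are collected as \<open>x * Q\<close>. Because
    \<open>K \<ge> 2\<close>, the remainder term in \<open>Q\<close> still vanishes at
    \<open>x = 0\<close>.\<close>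
  define Q where "Q z = A z * (H z + fst z * Hx z) + snd z * B z * Hy z - fst z ^ (K - 1) * snd z ^ J * e z" for z
  have Q: "smooth_on N Q"
    unfolding Q_def
    by (intro smooth_on_add smooth_on_diff smooth_on_mult smooth_on_power smooth_on_fst smooth_on_snd smooth_on_id
        N(1) A B(1) H Hxy e)
  let ?p = "A (0, y) / B (0, y)"
  \<comment> \<open>Eliminating the derivative of \<open>g (0, y)\<close> by the first equation
    leaves an identity in \<open>x\<close>. It is differentiated at \<open>x = 0\<close>, where only
    \<open>Q (0, y)\<close> is needed of the second summand.\<close>
  have zero: "\<alpha> * (A (x, y) - ?p * B (x, y)) + x * Q (x, y) = 0" if x: "(x, y) \<in> N" for x
  proof -
    have "((\<lambda>x. g (0, y) + x * H (x, y)) has_real_derivative H (x, y) + x * Hx (x, y)) (at x)"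
      unfolding Hx_def by (rule derivative_eq_intros refl has_derivative_slice_fst[OF H x])+ simp
    then have "((\<lambda>x. g (x, y)) has_real_derivative H (x, y) + x * Hx (x, y)) (at x)"
      by (rule has_field_derivative_transform_within_open[OF _ S(1)]) (use x gH in auto)
    then have gx: "frechet_derivative g (at (x, y)) (1, 0) = H (x, y) + x * Hx (x, y)"
      using has_derivative_slice_fst[OF g x] DERIV_unique by blast
    have "((\<lambda>y. g (0, y) + x * H (x, y)) has_real_derivative ?gy + x * Hy (x, y)) (at y)"
      unfolding Hy_def
      by (rule derivative_eq_intros refl has_derivative_slice_snd[OF H x] has_derivative_slice_snd[OF g y])+
        (simp add: mult.commute)
    then have "((\<lambda>y. g (x, y)) has_real_derivative ?gy + x * Hy (x, y)) (at y)"
      by (rule has_field_derivative_transform_within_open[OF _ smooth_on_slice_snd(1)[OF N(1) g, of x]]) (use x gH in auto)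
    then have gy: "frechet_derivative g (at (x, y)) (0, 1) = ?gy + x * Hy (x, y)"
      using has_derivative_slice_snd[OF g x] DERIV_unique by blast
    have xK: "x * x ^ (K - 1) = x ^ K" using K by (cases K) auto
    have "0 = \<alpha> * A (x, y) + \<beta> * B (x, y) + x * A (x, y) * (H (x, y) + x * Hx (x, y))
       + B (x, y) * (y * ?gy) + y * B (x, y) * (x * Hy (x, y)) - (x * x ^ (K - 1)) * y ^ J * e (x, y)"
      using eq[OF x] unfolding integral_error_def gx gy fst_conv snd_conv xK by (simp add: algebra_simps)
    also have "\<dots> = \<alpha> * (A (x, y) - ?p * B (x, y)) + x * Q (x, y)"
      unfolding 1 Q_def fst_conv snd_conv by (simp add: algebra_simps)
    finally show ?thesis by simp
  qed
  let ?Ax = "frechet_derivative A (at (0, y)) (1, 0)" and ?Bx = "frechet_derivative B (at (0, y)) (1, 0)"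
  have "isCont (\<lambda>x. Q (x, y)) 0"
    by (rule smooth_on_isCont[OF smooth_on_slice_fst[OF N(1) Q] S(2)])
  note DQ = DERIV_mult_self_zero[OF this]
  have "((\<lambda>x. \<alpha> * (A (x, y) - ?p * B (x, y)) + x * Q (x, y)) has_real_derivative
      \<alpha> * (?Ax - ?p * ?Bx) + Q (0, y)) (at 0)"
    by (rule DERIV_add[OF DERIV_cmult[OF DERIV_diff[OF has_derivative_slice_fst[OF A y]
        DERIV_cmult[OF has_derivative_slice_fst[OF B(1) y]]]] DQ])
  moreover have "((\<lambda>x. \<alpha> * (A (x, y) - ?p * B (x, y)) + x * Q (x, y)) has_real_derivative 0) (at 0)"
    by (rule has_field_derivative_transform_within_open[OF DERIV_const[of 0] S]) (use zero in auto)
  ultimately have 2: "\<alpha> * (?Ax - ?p * ?Bx) + Q (0, y) = 0" using DERIV_unique by blast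
  have "((\<lambda>x. A (x, y) / B (x, y)) has_real_derivative
      (?Ax * B (0, y) - A (0, y) * ?Bx) / (B (0, y) * B (0, y))) (at 0)"
    by (rule DERIV_divide[OF has_derivative_slice_fst[OF A y] has_derivative_slice_fst[OF B(1) y] B(2)[OF y]])
  from DERIV_imp_deriv[OF this] have p1: "deriv (\<lambda>x. A (x, y) / B (x, y)) 0 = (?Ax - ?p * ?Bx) / B (0, y)"
    using B(2)[OF y] by (simp add: field_simps)
  have ab: "y * h' + a / b * h + \<alpha> * (q / b) = 0" if "b \<noteq> 0" "\<alpha> * q + (a * h + y * b * h') = 0" for a b h h' q :: real
  proof -
    have "(y * h' + a / b * h + \<alpha> * (q / b)) * b = \<alpha> * q + (a * h + y * b * h')"
      using that(1) by (simp add: algebra_simps)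
    then show ?thesis using that by simp
  qed
  have \<gamma>: "frechet_derivative g (at (0, y)) (1, 0) = H (0, y)" for y
    unfolding H_def hadamard_zero ..
  have "deriv (\<lambda>y. H (0, y)) y = Hy (0, y)"
    unfolding Hy_def by (rule DERIV_imp_deriv[OF has_derivative_slice_snd[OF H y]])
  moreover have "Q (0, y) = A (0, y) * H (0, y) + y * B (0, y) * Hy (0, y)"
    unfolding Q_def using K by (simp add: power_0_left)
  ultimately show "y * deriv (\<lambda>y. frechet_derivative g (at (0, y)) (1, 0)) y
      + ?p * frechet_derivative g (at (0, y)) (1, 0) + \<alpha> * deriv (\<lambda>x. A (x, y) / B (x, y)) 0 = 0"
    using 2 B(2)[OF y] ab[of "B (0, y)" "?Ax - ?p * ?Bx" "A (0, y)" "H (0, y)" "Hy (0, y)"]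
    unfolding \<gamma> p1 by simp
qed

text \<open>The logarithmic derivative of \<open>L\<close> is chosen to cancel the term with
  \<open>A / B\<close> in the transport equation. What remains for
  \<open>- L * \<gamma> / \<alpha>\<close>, with \<gamma> the transverse derivative of
  \<open>g\<close>, is the Mellin equation with exponent \<open>\<beta> / \<alpha>\<close>, and its
  smooth solution is unique.\<close>

lemma approx_integral_mellin:
  fixes A B :: "real \<times> real \<Rightarrow> real"
  assumes N: "open N" "star_both N" and A: "smooth_on N A"
    and B: "smooth_on N B" "\<And>y. (0, y) \<in> N \<Longrightarrow> B (0, y) \<noteq> 0"
    and a: "approx_integral N A B \<alpha> \<beta> K J g e" and K: "K \<ge> 2"
    and L: "\<And>y. (0, y) \<in> N \<Longrightarrow> \<exists>d. (L has_real_derivative d) (at y) \<and> y * d = L y * (A (0, y) / B (0, y) + \<beta> / \<alpha>)"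
      "smooth_on {y. (0, y) \<in> N} L" "\<And>y. (0, y) \<in> N \<Longrightarrow> L y \<noteq> 0"
    and Y: "smooth_on {y. (0, y) \<in> N} Y"
      "\<And>y. (0, y) \<in> N \<Longrightarrow> y * deriv Y y - \<beta> / \<alpha> * Y y = L y * deriv (\<lambda>x. A (x, y) / B (x, y)) 0"
    and nr: "\<beta> / \<alpha> \<notin> range real" "\<alpha> \<noteq> 0"
    and y: "(0, y) \<in> N"
  shows "frechet_derivative g (at (0, y)) (1, 0) = - \<alpha> * Y y / L y"
proof -
  let ?I = "{y. (0, y) \<in> N}"
  define \<gamma> where "\<gamma> y = frechet_derivative g (at (0, y)) (1, 0)" for y
  have g: "smooth_on N g" using a unfolding approx_integral_def by auto
  note I = smooth_on_slice_snd(1)[OF N(1) g, of 0]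
  have \<gamma>: "smooth_on ?I \<gamma>"
    unfolding \<gamma>_def by (rule smooth_on_slice_snd(2)[OF N(1) smooth_on_dir[OF g]])
  define c where "c = - 1 / \<alpha>"
  define w where "w y = c * (L y * \<gamma> y)" for y
  have "w y = Y y"
  proof (rule mellin_unique[OF I star_both_slice[OF N(2)] nr(1) Y(1)])
    show "smooth_on ?I w" unfolding w_def by (intro smooth_on_mult smooth_on_const I L(2) \<gamma>)
    fix y assume "y \<in> ?I"
    then have y: "(0, y) \<in> N" by simp
    then show "y * deriv Y y - \<beta> / \<alpha> * Y y = L y * deriv (\<lambda>x. A (x, y) / B (x, y)) 0" by (rule Y(2))
    obtain d where d: "(L has_real_derivative d) (at y)" "y * d = L y * (A (0, y) / B (0, y) + \<beta> / \<alpha>)"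
      using L(1)[OF y] by auto
    have "(w has_real_derivative c * (d * \<gamma> y + deriv \<gamma> y * L y)) (at y)"
      unfolding w_def
      by (rule DERIV_cmult[OF DERIV_mult[OF d(1) smooth_on_deriv(1)[OF \<gamma>]]]) (use y in auto)
    note dw = DERIV_imp_deriv[OF this]
    have "y * deriv w y = c * ((y * d) * \<gamma> y + L y * (y * deriv \<gamma> y))"
      unfolding dw by (simp add: algebra_simps)
    also have "y * deriv \<gamma> y = - (A (0, y) / B (0, y)) * \<gamma> y - \<alpha> * deriv (\<lambda>x. A (x, y) / B (x, y)) 0"
      using approx_integral_transport(2)[OF N A B a K y] unfolding \<gamma>_def by simp
    finally show "y * deriv w y - \<beta> / \<alpha> * w y = L y * deriv (\<lambda>x. A (x, y) / B (x, y)) 0"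
      unfolding d(2) w_def c_def using nr(2) by (simp add: field_simps)
  qed (use y in auto)
  then have "L y * \<gamma> y = - \<alpha> * Y y" using nr(2) unfolding w_def c_def by (auto simp: field_simps)
  then show ?thesis using L(3)[OF y] unfolding \<gamma>_def by (simp add: field_simps)
qed

text \<open>The transverse component of the section is \<open>s * \<xi> s\<close> with \<xi>
  positive near 0. Its logarithm splits into \<open>ln s\<close> and a smooth part, which joins the
  other terms in \<open>G\<close>. The half of the second derivative comes from the Taylor expansion
  of \<xi>.\<close>

lemma section_expansion:
  fixes g :: "real \<times> real \<Rightarrow> real" and \<sigma> :: "real \<Rightarrow> real \<times> real"
  assumes N: "open N" and g: "smooth_on N g" and \<epsilon>: "\<epsilon> > 0"
    and \<sigma>: "smooth_on {-\<epsilon><..<\<epsilon>} (\<lambda>s. fst (\<sigma> s))" "smooth_on {-\<epsilon><..<\<epsilon>} (\<lambda>s. snd (\<sigma> s))"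
    and b: "\<sigma> 0 = (0, b)" "b > 0" "(0, b) \<in> N" and pos: "deriv (\<lambda>s. fst (\<sigma> s)) 0 > 0"
  defines "x1 \<equiv> deriv (\<lambda>s. fst (\<sigma> s)) 0" and "x2 \<equiv> deriv (deriv (\<lambda>s. fst (\<sigma> s))) 0" and "y1 \<equiv> deriv (\<lambda>s. snd (\<sigma> s)) 0"
  shows "\<exists>G s0. 0 < s0 \<and> s0 \<le> \<epsilon> \<and> smooth_on {-s0<..<s0} G \<and>
    (\<forall>s\<in>{0<..<s0}. \<sigma> s \<in> N \<and> 0 < fst (\<sigma> s) \<and> 0 < snd (\<sigma> s) \<and>
      \<alpha> * ln (fst (\<sigma> s)) + \<beta> * ln (snd (\<sigma> s)) + g (\<sigma> s) = \<alpha> * ln s + G s) \<and>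
    deriv G 0 = \<alpha> * (x2 / (2 * x1)) + \<beta> * (y1 / b) + x1 * frechet_derivative g (at (0, b)) (1, 0)
      + y1 * frechet_derivative g (at (0, b)) (0, 1)"
proof -
  let ?I = "{-\<epsilon><..<\<epsilon>}"
  define x where "x s = fst (\<sigma> s)" for s
  define y where "y s = snd (\<sigma> s)" for s
  have xy: "smooth_on ?I x" "smooth_on ?I y" unfolding x_def y_def by (rule \<sigma>)+
  have I: "open ?I" "0 \<in> ?I" using \<epsilon> by auto
  have st: "t * s \<in> ?I" if "s \<in> ?I" "0 \<le> t" "t \<le> 1" for s t
  proof -
    have "\<bar>t * s\<bar> \<le> \<bar>s\<bar>" using that by (simp add: abs_mult mult_left_le_one_le)
    then show ?thesis using that(1) by auto
  qed
  have x0: "x 0 = 0" "y 0 = b" using b(1) by (auto simp: x_def y_def)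
  obtain \<xi> where \<xi>: "smooth_on ?I \<xi>" "\<And>s. s \<in> ?I \<Longrightarrow> x s = s * \<xi> s"
    by (rule hadamard_1D[OF I(1) _ xy(1), unfolded x0 add_0]) (erule (2) st, blast)
  have d\<xi>: "deriv x s = \<xi> s + s * deriv \<xi> s" if s: "s \<in> ?I" for s
  proof (rule DERIV_imp_deriv)
    have "((\<lambda>s. s * \<xi> s) has_real_derivative \<xi> s + s * deriv \<xi> s) (at s)"
      using DERIV_mult[OF DERIV_ident smooth_on_deriv(1)[OF \<xi>(1) s]] by (simp add: mult.commute)
    then show "(x has_real_derivative \<xi> s + s * deriv \<xi> s) (at s)"
      by (rule has_field_derivative_transform_within_open[OF _ I(1) s]) (use \<xi>(2) in auto)
  qed
  have \<xi>0: "\<xi> 0 = x1" using d\<xi>[OF I(2)] unfolding x1_def x_def by simp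
  have \<xi>1: "deriv \<xi> 0 = x2 / 2"
  proof -
    have "((\<lambda>s. \<xi> s + s * deriv \<xi> s) has_real_derivative 2 * deriv \<xi> 0) (at 0)"
      using DERIV_add[OF smooth_on_deriv(1)[OF \<xi>(1) I(2)]
          DERIV_mult[OF DERIV_ident smooth_on_deriv(1)[OF smooth_on_deriv_smooth[OF I(1) \<xi>(1)] I(2)]]]
      by simp
    then have "(deriv x has_real_derivative 2 * deriv \<xi> 0) (at 0)"
      by (rule has_field_derivative_transform_within_open[OF _ I]) (use d\<xi> in auto)
    then show ?thesis unfolding x2_def x_def[symmetric] by (simp add: DERIV_imp_deriv)
  qed
  have cont: "isCont x 0" "isCont y 0" "isCont \<xi> 0"
    using smooth_on_isCont[OF _ I(2)] xy \<xi>(1) by auto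
  have "\<forall>\<^sub>F s in nhds 0. s \<in> ?I \<and> 0 < \<xi> s \<and> 0 < y s \<and> (x s, y s) \<in> N"
  proof (intro eventually_conj)
    show "\<forall>\<^sub>F s in nhds 0. s \<in> ?I" by (rule eventually_nhds_in_open[OF I])
    show "\<forall>\<^sub>F s in nhds 0. 0 < \<xi> s"
      using order_tendstoD(1)[OF cont(3)[unfolded isCont_def tendsto_at_iff_tendsto_nhds]] \<xi>0 pos x1_def by simp
    show "\<forall>\<^sub>F s in nhds 0. 0 < y s"
      using order_tendstoD(1)[OF cont(2)[unfolded isCont_def tendsto_at_iff_tendsto_nhds]] x0 b(2) by simp
    have "((\<lambda>s. (x s, y s)) \<longlongrightarrow> (x 0, y 0)) (nhds 0)"
      using cont unfolding isCont_def tendsto_at_iff_tendsto_nhds by (intro tendsto_Pair)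
    then show "\<forall>\<^sub>F s in nhds 0. (x s, y s) \<in> N"
      using topological_tendstoD N b(3) x0 by fastforce
  qed
  then obtain d where d: "d > 0" "\<And>s. \<bar>s\<bar> < d \<Longrightarrow> s \<in> ?I \<and> 0 < \<xi> s \<and> 0 < y s \<and> (x s, y s) \<in> N"
    unfolding eventually_nhds_metric by (auto simp: dist_real_def)
  define s0 where "s0 = min d \<epsilon>"
  have s0: "0 < s0" "s0 \<le> \<epsilon>" "\<And>s. s \<in> {-s0<..<s0} \<Longrightarrow> s \<in> ?I \<and> 0 < \<xi> s \<and> 0 < y s \<and> (x s, y s) \<in> N"
    using d \<epsilon> unfolding s0_def by auto
  let ?J = "{-s0<..<s0}"
  have J: "open ?J" "?J \<subseteq> ?I" "0 \<in> ?J" using s0 by auto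
  define G where "G s = \<alpha> * ln (\<xi> s) + \<beta> * ln (y s) + g (x s, y s)" for s
  have sm: "smooth_on ?J x" "smooth_on ?J y" "smooth_on ?J \<xi>"
    using xy \<xi>(1) smooth_on_subset[OF _ J(2)] by auto
  have gc: "smooth_on ?J (\<lambda>s. g (x s, y s))"
    by (rule smooth_on_compose[OF g N J(1) smooth_on_Pair[OF J(1) sm(1,2)]]) (use s0(3) in auto)
  have G: "smooth_on ?J G"
    unfolding G_def
    by (intro smooth_on_add smooth_on_mult smooth_on_const smooth_on_ln J(1) sm gc) (use s0(3) in auto)
  have e: "\<sigma> s \<in> N \<and> 0 < fst (\<sigma> s) \<and> 0 < snd (\<sigma> s) \<and>
      \<alpha> * ln (fst (\<sigma> s)) + \<beta> * ln (snd (\<sigma> s)) + g (\<sigma> s) = \<alpha> * ln s + G s" if s: "s \<in> {0<..<s0}" for s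
  proof -
    have 1: "s \<in> ?I" "0 < \<xi> s" "0 < y s" "(x s, y s) \<in> N" using s0(3)[of s] s by auto
    have 2: "\<sigma> s = (x s, y s)" unfolding x_def y_def by simp
    have 3: "x s = s * \<xi> s" by (rule \<xi>(2)[OF 1(1)])
    have "ln (x s) = ln s + ln (\<xi> s)" unfolding 3 using s 1(2) by (simp add: ln_mult)
    then show ?thesis using 1 s unfolding 2 G_def by (simp add: 3 algebra_simps)
  qed
  have "((\<lambda>s. (x s, y s)) has_derivative (\<lambda>v. (deriv x 0 * v, deriv y 0 * v))) (at 0)"
    using smooth_on_deriv(1)[OF xy(1) I(2)] smooth_on_deriv(1)[OF xy(2) I(2)]
    unfolding has_field_derivative_def by (intro has_derivative_Pair)
  from diff_chain_at[OF this smooth_on_has_derivative[OF g, of "(x 0, y 0)"]] b(3) x0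
  have dg: "((\<lambda>s. g (x s, y s)) has_derivative (\<lambda>v. frechet_derivative g (at (0, b)) (deriv x 0 * v, deriv y 0 * v))) (at 0)"
    by (simp add: o_def)
  have lin: "frechet_derivative g (at (0, b)) (p, q)
      = p * frechet_derivative g (at (0, b)) (1, 0) + q * frechet_derivative g (at (0, b)) (0, 1)" for p q
  proof -
    interpret linear "frechet_derivative g (at (0, b))"
      using smooth_on_has_derivative[OF g b(3)] has_derivative_linear by blast
    have "(p, q) = p *\<^sub>R (1, 0) + q *\<^sub>R (0, 1)" by simp
    then have "frechet_derivative g (at (0, b)) (p, q)
      = frechet_derivative g (at (0, b)) (p *\<^sub>R (1, 0) + q *\<^sub>R (0, 1))" by (rule arg_cong)
    then show ?thesis unfolding add scale real_scaleR_def .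
  qed
  have dl: "((\<lambda>s. ln (\<xi> s)) has_real_derivative deriv \<xi> 0 / \<xi> 0) (at 0)"
    "((\<lambda>s. ln (y s)) has_real_derivative deriv y 0 / y 0) (at 0)"
    using DERIV_chain2[OF DERIV_ln_divide[of "\<xi> 0"] smooth_on_deriv(1)[OF \<xi>(1) I(2)]]
      DERIV_chain2[OF DERIV_ln_divide[of "y 0"] smooth_on_deriv(1)[OF xy(2) I(2)]] \<xi>0 pos x1_def x0 b(2)
    by simp_all
  have "((\<lambda>s. g (x s, y s)) has_real_derivative (deriv x 0 * frechet_derivative g (at (0, b)) (1, 0)
      + deriv y 0 * frechet_derivative g (at (0, b)) (0, 1))) (at 0)"
    unfolding has_field_derivative_def
    by (rule has_derivative_eq_rhs[OF dg]) (rule ext, subst lin, simp add: algebra_simps)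
  then have "(G has_real_derivative \<alpha> * (deriv \<xi> 0 / \<xi> 0) + \<beta> * (deriv y 0 / y 0) +
     (deriv x 0 * frechet_derivative g (at (0, b)) (1, 0) + deriv y 0 * frechet_derivative g (at (0, b)) (0, 1))) (at 0)"
    unfolding G_def
    by (rule DERIV_add[OF DERIV_add[OF DERIV_cmult[OF dl(1)] DERIV_cmult[OF dl(2)]]])
  from DERIV_imp_deriv[OF this] have "deriv G 0 = \<alpha> * (x2 / (2 * x1)) + \<beta> * (y1 / b) + x1 * frechet_derivative g (at (0, b)) (1, 0)
      + y1 * frechet_derivative g (at (0, b)) (0, 1)"
    unfolding \<xi>0 \<xi>1 x0 by (simp add: x1_def y1_def x_def[abs_def] y_def[abs_def])
  with s0(1,2) G e show ?thesis by blast
qed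

section \<open>The passage near the corner\<close>

text \<open>A neighbourhood of both axis segments, made of two rectangles so that each coordinate
  can be contracted to 0 inside it; \<open>U\<close> may fail to have this property.\<close>

definition cross :: "real \<Rightarrow> real \<Rightarrow> real \<Rightarrow> (real \<times> real) set" where
  "cross a b \<eta> = {-\<eta><..<a + \<eta>} \<times> {-\<eta><..<\<eta>} \<union> {-\<eta><..<\<eta>} \<times> {-\<eta><..<b + \<eta>}"

lemma open_cross: "open (cross a b \<eta>)"
  unfolding cross_def by (intro open_Un open_Times) auto

lemma cross_axes:
  assumes "a > 0" "b > 0" "\<eta> > 0"
  shows "(x, 0) \<in> cross a b \<eta> \<longleftrightarrow> -\<eta> < x \<and> x < a + \<eta>" "(0, y) \<in> cross a b \<eta> \<longleftrightarrow> -\<eta> < y \<and> y < b + \<eta>"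
  using assms unfolding cross_def by auto

lemma swap_cross: "prod.swap -` cross a b \<eta> = cross b a \<eta>"
  unfolding cross_def by auto

lemma star_fst_cross: "a > 0 \<Longrightarrow> b > 0 \<Longrightarrow> \<eta> > 0 \<Longrightarrow> star_fst (cross a b \<eta>)"
proof -
  assume p: "a > 0" "b > 0" "\<eta> > 0"
  have 1: "t * u \<in> {-\<eta><..<c}" if "u \<in> {-\<eta><..<c}" "t \<in> {0..1}" "c > 0" for t u c :: real
  proof (cases "u \<ge> 0")
    case True
    then have "0 \<le> t * u" "t * u \<le> u" using that by (auto intro: mult_left_le_one_le)
    then show ?thesis using that p by auto
  next
    case False
    then have "t * u \<le> 0" "u \<le> t * u"
      using that mult_left_le_one_le[of "- u" t] by (auto simp: mult_nonneg_nonpos)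
    moreover have "-\<eta> < u" using that by simp
    ultimately have "-\<eta> < t * u" "t * u < c" using that(3) by linarith+
    then show ?thesis by simp
  qed
  show ?thesis
    unfolding star_fst_def cross_def using 1[of _ "a + \<eta>"] 1[of _ \<eta>] p by fastforce
qed

lemma star_both_cross: "a > 0 \<Longrightarrow> b > 0 \<Longrightarrow> \<eta> > 0 \<Longrightarrow> star_both (cross a b \<eta>)"
  unfolding star_both_def swap_cross by (simp add: star_fst_cross)

lemma cross_subset_open:
  assumes U: "open U" and p: "a > 0" "b > 0" "\<rho> > 0"
    and ax: "\<And>x. -\<rho> < x \<Longrightarrow> x < a + \<rho> \<Longrightarrow> (x, 0) \<in> U" "\<And>y. -\<rho> < y \<Longrightarrow> y < b + \<rho> \<Longrightarrow> (0, y) \<in> U"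
  obtains \<eta> where "0 < \<eta>" "\<eta> < \<rho>" "cross a b \<eta> \<subseteq> U"
proof -
  let ?S = "{-\<rho>/2..a + \<rho>/2} \<times> {0} \<union> {0} \<times> {-\<rho>/2..b + \<rho>/2}"
  have "compact ?S" by (intro compact_Un compact_Times) auto
  moreover have "?S \<subseteq> U" using ax p by force
  ultimately obtain e where e: "e > 0" "(\<Union>z\<in>?S. ball z e) \<subseteq> U"
    using compact_subset_open_imp_ball_epsilon_subset[OF _ U] by metis
  define \<eta> where "\<eta> = min e (\<rho> / 2)"
  have \<eta>: "0 < \<eta>" "\<eta> \<le> e" "\<eta> \<le> \<rho> / 2" using e p unfolding \<eta>_def by auto
  have "(x, y) \<in> U" if "(x, y) \<in> cross a b \<eta>" for x y
  proof -
    consider "x \<in> {-\<rho>/2..a + \<rho>/2}" "\<bar>y\<bar> < e" | "y \<in> {-\<rho>/2..b + \<rho>/2}" "\<bar>x\<bar> < e"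
      using \<open>(x, y) \<in> cross a b \<eta>\<close> \<eta> unfolding cross_def by fastforce
    then show ?thesis
    proof cases
      case 1
      then have "(x, y) \<in> ball (x, 0) e" by (simp add: dist_prod_def dist_real_def)
      then show ?thesis using e(2) 1(1) by blast
    next
      case 2
      then have "(x, y) \<in> ball (0, y) e" by (simp add: dist_prod_def dist_real_def)
      then show ?thesis using e(2) 2(1) by blast
    qed
  qed
  then have "cross a b \<eta> \<subseteq> U" by auto
  then show ?thesis using that[of \<eta>] \<eta> p by auto
qed

section \<open>Uniform bounds near the axes\<close>

lemma tube_lower_bound:
  fixes f :: "'a::metric_space \<Rightarrow> real"
  assumes "open U" "continuous_on U f" "compact S" "S \<subseteq> U" "\<And>z. z \<in> S \<Longrightarrow> f z > 0" "S \<noteq> {}"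
  obtains c r where "c > 0" "r > 0" "\<And>z w. z \<in> S \<Longrightarrow> dist z w < r \<Longrightarrow> c \<le> f w"
proof -
  obtain z0 where z0: "z0 \<in> S" "\<And>z. z \<in> S \<Longrightarrow> f z0 \<le> f z"
    using continuous_attains_inf[OF assms(3,6) continuous_on_subset[OF assms(2,4)]] by auto
  have f0: "f z0 > 0" using assms(5) z0 by auto
  let ?T = "U \<inter> f -` {f z0 / 2<..}"
  have "open ?T" by (rule continuous_open_preimage[OF assms(2,1)]) auto
  moreover have "S \<subseteq> ?T" using assms(4) z0(2) f0 by force
  ultimately obtain r where r: "r > 0" "(\<Union>z\<in>S. ball z r) \<subseteq> ?T"
    using compact_subset_open_imp_ball_epsilon_subset[OF assms(3)] by metis
  show ?thesis
  proof (rule that[of "f z0 / 2" r])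
    fix z w assume "z \<in> S" "dist z w < r"
    then have "w \<in> ball z r" by simp
    then have "w \<in> ?T" using r(2) \<open>z \<in> S\<close> by blast
    then show "f z0 / 2 \<le> f w" by auto
  qed (use f0 r in auto)
qed

lemma compact_bound:
  fixes f :: "'a::metric_space \<Rightarrow> real"
  assumes "compact S" "continuous_on S f"
  obtains C where "C > 0" "\<And>z. z \<in> S \<Longrightarrow> \<bar>f z\<bar> \<le> C"
  using bounded_pos[THEN iffD1, OF compact_imp_bounded[OF compact_continuous_image[OF assms(2,1)]]]
  by auto

text \<open>A closed neighbourhood of the two segments within the first quadrant; the arms get
  separate widths because the horizontal one must be chosen last and thinner.\<close>

definition corner :: "real \<Rightarrow> real \<Rightarrow> real \<Rightarrow> real \<Rightarrow> (real \<times> real) set" where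
  "corner a' b' r r' = {0..r} \<times> {0..b'} \<union> {0..a'} \<times> {0..r'}"

text \<open>Along orbits in the corner region \<open>x powr \<kappa> - M * y\<close> increases: near the vertical axis through
  its second, near the horizontal one through its first term.\<close>

lemma corner_region:
  fixes A B g e :: "real \<times> real \<Rightarrow> real"
  assumes p: "a > 0" "b > 0" "\<eta> > 0" "\<kappa> > 0"
    and c: "continuous_on (cross a b \<eta>) A" "continuous_on (cross a b \<eta>) B"
      "continuous_on (cross a b \<eta>) g" "continuous_on (cross a b \<eta>) e"
    and A: "\<And>x. 0 \<le> x \<Longrightarrow> x \<le> a + \<eta> / 2 \<Longrightarrow> A (x, 0) > 0"
    and B: "\<And>y. 0 \<le> y \<Longrightarrow> y \<le> b + \<eta> / 2 \<Longrightarrow> B (0, y) < 0"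
  obtains r r' M k C where "0 < r'" "r' \<le> r" "r \<le> \<eta> / 2" "r < a" "0 < M" "0 < k" "0 < C"
    "corner (a + \<eta> / 2) (b + \<eta> / 2) r r' \<subseteq> cross a b \<eta>"
    "r powr \<kappa> / M \<le> \<eta> / 8"
    "\<And>z. z \<in> corner (a + \<eta> / 2) (b + \<eta> / 2) r r' \<Longrightarrow> \<bar>g z\<bar> \<le> C \<and> \<bar>e z\<bar> \<le> C"
    "\<And>x y. (x, y) \<in> corner (a + \<eta> / 2) (b + \<eta> / 2) r r' \<Longrightarrow> x > 0 \<Longrightarrow>
      k * x powr \<kappa> \<le> \<kappa> * x powr \<kappa> * A (x, y) - M * y * B (x, y)"
proof -
  let ?a = "a + \<eta> / 2" and ?b = "b + \<eta> / 2"
  have segA: "{0..?a} \<times> {0} \<subseteq> cross a b \<eta>" and segB: "{0} \<times> {0..?b} \<subseteq> cross a b \<eta>"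
    using p unfolding cross_def by auto
  obtain c1 r1 where 1: "c1 > 0" "r1 > 0" "\<And>z w. z \<in> {0..?a} \<times> {0} \<Longrightarrow> dist z w < r1 \<Longrightarrow> c1 \<le> A w"
    by (rule tube_lower_bound[OF open_cross c(1) _ segA]) (use A p in \<open>auto intro: compact_Times\<close>)
  obtain c2 r2 where 2: "c2 > 0" "r2 > 0" "\<And>z w. z \<in> {0} \<times> {0..?b} \<Longrightarrow> dist z w < r2 \<Longrightarrow> c2 \<le> - B w"
    by (rule tube_lower_bound[OF open_cross continuous_on_minus[OF c(2)] _ segB]) (use B p in \<open>auto intro: compact_Times\<close>)
  define c0 where "c0 = min c1 c2"
  define r where "r = min (min (r1 / 2) (r2 / 2)) (min (\<eta> / 2) (a / 2))"
  have c0: "c0 > 0" unfolding c0_def using 1 2 by auto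
  have r: "0 < r" "r < r1" "r < r2" "r < \<eta>" "r < a" "r \<le> \<eta> / 2" unfolding r_def using 1 2 p by auto
  have Apos: "c0 \<le> A (x, y)" if "0 \<le> x" "x \<le> ?a" "0 \<le> y" "y \<le> r" for x y
    using 1(3)[of "(x, 0)" "(x, y)"] that r unfolding c0_def by (simp add: dist_prod_def dist_real_def)
  have Bneg: "c0 \<le> - B (x, y)" if "0 \<le> x" "x \<le> r" "0 \<le> y" "y \<le> ?b" for x y
    using 2(3)[of "(0, y)" "(x, y)"] that r unfolding c0_def by (simp add: dist_prod_def dist_real_def)
  let ?Q = "corner ?a ?b r r"
  have Q: "compact ?Q" "?Q \<subseteq> cross a b \<eta>"
    unfolding corner_def cross_def using r p by (auto intro!: compact_Un compact_Times)
  obtain CA where CA: "CA > 0" "\<And>z. z \<in> ?Q \<Longrightarrow> \<bar>A z\<bar> \<le> CA"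
    using compact_bound[OF Q(1) continuous_on_subset[OF c(1) Q(2)]] by blast
  obtain CB where CB: "CB > 0" "\<And>z. z \<in> ?Q \<Longrightarrow> \<bar>B z\<bar> \<le> CB"
    using compact_bound[OF Q(1) continuous_on_subset[OF c(2) Q(2)]] by blast
  obtain Cg where Cg: "Cg > 0" "\<And>z. z \<in> ?Q \<Longrightarrow> \<bar>g z\<bar> \<le> Cg"
    using compact_bound[OF Q(1) continuous_on_subset[OF c(3) Q(2)]] by blast
  obtain Ce where Ce: "Ce > 0" "\<And>z. z \<in> ?Q \<Longrightarrow> \<bar>e z\<bar> \<le> Ce"
    using compact_bound[OF Q(1) continuous_on_subset[OF c(4) Q(2)]] by blast
  \<comment> \<open>Near the origin both terms have the right sign. \<open>M\<close> is so large
    that on the vertical arm, where \<open>y \<ge> r\<close>, the second term outweighs the first;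
    its other bound yields \<open>r powr \<kappa> / M \<le> \<eta> / 8\<close>. Then
    \<open>r'\<close> is so small that on the horizontal arm the second term spoils at most half of
    the first, which is why \<open>k\<close> is half of \<kappa> \<open>c0\<close>.\<close>
  define k where "k = \<kappa> * c0 / 2"
  define M where "M = max ((\<kappa> * CA + k) * r powr \<kappa> / (r * c0)) (8 * r powr \<kappa> / \<eta>)"
  define r' where "r' = min r (\<kappa> * c0 * r powr \<kappa> / (2 * M * CB))"
  have k: "k > 0" unfolding k_def using p c0 by simp
  have rk: "r powr \<kappa> > 0" using r by simp
  have M: "(\<kappa> * CA + k) * r powr \<kappa> / (r * c0) \<le> M" "8 * r powr \<kappa> / \<eta> \<le> M"
    unfolding M_def by (rule max.cobounded1, rule max.cobounded2)
  have M0: "M > 0" using less_le_trans[OF _ M(2)] rk p by simp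
  have r': "0 < r'" "r' \<le> r" "r' \<le> \<kappa> * c0 * r powr \<kappa> / (2 * M * CB)"
    unfolding r'_def using r p c0 rk M0 CB by auto
  have sub: "corner ?a ?b r r' \<subseteq> ?Q" unfolding corner_def using r' by auto
  have main: "k * x powr \<kappa> \<le> \<kappa> * x powr \<kappa> * A (x, y) - M * y * B (x, y)"
    if z: "(x, y) \<in> corner ?a ?b r r'" and x: "x > 0" for x y
  proof -
    have zQ: "(x, y) \<in> ?Q" using z sub by auto
    have y: "y \<ge> 0" "x \<le> ?a" using z r p unfolding corner_def by auto
    have xk: "x powr \<kappa> > 0" using x by simp
    consider (corner) "x \<le> r" "y \<le> r" | (vert) "x \<le> r" "r < y" "y \<le> ?b" | (hor) "r < x" "y \<le> r'"
      using z r' unfolding corner_def by fastforce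
    then show ?thesis
    proof cases
      case corner
      have "\<kappa> * x powr \<kappa> * c0 \<le> \<kappa> * x powr \<kappa> * A (x, y)"
        using Apos[of x y] corner x y p xk by (intro mult_left_mono) auto
      moreover have "y \<le> ?b" using corner r p by simp
      then have "0 \<le> M * y * (- B (x, y))"
        using Bneg[of x y] corner x y M0 c0 by (intro mult_nonneg_nonneg) auto
      moreover have "k * x powr \<kappa> \<le> \<kappa> * x powr \<kappa> * c0" unfolding k_def using p c0 xk by simp
      ultimately show ?thesis by simp
    next
      case vert
      have "(\<kappa> * CA + k) * x powr \<kappa> \<le> (\<kappa> * CA + k) * r powr \<kappa>"
        using vert x p CA k by (intro mult_left_mono powr_mono2) auto
      also have "\<dots> \<le> M * (r * c0)"
        using M(1) r c0 by (simp add: pos_divide_le_eq)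
      also have "\<dots> \<le> M * (y * (- B (x, y)))"
        using Bneg[of x y] vert x y M0 c0 r by (intro mult_left_mono mult_mono) auto
      finally have "(\<kappa> * CA + k) * x powr \<kappa> \<le> - (M * y * B (x, y))" by simp
      moreover have "\<kappa> * x powr \<kappa> * (- CA) \<le> \<kappa> * x powr \<kappa> * A (x, y)"
        using CA(2)[OF zQ] p xk by (intro mult_left_mono) auto
      ultimately show ?thesis by (simp add: algebra_simps)
    next
      case hor
      have "M * y * B (x, y) \<le> M * r' * CB"
      proof -
        have "M * y * B (x, y) \<le> M * y * CB"
          using CB(2)[OF zQ] M0 y by (intro mult_left_mono) auto
        also have "\<dots> \<le> M * r' * CB"
          using hor M0 CB by (intro mult_right_mono mult_left_mono) auto
        finally show ?thesis .
      qed
      also have "\<dots> \<le> k * r powr \<kappa>"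
        using r'(3) M0 CB unfolding k_def by (simp add: pos_le_divide_eq algebra_simps)
      also have "\<dots> \<le> k * x powr \<kappa>"
        using hor x p k r by (intro mult_left_mono powr_mono2) auto
      finally have "M * y * B (x, y) \<le> k * x powr \<kappa>" .
      moreover have "\<kappa> * x powr \<kappa> * c0 \<le> \<kappa> * x powr \<kappa> * A (x, y)"
        using Apos[of x y] hor x y p xk r' by (intro mult_left_mono) auto
      moreover have "k * x powr \<kappa> + k * x powr \<kappa> = \<kappa> * x powr \<kappa> * c0" unfolding k_def by simp
      ultimately show ?thesis by linarith
    qed
  qed
  show ?thesis
  proof (rule that[of r' r M k "max Cg Ce"])
    show "r powr \<kappa> / M \<le> \<eta> / 8" using M(2) M0 p by (simp add: field_simps)
    show "corner ?a ?b r r' \<subseteq> cross a b \<eta>" using sub Q(2) by blast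
    fix z assume "z \<in> corner ?a ?b r r'"
    then have "z \<in> ?Q" using sub by blast
    then show "\<bar>g z\<bar> \<le> max Cg Ce \<and> \<bar>e z\<bar> \<le> max Cg Ce" using Cg(2)[of z] Ce(2)[of z] by auto
  qed (use r' r M0 k Cg main in auto)
qed

text \<open>A bootstrap at the infimum of the exit times: up to that time the path is in the closed
  set, hence at that time in the open set \<open>G\<close>, hence inside for a little longer.
  Estimates valid only inside \<open>C\<close> may thus be used to prove that the path never leaves
  \<open>C\<close>.\<close>

lemma stay_inside:
  fixes \<phi> :: "real \<Rightarrow> 'a::topological_space"
  assumes \<phi>: "continuous_on {0..T} \<phi>" and C: "closed C" and G: "open G"
    and G_C: "\<And>t. t \<in> {0..T} \<Longrightarrow> \<phi> t \<in> G \<Longrightarrow> \<phi> t \<in> C"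
    and start: "\<phi> 0 \<in> C"
    and step: "\<And>t. t \<in> {0..T} \<Longrightarrow> (\<And>s. s \<in> {0..t} \<Longrightarrow> \<phi> s \<in> C) \<Longrightarrow> \<phi> t \<in> G"
    and t: "t \<in> {0..T}"
  shows "\<phi> t \<in> C"
proof (rule ccontr)
  assume nC: "\<phi> t \<notin> C"
  define Z where "Z = {s \<in> {0..T}. \<phi> s \<notin> C}"
  define u where "u = Inf Z"
  have Z: "t \<in> Z" "bdd_below Z" using t nC unfolding Z_def by (auto intro: bdd_belowI[of _ 0])
  have u0: "0 \<le> u" unfolding u_def using Z(1) by (intro cInf_greatest) (auto simp: Z_def)
  have ut: "u \<le> t" unfolding u_def by (rule cInf_lower[OF Z])
  have before: "\<phi> s \<in> C" if "0 \<le> s" "s < u" for s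
  proof (rule ccontr)
    assume "\<phi> s \<notin> C"
    then have "s \<in> Z" using that ut t unfolding Z_def by auto
    then show False using cInf_lower[OF _ Z(2)] that(2) unfolding u_def by fastforce
  qed
  have uT: "u \<in> {0..T}" using u0 ut t by auto
  have "\<phi> u \<in> C"
  proof (rule ccontr)
    assume "\<phi> u \<notin> C"
    then obtain V where V: "open V" "u \<in> V" "\<And>s. s \<in> V \<Longrightarrow> s \<in> {0..T} \<Longrightarrow> \<phi> s \<in> - C"
      using continuous_on_topological[THEN iffD1, OF \<phi>] C uT by (metis ComplI open_Compl)
    obtain d where d: "d > 0" "\<And>s. \<bar>s - u\<bar> < d \<Longrightarrow> s \<in> V"
      using V(1,2) unfolding open_dist dist_real_def by blast
    have "u \<noteq> 0" using \<open>\<phi> u \<notin> C\<close> start by auto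
    then have s: "max 0 (u - d / 2) < u" using u0 d by auto
    have "\<phi> (max 0 (u - d / 2)) \<in> C" using before[OF _ s] by simp
    moreover have "max 0 (u - d / 2) \<in> V" using d s u0 by (intro d(2)) auto
    ultimately show False using V(3)[of "max 0 (u - d / 2)"] uT s by auto
  qed
  then have "\<phi> u \<in> G" using step[OF uT] before by (metis atLeastAtMost_iff less_le)
  then obtain V where V: "open V" "u \<in> V" "\<And>s. s \<in> V \<Longrightarrow> s \<in> {0..T} \<Longrightarrow> \<phi> s \<in> G"
    using continuous_on_topological[THEN iffD1, OF \<phi>] G uT by metis
  obtain d where d: "d > 0" "\<And>s. \<bar>s - u\<bar> < d \<Longrightarrow> s \<in> V"
    using V(1,2) unfolding open_dist dist_real_def by blast
  obtain s where s: "s \<in> Z" "s < u + d"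
    using cInf_lessD[of Z "u + d"] Z d(1) unfolding u_def by auto
  have "u \<le> s" unfolding u_def by (rule cInf_lower[OF s(1) Z(2)])
  then have "\<phi> s \<in> G" using V(3)[of s] d(2)[of s] s unfolding Z_def by auto
  then show False using G_C s(1) unfolding Z_def by auto
qed

text \<open>Since \<open>z\<close> is the logarithm of the approximate integral,
  \<open>exp (- J * z)\<close> times \<open>X ^ K * Y ^ J\<close> equals
  \<open>X powr \<kappa>\<close> up to a bounded factor. The derivative of
  \<open>exp (- J * z)\<close> is therefore bounded by a multiple of
  \<open>\<rho> * X powr \<kappa>\<close>, and by \<open>W\<close> also by a multiple of the
  derivative of \<open>X powr \<kappa> - M * Y\<close>. The transit time and the monomial factor,
  contained in \<rho>, drop out.\<close>

lemma orbit_estimate: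
  fixes X Y \<rho> :: "real \<Rightarrow> real"
  assumes N: "N = cross a b \<eta>"
    and ai: "approx_integral N A B \<theta> 1 K J g e" and \<kappa>: "\<kappa> = real K - \<theta> * real J"
    and Q: "Q \<subseteq> N" "\<And>z. z \<in> Q \<Longrightarrow> \<bar>g z\<bar> \<le> C \<and> \<bar>e z\<bar> \<le> C" and k: "k > 0"
    and W: "\<And>x y. (x, y) \<in> Q \<Longrightarrow> x > 0 \<Longrightarrow> k * x powr \<kappa> \<le> \<kappa> * x powr \<kappa> * A (x, y) - M * y * B (x, y)"
    and T: "0 \<le> T"
    and orb: "\<And>t. t \<in> {0..T} \<Longrightarrow> (X t, Y t) \<in> Q \<and> X t > 0 \<and> Y t > 0 \<and> \<rho> t > 0 \<and>
      (X has_real_derivative \<rho> t * (X t * A (X t, Y t))) (at t within {0..T}) \<and>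
      (Y has_real_derivative \<rho> t * (Y t * B (X t, Y t))) (at t within {0..T})"
  defines "z \<equiv> \<lambda>t. \<theta> * ln (X t) + ln (Y t) + g (X t, Y t)"
  shows "X 0 powr \<kappa> - M * Y 0 \<le> X T powr \<kappa> - M * Y T"
    "\<bar>exp (- real J * z T) - exp (- real J * z 0)\<bar> \<le>
      real J * C * exp (real J * C) / k * ((X T powr \<kappa> - M * Y T) - (X 0 powr \<kappa> - M * Y 0))"
proof -
  define w where "w t = X t powr \<kappa> - M * Y t" for t
  define E where "E t = exp (- real J * z t)" for t
  define D where "D = real J * C * exp (real J * C) / k"
  have g: "smooth_on N g" and eq: "\<And>z. z \<in> N \<Longrightarrow> integral_error A B \<theta> 1 g z = fst z ^ K * snd z ^ J * e z"
    using ai unfolding approx_integral_def by auto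
  have contX: "continuous_on {0..T} X"
    by (rule DERIV_continuous_on[where D = "\<lambda>t. \<rho> t * (X t * A (X t, Y t))"]) (use orb in auto)
  have contY: "continuous_on {0..T} Y"
    by (rule DERIV_continuous_on[where D = "\<lambda>t. \<rho> t * (Y t * B (X t, Y t))"]) (use orb in auto)
  have contg: "continuous_on {0..T} (\<lambda>t. g (X t, Y t))"
    by (rule continuous_on_compose2[OF smooth_on_continuous[OF g] continuous_on_Pair[OF contX contY]])
      (use orb Q(1) in auto)
  have pos: "X t > 0" "Y t > 0" if "t \<in> {0..T}" for t using orb[OF that] by auto
  have contw: "continuous_on {0..T} w"
    unfolding w_def using pos by (intro continuous_intros contX contY continuous_on_powr) force
  have contE: "continuous_on {0..T} E"
    unfolding E_def z_def using pos by (intro continuous_intros contX contY contg) force+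
  have key: "\<exists>w' E'. (w has_real_derivative w') (at t) \<and> (E has_real_derivative E') (at t) \<and> 0 \<le> w' \<and> \<bar>E'\<bar> \<le> D * w'"
    if t: "0 < t" "t < T" for t
  proof -
    have at: "at t within {0..T} = at t" using t by (rule at_within_Icc_at)
    have tT: "t \<in> {0..T}" using t by auto
    let ?A = "A (X t, Y t)" and ?B = "B (X t, Y t)"
    have inQ: "(X t, Y t) \<in> Q" and rho: "\<rho> t > 0" using orb[OF tT] by auto
    have inN: "(X t, Y t) \<in> N" using inQ Q(1) by auto
    have dX: "(X has_real_derivative \<rho> t * (X t * ?A)) (at t)" and dY: "(Y has_real_derivative \<rho> t * (Y t * ?B)) (at t)"
      using orb[OF tT] unfolding at by auto
    have X: "X t > 0" and Y: "Y t > 0" using pos[OF tT] .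
    define w' where "w' = \<rho> t * (\<kappa> * X t powr \<kappa> * ?A - M * Y t * ?B)"
    have "X t powr (\<kappa> - 1) * X t = X t powr \<kappa>"
      using X by (simp add: powr_diff)
    then have "(\<kappa> * X t powr (\<kappa> - 1)) * (\<rho> t * (X t * ?A)) = \<rho> t * (\<kappa> * X t powr \<kappa> * ?A)"
      by (metis (no_types, opaque_lifting) mult.assoc mult.commute)
    with DERIV_chain2[OF has_real_derivative_powr[OF X] dX, of \<kappa>]
    have "((\<lambda>t. X t powr \<kappa>) has_real_derivative \<rho> t * (\<kappa> * X t powr \<kappa> * ?A)) (at t)"
      by simp
    from DERIV_diff[OF this DERIV_cmult[OF dY, of M]]
    have dw: "(w has_real_derivative w') (at t)" unfolding w_def w'_def by (simp add: algebra_simps)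
    have w'k: "\<rho> t * (k * X t powr \<kappa>) \<le> w'"
      unfolding w'_def using W[OF inQ X] rho by (intro mult_left_mono) auto
    have dg: "((\<lambda>t. g (X t, Y t)) has_real_derivative
        \<rho> t * (X t * ?A) * frechet_derivative g (at (X t, Y t)) (1, 0)
        + \<rho> t * (Y t * ?B) * frechet_derivative g (at (X t, Y t)) (0, 1)) (at t)"
    proof -
      let ?p = "\<rho> t * (X t * ?A)" and ?q = "\<rho> t * (Y t * ?B)"
      have "((\<lambda>t. (X t, Y t)) has_derivative (\<lambda>v. (?p * v, ?q * v))) (at t)"
        using dX dY unfolding has_field_derivative_def by (intro has_derivative_Pair)
      from diff_chain_at[OF this smooth_on_has_derivative[OF g inN]]
      have 1: "((\<lambda>t. g (X t, Y t)) has_derivative (\<lambda>v. frechet_derivative g (at (X t, Y t)) (?p * v, ?q * v))) (at t)"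
        by (simp add: o_def)
      interpret linear "frechet_derivative g (at (X t, Y t))"
        using smooth_on_has_derivative[OF g inN] has_derivative_linear by blast
      have 2: "frechet_derivative g (at (X t, Y t)) (?p * v, ?q * v) =
          (?p * frechet_derivative g (at (X t, Y t)) (1, 0) + ?q * frechet_derivative g (at (X t, Y t)) (0, 1)) * v" for v
      proof -
        have "(?p * v, ?q * v) = (?p * v) *\<^sub>R (1, 0) + (?q * v) *\<^sub>R (0, 1)" by simp
        then have "frechet_derivative g (at (X t, Y t)) (?p * v, ?q * v)
          = frechet_derivative g (at (X t, Y t)) ((?p * v) *\<^sub>R (1, 0) + (?q * v) *\<^sub>R (0, 1))" by (rule arg_cong)
        also have "\<dots> = (?p * v) * frechet_derivative g (at (X t, Y t)) (1, 0) + (?q * v) * frechet_derivative g (at (X t, Y t)) (0, 1)"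
          unfolding add scale real_scaleR_def ..
        also have "\<dots> = (?p * frechet_derivative g (at (X t, Y t)) (1, 0) + ?q * frechet_derivative g (at (X t, Y t)) (0, 1)) * v"
          by (simp only: algebra_simps)
        finally show ?thesis .
      qed
      show ?thesis
        unfolding has_field_derivative_def by (rule has_derivative_eq_rhs[OF 1]) (rule ext, rule 2)
    qed
    let ?R = "X t ^ K * Y t ^ J * e (X t, Y t)"
    have dlX: "((\<lambda>t. ln (X t)) has_real_derivative \<rho> t * ?A) (at t)"
      using DERIV_chain2[OF DERIV_ln_divide[OF X] dX] X by simp
    have dlY: "((\<lambda>t. ln (Y t)) has_real_derivative \<rho> t * ?B) (at t)"
      using DERIV_chain2[OF DERIV_ln_divide[OF Y] dY] Y by simp
    have "(z has_real_derivative \<theta> * (\<rho> t * ?A) + \<rho> t * ?B + (\<rho> t * (X t * ?A) * frechet_derivative g (at (X t, Y t)) (1, 0)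
        + \<rho> t * (Y t * ?B) * frechet_derivative g (at (X t, Y t)) (0, 1))) (at t)"
      unfolding z_def by (rule DERIV_add[OF DERIV_add[OF DERIV_cmult[OF dlX] dlY] dg])
    moreover have "\<theta> * (\<rho> t * ?A) + \<rho> t * ?B + (\<rho> t * (X t * ?A) * frechet_derivative g (at (X t, Y t)) (1, 0)
        + \<rho> t * (Y t * ?B) * frechet_derivative g (at (X t, Y t)) (0, 1))
        = \<rho> t * integral_error A B \<theta> 1 g (X t, Y t)"
      unfolding integral_error_def by (simp add: algebra_simps)
    moreover have "integral_error A B \<theta> 1 g (X t, Y t) = ?R" using eq[OF inN] by simp
    ultimately have dz: "(z has_real_derivative \<rho> t * ?R) (at t)" by simp
    have dE: "(E has_real_derivative E t * (- real J * (\<rho> t * ?R))) (at t)"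
      unfolding E_def by (rule DERIV_chain2[OF DERIV_exp DERIV_cmult[OF dz]])
    \<comment> \<open>The heart of the estimate: no power of \<open>Y\<close> survives, and
      \<open>\<kappa> = K - \<theta> * J\<close> is the exponent left for \<open>X\<close>.\<close>
    have EXY: "E t * (X t ^ K * Y t ^ J) = X t powr \<kappa> * exp (- real J * g (X t, Y t))"
    proof -
      have "X t ^ K * Y t ^ J = exp (real K * ln (X t) + real J * ln (Y t))"
        using X Y by (simp add: exp_add exp_of_nat_mult)
      then show ?thesis
        unfolding E_def z_def powr_def \<kappa> using X
        by (simp add: exp_add[symmetric] algebra_simps)
    qed
    have C: "\<bar>g (X t, Y t)\<bar> \<le> C" "\<bar>e (X t, Y t)\<bar> \<le> C" using Q(2)[OF inQ] by auto
    have "\<bar>E t * (- real J * (\<rho> t * ?R))\<bar> = \<rho> t * (real J * (X t powr \<kappa> * exp (- real J * g (X t, Y t)) * \<bar>e (X t, Y t)\<bar>))"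
      unfolding EXY[symmetric] using rho X Y by (simp add: abs_mult E_def)
    also have "\<dots> \<le> \<rho> t * (real J * (X t powr \<kappa> * exp (real J * C) * C))"
    proof (intro mult_left_mono mult_mono)
      show "exp (- real J * g (X t, Y t)) \<le> exp (real J * C)"
        using C(1) mult_left_mono[of "- g (X t, Y t)" C "real J"] by simp
    qed (use C rho in auto)
    also have "\<dots> = D * (\<rho> t * (k * X t powr \<kappa>))" unfolding D_def using k by simp
    also have "\<dots> \<le> D * w'"
    proof (rule mult_left_mono[OF w'k])
      show "D \<ge> 0" unfolding D_def using C(1) k by simp
    qed
    finally have "\<bar>E t * (- real J * (\<rho> t * ?R))\<bar> \<le> D * w'" .
    moreover have "0 \<le> w'" using w'k rho k X by (meson less_imp_le mult_nonneg_nonneg order_trans powr_ge_zero)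
    ultimately show ?thesis using dw dE by blast
  qed
  show "X 0 powr \<kappa> - M * Y 0 \<le> X T powr \<kappa> - M * Y T"
    unfolding w_def[symmetric]
    by (rule DERIV_nonneg_imp_increasing_open[OF T _ contw]) (use key in blast)
  \<comment> \<open>The bound on the derivative of \<open>E\<close> is integrated by noting that
    both \<open>D * w - E\<close> and \<open>D * w + E\<close> are nondecreasing.\<close>
  have "D * w 0 - E 0 \<le> D * w T - E T"
  proof (rule DERIV_nonneg_imp_increasing_open[OF T])
    fix t assume "0 < t" "t < T"
    from key[OF this] obtain w' E' where *: "(w has_real_derivative w') (at t)" "(E has_real_derivative E') (at t)" "\<bar>E'\<bar> \<le> D * w'"
      by blast
    show "\<exists>y. ((\<lambda>t. D * w t - E t) has_real_derivative y) (at t) \<and> 0 \<le> y"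
      using DERIV_diff[OF DERIV_cmult[OF *(1), of D] *(2)] *(3) by (intro exI[of _ "D * w' - E'"]) auto
  qed (intro continuous_intros contw contE)
  moreover have "D * w 0 + E 0 \<le> D * w T + E T"
  proof (rule DERIV_nonneg_imp_increasing_open[OF T])
    fix t assume "0 < t" "t < T"
    from key[OF this] obtain w' E' where *: "(w has_real_derivative w') (at t)" "(E has_real_derivative E') (at t)" "\<bar>E'\<bar> \<le> D * w'"
      by blast
    show "\<exists>y. ((\<lambda>t. D * w t + E t) has_real_derivative y) (at t) \<and> 0 \<le> y"
      using DERIV_add[OF DERIV_cmult[OF *(1), of D] *(2)] *(3) by (intro exI[of _ "D * w' + E'"]) auto
  qed (intro continuous_intros contw contE)
  ultimately have "\<bar>E T - E 0\<bar> \<le> D * (w T - w 0)" by (simp add: right_diff_distrib abs_le_iff)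
  then show "\<bar>exp (- real J * z T) - exp (- real J * z 0)\<bar> \<le>
      real J * C * exp (real J * C) / k * ((X T powr \<kappa> - M * Y T) - (X 0 powr \<kappa> - M * Y 0))"
    unfolding E_def w_def D_def .
qed

section \<open>Confinement to the corner region\<close>

lemma closed_corner: "closed (corner a' b' r r')"
  unfolding corner_def by (intro closed_Un closed_Times closed_atLeastAtMost)

text \<open>An orbit entering the corner region near the vertical axis stays there until it hits the curve
  \<open>x = h y\<close>: the quantity \<open>z\<close> is almost conserved, which keeps the orbit away from the remaining
  part of the boundary, and beyond the curve it would have crossed the curve before.\<close>

lemma corner_passage:
  fixes X Y \<rho> h :: "real \<Rightarrow> real"
  assumes p: "a > 0" "b > 0" "\<eta> > 0" and N: "N = cross a b \<eta>"
    and ai: "approx_integral N A B \<theta> 1 K J g e" and \<kappa>: "\<kappa> = real K - \<theta> * real J" "\<kappa> > 0" and J: "J \<ge> 1" and \<theta>: "\<theta> > 0"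
    and reg: "0 < r'" "r' \<le> r" "r \<le> \<eta> / 2" "r < a" "0 < M" "0 < k" "0 < C" "Q \<subseteq> N" "r powr \<kappa> / M \<le> \<eta> / 8"
      "\<And>z. z \<in> Q \<Longrightarrow> \<bar>g z\<bar> \<le> C \<and> \<bar>e z\<bar> \<le> C"
      "\<And>x y. (x, y) \<in> Q \<Longrightarrow> x > 0 \<Longrightarrow> k * x powr \<kappa> \<le> \<kappa> * x powr \<kappa> * A (x, y) - M * y * B (x, y)"
    and Q: "Q = corner (a + \<eta> / 2) (b + \<eta> / 2) r r'"
    and T: "0 \<le> T"
    and orb: "\<And>t. t \<in> {0..T} \<Longrightarrow> X t > 0 \<and> Y t > 0 \<and> \<rho> t > 0 \<and>
      (X has_real_derivative \<rho> t * (X t * A (X t, Y t))) (at t within {0..T}) \<and>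
      (Y has_real_derivative \<rho> t * (Y t * B (X t, Y t))) (at t within {0..T})"
    and start: "X 0 < r" "Y 0 < b + \<eta> / 4"
    and h: "y2 > 0" "continuous_on {0..y2} h" "\<And>y. y \<in> {0..y2} \<Longrightarrow> r < h y \<and> h y < a + \<eta> / 2"
    and avoid: "\<And>t. 0 < t \<Longrightarrow> t < T \<Longrightarrow> Y t \<in> {0..y2} \<Longrightarrow> X t \<noteq> h (Y t)"
  defines "z \<equiv> \<lambda>t. \<theta> * ln (X t) + ln (Y t) + g (X t, Y t)"
    and "D \<equiv> real J * C * exp (real J * C) / k * ((a + \<eta> / 2) powr \<kappa> + M * (b + \<eta> / 2))"
  assumes small: "2 * D \<le> exp (- real J * z 0)" "exp (z 0 + 1 + C) < r powr \<theta> * min r' y2"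
  shows "\<bar>real J * (z T - z 0)\<bar> \<le> 2 * (D * exp (real J * z 0))"
proof -
  let ?a = "a + \<eta> / 2" and ?b = "b + \<eta> / 2"
  define E where "E t = exp (- real J * z t)" for t
  have contX: "continuous_on {0..T} X"
    by (rule DERIV_continuous_on[where D = "\<lambda>t. \<rho> t * (X t * A (X t, Y t))"]) (use orb in auto)
  have contY: "continuous_on {0..T} Y"
    by (rule DERIV_continuous_on[where D = "\<lambda>t. \<rho> t * (Y t * B (X t, Y t))"]) (use orb in auto)
  have Qb: "x \<le> ?a \<and> y \<le> ?b" if "(x, y) \<in> Q" for x y
    using that reg p unfolding Q corner_def by auto
  have D: "D \<ge> 0" unfolding D_def using reg p by simp
  have E0: "E 0 > 0" "2 * D \<le> E 0" using small unfolding E_def by auto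
  have est: "X 0 powr \<kappa> - M * Y 0 \<le> X t powr \<kappa> - M * Y t" "\<bar>E t - E 0\<bar> \<le> D"
    if t: "t \<in> {0..T}" and inQ: "\<And>s. s \<in> {0..t} \<Longrightarrow> (X s, Y s) \<in> Q" for t
  proof -
    have sub: "{0..t} \<subseteq> {0..T}" using t by auto
    have o: "(X s, Y s) \<in> Q \<and> X s > 0 \<and> Y s > 0 \<and> \<rho> s > 0 \<and>
      (X has_real_derivative \<rho> s * (X s * A (X s, Y s))) (at s within {0..t}) \<and>
      (Y has_real_derivative \<rho> s * (Y s * B (X s, Y s))) (at s within {0..t})" if "s \<in> {0..t}" for s
      using orb[of s] inQ[OF that] that sub DERIV_subset[OF _ sub] by blast
    have t0: "0 \<le> t" using t by simp
    note oe = orbit_estimate[OF N ai \<kappa>(1) reg(8,10,6,11) t0 o]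
    show "X 0 powr \<kappa> - M * Y 0 \<le> X t powr \<kappa> - M * Y t" by (rule oe(1))
    have 1: "X t powr \<kappa> \<le> ?a powr \<kappa>" "Y 0 \<le> ?b"
      using Qb[OF inQ[of t]] Qb[OF inQ[of 0]] orb[OF t] t0 \<kappa>(2) by (auto intro!: powr_mono2)
    have "M * Y 0 \<le> M * ?b" using 1(2) reg(5) by simp
    moreover have "0 \<le> M * Y t" using orb[OF t] reg(5) by simp
    ultimately have 2: "(X t powr \<kappa> - M * Y t) - (X 0 powr \<kappa> - M * Y 0) \<le> ?a powr \<kappa> + M * ?b"
      using 1(1) powr_ge_zero[of "X 0" \<kappa>] by linarith
    have "real J * C * exp (real J * C) / k * ((X t powr \<kappa> - M * Y t) - (X 0 powr \<kappa> - M * Y 0)) \<le> D"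
      unfolding D_def using 2 reg by (intro mult_left_mono) auto
    then show "\<bar>E t - E 0\<bar> \<le> D" using oe(2) unfolding E_def z_def by linarith
  qed
  \<comment> \<open>As \<open>E\<close> changes by at most half of its initial value,
    \<open>z\<close> grows by at most 1, where \<open>2 \<le> exp 1\<close> and
    \<open>J \<ge> 1\<close> are used. Hence the product of \<open>X powr \<theta>\<close> and
    \<open>Y\<close> keeps the small size forced on it at the start.\<close>
  have prod: "X t powr \<theta> * Y t < r powr \<theta> * min r' y2"
    if t: "t \<in> {0..T}" and inQ: "\<And>s. s \<in> {0..t} \<Longrightarrow> (X s, Y s) \<in> Q" for t
  proof -
    have "\<bar>E t - E 0\<bar> \<le> D" by (rule est(2)[OF t inQ])
    then have "E 0 \<le> 2 * E t" using E0 by linarith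
    also have "\<dots> \<le> exp 1 * E t" using exp_ge_add_one_self[of 1] unfolding E_def by (intro mult_right_mono) auto
    finally have "exp (- real J * z 0) \<le> exp (1 - real J * z t)"
      unfolding E_def by (simp add: exp_add[symmetric])
    then have 1: "real J * (z t - z 0) \<le> 1" by (simp add: right_diff_distrib)
    have "z t - z 0 \<le> 1"
    proof (cases "z t - z 0 \<le> 0")
      case False
      then have "1 * (z t - z 0) \<le> real J * (z t - z 0)" using J by (intro mult_right_mono) auto
      then show ?thesis using 1 by simp
    qed simp
    moreover have "\<bar>g (X t, Y t)\<bar> \<le> C" using reg(10)[OF inQ[of t]] t by auto
    ultimately have "\<theta> * ln (X t) + ln (Y t) \<le> z 0 + 1 + C" unfolding z_def by linarith
    moreover have "X t powr \<theta> * Y t = exp (\<theta> * ln (X t) + ln (Y t))"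
      using orb[OF t] by (simp add: powr_def exp_add)
    ultimately show ?thesis using small(2) by (smt (verit) exp_le_cancel_iff)
  qed
  \<comment> \<open>Wherever \<open>X\<close> is not small the product bound makes \<open>Y\<close>
    small: below the width of the horizontal arm and within the range of the curve
    \<open>h\<close>.\<close>
  have low: "Y t < min r' y2" if t: "t \<in> {0..T}" and inQ: "\<And>s. s \<in> {0..t} \<Longrightarrow> (X s, Y s) \<in> Q" and X: "r \<le> X t" for t
  proof -
    have "r powr \<theta> * Y t \<le> X t powr \<theta> * Y t"
      using X reg \<theta> orb[OF t] by (intro mult_right_mono powr_mono2) auto
    then have "r powr \<theta> * Y t < r powr \<theta> * min r' y2" using prod[OF t inQ] by linarith
    then show ?thesis using reg by (simp add: mult_less_cancel_left)
  qed
  \<comment> \<open>The corner region with strict outer bounds. It is left unbounded below, since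
    both coordinates of the orbit are positive.\<close>
  let ?G = "{..<r} \<times> {..<?b} \<union> {..<?a} \<times> {..<r'}"
  have cont: "continuous_on {0..T} (\<lambda>t. (X t, Y t))" by (intro continuous_on_Pair contX contY)
  have inside: "(X t, Y t) \<in> Q" if "t \<in> {0..T}" for t
  proof (rule stay_inside[where G = ?G and \<phi> = "\<lambda>t. (X t, Y t)" and T = T])
    show "closed Q" unfolding Q by (rule closed_corner)
    show "open ?G" by (intro open_Un open_Times) auto
    show "(X t, Y t) \<in> Q" if "t \<in> {0..T}" "(X t, Y t) \<in> ?G" for t
      using that orb[of t] unfolding Q corner_def by auto
    show "(X 0, Y 0) \<in> Q"
      using orb[of 0] T start p unfolding Q corner_def by auto
    fix t assume t: "t \<in> {0..T}" and inQ: "\<And>s. s \<in> {0..t} \<Longrightarrow> (X s, Y s) \<in> Q"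
    show "(X t, Y t) \<in> ?G"
    proof (cases "X t < r")
      case True
      \<comment> \<open>The vertical arm cannot be left upwards: by monotonicity of
        \<open>X powr \<kappa> - M * Y\<close> the ordinate exceeds its initial value by at most
        \<eta>/8, and it started below \<open>b + \<eta> / 4\<close>.\<close>
      have "M * Y t \<le> M * Y 0 + X t powr \<kappa>"
        using est(1)[OF t inQ] powr_ge_zero[of "X 0" \<kappa>] by linarith
      also have "\<dots> \<le> M * Y 0 + r powr \<kappa>"
        using True orb[OF t] \<kappa>(2) by (intro add_left_mono powr_mono2) auto
      also have "\<dots> \<le> M * Y 0 + M * (\<eta> / 8)"
        using reg(5,9) by (simp add: field_simps)
      finally have "M * Y t \<le> M * (Y 0 + \<eta> / 8)" by (simp add: distrib_left)
      then have "Y t \<le> Y 0 + \<eta> / 8" using reg(5) by simp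
      then show ?thesis using True start(2) p by auto
    next
      case False
      then have low_t: "Y t < min r' y2" using low[OF t inQ] by simp
      have "X t < ?a"
      proof (rule ccontr)
        assume nX: "\<not> X t < ?a"
        \<comment> \<open>The sign of \<omega> tells the side of the curve \<open>x = h y\<close>;
          clamping the ordinate to the domain of \<open>h\<close> keeps it continuous on the whole
          time interval. At a zero of \<omega> the abscissa exceeds \<open>r\<close>, so the
          ordinate is below \<open>y2\<close>, the clamping is inactive and the orbit really meets
          the curve too early.\<close>
        define \<omega> where "\<omega> s = X s - h (max 0 (min (Y s) y2))" for s
        have sub: "{0..t} \<subseteq> {0..T}" using t by auto
        have "continuous_on {0..t} (\<lambda>s. h (max 0 (min (Y s) y2)))"
          by (rule continuous_on_compose2[OF h(2)])
            (use h(1) in \<open>auto intro!: continuous_on_max continuous_on_min continuous_on_const continuous_on_subset[OF contY sub]\<close>)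
        then have c\<omega>: "continuous_on {0..t} \<omega>"
          unfolding \<omega>_def by (intro continuous_on_diff continuous_on_subset[OF contX sub])
        have hb: "r < h (max 0 (min y y2)) \<and> h (max 0 (min y y2)) < ?a" for y
          by (rule h(3)) (use h(1) in auto)
        have \<omega>0: "\<omega> 0 < 0" using hb[of "Y 0"] start(1) unfolding \<omega>_def by auto
        have \<omega>t: "\<omega> t > 0" using hb[of "Y t"] nX unfolding \<omega>_def by auto
        obtain s where s: "0 \<le> s" "s \<le> t" "\<omega> s = 0"
          using IVT'[of \<omega> 0 0 t] c\<omega> \<omega>0 \<omega>t t by auto
        have s': "0 < s" "s < t" using s \<omega>0 \<omega>t by (auto simp: less_le)
        have sT: "s \<in> {0..T}" "s < T" using s' t by auto
        have "r \<le> X s" using s(3) hb[of "Y s"] unfolding \<omega>_def by auto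
        then have "Y s < min r' y2" using low[OF sT(1)] inQ s(2) by auto
        moreover have "Y s > 0" using orb[OF sT(1)] by auto
        ultimately have "Y s \<in> {0..y2}" "max 0 (min (Y s) y2) = Y s" by auto
        then show False using avoid[OF s'(1) sT(2)] s(3) unfolding \<omega>_def by auto
      qed
      then show ?thesis using low_t by auto
    qed
  qed (use cont that in auto)
  have TT: "T \<in> {0..T}" using T by simp
  have "\<bar>E T - E 0\<bar> \<le> D" by (rule est(2)[OF TT inside])  auto
  \<comment> \<open>The estimate holds for \<open>E = exp (- J * z)\<close>; the relative change
    \<open>u\<close> is at most 1/2 in absolute value, so \<open>ln (1 + u)\<close> turns it into
    one for \<open>z\<close> at the price of a factor 2.\<close>
  define u where "u = (E T - E 0) / E 0"
  have u: "\<bar>u\<bar> \<le> D / E 0" "\<bar>u\<bar> \<le> 1 / 2"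
    using \<open>\<bar>E T - E 0\<bar> \<le> D\<close> E0 unfolding u_def by (auto simp: field_simps)
  have "1 + u = E T / E 0" using E0(1) unfolding u_def by (simp add: field_simps)
  also have "\<dots> = exp (real J * (z 0 - z T))" unfolding E_def by (simp add: exp_diff[symmetric] right_diff_distrib)
  finally have "ln (1 + u) = real J * (z 0 - z T)" by simp
  moreover have "\<bar>ln (1 + u)\<bar> \<le> 2 * \<bar>u\<bar>"
  proof -
    have "\<bar>ln (1 + u) - u\<bar> \<le> 2 * u\<^sup>2" by (rule abs_ln_one_plus_x_minus_x_bound[OF u(2)])
    also have "\<dots> = 2 * \<bar>u\<bar> * \<bar>u\<bar>" by (simp add: power2_eq_square abs_mult_self_eq)
    also have "\<dots> \<le> 1 * \<bar>u\<bar>" using u(2) by (intro mult_right_mono) auto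
    finally show ?thesis by linarith
  qed
  ultimately have "\<bar>real J * (z 0 - z T)\<bar> \<le> 2 * (D / E 0)" using u(1) by simp
  also have "D / E 0 = D * exp (real J * z 0)" unfolding E_def by (simp add: exp_minus field_simps)
  finally show ?thesis by (simp add: abs_mult abs_minus_commute)
qed

text \<open>Along the section the coordinate transverse to the axis is strictly increasing for small
  \<open>s\<close>, so a short piece of it is a graph over that coordinate. This graph serves as the
  barrier at the far end of the horizontal arm.\<close>

lemma graph_of_section:
  fixes x y :: "real \<Rightarrow> real"
  assumes \<epsilon>: "\<epsilon> > 0" and x: "smooth_on {-\<epsilon><..<\<epsilon>} x" and y: "smooth_on {-\<epsilon><..<\<epsilon>} y"
    and y0: "y 0 = 0" "deriv y 0 > 0" and d: "\<delta> > 0" "\<tau> > 0"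
  obtains y2 h where "y2 > 0" "continuous_on {0..y2} h"
    "\<And>v. v \<in> {0..y2} \<Longrightarrow> \<bar>h v - x 0\<bar> < \<tau> \<and> (\<exists>s\<in>{0..<\<delta>}. (h v, v) = (x s, y s))"
proof -
  let ?I = "{-\<epsilon><..<\<epsilon>}"
  have I: "open ?I" "0 \<in> ?I" using \<epsilon> by auto
  have cx: "isCont x 0" and cy: "isCont (deriv y) 0"
    using smooth_on_isCont[OF x I(2)] smooth_on_isCont[OF smooth_on_deriv_smooth[OF I(1) y] I(2)] .
  have "\<forall>\<^sub>F s in nhds 0. s \<in> ?I \<and> deriv y s > 0 \<and> \<bar>x s - x 0\<bar> < \<tau>"
  proof (intro eventually_conj)
    show "\<forall>\<^sub>F s in nhds 0. s \<in> ?I" by (rule eventually_nhds_in_open[OF I])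
    show "\<forall>\<^sub>F s in nhds 0. 0 < deriv y s"
      using order_tendstoD(1)[OF cy[unfolded isCont_def tendsto_at_iff_tendsto_nhds] y0(2)] .
    show "\<forall>\<^sub>F s in nhds 0. \<bar>x s - x 0\<bar> < \<tau>"
      using tendstoD[OF cx[unfolded isCont_def tendsto_at_iff_tendsto_nhds] d(2)] by (simp add: dist_real_def)
  qed
  then obtain r where r: "r > 0" "\<And>s. \<bar>s\<bar> < r \<Longrightarrow> s \<in> ?I \<and> deriv y s > 0 \<and> \<bar>x s - x 0\<bar> < \<tau>"
    unfolding eventually_nhds_metric by (auto simp: dist_real_def)
  define q where "q = min (r / 2) (\<delta> / 2)"
  have q: "0 < q" "q < r" "q < \<delta>" unfolding q_def using r d by auto
  have loc: "s \<in> ?I" "deriv y s > 0" "\<bar>x s - x 0\<bar> < \<tau>" if "s \<in> {0..q}" for s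
    using r(2)[of s] that q by auto
  have mono: "y s < y t" if "0 \<le> s" "s < t" "t \<le> q" for s t
  proof (rule DERIV_pos_imp_increasing[OF that(2)])
    fix u assume "s \<le> u" "u \<le> t"
    then have "u \<in> {0..q}" using that by auto
    then show "\<exists>d. (y has_real_derivative d) (at u) \<and> d > 0"
      using loc(2) smooth_on_deriv(1)[OF y loc(1)] by blast
  qed
  have inj: "inj_on y {0..q}"
    by (rule strict_mono_on_imp_inj_on, rule strict_mono_onI) (use mono in auto)
  have sub: "{0..q} \<subseteq> ?I" using loc(1) by blast
  have cont: "continuous_on {0..q} x" "continuous_on {0..q} y"
    using continuous_on_subset[OF smooth_on_continuous sub] x y by auto
  have y2: "y q > 0" using mono[of 0 q] y0 q by simp
  have img: "y ` {0..q} = {0..y q}"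
  proof
    show "y ` {0..q} \<subseteq> {0..y q}"
    proof
      fix v assume "v \<in> y ` {0..q}"
      then obtain s where s: "v = y s" "0 \<le> s" "s \<le> q" by auto
      then show "v \<in> {0..y q}"
        using mono[of 0 s] mono[of s q] y0 by (cases "s = 0"; cases "s = q") auto
    qed
    show "{0..y q} \<subseteq> y ` {0..q}"
    proof
      fix v assume "v \<in> {0..y q}"
      then show "v \<in> y ` {0..q}" using IVT'[of y 0 v q] cont(2) q y0 by auto
    qed
  qed
  define i where "i = the_inv_into {0..q} y"
  have ci: "continuous_on {0..y q} i"
    using continuous_on_inv_into[OF cont(2) compact_Icc inj] unfolding img i_def .
  have i: "i v \<in> {0..q}" "y (i v) = v" if "v \<in> {0..y q}" for v
    using that unfolding i_def img[symmetric]
    by (auto intro: the_inv_into_into[OF inj] f_the_inv_into_f[OF inj] simp del: atLeastAtMost_iff)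
  show ?thesis
  proof (rule that[of "y q" "\<lambda>v. x (i v)"])
    show "continuous_on {0..y q} (\<lambda>v. x (i v))"
      by (rule continuous_on_compose2[OF cont(1) ci]) (use i(1) in auto)
    fix v assume v: "v \<in> {0..y q}"
    have "i v \<in> {0..<\<delta>}" using i(1)[OF v] q by auto
    then show "\<bar>x (i v) - x 0\<bar> < \<tau> \<and> (\<exists>s\<in>{0..<\<delta>}. (x (i v), v) = (x s, y s))"
      using loc(3)[OF i(1)[OF v]] i(2)[OF v] by force
  qed (rule y2)
qed

text \<open>The derivative of \<open>g\<close> along the axis is
  \<open>- (\<alpha> * A / B + \<beta>) / b\<close> at the base point. Its \<beta>-part cancels the
  contribution of the second logarithm, so a factor \<alpha> remains in front of the whole
  expression. The statement serves both sections, with coordinates exchanged for the second.\<close>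

lemma section_invariant:
  fixes A B g :: "real \<times> real \<Rightarrow> real" and \<sigma> :: "real \<Rightarrow> real \<times> real"
  assumes p: "a > 0" "b > 0" "0 < \<eta>" "\<eta> < \<rho>" and N: "N = cross a b \<eta>"
    and A: "smooth_on N A" and B: "smooth_on N B" "\<And>y. (0, y) \<in> N \<Longrightarrow> B (0, y) \<noteq> 0"
    and ai: "approx_integral N A B \<alpha> \<beta> K J g e" and K: "K \<ge> 2" and \<alpha>: "\<alpha> \<noteq> 0" "\<beta> / \<alpha> \<notin> range real"
    and L: "\<And>y. -\<rho> < y \<Longrightarrow> y < b + \<rho> \<Longrightarrow>
        \<exists>d. (L has_real_derivative d) (at y) \<and> y * d = L y * (A (0, y) / B (0, y) + \<beta> / \<alpha>)"
      "smooth_on {-\<rho><..<b + \<rho>} L" "\<And>y. -\<rho> < y \<Longrightarrow> y < b + \<rho> \<Longrightarrow> L y \<noteq> 0"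
    and Y: "smooth_on {-\<rho><..<b + \<rho>} Y"
      "\<And>y. -\<rho> < y \<Longrightarrow> y < b + \<rho> \<Longrightarrow> y * deriv Y y - \<beta> / \<alpha> * Y y = L y * deriv (\<lambda>x. A (x, y) / B (x, y)) 0"
    and \<epsilon>: "\<epsilon> > 0"
    and \<sigma>: "smooth_on {-\<epsilon><..<\<epsilon>} (\<lambda>s. fst (\<sigma> s))" "smooth_on {-\<epsilon><..<\<epsilon>} (\<lambda>s. snd (\<sigma> s))"
      "\<sigma> 0 = (0, b)" "deriv (\<lambda>s. fst (\<sigma> s)) 0 > 0"
  defines "x1 \<equiv> deriv (\<lambda>s. fst (\<sigma> s)) 0" and "x2 \<equiv> deriv (deriv (\<lambda>s. fst (\<sigma> s))) 0" and "y1 \<equiv> deriv (\<lambda>s. snd (\<sigma> s)) 0"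
  shows "\<exists>G s0. 0 < s0 \<and> s0 \<le> \<epsilon> \<and> smooth_on {-s0<..<s0} G \<and>
    (\<forall>s\<in>{0<..<s0}. \<sigma> s \<in> N \<and> 0 < fst (\<sigma> s) \<and> 0 < snd (\<sigma> s) \<and>
      \<alpha> * ln (fst (\<sigma> s)) + \<beta> * ln (snd (\<sigma> s)) + g (\<sigma> s) = \<alpha> * ln s + G s) \<and>
    deriv G 0 = \<alpha> * (x2 / (2 * x1) - y1 / b * (A (0, b) / B (0, b)) - x1 / L b * Y b)"
proof -
  have oN: "open N" unfolding N by (rule open_cross)
  have sN: "star_both N" unfolding N by (rule star_both_cross[OF p(1-3)])
  have g: "smooth_on N g" using ai unfolding approx_integral_def by auto
  have I: "(0, y) \<in> N \<longleftrightarrow> -\<eta> < y \<and> y < b + \<eta>" for y unfolding N using cross_axes(2)[OF p(1-3)] .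
  have bN: "(0, b) \<in> N" unfolding I using p(2,3) by linarith
  have sub: "{y. (0, y) \<in> N} \<subseteq> {-\<rho><..<b + \<rho>}"
  proof
    fix y assume "y \<in> {y. (0, y) \<in> N}"
    then have "-\<eta> < y \<and> y < b + \<eta>" unfolding mem_Collect_eq I .
    then show "y \<in> {-\<rho><..<b + \<rho>}" using p(4) by simp
  qed
  have 1: "b * frechet_derivative g (at (0, b)) (0, 1) = - (\<alpha> * (A (0, b) / B (0, b)) + \<beta>)"
    by (rule approx_integral_transport(1)[OF oN sN A B ai K bN])
  have 2: "frechet_derivative g (at (0, b)) (1, 0) = - \<alpha> * Y b / L b"
  proof (rule approx_integral_mellin[OF oN sN A B ai K _ smooth_on_subset[OF L(2) sub] _ smooth_on_subset[OF Y(1) sub] _ \<alpha>(2,1) bN])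
    fix y assume "(0, y) \<in> N"
    then have "-\<eta> < y \<and> y < b + \<eta>" unfolding I .
    then have y: "-\<rho> < y" "y < b + \<rho>" using p(4) by linarith+
    show "\<exists>d. (L has_real_derivative d) (at y) \<and> y * d = L y * (A (0, y) / B (0, y) + \<beta> / \<alpha>)" by (rule L(1)[OF y])
    show "L y \<noteq> 0" by (rule L(3)[OF y])
    show "y * deriv Y y - \<beta> / \<alpha> * Y y = L y * deriv (\<lambda>x. A (x, y) / B (x, y)) 0" by (rule Y(2)[OF y])
  qed
  obtain G s0 where G: "0 < s0" "s0 \<le> \<epsilon>" "smooth_on {-s0<..<s0} G"
    "\<forall>s\<in>{0<..<s0}. \<sigma> s \<in> N \<and> 0 < fst (\<sigma> s) \<and> 0 < snd (\<sigma> s) \<and>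
      \<alpha> * ln (fst (\<sigma> s)) + \<beta> * ln (snd (\<sigma> s)) + g (\<sigma> s) = \<alpha> * ln s + G s"
    "deriv G 0 = \<alpha> * (x2 / (2 * x1)) + \<beta> * (y1 / b) + x1 * frechet_derivative g (at (0, b)) (1, 0)
      + y1 * frechet_derivative g (at (0, b)) (0, 1)"
    using section_expansion[OF oN g \<epsilon> \<sigma>(1,2,3) p(2) bN \<sigma>(4), of \<alpha> \<beta>] unfolding x1_def x2_def y1_def by blast
  have "frechet_derivative g (at (0, b)) (0, 1) = - (\<alpha> * (A (0, b) / B (0, b)) + \<beta>) / b"
    using 1 p(2) by (simp add: field_simps)
  moreover have "\<alpha> * q + \<beta> * (y1 / b) + x1 * (- \<alpha> * Y b / L b) + y1 * (- (\<alpha> * P + \<beta>) / b)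
      = \<alpha> * (q - y1 / b * P - x1 / L b * Y b)" for P q
    by (simp add: diff_divide_distrib algebra_simps)
  ultimately have "deriv G 0 = \<alpha> * (x2 / (2 * x1) - y1 / b * (A (0, b) / B (0, b)) - x1 / L b * Y b)"
    unfolding G(5) 2 by (simp only:)
  with G(1-4) show ?thesis by blast
qed

section \<open>The approximate integral evaluated at the two ends of the Dulac map\<close>

lemma orbit_components:
  assumes "orbit_first_hit (\<lambda>z. (1 / (fst z ^ i * snd z ^ j)) *\<^sub>R (fst z * A z, snd z * B z))
    (U \<inter> {0<..} \<times> {0<..}) S p q"
  obtains T X Y \<rho> where "0 < T" "p = (X 0, Y 0)" "q = (X T, Y T)"
    "\<And>t. t \<in> {0..T} \<Longrightarrow> X t > 0 \<and> Y t > 0 \<and> \<rho> t > 0 \<and>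
      (X has_real_derivative \<rho> t * (X t * A (X t, Y t))) (at t within {0..T}) \<and>
      (Y has_real_derivative \<rho> t * (Y t * B (X t, Y t))) (at t within {0..T})"
    "\<And>t. 0 < t \<Longrightarrow> t < T \<Longrightarrow> (X t, Y t) \<notin> S"
proof -
  let ?F = "\<lambda>z. (1 / (fst z ^ i * snd z ^ j)) *\<^sub>R (fst z * A z, snd z * B z)"
  from assms obtain T \<phi> where T: "0 < T" and \<phi>: "\<phi> 0 = p" "\<phi> T = q"
    and orb: "\<And>t. t \<in> {0..T} \<Longrightarrow> \<phi> t \<in> U \<inter> {0<..} \<times> {0<..} \<and> (\<phi> has_vector_derivative ?F (\<phi> t)) (at t within {0..T})"
    and av: "\<And>t. t \<in> {0<..<T} \<Longrightarrow> \<phi> t \<notin> S"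
    unfolding orbit_first_hit_def by blast
  let ?\<rho> = "\<lambda>t. 1 / (fst (\<phi> t) ^ i * snd (\<phi> t) ^ j)"
  show ?thesis
  proof (rule that[of T "\<lambda>t. fst (\<phi> t)" "\<lambda>t. snd (\<phi> t)" ?\<rho>])
    fix t assume t: "t \<in> {0..T}"
    then have pos: "fst (\<phi> t) > 0" "snd (\<phi> t) > 0" using orb[OF t] by (auto simp: mem_Times_iff)
    have d: "(\<phi> has_vector_derivative ?F (\<phi> t)) (at t within {0..T})" using orb[OF t] by simp
    show "fst (\<phi> t) > 0 \<and> snd (\<phi> t) > 0 \<and> ?\<rho> t > 0 \<and>
      ((\<lambda>t. fst (\<phi> t)) has_real_derivative ?\<rho> t * (fst (\<phi> t) * A (fst (\<phi> t), snd (\<phi> t)))) (at t within {0..T}) \<and>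
      ((\<lambda>t. snd (\<phi> t)) has_real_derivative ?\<rho> t * (snd (\<phi> t) * B (fst (\<phi> t), snd (\<phi> t)))) (at t within {0..T})"
      using pos bounded_linear.has_vector_derivative[OF bounded_linear_fst d]
        bounded_linear.has_vector_derivative[OF bounded_linear_snd d]
      by (simp add: has_real_derivative_iff_has_vector_derivative)
  next
    fix t assume "0 < t" "t < T"
    then show "(fst (\<phi> t), snd (\<phi> t)) \<notin> S" using av[of t] by simp
  qed (use T \<phi> in auto)
qed

text \<open>Both quantities in the estimate are values of the logarithm of one approximate integral,
  at the end and at the start of the same orbit. \<open>G1\<close>, \<open>G2\<close> and
  \<open>c\<close> depend on the precision \<open>q\<close>, but the derivatives of
  \<open>G1\<close> and \<open>G2\<close> at 0 do not.\<close>

lemma dulac_invariant: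
  fixes A B :: "real \<times> real \<Rightarrow> real" and \<sigma>1 \<sigma>2 :: "real \<Rightarrow> real \<times> real"
  assumes U: "open U" and p: "a > 0" "b > 0" "\<rho> > 0" "\<epsilon> > 0"
    and ax: "\<And>x. -\<rho> < x \<Longrightarrow> x < a + \<rho> \<Longrightarrow> (x, 0) \<in> U" "\<And>y. -\<rho> < y \<Longrightarrow> y < b + \<rho> \<Longrightarrow> (0, y) \<in> U"
    and A: "smooth_on U A" "\<And>x. (x, 0) \<in> U \<Longrightarrow> A (x, 0) > 0"
    and B: "smooth_on U B" "\<And>y. (0, y) \<in> U \<Longrightarrow> B (0, y) < 0"
    and \<theta>: "\<theta> = - B (0, 0) / A (0, 0)" "\<theta> \<notin> \<rat>"
    and L1: "\<And>y. -\<rho> < y \<Longrightarrow> y < b + \<rho> \<Longrightarrow>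
        \<exists>d. (L1 has_real_derivative d) (at y) \<and> y * d = L1 y * (A (0, y) / B (0, y) + 1 / \<theta>)"
      "smooth_on {-\<rho><..<b + \<rho>} L1" "\<And>y. -\<rho> < y \<Longrightarrow> y < b + \<rho> \<Longrightarrow> L1 y \<noteq> 0"
    and Y1: "smooth_on {-\<rho><..<b + \<rho>} Y1"
      "\<And>y. -\<rho> < y \<Longrightarrow> y < b + \<rho> \<Longrightarrow> y * deriv Y1 y - 1 / \<theta> * Y1 y = L1 y * deriv (\<lambda>x. A (x, y) / B (x, y)) 0"
    and L2: "\<And>x. -\<rho> < x \<Longrightarrow> x < a + \<rho> \<Longrightarrow>
        \<exists>d. (L2 has_real_derivative d) (at x) \<and> x * d = L2 x * (B (x, 0) / A (x, 0) + \<theta>)"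
      "smooth_on {-\<rho><..<a + \<rho>} L2" "\<And>x. -\<rho> < x \<Longrightarrow> x < a + \<rho> \<Longrightarrow> L2 x \<noteq> 0"
    and Y2: "smooth_on {-\<rho><..<a + \<rho>} Y2"
      "\<And>x. -\<rho> < x \<Longrightarrow> x < a + \<rho> \<Longrightarrow> x * deriv Y2 x - \<theta> * Y2 x = L2 x * deriv (\<lambda>y. B (x, y) / A (x, y)) 0"
    and \<sigma>1: "smooth_on {-\<epsilon><..<\<epsilon>} (\<lambda>s. fst (\<sigma>1 s))" "smooth_on {-\<epsilon><..<\<epsilon>} (\<lambda>s. snd (\<sigma>1 s))"
      "\<sigma>1 0 = (0, b)" "deriv (\<lambda>s. fst (\<sigma>1 s)) 0 > 0"
    and \<sigma>2: "smooth_on {-\<epsilon><..<\<epsilon>} (\<lambda>s. fst (\<sigma>2 s))" "smooth_on {-\<epsilon><..<\<epsilon>} (\<lambda>s. snd (\<sigma>2 s))"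
      "\<sigma>2 0 = (a, 0)" "deriv (\<lambda>s. snd (\<sigma>2 s)) 0 > 0"
    and dulac: "\<forall>\<^sub>F \<delta> in at_right 0. \<forall>\<^sub>F s in at_right 0. D s \<in> {0<..<\<delta>} \<and>
      orbit_first_hit (\<lambda>z. (1 / (fst z ^ i * snd z ^ j)) *\<^sub>R (fst z * A z, snd z * B z))
        (U \<inter> {0<..} \<times> {0<..}) (\<sigma>2 ` {-\<delta><..<\<delta>}) (\<sigma>1 s) (\<sigma>2 (D s))"
  shows "\<exists>G1 G2 s0 c. 0 < s0 \<and> smooth_on {-s0<..<s0} G1 \<and> smooth_on {-s0<..<s0} G2 \<and>
    deriv G1 0 = \<theta> * (deriv (deriv (\<lambda>s. fst (\<sigma>1 s))) 0 / (2 * deriv (\<lambda>s. fst (\<sigma>1 s)) 0)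
       - deriv (\<lambda>s. snd (\<sigma>1 s)) 0 / b * (A (0, b) / B (0, b)) - deriv (\<lambda>s. fst (\<sigma>1 s)) 0 / L1 b * Y1 b) \<and>
    deriv G2 0 = deriv (deriv (\<lambda>s. snd (\<sigma>2 s))) 0 / (2 * deriv (\<lambda>s. snd (\<sigma>2 s)) 0)
       - deriv (\<lambda>s. fst (\<sigma>2 s)) 0 / a * (B (a, 0) / A (a, 0)) - deriv (\<lambda>s. snd (\<sigma>2 s)) 0 / L2 a * Y2 a \<and>
    (\<forall>\<^sub>F s in at_right 0. \<bar>ln (D s) + G2 (D s) - (\<theta> * ln s + G1 s)\<bar> \<le> c * s powr q)"
proof -
  obtain \<eta> where \<eta>: "0 < \<eta>" "\<eta> < \<rho>" "cross a b \<eta> \<subseteq> U"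
    by (rule cross_subset_open[OF U p(1-3) ax])
  define N where "N = cross a b \<eta>"
  have oN: "open N" unfolding N_def by (rule open_cross)
  have sN: "star_both N" unfolding N_def by (rule star_both_cross[OF p(1,2) \<eta>(1)])
  have NU: "N \<subseteq> U" using \<eta>(3) unfolding N_def .
  have AN: "smooth_on N A" "\<And>x. (x, 0) \<in> N \<Longrightarrow> A (x, 0) \<noteq> 0"
    using smooth_on_subset[OF A(1) NU] A(2) NU by force+
  have BN: "smooth_on N B" "\<And>y. (0, y) \<in> N \<Longrightarrow> B (0, y) \<noteq> 0"
    using smooth_on_subset[OF B(1) NU] B(2) NU by force+
  have 00: "(0, 0) \<in> N" unfolding N_def cross_def using p \<eta> by auto
  have \<theta>0: "\<theta> > 0" unfolding \<theta>(1) using A(2)[of 0] B(2)[of 0] 00 NU by (auto intro: divide_neg_pos simp: divide_neg_pos)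
  obtain J0 :: nat where J0: "real J0 > max (q / \<theta>) (1 / \<theta>)" using reals_Archimedean2 by blast
  \<comment> \<open>The passage costs an error of order \<open>s powr (\<theta> * J)\<close>, so
    \<theta> J has to reach \<open>q\<close>. From \<open>K > \<theta> * J\<close> and \<theta> J
    \<ge> 1 follows \<open>K \<ge> 2\<close>, needed for the coefficients at the vertical axis;
    \<open>J \<ge> 2\<close> does the same at the horizontal one.\<close>
  define J where "J = max 2 J0"
  have "real J > q / \<theta>" "real J > 1 / \<theta>" using J0 unfolding J_def by auto
  then have J: "J \<ge> 2" "q \<le> \<theta> * real J" "1 \<le> \<theta> * real J"
    using \<theta>0 unfolding J_def by (auto simp: field_simps)
  obtain K g e where K: "real K > \<theta> * real J" and ai: "approx_integral N A B \<theta> 1 K J g e"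
    using approx_integral_exists[OF oN sN 00 AN BN \<theta>(1) \<theta>0 \<theta>(2), of J] J(1) by auto
  have K2: "K \<ge> 2" using K J(3) by linarith
  have nr: "1 / \<theta> \<notin> range real" "\<theta> / 1 \<notin> range real"
  proof -
    have "x \<notin> range real" if "x \<notin> \<rat>" for x using that by (metis Rats_of_nat rangeE)
    moreover have "1 / \<theta> \<notin> \<rat>"
    proof
      assume "1 / \<theta> \<in> \<rat>"
      from Rats_divide[OF Rats_1 this] show False using \<theta>(2) by simp
    qed
    ultimately show "1 / \<theta> \<notin> range real" "\<theta> / 1 \<notin> range real" using \<theta>(2) by auto
  qed
  obtain G1 s1 where G1: "0 < s1" "s1 \<le> \<epsilon>" "smooth_on {-s1<..<s1} G1"
    "\<And>s. s \<in> {0<..<s1} \<Longrightarrow> \<sigma>1 s \<in> N \<and> 0 < fst (\<sigma>1 s) \<and> 0 < snd (\<sigma>1 s) \<and>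
      \<theta> * ln (fst (\<sigma>1 s)) + 1 * ln (snd (\<sigma>1 s)) + g (\<sigma>1 s) = \<theta> * ln s + G1 s"
    "deriv G1 0 = \<theta> * (deriv (deriv (\<lambda>s. fst (\<sigma>1 s))) 0 / (2 * deriv (\<lambda>s. fst (\<sigma>1 s)) 0)
       - deriv (\<lambda>s. snd (\<sigma>1 s)) 0 / b * (A (0, b) / B (0, b)) - deriv (\<lambda>s. fst (\<sigma>1 s)) 0 / L1 b * Y1 b)"
    using section_invariant[OF p(1,2) \<eta>(1,2) N_def AN(1) BN ai K2 _ nr(1) L1 Y1 p(4) \<sigma>1] \<theta>0 by auto
  let ?A = "\<lambda>z. A (snd z, fst z)" and ?B = "\<lambda>z. B (snd z, fst z)" and ?g = "\<lambda>z. g (snd z, fst z)"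
  have sw: "prod.swap -` N = cross b a \<eta>" unfolding N_def by (rule swap_cross)
  have ai': "approx_integral (cross b a \<eta>) ?B ?A 1 \<theta> J K ?g (\<lambda>z. e (snd z, fst z))"
    using approx_integral_swap[OF oN ai] unfolding sw .
  have sA: "smooth_on (cross b a \<eta>) ?A" and sB: "smooth_on (cross b a \<eta>) ?B"
    using smooth_on_swap[OF oN AN(1)] smooth_on_swap[OF oN BN(1)] unfolding sw by auto
  have A0: "?A (0, y) \<noteq> 0" if "(0, y) \<in> cross b a \<eta>" for y
    using that AN(2)[of y] unfolding sw[symmetric] by simp
  \<comment> \<open>The second section with coordinates exchanged: the exponents become 1 and
    \<theta>, so the Mellin exponent there is \<theta> instead of 1/\<theta>.\<close>
  obtain G2 s2 where G2: "0 < s2" "s2 \<le> \<epsilon>" "smooth_on {-s2<..<s2} G2"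
    "\<And>s. s \<in> {0<..<s2} \<Longrightarrow> 0 < snd (\<sigma>2 s) \<and> 0 < fst (\<sigma>2 s) \<and>
      1 * ln (snd (\<sigma>2 s)) + \<theta> * ln (fst (\<sigma>2 s)) + g (\<sigma>2 s) = 1 * ln s + G2 s"
    "deriv G2 0 = deriv (deriv (\<lambda>s. snd (\<sigma>2 s))) 0 / (2 * deriv (\<lambda>s. snd (\<sigma>2 s)) 0)
       - deriv (\<lambda>s. fst (\<sigma>2 s)) 0 / a * (B (a, 0) / A (a, 0)) - deriv (\<lambda>s. snd (\<sigma>2 s)) 0 / L2 a * Y2 a"
    using section_invariant[OF p(2,1) \<eta>(1,2) refl sB sA A0 ai' J(1) _ nr(2), of L2 Y2 \<epsilon> "\<lambda>s. (snd (\<sigma>2 s), fst (\<sigma>2 s))"]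
      L2 Y2 p(4) \<sigma>2 by auto
  define \<kappa> where "\<kappa> = real K - \<theta> * real J"
  have \<kappa>: "\<kappa> > 0" using K unfolding \<kappa>_def by simp
  have ge: "smooth_on N g" "smooth_on N e" using ai unfolding approx_integral_def by auto
  have Apos: "A (x, 0) > 0" if "0 \<le> x" "x \<le> a + \<eta> / 2" for x
    using A(2)[OF ax(1)] that \<eta> p by auto
  have Bneg: "B (0, y) < 0" if "0 \<le> y" "y \<le> b + \<eta> / 2" for y
    using B(2)[OF ax(2)] that \<eta> p by auto
  obtain r r' M k C where reg: "0 < r'" "r' \<le> r" "r \<le> \<eta> / 2" "r < a" "0 < M" "0 < k" "0 < C"
    "corner (a + \<eta> / 2) (b + \<eta> / 2) r r' \<subseteq> N" "r powr \<kappa> / M \<le> \<eta> / 8"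
    "\<And>z. z \<in> corner (a + \<eta> / 2) (b + \<eta> / 2) r r' \<Longrightarrow> \<bar>g z\<bar> \<le> C \<and> \<bar>e z\<bar> \<le> C"
    "\<And>x y. (x, y) \<in> corner (a + \<eta> / 2) (b + \<eta> / 2) r r' \<Longrightarrow> x > 0 \<Longrightarrow>
      k * x powr \<kappa> \<le> \<kappa> * x powr \<kappa> * A (x, y) - M * y * B (x, y)"
    by (rule corner_region[OF p(1,2) \<eta>(1) \<kappa> smooth_on_continuous[OF AN(1), unfolded N_def]
          smooth_on_continuous[OF BN(1), unfolded N_def] smooth_on_continuous[OF ge(1), unfolded N_def]
          smooth_on_continuous[OF ge(2), unfolded N_def] Apos Bneg])
      (auto simp: N_def)
  define Dc where "Dc = real J * C * exp (real J * C) / k * ((a + \<eta> / 2) powr \<kappa> + M * (b + \<eta> / 2))"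
  have Dc: "Dc \<ge> 0" unfolding Dc_def using reg p \<eta> by simp
  have "\<forall>\<^sub>F \<delta> in at_right 0. \<delta> \<in> {0<..<s2}"
    using eventually_at_right_less[of 0] eventually_at_right_field G2(1) by (auto simp: eventually_at_right_field)
  with dulac have "\<forall>\<^sub>F \<delta> in at_right 0. \<delta> \<in> {0<..<s2} \<and> (\<forall>\<^sub>F s in at_right 0. D s \<in> {0<..<\<delta>} \<and>
      orbit_first_hit (\<lambda>z. (1 / (fst z ^ i * snd z ^ j)) *\<^sub>R (fst z * A z, snd z * B z))
        (U \<inter> {0<..} \<times> {0<..}) (\<sigma>2 ` {-\<delta><..<\<delta>}) (\<sigma>1 s) (\<sigma>2 (D s)))"
    by eventually_elim auto
  then obtain \<delta> where \<delta>: "0 < \<delta>" "\<delta> < s2" and ev1: "\<forall>\<^sub>F s in at_right 0. D s \<in> {0<..<\<delta>} \<and>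
      orbit_first_hit (\<lambda>z. (1 / (fst z ^ i * snd z ^ j)) *\<^sub>R (fst z * A z, snd z * B z))
        (U \<inter> {0<..} \<times> {0<..}) (\<sigma>2 ` {-\<delta><..<\<delta>}) (\<sigma>1 s) (\<sigma>2 (D s))"
    using eventually_happens'[OF trivial_limit_at_right_real] by (metis (no_types, lifting) greaterThanLessThan_iff)
  obtain y2 h where h: "y2 > 0" "continuous_on {0..y2} h"
    "\<And>v. v \<in> {0..y2} \<Longrightarrow> \<bar>h v - fst (\<sigma>2 0)\<bar> < min (\<eta> / 2) (a - r) \<and> (\<exists>s\<in>{0..<\<delta>}. (h v, v) = (fst (\<sigma>2 s), snd (\<sigma>2 s)))"
    by (rule graph_of_section[OF p(4) \<sigma>2(1,2) _ \<sigma>2(4) \<delta>(1), of "min (\<eta> / 2) (a - r)"])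
      (use \<sigma>2(3) \<eta> reg(4) in auto)
  have h': "r < h v \<and> h v < a + \<eta> / 2" if "v \<in> {0..y2}" for v
  proof -
    have "\<bar>h v - a\<bar> < \<eta> / 2" "\<bar>h v - a\<bar> < a - r" using h(3)[OF that] \<sigma>2(3) by auto
    then show ?thesis by linarith
  qed
  have lim0: "((\<lambda>s. f s) \<longlongrightarrow> f 0) (at_right 0)" if "smooth_on {-s0<..<s0} f" "s0 > 0" for f :: "real \<Rightarrow> real" and s0
    using smooth_on_isCont[OF that(1), of 0] that(2) by (auto simp: isCont_def intro: filterlim_at_split[THEN iffD1, THEN conjunct2])
  define R where "R = r powr \<theta> * min r' y2"
  have R: "R > 0" unfolding R_def using reg h by simp
  \<comment> \<open>If \<open>- z s\<close> exceeds this number, both smallness conditions of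
    \<open>corner_passage\<close> hold: the first entry gives \<open>2 * Dc \<le> exp Z\<close>, the
    second keeps \<open>z s + 1 + C\<close> strictly below \<open>ln R\<close>.\<close>
  define Z where "Z = max (ln (2 * Dc + 1)) (2 + C - ln R)"
  define z where "z s = \<theta> * ln s + G1 s" for s
  have ev2: "\<forall>\<^sub>F s in at_right 0. z s \<le> - Z"
  proof -
    have "filterlim (\<lambda>s. \<theta> * ln s) at_bot (at_right 0)"
      by (rule filterlim_tendsto_pos_mult_at_bot[OF tendsto_const \<theta>0 ln_at_0])
    then have "\<forall>\<^sub>F s in at_right 0. \<theta> * ln s \<le> - Z - (G1 0 + 1)"
      unfolding filterlim_at_bot by blast
    moreover have "\<forall>\<^sub>F s in at_right 0. G1 s < G1 0 + 1"
      by (rule order_tendstoD(2)[OF lim0[OF G1(3,1)]]) simp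
    ultimately show ?thesis unfolding z_def by eventually_elim linarith
  qed
  have ev3: "\<forall>\<^sub>F s in at_right 0. fst (\<sigma>1 s) < r \<and> snd (\<sigma>1 s) < b + \<eta> / 4"
    using order_tendstoD(2)[OF lim0[OF \<sigma>1(1) p(4)], of r] order_tendstoD(2)[OF lim0[OF \<sigma>1(2) p(4)], of "b + \<eta> / 4"]
      \<sigma>1(3) reg \<eta> by (auto intro: eventually_conj)
  have ev4: "\<forall>\<^sub>F s in at_right 0. G1 s < G1 0 + 1"
    by (rule order_tendstoD(2)[OF lim0[OF G1(3,1)]]) simp
  have ev5: "\<forall>\<^sub>F s in at_right 0. s \<in> {0<..<min 1 s1}"
    unfolding eventually_at_right_field by (rule exI[of _ "min 1 s1"]) (use G1(1) in auto)
  define c where "c = 2 * (Dc * exp (real J * (G1 0 + 1)))"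
  have "\<forall>\<^sub>F s in at_right 0. \<bar>ln (D s) + G2 (D s) - (\<theta> * ln s + G1 s)\<bar> \<le> c * s powr q"
    using ev1 ev2 ev3 ev4 ev5
  proof eventually_elim
    case (elim s)
    have Ds: "D s \<in> {0<..<s2}" using elim(1) \<delta> by auto
    show ?case
    proof (rule orbit_components[OF conjunct2[OF elim(1)]])
    fix T X Y \<rho>' assume T: "0 < T" "\<sigma>1 s = (X 0, Y 0)" "\<sigma>2 (D s) = (X T, Y T)"
      and orb: "\<And>t. t \<in> {0..T} \<Longrightarrow> X t > 0 \<and> Y t > 0 \<and> \<rho>' t > 0 \<and>
      (X has_real_derivative \<rho>' t * (X t * A (X t, Y t))) (at t within {0..T}) \<and>
      (Y has_real_derivative \<rho>' t * (Y t * B (X t, Y t))) (at t within {0..T})"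
      and av: "\<And>t. 0 < t \<Longrightarrow> t < T \<Longrightarrow> (X t, Y t) \<notin> \<sigma>2 ` {-\<delta><..<\<delta>}"
    define w where "w t = \<theta> * ln (X t) + ln (Y t) + g (X t, Y t)" for t
    have w0: "w 0 = z s" using G1(4)[of s] elim(5) T(2) unfolding w_def z_def by simp
    have wT: "w T = ln (D s) + G2 (D s)" using G2(4)[OF Ds] T(3) unfolding w_def by (simp add: add.commute)
    have Z0: "Z \<ge> 0"
      unfolding Z_def by (rule max.coboundedI1, rule ln_ge_zero) (use Dc in simp)
    have "2 * Dc \<le> exp Z" 
    proof -
      have "2 * Dc \<le> exp (ln (2 * Dc + 1))" using Dc by simp
      also have "\<dots> \<le> exp Z" unfolding Z_def by simp
      finally show ?thesis .
    qed
    also have "\<dots> \<le> exp (- real J * w 0)"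
    proof -
      have "1 * Z \<le> real J * (- w 0)" using elim(2) J(1) Z0 w0 by (intro mult_mono) auto
      then show ?thesis by simp
    qed
    finally have sm1: "2 * Dc \<le> exp (- real J * w 0)" .
    have "w 0 + 1 + C < ln R" using elim(2) w0 unfolding Z_def by auto
    then have "exp (w 0 + 1 + C) < exp (ln R)" by simp
    then have sm2: "exp (w 0 + 1 + C) < r powr \<theta> * min r' y2" using R unfolding R_def by simp
    have "\<bar>real J * (w T - w 0)\<bar> \<le> 2 * (Dc * exp (real J * w 0))"
      unfolding w_def Dc_def
    proof (rule corner_passage[OF p(1,2) \<eta>(1) N_def ai \<kappa>_def \<kappa> _ \<theta>0 reg refl _ orb _ _ h(1,2) h'])
      show "1 \<le> J" using J by simp
      show "X 0 < r" "Y 0 < b + \<eta> / 4" using elim(3) T(2) by auto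
      fix t assume t: "0 < t" "t < T" "Y t \<in> {0..y2}"
      show "X t \<noteq> h (Y t)"
      proof
        assume "X t = h (Y t)"
        then obtain s' where "s' \<in> {0..<\<delta>}" "(X t, Y t) = \<sigma>2 s'" using h(3)[OF t(3)] by auto
        then have "(X t, Y t) \<in> \<sigma>2 ` {-\<delta><..<\<delta>}" by force
        then show False using av[OF t(1,2)] by simp
      qed
    qed (use T(1) sm1 sm2 in \<open>auto simp: w_def Dc_def\<close>)
    then have "real J * \<bar>w T - w 0\<bar> \<le> 2 * (Dc * exp (real J * w 0))" by (simp add: abs_mult)
    moreover have "1 * \<bar>w T - w 0\<bar> \<le> real J * \<bar>w T - w 0\<bar>" using J(1) by (intro mult_right_mono) auto
    ultimately have 1: "\<bar>w T - w 0\<bar> \<le> 2 * (Dc * exp (real J * w 0))" by simp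
    have s: "0 < s" "s < 1" using elim(5) by auto
    \<comment> \<open>The error in terms of \<open>s\<close>: \<open>w 0\<close> is
      \<open>\<theta> * ln s\<close> plus a bounded function, and
      \<open>\<theta> * J \<ge> q\<close>.\<close>
    have "exp (real J * w 0) = s powr (\<theta> * real J) * exp (real J * G1 s)"
      unfolding w0 z_def powr_def using s by (simp add: exp_add[symmetric] algebra_simps)
    also have "\<dots> \<le> s powr q * exp (real J * (G1 0 + 1))"
      using s J elim(4) by (intro mult_mono powr_mono') auto
    finally have "Dc * exp (real J * w 0) \<le> Dc * (s powr q * exp (real J * (G1 0 + 1)))"
      using Dc by (rule mult_left_mono)
    with 1 have "\<bar>w T - w 0\<bar> \<le> c * s powr q" unfolding c_def by (simp add: mult_ac)
    then show "\<bar>ln (D s) + G2 (D s) - (\<theta> * ln s + G1 s)\<bar> \<le> c * s powr q" unfolding w0 wT z_def .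
    qed
  qed
  moreover define s0 where "s0 = min s1 s2"
  have "0 < s0" "smooth_on {-s0<..<s0} G1" "smooth_on {-s0<..<s0} G2"
    using G1(1) G2(1) unfolding s0_def
    by (auto intro!: smooth_on_subset[OF G1(3)] smooth_on_subset[OF G2(3)])
  ultimately show ?thesis using G1(5) G2(5) by blast
qed

section \<open>Comparison of asymptotic expansions\<close>

lemma tendsto_powr_at_right_zero:
  fixes p :: real
  assumes "p > 0"
  shows "((\<lambda>s. s powr p) \<longlongrightarrow> 0) (at_right 0)"
proof -
  have "\<forall>\<^sub>F s in at_right 0. (0::real) \<le> s"
    by (rule eventually_mono[OF eventually_at_right_less]) auto
  then show ?thesis
    using tendsto_powr'[OF tendsto_ident_at[of 0 "{0<..}"] tendsto_const[of p]] assms by auto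
qed

text \<open>Divide by the power with the least exponent among the nonzero coefficients and let
  \<open>s\<close> tend to 0: the sum tends to that coefficient, the bound to 0. Injectivity of the
  exponents excludes cancellation.\<close>

lemma powr_sum_unique:
  fixes c e :: "'i \<Rightarrow> real"
  assumes S: "finite S" "inj_on e S"
    and bound: "\<forall>\<^sub>F s in at_right 0. \<bar>\<Sum>x\<in>S. c x * s powr e x\<bar> \<le> C * s powr q"
    and x: "x \<in> S" "e x < q"
  shows "c x = 0"
proof (rule ccontr)
  assume "c x \<noteq> 0"
  define Z where "Z = {y \<in> S. c y \<noteq> 0}"
  have Z: "finite Z" "Z \<noteq> {}" "x \<in> Z" using S x \<open>c x \<noteq> 0\<close> unfolding Z_def by auto
  obtain y where y: "y \<in> Z" "\<And>v. v \<in> Z \<Longrightarrow> e y \<le> e v"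
    using ex_min_if_finite[of "e ` Z"] Z(1,2) by (auto simp: not_less)
  have yS: "y \<in> S" "c y \<noteq> 0" using y unfolding Z_def by auto
  have yq: "e y < q" using y(2)[OF Z(3)] x(2) by simp
  have pos: "\<forall>\<^sub>F s in at_right 0. (0::real) < s" by (rule eventually_at_right_less)
  note lim0 = tendsto_powr_at_right_zero
  have "((\<lambda>s. \<Sum>v\<in>S. c v * s powr (e v - e y)) \<longlongrightarrow> (\<Sum>v\<in>S. if v = y then c y else 0)) (at_right 0)"
  proof (rule tendsto_sum)
    fix v assume v: "v \<in> S"
    show "((\<lambda>s. c v * s powr (e v - e y)) \<longlongrightarrow> (if v = y then c y else 0)) (at_right 0)"
    proof (cases "v = y \<or> c v = 0")
      case True
      have "\<forall>\<^sub>F s in at_right 0. c v * s powr (e v - e y) = (if v = y then c y else 0)"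
        using pos True yS by (auto elim!: eventually_mono)
      then show ?thesis by (rule tendsto_eventually)
    next
      case False
      then have "v \<in> Z" using v unfolding Z_def by simp
      then have "e y < e v" using y(2)[of v] S(2) v yS False by (auto simp: inj_on_def less_le)
      then show ?thesis using tendsto_mult[OF tendsto_const[of "c v"] lim0[of "e v - e y"]] False by simp
    qed
  qed
  then have "((\<lambda>s. \<Sum>v\<in>S. c v * s powr (e v - e y)) \<longlongrightarrow> c y) (at_right 0)"
    using S(1) yS(1) by simp
  moreover have "((\<lambda>s. \<Sum>v\<in>S. c v * s powr (e v - e y)) \<longlongrightarrow> 0) (at_right 0)"
  proof (rule Lim_null_comparison)
    show "\<forall>\<^sub>F s in at_right 0. norm (\<Sum>v\<in>S. c v * s powr (e v - e y)) \<le> C * s powr (q - e y)"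
      using bound pos
    proof eventually_elim
      case (elim s)
      have "(\<Sum>v\<in>S. c v * s powr (e v - e y)) = (\<Sum>v\<in>S. c v * s powr e v) / s powr e y"
        unfolding sum_divide_distrib powr_diff by simp
      then have "norm (\<Sum>v\<in>S. c v * s powr (e v - e y)) = \<bar>\<Sum>v\<in>S. c v * s powr e v\<bar> / s powr e y"
        by (simp add: abs_divide)
      also have "\<dots> \<le> C * s powr q / s powr e y" using elim by (intro divide_right_mono) auto
      finally show ?case by (simp add: powr_diff)
    qed
    show "((\<lambda>s. C * s powr (q - e y)) \<longlongrightarrow> 0) (at_right 0)"
      using tendsto_mult[OF tendsto_const[of C] lim0[of "q - e y"]] yq by simp
  qed
  ultimately have "c y = 0" using tendsto_unique[OF trivial_limit_at_right_real] by blast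
  then show False using yS by simp
qed

lemma smooth_on_locally_bounded:
  fixes f :: "real \<Rightarrow> real"
  assumes "isCont f 0"
  shows "\<forall>\<^sub>F s in at_right 0. \<bar>f s\<bar> \<le> \<bar>f 0\<bar> + 1"
proof -
  have "(f \<longlongrightarrow> f 0) (at_right 0)"
    using assms by (simp add: isCont_def filterlim_at_split)
  then have "((\<lambda>s. \<bar>f s\<bar>) \<longlongrightarrow> \<bar>f 0\<bar>) (at_right 0)" by (rule tendsto_rabs)
  from order_tendstoD(2)[OF this, of "\<bar>f 0\<bar> + 1"] show ?thesis
    by (auto elim: eventually_mono)
qed

lemma taylor_1D:
  fixes f :: "real \<Rightarrow> real"
  assumes r: "r > 0" and f: "smooth_on {-r<..<r} f"
  obtains a e where "\<And>s. s \<in> {-r<..<r} \<Longrightarrow> f s = (\<Sum>i<k. a i * s ^ i) + s ^ k * e s" "isCont e 0"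
    "a 0 = f 0" "a 1 = deriv f 0"
proof -
  let ?\<Omega> = "{-r<..<r} \<times> (UNIV :: real set)"
  have st: "t * u \<in> {-r<..<r}" if "u \<in> {-r<..<r}" "t \<in> {0..1}" for t u
  proof -
    have "\<bar>t * u\<bar> \<le> \<bar>u\<bar>" using that by (simp add: abs_mult mult_left_le_one_le)
    then show ?thesis using that(1) by auto
  qed
  have \<Omega>: "open ?\<Omega>" "star_fst ?\<Omega>" using st unfolding star_fst_def by (auto intro: open_Times)
  have F: "smooth_on ?\<Omega> (\<lambda>x. f (fst x))"
    by (rule smooth_on_compose[OF f open_greaterThanLessThan \<Omega>(1) smooth_on_fst[OF \<Omega>(1) smooth_on_id]]) auto
  let ?h = "\<lambda>i. (hadamard ^^ i) (\<lambda>x :: real \<times> real. f (fst x))"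
  have 0: "(0, 0) \<in> ?\<Omega>" using r by auto
  show ?thesis
  proof (rule that[of "\<lambda>i. ?h i (0, 0)" "\<lambda>s. ?h k (s, 0)"])
    show "f s = (\<Sum>i<k. ?h i (0, 0) * s ^ i) + s ^ k * ?h k (s, 0)" if "s \<in> {-r<..<r}" for s
      using hadamard_expansion[OF \<Omega> F, of s 0 k] that by simp
    show "isCont (\<lambda>s. ?h k (s, 0)) 0"
      by (rule smooth_on_isCont[OF smooth_on_slice_fst[OF \<Omega>(1) smooth_on_hadamard_iter[OF \<Omega> F]]]) (use r in auto)
    show "?h 0 (0, 0) = f 0" by simp
    show "?h 1 (0, 0) = deriv f 0" using deriv_iter_hadamard[OF \<Omega> F 0, of 1] by simp
  qed
qed

text \<open>For irrational \<open>\<theta>\<close> the monomials \<open>s ^ i * w ^ j\<close> have different orders along \<open>w = s powr \<theta>\<close>,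
  so that smallness along this curve kills the low Taylor coefficients of \<open>H\<close>.\<close>

lemma taylor_coefficients_on_curve:
  fixes H :: "real \<times> real \<Rightarrow> real"
  assumes r: "r > 0" and H: "smooth_on ({-r<..<r} \<times> {-r<..<r}) H"
    and \<theta>: "\<theta> > 0" "\<theta> \<notin> \<rat>" and q: "q > \<theta> + 1"
    and bound: "\<forall>\<^sub>F s in at_right 0. \<bar>H (s, s powr \<theta>)\<bar> \<le> C * s powr q"
  shows "H (0, 0) = 0" "deriv (\<lambda>s. H (s, 0)) 0 = 0"
    "frechet_derivative H (at (0, 0)) (0, 1) = 0" "deriv (\<lambda>s. frechet_derivative H (at (s, 0)) (0, 1)) 0 = 0"
proof -
  let ?I = "{-r<..<r}" and ?\<Omega> = "{-r<..<r} \<times> {-r<..<r}"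
  have st: "t * u \<in> ?I" if "u \<in> ?I" "t \<in> {0..1}" for t u
  proof -
    have "\<bar>t * u\<bar> \<le> \<bar>u\<bar>" using that by (simp add: abs_mult mult_left_le_one_le)
    then show ?thesis using that(1) by auto
  qed
  have \<Omega>: "open ?\<Omega>" "star_fst ?\<Omega>" using st unfolding star_fst_def by (auto intro: open_Times)
  have sw: "prod.swap -` ?\<Omega> = ?\<Omega>" by auto
  \<comment> \<open>The arguments are exchanged so that Hadamard quotients expand in
    \<open>w\<close> first. The coefficients \<open>c j\<close> are functions of \<open>s\<close>,
    to be expanded in a second step.\<close>
  define F where "F = (\<lambda>z. H (snd z, fst z))"
  have F: "smooth_on ?\<Omega> F" using smooth_on_swap[OF \<Omega>(1) H] unfolding sw F_def .
  \<comment> \<open>One order for both expansions: the remainders \<open>s ^ k\<close> and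
    \<open>w ^ k\<close> on the curve \<open>w = s powr \<theta>\<close> are then at most
    \<open>s powr q\<close>, and the indices 0 and 1 are below \<open>k\<close>.\<close>
  obtain k :: nat where k: "real k > max (max q (q / \<theta>)) 2" using reals_Archimedean2 by blast
  then have k1: "real k \<ge> q" "\<theta> * real k \<ge> q" "k > 2" using \<theta>(1) by (auto simp: field_simps)
  define c where "c j s = (hadamard ^^ j) F (0, s)" for j s
  define R where "R = (hadamard ^^ k) F"
  have R: "smooth_on ?\<Omega> R" unfolding R_def by (rule smooth_on_hadamard_iter[OF \<Omega> F])
  have c: "smooth_on ?I (c j)" for j
    unfolding c_def
    by (rule smooth_on_subset[OF smooth_on_slice_snd(2)[OF \<Omega>(1) smooth_on_hadamard_iter[OF \<Omega> F, of j], of 0]])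
      (use r in auto)
  have exp: "H (s, w) = (\<Sum>j<k. c j s * w ^ j) + w ^ k * R (w, s)" if "s \<in> ?I" "w \<in> ?I" for s w
    using hadamard_expansion[OF \<Omega> F, of w s k] that unfolding F_def[symmetric] c_def R_def by (simp add: F_def)
  have "\<forall>j. \<exists>p. (\<forall>s\<in>?I. c j s = (\<Sum>i<k. fst p i * s ^ i) + s ^ k * snd p s) \<and> isCont (snd p) 0 \<and>
    fst p 0 = c j 0 \<and> fst p 1 = deriv (c j) 0"
  proof
    fix j
    show "\<exists>p. (\<forall>s\<in>?I. c j s = (\<Sum>i<k. fst p i * s ^ i) + s ^ k * snd p s) \<and> isCont (snd p) 0 \<and>
      fst p 0 = c j 0 \<and> fst p 1 = deriv (c j) 0"
    proof (rule taylor_1D[OF r c[of j], where k = k])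
      fix a :: "nat \<Rightarrow> real" and e :: "real \<Rightarrow> real"
      assume "\<And>s. s \<in> ?I \<Longrightarrow> c j s = (\<Sum>i<k. a i * s ^ i) + s ^ k * e s" "isCont e 0" "a 0 = c j 0" "a 1 = deriv (c j) 0"
      then show ?thesis by (intro exI[of _ "(a, e)"]) auto
    qed
  qed
  from choice[OF this] obtain p where p: "\<forall>j. (\<forall>s\<in>?I. c j s = (\<Sum>i<k. fst (p j) i * s ^ i) + s ^ k * snd (p j) s) \<and>
    isCont (snd (p j)) 0 \<and> fst (p j) 0 = c j 0 \<and> fst (p j) 1 = deriv (c j) 0" by (rule exE)
  define a where "a j = fst (p j)" for j
  define e where "e j = snd (p j)" for j
  have ae: "\<And>j s. s \<in> ?I \<Longrightarrow> c j s = (\<Sum>i<k. a j i * s ^ i) + s ^ k * e j s" "\<And>j. isCont (e j) 0"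
    "\<And>j. a j 0 = c j 0" "\<And>j. a j 1 = deriv (c j) 0"
    unfolding a_def e_def using p by blast+
  define E where "E = (\<lambda>(i, j). real i + \<theta> * real j)"
  let ?S = "{..<k} \<times> {..<k}"
  have inj: "inj_on E ?S"
  proof (rule inj_onI)
    fix x y assume "E x = E y"
    obtain i j i' j' where xy: "x = (i, j)" "y = (i', j')" by (cases x, cases y) auto
    have e: "real i + \<theta> * real j = real i' + \<theta> * real j'" using \<open>E x = E y\<close> unfolding E_def xy by simp
    have "j = j'"
    proof (rule ccontr)
      assume "j \<noteq> j'"
      \<comment> \<open>Two monomials of equal order along the curve would make \<theta>
        rational.\<close>
      then have "\<theta> = (real i' - real i) / (real j - real j')" using e by (simp add: field_simps)
      then show False using \<theta>(2) by simp
    qed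
    then show "x = y" using e xy by simp
  qed
  have sI: "\<forall>\<^sub>F s in at_right 0. 0 < s \<and> s < min 1 r"
    unfolding eventually_at_right_field by (rule exI[of _ "min 1 r"]) (use r in auto)
  have sw0: "\<forall>\<^sub>F s in at_right 0. s powr \<theta> < r"
  proof -
    have "((\<lambda>s. s powr \<theta>) \<longlongrightarrow> 0) (at_right 0)"
      by (rule tendsto_powr_at_right_zero[OF \<theta>(1)])
    then show ?thesis using r by (rule order_tendstoD(2))
  qed
  have Rb: "\<forall>\<^sub>F s in at_right 0. \<bar>R (s powr \<theta>, s)\<bar> \<le> \<bar>R (0, 0)\<bar> + 1"
  proof -
    note 1 = tendsto_powr_at_right_zero[OF \<theta>(1)]
    have "isCont R (0, 0)" by (rule smooth_on_isCont[OF R]) (use r in auto)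
    from isCont_tendsto_compose[OF this tendsto_Pair[OF 1 tendsto_ident_at]]
    have "((\<lambda>s. \<bar>R (s powr \<theta>, s)\<bar>) \<longlongrightarrow> \<bar>R (0, 0)\<bar>) (at_right 0)" by (rule tendsto_rabs)
    from order_tendstoD(2)[OF this, of "\<bar>R (0, 0)\<bar> + 1"] show ?thesis by (auto elim: eventually_mono)
  qed
  have eb: "\<forall>\<^sub>F s in at_right 0. \<forall>j\<in>{..<k}. \<bar>e j s\<bar> \<le> \<bar>e j 0\<bar> + 1"
    using smooth_on_locally_bounded[OF ae(2)] by (intro eventually_ball_finite) auto
  have "\<forall>\<^sub>F s in at_right 0. \<bar>\<Sum>x\<in>?S. a (snd x) (fst x) * s powr E x\<bar> \<le>
      (C + (\<bar>R (0, 0)\<bar> + 1) + (\<Sum>j<k. \<bar>e j 0\<bar> + 1)) * s powr q"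
    using bound sI sw0 Rb eb
  proof eventually_elim
    case (elim s)
    have "-r < s powr \<theta>" using r powr_ge_zero[of s \<theta>] by linarith
    then have s: "0 < s" "s < 1" "s \<in> ?I" "s powr \<theta> \<in> ?I" using elim by auto
    let ?w = "s powr \<theta>"
    have wj: "?w ^ j = s powr (\<theta> * real j)" for j using s by (simp add: powr_realpow[symmetric] powr_powr)
    have "(\<Sum>x\<in>?S. a (snd x) (fst x) * s powr E x) = (\<Sum>i<k. \<Sum>j<k. a j i * s ^ i * ?w ^ j)"
      unfolding sum.cartesian_product E_def using s
      by (intro sum.cong) (auto simp: powr_add wj powr_realpow)
    also have "\<dots> = (\<Sum>j<k. (\<Sum>i<k. a j i * s ^ i) * ?w ^ j)"
      by (subst sum.swap) (simp add: sum_distrib_right)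
    also have "\<dots> = (\<Sum>j<k. (c j s - s ^ k * e j s) * ?w ^ j)"
      using ae(1)[OF s(3)] by simp
    also have "\<dots> = (\<Sum>j<k. c j s * ?w ^ j) - (\<Sum>j<k. s ^ k * e j s * ?w ^ j)"
      by (simp add: left_diff_distrib sum_subtractf)
    also have "(\<Sum>j<k. c j s * ?w ^ j) = H (s, ?w) - ?w ^ k * R (?w, s)"
      using exp[OF s(3,4)] by simp
    finally have eq: "(\<Sum>x\<in>?S. a (snd x) (fst x) * s powr E x) =
      H (s, ?w) - ?w ^ k * R (?w, s) - (\<Sum>j<k. s ^ k * e j s * ?w ^ j)" .
    have b1: "\<bar>?w ^ k * R (?w, s)\<bar> \<le> s powr q * (\<bar>R (0, 0)\<bar> + 1)"
      unfolding abs_mult wj using elim s k1 by (intro mult_mono) (auto intro: powr_mono')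
    have sk: "s ^ k \<le> s powr q"
      using s k1 by (subst powr_realpow[symmetric]) (auto intro: powr_mono')
    have w1: "?w ^ j \<le> 1" for j using s \<theta>(1) by (intro power_le_one) (auto simp: powr_le1)
    have "\<bar>\<Sum>j<k. s ^ k * e j s * ?w ^ j\<bar> \<le> (\<Sum>j<k. s powr q * (\<bar>e j 0\<bar> + 1) * 1)"
    proof (rule order_trans[OF sum_abs sum_mono])
      fix j assume j: "j \<in> {..<k}"
      have "\<bar>s ^ k * e j s * ?w ^ j\<bar> = s ^ k * \<bar>e j s\<bar> * ?w ^ j" using s by (simp add: abs_mult)
      also have "\<dots> \<le> s powr q * (\<bar>e j 0\<bar> + 1) * 1"
        using elim(5) j sk w1[of j] s by (intro mult_mono) auto
      finally show "\<bar>s ^ k * e j s * ?w ^ j\<bar> \<le> s powr q * (\<bar>e j 0\<bar> + 1) * 1" .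
    qed
    also have "\<dots> = s powr q * (\<Sum>j<k. \<bar>e j 0\<bar> + 1)" by (simp add: sum_distrib_left)
    finally have b2: "\<bar>\<Sum>j<k. s ^ k * e j s * ?w ^ j\<bar> \<le> s powr q * (\<Sum>j<k. \<bar>e j 0\<bar> + 1)" .
    have "(C + (\<bar>R (0, 0)\<bar> + 1) + (\<Sum>j<k. \<bar>e j 0\<bar> + 1)) * s powr q
      = C * s powr q + s powr q * (\<bar>R (0, 0)\<bar> + 1) + s powr q * (\<Sum>j<k. \<bar>e j 0\<bar> + 1)"
      by (simp only: distrib_right mult.commute[of "s powr q"])
    then show ?case unfolding eq using elim(1) b1 b2 by linarith
  qed
  from powr_sum_unique[OF _ inj this]
  have zero: "a j i = 0" if "i < k" "j < k" "real i + \<theta> * real j < q" for i j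
    using that unfolding E_def by force
  \<comment> \<open>The coefficients of \<open>w ^ 0\<close> and \<open>w ^ 1\<close> are
    \<open>H\<close> and its \<open>w\<close>-derivative on \<open>w = 0\<close>; their Taylor
    coefficients of orders 0 and 1 in \<open>s\<close> are the four numbers claimed to vanish. All
    four monomials have order below \<open>q\<close>.\<close>
  have c0: "c 0 = (\<lambda>s. H (s, 0))" unfolding c_def F_def by simp
  have c1: "c 1 s = frechet_derivative H (at (s, 0)) (0, 1)" if "s \<in> ?I" for s
    using frechet_derivative_swap(1)[OF \<Omega>(1) H, of s 0] that r
    unfolding c_def F_def by (simp add: hadamard_zero)
  have 00: "0 \<in> ?I" using r by simp
  show "H (0, 0) = 0" using zero[of 0 0] ae(3)[of 0] k1 q \<theta>(1) unfolding c0 by simp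
  show "deriv (\<lambda>s. H (s, 0)) 0 = 0" using zero[of 1 0] ae(4)[of 0] k1 q \<theta>(1) unfolding c0 by simp
  show "frechet_derivative H (at (0, 0)) (0, 1) = 0"
    using zero[of 0 1] ae(3)[of 1] k1 q \<theta>(1) unfolding c1[OF 00] by simp
  have "deriv (\<lambda>s. frechet_derivative H (at (s, 0)) (0, 1)) 0 = deriv (c 1) 0"
    by (rule deriv_cong_ev) (use eventually_nhds_in_open[of ?I 0] 00 c1 in \<open>auto elim!: eventually_mono\<close>)
  then show "deriv (\<lambda>s. frechet_derivative H (at (s, 0)) (0, 1)) 0 = 0"
    using zero[of 1 1] ae(4)[of 1] k1 q \<theta>(1) by simp
qed

section \<open>Relations between the coefficients of the expansion\<close>

lemma local_lipschitz:
  fixes f :: "real \<Rightarrow> real"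
  assumes "open S" "smooth_on S f" "p \<in> S"
  obtains \<delta> K where "\<delta> > 0" "K \<ge> 0" "\<And>x y. \<bar>x - p\<bar> < \<delta> \<Longrightarrow> \<bar>y - p\<bar> < \<delta> \<Longrightarrow> \<bar>f x - f y\<bar> \<le> K * \<bar>x - y\<bar>"
proof -
  have "isCont (deriv f) p" by (rule smooth_on_isCont[OF smooth_on_deriv_smooth[OF assms(1,2)] assms(3)])
  then have "((\<lambda>x. \<bar>deriv f x\<bar>) \<longlongrightarrow> \<bar>deriv f p\<bar>) (nhds p)"
    unfolding isCont_def tendsto_at_iff_tendsto_nhds by (rule tendsto_rabs)
  from order_tendstoD(2)[OF this, of "\<bar>deriv f p\<bar> + 1"]
  have "\<forall>\<^sub>F x in nhds p. \<bar>deriv f x\<bar> < \<bar>deriv f p\<bar> + 1" by simp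
  with eventually_nhds_in_open[OF assms(1,3)]
  have "\<forall>\<^sub>F x in nhds p. x \<in> S \<and> \<bar>deriv f x\<bar> < \<bar>deriv f p\<bar> + 1" by (rule eventually_conj)
  then obtain \<delta> where \<delta>: "\<delta> > 0" "\<And>x. dist x p < \<delta> \<Longrightarrow> x \<in> S \<and> \<bar>deriv f x\<bar> < \<bar>deriv f p\<bar> + 1"
    unfolding eventually_nhds_metric by blast
  show ?thesis
  proof (rule that[of \<delta> "\<bar>deriv f p\<bar> + 1"])
    fix x y assume xy: "\<bar>x - p\<bar> < \<delta>" "\<bar>y - p\<bar> < \<delta>"
    have "norm (f x - f y) \<le> (\<bar>deriv f p\<bar> + 1) * norm (x - y)"
    proof (rule field_differentiable_bound[OF convex_ball[of p \<delta>]])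
      fix z assume "z \<in> ball p \<delta>"
      then have z: "dist z p < \<delta>" by (simp add: dist_commute)
      show "(f has_field_derivative deriv f z) (at z within ball p \<delta>)"
        using smooth_on_deriv(1)[OF assms(2), of z] \<delta>(2)[OF z] has_field_derivative_at_within by blast
      show "norm (deriv f z) \<le> \<bar>deriv f p\<bar> + 1" using \<delta>(2)[OF z] by simp
    qed (use xy in \<open>auto simp: dist_real_def abs_minus_commute\<close>)
    then show "\<bar>f x - f y\<bar> \<le> (\<bar>deriv f p\<bar> + 1) * \<bar>x - y\<bar>" by simp
  qed (use \<delta> in auto)
qed

text \<open>Every index outside the unit square has \<open>i \<ge> 2\<close> or
  \<open>j \<ge> 2\<close>. The terms with factor \<open>s\<^sup>2\<close> or
  \<open>w\<^sup>2\<close> do not influence the coefficients of 1, \<open>s\<close>,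
  \<open>w\<close> and \<open>s * w\<close>, even after composition with smooth functions.\<close>

lemma low_order_split:
  fixes d :: "nat \<Rightarrow> nat \<Rightarrow> real"
  assumes S: "finite S" "{(0, 0), (1, 0), (0, 1), (1, 1)} \<subseteq> S"
  obtains P Q :: "real \<times> real \<Rightarrow> real" where "smooth_on UNIV P" "smooth_on UNIV Q"
    "\<And>s w. (\<Sum>(i, j)\<in>S. d i j * (s ^ i * w ^ j)) =
      d 0 0 + d 1 0 * s + d 0 1 * w + d 1 1 * (s * w) + s\<^sup>2 * P (s, w) + w\<^sup>2 * Q (s, w)"
proof -
  let ?S0 = "{(0, 0), (1, 0), (0, 1), (1, 1)} :: (nat \<times> nat) set"
  define S1 where "S1 = {x \<in> S. fst x \<ge> 2}"
  define S2 where "S2 = {x \<in> S. fst x < 2 \<and> snd x \<ge> 2}"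
  have fin: "finite S1" "finite S2" using S(1) unfolding S1_def S2_def by auto
  have part: "S = ?S0 \<union> (S1 \<union> S2)" "?S0 \<inter> (S1 \<union> S2) = {}" "S1 \<inter> S2 = {}"
    using S(2) unfolding S1_def S2_def by (auto simp: not_le less_2_cases_iff)
  define P where "P z = (\<Sum>x\<in>S1. d (fst x) (snd x) * (fst z ^ (fst x - 2) * snd z ^ snd x))" for z :: "real \<times> real"
  define Q where "Q z = (\<Sum>x\<in>S2. d (fst x) (snd x) * (fst z ^ fst x * snd z ^ (snd x - 2)))" for z :: "real \<times> real"
  have "smooth_on UNIV P" "smooth_on UNIV Q"
    unfolding P_def Q_def
    by (intro smooth_on_sum smooth_on_mult smooth_on_const smooth_on_power smooth_on_fst smooth_on_snd smooth_on_id open_UNIV)+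
  moreover have "(\<Sum>(i, j)\<in>S. d i j * (s ^ i * w ^ j)) =
      d 0 0 + d 1 0 * s + d 0 1 * w + d 1 1 * (s * w) + s\<^sup>2 * P (s, w) + w\<^sup>2 * Q (s, w)" for s w
  proof -
    let ?t = "\<lambda>x. d (fst x) (snd x) * (s ^ fst x * w ^ snd x)"
    have "sum ?t S = sum ?t ?S0 + (sum ?t S1 + sum ?t S2)"
      using fin part by (subst part(1)) (simp only: sum.union_disjoint finite.intros finite_UnI)
    moreover have "sum ?t ?S0 = d 0 0 + d 1 0 * s + d 0 1 * w + d 1 1 * (s * w)" by simp
    moreover have "sum ?t S1 = s\<^sup>2 * P (s, w)"
      unfolding P_def sum_distrib_left
    proof (rule sum.cong)
      fix x assume "x \<in> S1"
      then have "2 \<le> fst x" unfolding S1_def by simp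
      then have "fst x = 2 + (fst x - 2)" by linarith
      then have "s ^ fst x = s\<^sup>2 * s ^ (fst x - 2)" by (metis power_add)
      then show "?t x = s\<^sup>2 * (d (fst x) (snd x) * (fst (s, w) ^ (fst x - 2) * snd (s, w) ^ snd x))" by simp
    qed simp
    moreover have "sum ?t S2 = w\<^sup>2 * Q (s, w)"
      unfolding Q_def sum_distrib_left
    proof (rule sum.cong)
      fix x assume "x \<in> S2"
      then have "2 \<le> snd x" unfolding S2_def by simp
      then have "snd x = 2 + (snd x - 2)" by linarith
      then have "w ^ snd x = w\<^sup>2 * w ^ (snd x - 2)" by (metis power_add)
      then show "?t x = w\<^sup>2 * (d (fst x) (snd x) * (fst (s, w) ^ fst x * snd (s, w) ^ (snd x - 2)))" by simp
    qed simp
    ultimately show ?thesis by (simp add: case_prod_beta')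
  qed
  ultimately show ?thesis using that by blast
qed

text \<open>Up to high order \<open>D = w * F (s, w)\<close> with \<open>w = s powr \<theta>\<close>
  and a polynomial \<open>F\<close>. Then \<open>\<theta> * ln s\<close> cancels and the invariant
  says that a smooth function of \<open>(s, w)\<close> is small along the curve. By irrationality
  its coefficients of \<open>s\<close>, \<open>w\<close> and \<open>s * w\<close> vanish, and these
  are the three relations.\<close>

lemma coefficient_relations:
  fixes G1 G2 D :: "real \<Rightarrow> real" and d :: "nat \<Rightarrow> nat \<Rightarrow> real"
  assumes s0: "s0 > 0" and G: "smooth_on {-s0<..<s0} G1" "smooth_on {-s0<..<s0} G2"
    and S: "finite S" "{(0, 0), (1, 0), (0, 1), (1, 1)} \<subseteq> S" and d0: "d 0 0 > 0"
    and \<theta>: "\<theta> > 0" "\<theta> \<notin> \<rat>" and q: "q > \<theta> + 1"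
    and inv: "\<forall>\<^sub>F s in at_right 0. \<bar>ln (D s) + G2 (D s) - (\<theta> * ln s + G1 s)\<bar> \<le> c * s powr q"
    and expn: "\<forall>\<^sub>F s in at_right 0. \<bar>D s - s powr \<theta> * (\<Sum>(i, j)\<in>S. d i j * s powr (real i + \<theta> * real j))\<bar> \<le> C * s powr (\<theta> + q)"
  shows "d 1 0 = d 0 0 * deriv G1 0" "d 0 1 = - (d 0 0)\<^sup>2 * deriv G2 0"
    "d 1 1 = - 2 * (d 0 0)\<^sup>2 * deriv G1 0 * deriv G2 0"
proof -
  obtain P Q where P: "smooth_on UNIV P" and Q: "smooth_on UNIV Q"
    and F_eq: "\<And>s w. (\<Sum>(i, j)\<in>S. d i j * (s ^ i * w ^ j)) =
      d 0 0 + d 1 0 * s + d 0 1 * w + d 1 1 * (s * w) + s\<^sup>2 * P (s, w) + w\<^sup>2 * Q (s, w)"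
    by (rule low_order_split[OF S, of d], rule that)
  define F where "F z = d 0 0 + d 1 0 * fst z + d 0 1 * snd z + d 1 1 * (fst z * snd z)
    + (fst z)\<^sup>2 * P z + (snd z)\<^sup>2 * Q z" for z
  have F: "smooth_on UNIV F"
    unfolding F_def
    by (intro smooth_on_add smooth_on_mult smooth_on_const smooth_on_power smooth_on_fst smooth_on_snd smooth_on_id open_UNIV P Q)
  have F0: "F (0, 0) = d 0 0" unfolding F_def by simp
  have "isCont F (0, 0)" by (rule smooth_on_isCont[OF F]) simp
  then have limF: "(F \<longlongrightarrow> d 0 0) (nhds (0, 0))" 
    unfolding isCont_def tendsto_at_iff_tendsto_nhds by (simp only: F0)
  have "\<forall>\<^sub>F z in nhds (0, 0). F z > d 0 0 / 2 \<and> \<bar>snd z * F z\<bar> < s0 \<and> \<bar>fst z\<bar> < s0"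
  proof (intro eventually_conj)
    show "\<forall>\<^sub>F z in nhds (0, 0). F z > d 0 0 / 2" by (rule order_tendstoD(1)[OF limF]) (use d0 in simp)
    have id: "((\<lambda>z. z) \<longlongrightarrow> (0, 0)) (nhds (0::real, 0::real))" by (rule filterlim_ident)
    have "((\<lambda>z. \<bar>snd z * F z\<bar>) \<longlongrightarrow> \<bar>snd (0::real, 0::real) * d 0 0\<bar>) (nhds (0, 0))"
      by (rule tendsto_rabs[OF tendsto_mult[OF tendsto_snd[OF id] limF]])
    from order_tendstoD(2)[OF this, of s0] show "\<forall>\<^sub>F z in nhds (0, 0). \<bar>snd z * F z\<bar> < s0" using s0 by simp
    have "((\<lambda>z. \<bar>fst z\<bar>) \<longlongrightarrow> \<bar>fst (0::real, 0::real)\<bar>) (nhds (0::real, 0::real))"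
      by (rule tendsto_rabs[OF tendsto_fst[OF id]])
    from order_tendstoD(2)[OF this, of s0] show "\<forall>\<^sub>F z in nhds (0::real, 0::real). \<bar>fst z\<bar> < s0" using s0 by simp
  qed
  then obtain t where t: "t > 0" "\<And>z. dist z (0, 0) < t \<Longrightarrow> F z > d 0 0 / 2 \<and> \<bar>snd z * F z\<bar> < s0 \<and> \<bar>fst z\<bar> < s0"
    unfolding eventually_nhds_metric by blast
  define r where "r = t / 2"
  have r: "r > 0" using t unfolding r_def by simp
  let ?B = "{-r<..<r} \<times> {-r<..<r}"
  have oB: "open ?B" by (intro open_Times) auto
  have box: "F z > d 0 0 / 2" "snd z * F z \<in> {-s0<..<s0}" "fst z \<in> {-s0<..<s0}" if zB: "z \<in> ?B" for z
  proof -
    obtain x y where z: "z = (x, y)" "\<bar>x\<bar> < r" "\<bar>y\<bar> < r" using zB by (cases z) auto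
    have "dist z (0, 0) \<le> \<bar>x\<bar> + \<bar>y\<bar>" using norm_Pair_le[of x y] unfolding z(1) by (simp add: dist_norm)
    then have "dist z (0, 0) < t" using z unfolding r_def by simp
    from t(2)[OF this] show "F z > d 0 0 / 2" "snd z * F z \<in> {-s0<..<s0}" "fst z \<in> {-s0<..<s0}" by auto
  qed
  \<comment> \<open>The logarithm of \<open>D\<close> without \<open>\<theta> * ln s\<close> is
    \<open>ln F\<close>, which is smooth near the origin because \<open>F (0, 0) = d 0 0\<close> is
    positive.\<close>
  define H where "H z = ln (F z) + G2 (snd z * F z) - G1 (fst z)" for z
  have FB: "smooth_on ?B F" by (rule smooth_on_subset[OF F]) simp
  have H: "smooth_on ?B H"
    unfolding H_def
  proof (intro smooth_on_diff smooth_on_add smooth_on_ln oB FB)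
    show "F x > 0" if "x \<in> ?B" for x using box(1)[OF that] d0 by simp
    show "smooth_on ?B (\<lambda>x. G2 (snd x * F x))"
      by (rule smooth_on_compose[OF G(2) open_greaterThanLessThan oB smooth_on_mult[OF oB smooth_on_snd[OF oB smooth_on_id] FB] box(2)])
    show "smooth_on ?B (\<lambda>x. G1 (fst x))"
      by (rule smooth_on_compose[OF G(1) open_greaterThanLessThan oB smooth_on_fst[OF oB smooth_on_id] box(3)])
  qed
  obtain \<delta>1 K1 where K1: "\<delta>1 > 0" "K1 \<ge> 0" "\<And>x y. \<bar>x - d 0 0\<bar> < \<delta>1 \<Longrightarrow> \<bar>y - d 0 0\<bar> < \<delta>1 \<Longrightarrow> \<bar>ln x - ln y\<bar> \<le> K1 * \<bar>x - y\<bar>"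
    using local_lipschitz[OF open_greaterThan smooth_on_ln_UNIV, of "d 0 0"] d0 by auto
  obtain \<delta>2 K2 where K2: "\<delta>2 > 0" "K2 \<ge> 0" "\<And>x y. \<bar>x\<bar> < \<delta>2 \<Longrightarrow> \<bar>y\<bar> < \<delta>2 \<Longrightarrow> \<bar>G2 x - G2 y\<bar> \<le> K2 * \<bar>x - y\<bar>"
    using local_lipschitz[OF open_greaterThanLessThan G(2), of 0] s0 by auto
  define f where "f s = F (s, s powr \<theta>)" for s
  \<comment> \<open>\<open>u\<close> is compared with \<open>f\<close> instead of \<open>D\<close>
    with \<open>w * f\<close>, so that both stay near \<open>d 0 0\<close>, where \<open>ln\<close>
    is Lipschitz; dividing by \<open>w\<close> lowers the order of the error from \<theta> +
    \<open>q\<close> to \<open>q\<close>.\<close>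
  define u where "u s = D s / s powr \<theta>" for s
  have pos: "\<forall>\<^sub>F s in at_right 0. 0 < s \<and> s < (1::real)"
    unfolding eventually_at_right_field by (rule exI[of _ 1]) auto
  have limw: "((\<lambda>s. s powr \<theta>) \<longlongrightarrow> 0) (at_right 0)" by (rule tendsto_powr_at_right_zero[OF \<theta>(1)])
  have limf: "(f \<longlongrightarrow> d 0 0) (at_right 0)"
    unfolding f_def
    using isCont_tendsto_compose[OF \<open>isCont F (0, 0)\<close> tendsto_Pair[OF tendsto_ident_at limw]] F0 by simp
  have uf: "\<forall>\<^sub>F s in at_right 0. \<bar>u s - f s\<bar> \<le> C * s powr q"
    using expn pos
  proof eventually_elim
    case (elim s)
    let ?w = "s powr \<theta>"
    have w: "?w > 0" using elim by simp
    have "(\<Sum>(i, j)\<in>S. d i j * s powr (real i + \<theta> * real j)) = (\<Sum>(i, j)\<in>S. d i j * (s ^ i * ?w ^ j))"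
      using elim(2) by (intro sum.cong) (auto simp: powr_add powr_realpow[symmetric] powr_powr)
    also have "\<dots> = f s" unfolding F_eq f_def F_def by simp
    finally have "\<bar>D s - ?w * f s\<bar> \<le> C * s powr (\<theta> + q)" using elim(1) by simp
    moreover have "\<bar>u s - f s\<bar> = \<bar>D s - ?w * f s\<bar> / ?w"
    proof -
      have "u s - f s = (D s - ?w * f s) / ?w" unfolding u_def using w by (simp add: diff_divide_distrib)
      then show ?thesis using w by (simp add: abs_divide)
    qed
    ultimately have "\<bar>u s - f s\<bar> \<le> C * s powr (\<theta> + q) / ?w" using w by (simp add: divide_right_mono)
    then show ?case using w by (simp add: powr_add)
  qed
  have limu: "(u \<longlongrightarrow> d 0 0) (at_right 0)"
  proof -
    have "((\<lambda>s. C * s powr q) \<longlongrightarrow> 0) (at_right 0)"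
      using tendsto_mult[OF tendsto_const[of C] tendsto_powr_at_right_zero[of q]] q \<theta> by simp
    then have "((\<lambda>s. u s - f s) \<longlongrightarrow> 0) (at_right 0)"
      using Lim_null_comparison[of "\<lambda>s. u s - f s"] uf by simp
    from tendsto_add[OF this limf] show ?thesis by simp
  qed
  have near: "\<forall>\<^sub>F s in at_right 0. \<bar>g s - l\<bar> < e" if "(g \<longlongrightarrow> l) (at_right 0)" "e > 0" for g :: "real \<Rightarrow> real" and l e
    using tendstoD[OF that] by (simp add: dist_real_def)
  have l1: "((\<lambda>s. s powr \<theta> * f s) \<longlongrightarrow> 0) (at_right 0)" "((\<lambda>s. s powr \<theta> * u s) \<longlongrightarrow> 0) (at_right 0)"
    using tendsto_mult[OF limw limf] tendsto_mult[OF limw limu] by auto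
  have "\<forall>\<^sub>F s in at_right 0. \<bar>H (s, s powr \<theta>)\<bar> \<le> (K1 * C + K2 * C + c) * s powr q"
    using inv pos uf near[OF limf K1(1)] near[OF limu K1(1)] near[OF l1(1) K2(1)] near[OF l1(2) K2(1)]
      order_tendstoD(1)[OF limu d0]
  proof eventually_elim
    case (elim s)
    let ?w = "s powr \<theta>"
    have s: "0 < s" "s < 1" and w: "0 < ?w" "?w \<le> 1" using elim(2) \<theta> by (auto simp: powr_le1)
    have Ds: "D s = ?w * u s" unfolding u_def using w by simp
    have lnD: "ln (D s) = \<theta> * ln s + ln (u s)" unfolding Ds using w elim(8) s by (simp add: ln_mult)
    have "\<bar>ln (f s) - ln (u s)\<bar> \<le> K1 * \<bar>f s - u s\<bar>" by (rule K1(3)) (use elim in auto)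
    also have "\<dots> \<le> K1 * (C * s powr q)" using elim(3) K1(2) by (intro mult_left_mono) auto
    finally have b1: "\<bar>ln (f s) - ln (u s)\<bar> \<le> K1 * (C * s powr q)" .
    have "\<bar>G2 (?w * f s) - G2 (D s)\<bar> \<le> K2 * \<bar>?w * f s - D s\<bar>"
      unfolding Ds by (rule K2(3)) (use elim in auto)
    also have "\<bar>?w * f s - D s\<bar> = ?w * \<bar>f s - u s\<bar>"
      unfolding Ds right_diff_distrib[symmetric] abs_mult using w by simp
    also have "\<dots> \<le> 1 * \<bar>f s - u s\<bar>" using w by (intro mult_right_mono) auto
    also have "\<dots> \<le> C * s powr q" using elim(3) by simp
    finally have b2: "\<bar>G2 (?w * f s) - G2 (D s)\<bar> \<le> K2 * (C * s powr q)" using K2(2) by (simp add: mult_left_mono)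
    have "H (s, ?w) = (ln (f s) - ln (u s)) + (G2 (?w * f s) - G2 (D s)) + (ln (D s) + G2 (D s) - (\<theta> * ln s + G1 s))"
      unfolding H_def f_def lnD by simp
    then show ?case using b1 b2 elim(1) by (simp add: distrib_right)
  qed
  note tc = taylor_coefficients_on_curve[OF r H \<theta> q this]
  let ?I = "{-r<..<r}"
  have I: "open ?I" "0 \<in> ?I" using r by auto
  define p where "p s = P (s, 0)" for s
  define p' where "p' s = frechet_derivative P (at (s, 0)) (0, 1)" for s
  have sp: "smooth_on UNIV p" "smooth_on UNIV p'"
    unfolding p_def p'_def using smooth_on_slice_fst[OF open_UNIV P] smooth_on_slice_fst[OF open_UNIV smooth_on_dir[OF P]]
    by auto
  define f0 where "f0 s = d 0 0 + d 1 0 * s + s\<^sup>2 * p s" for s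
  define f1 where "f1 s = d 0 1 + d 1 1 * s + s\<^sup>2 * p' s" for s
  have df: "(f0 has_real_derivative d 1 0) (at 0)" "(f1 has_real_derivative d 1 1) (at 0)"
    unfolding f0_def f1_def
    by (auto intro!: derivative_eq_intros smooth_on_deriv(1)[OF sp(1)] smooth_on_deriv(1)[OF sp(2)])
  have F_0: "F (s, 0) = f0 s" for s unfolding F_def f0_def p_def by simp
  have f0pos: "f0 s > 0" if "s \<in> ?I" for s using box(1)[of "(s, 0)"] that r d0 unfolding F_0 by auto
  have f00: "f0 0 = d 0 0" "f1 0 = d 0 1" unfolding f0_def f1_def by auto
  have G1d: "(G1 has_real_derivative deriv G1 0) (at 0)" and G2d: "(G2 has_real_derivative deriv G2 0) (at 0)"
    using smooth_on_deriv(1)[OF G(1)] smooth_on_deriv(1)[OF G(2)] s0 by auto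
  have "((\<lambda>s. ln (f0 s) + G2 0 - G1 s) has_real_derivative d 1 0 / d 0 0 - deriv G1 0) (at 0)"
    using DERIV_diff[OF DERIV_add[OF DERIV_chain2[OF DERIV_ln_divide df(1)] DERIV_const[of "G2 0"]] G1d] d0 f00 by simp
  moreover have "(\<lambda>s. H (s, 0)) = (\<lambda>s. ln (f0 s) + G2 0 - G1 s)" unfolding H_def F_0 by simp
  ultimately have e1: "d 1 0 / d 0 0 - deriv G1 0 = 0" using tc(2) DERIV_imp_deriv by metis
  then show r1: "d 1 0 = d 0 0 * deriv G1 0" using d0 by (simp add: field_simps)
  \<comment> \<open>\<open>f0\<close> and \<open>f1\<close> are the coefficients of
    \<open>w ^ 0\<close> and \<open>w ^ 1\<close> in \<open>F\<close>. The argument of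
    \<open>G2\<close> vanishes on \<open>w = 0\<close>, so only \<open>deriv G2 0\<close>
    enters.\<close>
  have Hw: "frechet_derivative H (at (s, 0)) (0, 1) = f1 s / f0 s + deriv G2 0 * f0 s" if s: "s \<in> ?I" for s
  proof -
    have dP: "((\<lambda>w. P (s, w)) has_real_derivative p' s) (at 0)"
      unfolding p'_def by (rule has_derivative_slice_snd[OF P]) simp
    have dQ: "((\<lambda>w. Q (s, w)) has_real_derivative frechet_derivative Q (at (s, 0)) (0, 1)) (at 0)"
      by (rule has_derivative_slice_snd[OF Q]) simp
    have dF: "((\<lambda>w. F (s, w)) has_real_derivative f1 s) (at 0)"
      unfolding F_def f1_def fst_conv snd_conv
      by (rule derivative_eq_intros refl dP dQ)+ simp
    have "((\<lambda>w. w * F (s, w)) has_real_derivative f0 s) (at 0)"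
      using DERIV_mult[OF DERIV_ident dF] F_0 by simp
    from DERIV_chain2[OF _ this, of G2 "deriv G2 0"] G2d
    have dG: "((\<lambda>w. G2 (w * F (s, w))) has_real_derivative deriv G2 0 * f0 s) (at 0)" by simp
    have "((\<lambda>w. ln (F (s, w))) has_real_derivative f1 s / f0 s) (at 0)"
      using DERIV_chain2[OF DERIV_ln_divide dF] f0pos[OF s] F_0 by simp
    from DERIV_diff[OF DERIV_add[OF this dG] DERIV_const[of "G1 s"]]
    have "((\<lambda>w. H (s, w)) has_real_derivative f1 s / f0 s + deriv G2 0 * f0 s) (at 0)"
      unfolding H_def by simp
    then show ?thesis
      using has_derivative_slice_snd[OF H, of s 0] s r DERIV_unique by auto
  qed
  have e2: "d 0 1 / d 0 0 + deriv G2 0 * d 0 0 = 0" using tc(3) Hw[OF I(2)] f00 by simp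
  then show r2: "d 0 1 = - (d 0 0)\<^sup>2 * deriv G2 0" using d0 by (simp add: field_simps power2_eq_square)
  have "((\<lambda>s. f1 s / f0 s + deriv G2 0 * f0 s) has_real_derivative
      (d 1 1 * d 0 0 - d 0 1 * d 1 0) / (d 0 0 * d 0 0) + deriv G2 0 * d 1 0) (at 0)"
    using DERIV_add[OF DERIV_divide[OF df(2,1)] DERIV_cmult[OF df(1), of "deriv G2 0"]] d0 f00 by simp
  then have "((\<lambda>s. frechet_derivative H (at (s, 0)) (0, 1)) has_real_derivative
      (d 1 1 * d 0 0 - d 0 1 * d 1 0) / (d 0 0 * d 0 0) + deriv G2 0 * d 1 0) (at 0)"
    by (rule has_field_derivative_transform_within_open[OF _ I]) (simp add: Hw)
  then have "(d 1 1 * d 0 0 - d 0 1 * d 1 0) / (d 0 0 * d 0 0) + deriv G2 0 * d 1 0 = 0"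
    using tc(4) DERIV_imp_deriv by metis
  \<comment> \<open>The relations already found make the two terms on the right equal; this is the
    origin of the factor 2.\<close>
  then have "d 1 1 * d 0 0 = d 0 1 * d 1 0 - deriv G2 0 * d 1 0 * (d 0 0 * d 0 0)"
    using d0 by (simp add: field_simps)
  also have "\<dots> = (- 2 * (d 0 0)\<^sup>2 * deriv G1 0 * deriv G2 0) * d 0 0"
    unfolding r1 r2 by (simp add: power2_eq_square algebra_simps)
  finally have "d 1 1 * d 0 0 = (- 2 * (d 0 0)\<^sup>2 * deriv G1 0 * deriv G2 0) * d 0 0" .
  moreover have "d 0 0 \<noteq> 0" using d0 by simp
  ultimately show "d 1 1 = - 2 * (d 0 0)\<^sup>2 * deriv G1 0 * deriv G2 0"
    using mult_right_cancel by blast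
qed

section \<open>Dependence on the parameter\<close>

text \<open>In \<open>Q (x, (u, m))\<close> the coordinate \<open>x\<close> is transverse to the
  axis and \<open>u\<close> runs along it, so that one statement covers both axes. As the numerator
  of the integrand vanishes at the origin, the quotient by \<open>z\<close> is a Hadamard quotient,
  and the integral is smooth in end point and parameter together.\<close>

lemma axis_data:
  fixes Q :: "real \<times> (real \<times> 'p::euclidean_space) \<Rightarrow> real" and \<alpha> :: "'p \<Rightarrow> real"
  assumes V: "open V" and \<alpha>: "smooth_on V \<alpha>"
    and \<Omega>: "open \<Omega>" "star_fst \<Omega>" "\<Omega> \<subseteq> UNIV \<times> V"
    and T: "open T" "\<And>x. x \<in> \<Omega> \<Longrightarrow> (0, x) \<in> T" and Q: "smooth_on T Q"
    and Q0: "\<And>m. (0, m) \<in> \<Omega> \<Longrightarrow> Q (0, (0, m)) = - \<alpha> m"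
  obtains L M :: "real \<times> 'p \<Rightarrow> real" where "smooth_on \<Omega> L" "smooth_on \<Omega> M"
    "\<And>u m. (u, m) \<in> \<Omega> \<Longrightarrow> exp (LBINT z=0..u. (Q (0, (z, m)) + \<alpha> m) / z) = L (u, m)"
    "\<And>u m. (u, m) \<in> \<Omega> \<Longrightarrow> L (u, m) * deriv (\<lambda>x. Q (x, (u, m))) 0 = M (u, m)"
    "\<And>u m. (u, m) \<in> \<Omega> \<Longrightarrow> L (u, m) > 0"
    "\<And>u m. (u, m) \<in> \<Omega> \<Longrightarrow> \<exists>d. ((\<lambda>u. L (u, m)) has_real_derivative d) (at u) \<and> u * d = L (u, m) * (Q (0, (u, m)) + \<alpha> m)"
proof -
  have id: "smooth_on \<Omega> (\<lambda>x. (0::real, x))"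
    by (intro smooth_on_Pair smooth_on_const smooth_on_id \<Omega>(1))
  have \<alpha>': "smooth_on \<Omega> (\<lambda>x. \<alpha> (snd x))"
    by (rule smooth_on_compose[OF \<alpha> V \<Omega>(1) smooth_on_snd[OF \<Omega>(1) smooth_on_id]]) (use \<Omega>(3) in auto)
  define q where "q x = Q (0, x) + \<alpha> (snd x)" for x
  have q: "smooth_on \<Omega> q"
    unfolding q_def by (intro smooth_on_add \<Omega>(1) \<alpha>' smooth_on_compose[OF Q T(1) \<Omega>(1) id T(2)])
  define l where "l = hadamard q"
  have l: "smooth_on \<Omega> l" unfolding l_def by (rule smooth_on_hadamard[OF \<Omega>(1,2) q])
  have ql: "q (u, m) = u * l (u, m)" if "(u, m) \<in> \<Omega>" for u m
    using hadamard[OF \<Omega>(2) q that] Q0[OF star_fst_zero[OF \<Omega>(2) that]] unfolding l_def by (simp add: q_def)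
  obtain Y where Y: "smooth_on \<Omega> Y"
    "\<And>u m. (u, m) \<in> \<Omega> \<Longrightarrow> \<exists>d. ((\<lambda>u. Y (u, m)) has_real_derivative d) (at u) \<and> u * d + 1 * Y (u, m) = l (u, m)"
    by (rule euler_solution[OF \<Omega>(1,2) l V \<Omega>(3) smooth_on_const[of V "1::real"]]) auto
  define \<Lambda> where "\<Lambda> x = fst x * Y x" for x
  have \<Lambda>: "smooth_on \<Omega> \<Lambda>" unfolding \<Lambda>_def by (intro smooth_on_mult smooth_on_fst smooth_on_id \<Omega>(1) Y(1))
  have d\<Lambda>: "((\<lambda>u. \<Lambda> (u, m)) has_real_derivative l (u, m)) (at u)" if um: "(u, m) \<in> \<Omega>" for u m
  proof -
    obtain d where d: "((\<lambda>u. Y (u, m)) has_real_derivative d) (at u)" "u * d + 1 * Y (u, m) = l (u, m)"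
      using Y(2)[OF um] by blast
    have "((\<lambda>u. u * Y (u, m)) has_real_derivative Y (u, m) + d * u) (at u)"
      using DERIV_mult[OF DERIV_ident d(1)] by simp
    then show ?thesis unfolding \<Lambda>_def d(2)[symmetric] by (simp add: algebra_simps)
  qed
  define L where "L x = exp (\<Lambda> x)" for x
  have L: "smooth_on \<Omega> L" unfolding L_def by (rule smooth_on_exp[OF \<Omega>(1) \<Lambda>])
  define M where "M x = L x * frechet_derivative Q (at (0, x)) (1, 0)" for x
  have M: "smooth_on \<Omega> M"
    unfolding M_def by (intro smooth_on_mult \<Omega>(1) L smooth_on_compose[OF smooth_on_dir[OF Q] T(1) \<Omega>(1) id T(2)])
  have LI: "exp (LBINT z=0..u. (Q (0, (z, m)) + \<alpha> m) / z) = L (u, m)" if um: "(u, m) \<in> \<Omega>" for u m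
  proof -
    have seg: "(z, m) \<in> \<Omega>" if z: "min 0 u \<le> z" "z \<le> max 0 u" for z
    proof (cases "u = 0")
      case True
      then show ?thesis using z um by simp
    next
      case False
      then have "0 \<le> z / u" "z / u \<le> 1" using z by (auto simp: zero_le_divide_iff divide_le_eq_1 min_def max_def split: if_splits)
      from star_fstD[OF \<Omega>(2) um this] show ?thesis using False by simp
    qed
    \<comment> \<open>On the open integration interval \<open>z\<close> is never 0, so the singular
      integrand agrees there with the smooth \<open>l\<close>.\<close>
    have z: "z \<noteq> 0" "min 0 u \<le> z" "z \<le> max 0 u" if "z \<in> einterval (min 0 (ereal u)) (max 0 (ereal u))" for z
    proof -
      have "min 0 (ereal u) < ereal z" "ereal z < max 0 (ereal u)" using that unfolding einterval_def by auto
      then have "min 0 u < z" "z < max 0 u"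
        by (auto simp: zero_ereal_def min_def max_def split: if_splits)
      then show "z \<noteq> 0" "min 0 u \<le> z" "z \<le> max 0 u" by (auto simp: min_def max_def split: if_splits)
    qed
    have "(LBINT z=0..u. (Q (0, (z, m)) + \<alpha> m) / z) = (LBINT z=0..u. l (z, m))"
    proof (rule interval_integral_cong)
      fix x assume x: "x \<in> einterval (min 0 (ereal u)) (max 0 (ereal u))"
      show "(Q (0, (x, m)) + \<alpha> m) / x = l (x, m)"
        using ql[OF seg[OF z(2,3)[OF x]]] z(1)[OF x] unfolding q_def by simp
    qed
    also have "\<dots> = \<Lambda> (u, m) - \<Lambda> (0, m)"
    proof -
      have "(LBINT z=ereal 0..ereal u. l (z, m)) = \<Lambda> (u, m) - \<Lambda> (0, m)"
      proof (rule interval_integral_FTC_finite)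
        have "continuous_on {u. (u, m) \<in> \<Omega>} (\<lambda>z. l (z, m))"
          by (rule smooth_on_continuous[OF smooth_on_slice_fst[OF \<Omega>(1) l]])
        then show "continuous_on {min 0 u..max 0 u} (\<lambda>z. l (z, m))"
          by (rule continuous_on_subset) (use seg in auto)
        fix x assume "min 0 u \<le> x" "x \<le> max 0 u"
        from d\<Lambda>[OF seg[OF this]]
        show "((\<lambda>u. \<Lambda> (u, m)) has_vector_derivative l (x, m)) (at x within {min 0 u..max 0 u})"
          by (simp add: has_real_derivative_iff_has_vector_derivative has_vector_derivative_at_within)
      qed
      then show ?thesis by (simp add: zero_ereal_def)
    qed
    also have "\<dots> = \<Lambda> (u, m)" unfolding \<Lambda>_def by simp
    finally show ?thesis unfolding L_def by simp
  qed
  have LM: "L (u, m) * deriv (\<lambda>x. Q (x, (u, m))) 0 = M (u, m)" if um: "(u, m) \<in> \<Omega>" for u m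
    unfolding M_def using DERIV_imp_deriv[OF has_derivative_slice_fst[OF Q T(2)[OF um]]] by simp
  have Ld: "\<exists>d. ((\<lambda>u. L (u, m)) has_real_derivative d) (at u) \<and> u * d = L (u, m) * (Q (0, (u, m)) + \<alpha> m)"
    if um: "(u, m) \<in> \<Omega>" for u m
  proof (intro exI conjI)
    show "((\<lambda>u. L (u, m)) has_real_derivative L (u, m) * l (u, m)) (at u)"
      unfolding L_def by (rule DERIV_chain2[OF DERIV_exp d\<Lambda>[OF um]])
    show "u * (L (u, m) * l (u, m)) = L (u, m) * (Q (0, (u, m)) + \<alpha> m)"
      using ql[OF um] unfolding q_def by simp
  qed
  show ?thesis by (rule that[OF L M LI LM _ Ld]) (auto simp: L_def)
qed

text \<open>Iterated derivatives at \<open>s = 0\<close> are factorials times iterated Hadamard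
  quotients, and the latter are integrals that depend smoothly on the parameter.\<close>

lemma smooth_on_dsec:
  fixes f :: "real \<times> 'p::euclidean_space \<Rightarrow> real"
  assumes \<epsilon>: "\<epsilon> > 0" and V: "open V" and f: "smooth_on ({-\<epsilon><..<\<epsilon>} \<times> V) f"
  shows "smooth_on V (\<lambda>m. (deriv ^^ k) (\<lambda>s. f (s, m)) 0)"
proof -
  let ?\<Omega> = "{-\<epsilon><..<\<epsilon>} \<times> V"
  have "t * u \<in> {-\<epsilon><..<\<epsilon>}" if "u \<in> {-\<epsilon><..<\<epsilon>}" "t \<in> {0..1}" for t u
  proof -
    have "\<bar>t * u\<bar> \<le> \<bar>u\<bar>" using that by (simp add: abs_mult mult_left_le_one_le)
    then show ?thesis using that(1) by auto
  qed
  then have \<Omega>: "open ?\<Omega>" "star_fst ?\<Omega>" using V unfolding star_fst_def by (auto intro: open_Times)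
  have s: "smooth_on V (\<lambda>m. fact k * (hadamard ^^ k) f (0, m))"
    by (intro smooth_on_mult smooth_on_const V
        smooth_on_compose[OF smooth_on_hadamard_iter[OF \<Omega> f] \<Omega>(1) V smooth_on_Pair[OF V smooth_on_const smooth_on_id]])
      (use \<epsilon> in auto)
  show ?thesis
    by (rule smooth_on_cong[THEN iffD2, OF V _ s]) (rule deriv_iter_hadamard[OF \<Omega> f], use \<epsilon> in auto)
qed

text \<open>The value at \<open>p\<close> is recorded separately because \<open>p\<close> usually
  lies outside \<open>A\<close>. In this form smooth extension and limit pass together through
  products and differences.\<close>

definition extends_to :: "'a set \<Rightarrow> ('a::real_normed_vector \<Rightarrow> real) \<Rightarrow> 'a \<Rightarrow> real \<Rightarrow> bool" where
  "extends_to A f p c \<longleftrightarrow>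
     (\<exists>V g. open V \<and> p \<in> V \<and> smooth_on V g \<and> (\<forall>x\<in>V \<inter> A. g x = f x) \<and> g p = c)"

lemma extends_toI:
  "open V \<Longrightarrow> p \<in> V \<Longrightarrow> smooth_on V g \<Longrightarrow> (\<And>x. x \<in> V \<Longrightarrow> x \<in> A \<Longrightarrow> g x = f x) \<Longrightarrow> g p = c \<Longrightarrow> extends_to A f p c"
  unfolding extends_to_def by blast

lemma extends_to_smooth: "open V \<Longrightarrow> p \<in> V \<Longrightarrow> smooth_on V f \<Longrightarrow> extends_to A f p (f p)"
  by (rule extends_toI) auto

lemma extends_to_imp:
  assumes "extends_to A f p c"
  shows "extends_smoothly_at A f p" "(f \<longlongrightarrow> c) (at p within A)"
proof -
  obtain V g where V: "open V" "p \<in> V" "smooth_on V g" "\<And>x. x \<in> V \<inter> A \<Longrightarrow> g x = f x" "g p = c"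
    using assms unfolding extends_to_def by blast
  show "extends_smoothly_at A f p" unfolding extends_smoothly_at_def using V by blast
  have "(g \<longlongrightarrow> c) (at p within A)"
    using smooth_on_isCont[OF V(3,2)] V(5) by (auto simp: isCont_def intro: tendsto_within_subset)
  moreover have "\<forall>\<^sub>F x in at p within A. g x = f x"
    unfolding eventually_at_filter
    by (rule eventually_mono[OF eventually_nhds_in_open[OF V(1,2)]]) (use V(4) in auto)
  ultimately show "(f \<longlongrightarrow> c) (at p within A)" by (rule Lim_transform_eventually)
qed

lemma extends_to_mono: "extends_to A f p c \<Longrightarrow> B \<subseteq> A \<Longrightarrow> extends_to B f p c"
  unfolding extends_to_def by blast

lemma extends_to_cong: "extends_to A f p c \<Longrightarrow> (\<And>x. x \<in> A \<Longrightarrow> f x = g x) \<Longrightarrow> c = d \<Longrightarrow> extends_to A g p d"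
  unfolding extends_to_def by fastforce

lemma extends_to_cong_open:
  assumes "open S" "p \<in> S" "extends_to A f p c" "\<And>x. x \<in> S \<Longrightarrow> x \<in> A \<Longrightarrow> f x = g x"
  shows "extends_to A g p c"
proof -
  obtain V h where V: "open V" "p \<in> V" "smooth_on V h" "\<And>x. x \<in> V \<inter> A \<Longrightarrow> h x = f x" "h p = c"
    using assms(3) unfolding extends_to_def by blast
  show ?thesis
    by (rule extends_toI[of "V \<inter> S" _ h]) (use V assms in \<open>auto intro: smooth_on_subset[OF V(3)]\<close>)
qed

lemma extends_to_mult:
  assumes "extends_to A f p c" "extends_to A g p d"
  shows "extends_to A (\<lambda>x. f x * g x) p (c * d)"
proof -
  obtain V f' where V: "open V" "p \<in> V" "smooth_on V f'" "\<And>x. x \<in> V \<inter> A \<Longrightarrow> f' x = f x" "f' p = c"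
    using assms(1) unfolding extends_to_def by blast
  obtain W g' where W: "open W" "p \<in> W" "smooth_on W g'" "\<And>x. x \<in> W \<inter> A \<Longrightarrow> g' x = g x" "g' p = d"
    using assms(2) unfolding extends_to_def by blast
  show ?thesis
    by (rule extends_toI[of "V \<inter> W" _ "\<lambda>x. f' x * g' x"])
      (use V W in \<open>auto intro!: smooth_on_mult smooth_on_subset[OF V(3)] smooth_on_subset[OF W(3)]\<close>)
qed

lemma extends_to_diff:
  assumes "extends_to A f p c" "extends_to A g p d"
  shows "extends_to A (\<lambda>x. f x - g x) p (c - d)"
proof -
  obtain V f' where V: "open V" "p \<in> V" "smooth_on V f'" "\<And>x. x \<in> V \<inter> A \<Longrightarrow> f' x = f x" "f' p = c"
    using assms(1) unfolding extends_to_def by blast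
  obtain W g' where W: "open W" "p \<in> W" "smooth_on W g'" "\<And>x. x \<in> W \<inter> A \<Longrightarrow> g' x = g x" "g' p = d"
    using assms(2) unfolding extends_to_def by blast
  show ?thesis
    by (rule extends_toI[of "V \<inter> W" _ "\<lambda>x. f' x - g' x"])
      (use V W in \<open>auto intro!: smooth_on_diff smooth_on_subset[OF V(3)] smooth_on_subset[OF W(3)]\<close>)
qed

text \<open>Taylor terms of order at least \<open>k > \<alpha> m0\<close> contribute smoothly near
  \<open>m0\<close>, and of the finitely many other denominators at most the one with
  \<open>real j = \<alpha> m0\<close> vanishes there. Multiplying by it leaves its Taylor
  coefficient times a power of \<open>b\<close>. The second conclusion keeps the whole solution,
  which the transport along the axis needs.\<close>

lemma mellin_param:
  fixes F :: "real \<times> 'p::euclidean_space \<Rightarrow> real" and b \<alpha> :: "'p \<Rightarrow> real"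
  assumes V: "open V" and \<Omega>: "open \<Omega>" "star_fst \<Omega>" "\<Omega> \<subseteq> UNIV \<times> V" and F: "smooth_on \<Omega> F"
    and \<alpha>: "smooth_on V \<alpha>" and b: "smooth_on V b" "\<And>m. m \<in> V \<Longrightarrow> (b m, m) \<in> \<Omega>"
    and M: "\<And>u m. (u, m) \<in> \<Omega> \<Longrightarrow> M m u = F (u, m)"
    and m0: "m0 \<in> V"
  defines "A \<equiv> \<lambda>m. mellin {u. (u, m) \<in> \<Omega>} (M m) (\<alpha> m) (b m)"
  shows "\<alpha> m0 \<notin> range real \<Longrightarrow> extends_to UNIV A m0 (A m0)"
    "\<alpha> m0 \<notin> range real \<Longrightarrow> \<exists>y. smooth_on {u. (u, m0) \<in> \<Omega>} y \<and>
       (\<forall>u. (u, m0) \<in> \<Omega> \<longrightarrow> u * deriv y u - \<alpha> m0 * y u = M m0 u) \<and> y (b m0) = A m0"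
    "\<alpha> m0 = real i \<Longrightarrow> extends_to {m. \<alpha> m \<notin> range real} (\<lambda>m. (real i - \<alpha> m) * A m) m0
       ((deriv ^^ i) (M m0) 0 / fact i * b m0 ^ i)"
proof -
  obtain k where k: "\<alpha> m0 < real k" using reals_Archimedean2 by blast
  define h where "h j m = (hadamard ^^ j) F (0, m)" for j m
  have z: "(0, m) \<in> \<Omega>" if "m \<in> V" for m using star_fst_zero[OF \<Omega>(2) b(2)[OF that]] .
  have h: "smooth_on V (h j)" for j
    unfolding h_def
    by (rule smooth_on_compose[OF smooth_on_hadamard_iter[OF \<Omega>(1,2) F] \<Omega>(1) V smooth_on_Pair[OF V smooth_on_const smooth_on_id]])
      (rule z)
  have c\<alpha>: "continuous_on V \<alpha>" by (rule smooth_on_continuous[OF \<alpha>])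
  \<comment> \<open>Where \<alpha> stays below \<open>k\<close>, the remainder of the expansion has
    positive exponent and is smooth.\<close>
  define Vk where "Vk = V \<inter> \<alpha> -` {..<real k}"
  have Vk: "open Vk" "Vk \<subseteq> V" "m0 \<in> Vk"
    unfolding Vk_def using continuous_open_preimage[OF c\<alpha> V, of "{..<real k}"] m0 k by auto
  let ?\<Omega> = "\<Omega> \<inter> UNIV \<times> Vk"
  have \<Omega>': "open ?\<Omega>" "star_fst ?\<Omega>" "?\<Omega> \<subseteq> UNIV \<times> Vk"
    using \<Omega>(1,2) Vk(1) unfolding star_fst_def by (auto intro: open_Times)
  obtain R where R: "smooth_on ?\<Omega> R"
    and R2: "\<And>u m f. (u, m) \<in> ?\<Omega> \<Longrightarrow> (\<And>u. (u, m) \<in> ?\<Omega> \<Longrightarrow> f u = F (u, m)) \<Longrightarrow> (\<And>j. j < k \<Longrightarrow> \<alpha> m \<noteq> real j) \<Longrightarrow>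
      mellin {u. (u, m) \<in> ?\<Omega>} f (\<alpha> m) u =
        (\<Sum>j<k. (hadamard ^^ j) F (0, m) / (real j - \<alpha> m) * u ^ j) + u ^ k * R (u, m)"
    and R3: "\<And>m f. (\<And>u. (u, m) \<in> ?\<Omega> \<Longrightarrow> f u = F (u, m)) \<Longrightarrow> (\<And>j. j < k \<Longrightarrow> \<alpha> m \<noteq> real j) \<Longrightarrow>
      \<exists>y. smooth_on {u. (u, m) \<in> ?\<Omega>} y \<and> (\<forall>u. (u, m) \<in> ?\<Omega> \<longrightarrow> u * deriv y u - \<alpha> m * y u = f u)"
    by (rule mellin_expansion[OF \<Omega>'(1,2) smooth_on_subset[OF F] Vk(1) \<Omega>'(3) smooth_on_subset[OF \<alpha> Vk(2)], of k])
      (auto simp: Vk_def)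
  have sl: "{u. (u, m) \<in> ?\<Omega>} = {u. (u, m) \<in> \<Omega>}" if "m \<in> Vk" for m using that by auto
  define r where "r m = b m ^ k * R (b m, m)" for m
  have r: "smooth_on Vk r"
    unfolding r_def
    by (intro smooth_on_mult smooth_on_power Vk(1) smooth_on_subset[OF b(1) Vk(2)]
        smooth_on_compose[OF R \<Omega>'(1) Vk(1)] smooth_on_Pair smooth_on_id) (use b(2) Vk(2) in auto)
  have A: "A m = (\<Sum>j<k. h j m / (real j - \<alpha> m) * b m ^ j) + r m"
    if "m \<in> Vk" "\<And>j. j < k \<Longrightarrow> \<alpha> m \<noteq> real j" for m
  proof -
    have "(b m, m) \<in> ?\<Omega>" using b(2) that(1) Vk(2) by auto
    from R2[OF this, of "M m"] that M show ?thesis unfolding A_def h_def r_def sl[OF that(1)] by auto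
  qed
  have opn: "open {m \<in> Vk. \<forall>j\<in>J. \<alpha> m \<noteq> real j}" if "finite J" for J
  proof -
    have "open (Vk \<inter> \<alpha> -` (- real ` J))"
      by (rule continuous_open_preimage[OF continuous_on_subset[OF c\<alpha> Vk(2)] Vk(1)])
        (use that in \<open>auto intro: finite_imp_closed\<close>)
    moreover have "{m \<in> Vk. \<forall>j\<in>J. \<alpha> m \<noteq> real j} = Vk \<inter> \<alpha> -` (- real ` J)" by auto
    ultimately show ?thesis by simp
  qed
  show "extends_to UNIV A m0 (A m0)" if nr: "\<alpha> m0 \<notin> range real"
  proof -
    let ?V = "{m \<in> Vk. \<forall>j\<in>{..<k}. \<alpha> m \<noteq> real j}"
    have sub: "?V \<subseteq> Vk" "?V \<subseteq> V" using Vk(2) by auto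
    have m0V: "m0 \<in> ?V" using Vk(3) nr by auto
    show ?thesis
    proof (rule extends_toI[of ?V m0 "\<lambda>m. (\<Sum>j<k. h j m / (real j - \<alpha> m) * b m ^ j) + r m"])
      show "open ?V" by (rule opn) simp
      then show "smooth_on ?V (\<lambda>m. (\<Sum>j<k. h j m / (real j - \<alpha> m) * b m ^ j) + r m)"
        by (intro smooth_on_add smooth_on_sum smooth_on_mult smooth_on_divide smooth_on_diff smooth_on_const smooth_on_power
            smooth_on_subset[OF h sub(2)] smooth_on_subset[OF \<alpha> sub(2)] smooth_on_subset[OF b(1) sub(2)] smooth_on_subset[OF r sub(1)])
          force+
    qed (use m0V A in auto)
  qed
  show "\<exists>y. smooth_on {u. (u, m0) \<in> \<Omega>} y \<and>
       (\<forall>u. (u, m0) \<in> \<Omega> \<longrightarrow> u * deriv y u - \<alpha> m0 * y u = M m0 u) \<and> y (b m0) = A m0"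
    if nr: "\<alpha> m0 \<notin> range real"
  proof -
    have "\<exists>y. smooth_on {u. (u, m0) \<in> ?\<Omega>} y \<and> (\<forall>u. (u, m0) \<in> ?\<Omega> \<longrightarrow> u * deriv y u - \<alpha> m0 * y u = M m0 u)"
      by (rule R3) (use M nr in auto)
    then obtain y where y: "smooth_on {u. (u, m0) \<in> \<Omega>} y"
      "\<And>u. (u, m0) \<in> \<Omega> \<Longrightarrow> u * deriv y u - \<alpha> m0 * y u = M m0 u"
      unfolding sl[OF Vk(3)] using Vk(3) by auto
    have "A m0 = y (b m0)"
      unfolding A_def
      by (rule mellin_eqI[OF open_slice_fst[OF \<Omega>(1)] _ nr y(1)]) (use star_fstD[OF \<Omega>(2)] y(2) b(2)[OF m0] in auto)
    then show ?thesis using y by metis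
  qed
  show "extends_to {m. \<alpha> m \<notin> range real} (\<lambda>m. (real i - \<alpha> m) * A m) m0 ((deriv ^^ i) (M m0) 0 / fact i * b m0 ^ i)"
    if i: "\<alpha> m0 = real i"
  proof -
    have ik: "i < k" using i k by simp
    \<comment> \<open>All denominators except the one under study are kept away from 0.\<close>
    let ?V = "{m \<in> Vk. \<forall>j\<in>{..<k} - {i}. \<alpha> m \<noteq> real j}"
    have sub: "?V \<subseteq> Vk" "?V \<subseteq> V" using Vk(2) by auto
    have m0V: "m0 \<in> ?V" using Vk(3) i by auto
    define g where "g m = h i m * b m ^ i
      + (real i - \<alpha> m) * ((\<Sum>j\<in>{..<k} - {i}. h j m / (real j - \<alpha> m) * b m ^ j) + r m)" for m
    show ?thesis
    proof (rule extends_toI[of ?V m0 g])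
      show o: "open ?V" by (rule opn) simp
      show "smooth_on ?V g"
        unfolding g_def
        by (intro smooth_on_add smooth_on_sum smooth_on_mult smooth_on_divide smooth_on_diff smooth_on_const smooth_on_power o
            smooth_on_subset[OF h sub(2)] smooth_on_subset[OF \<alpha> sub(2)] smooth_on_subset[OF b(1) sub(2)] smooth_on_subset[OF r sub(1)])
          force+
      show "m0 \<in> ?V" by (rule m0V)
      show "g m = (real i - \<alpha> m) * A m" if m: "m \<in> ?V" "m \<in> {m. \<alpha> m \<notin> range real}" for m
      proof -
        have "\<alpha> m \<noteq> real i"
        proof
          assume e: "\<alpha> m = real i"
          have "\<alpha> m \<in> range real" unfolding e by (rule rangeI)
          then show False using m(2) by blast
        qed
        then have ne: "real i - \<alpha> m \<noteq> 0" by linarith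
        have "A m = (\<Sum>j<k. h j m / (real j - \<alpha> m) * b m ^ j) + r m" by (rule A) (use m in auto)
        also have "(\<Sum>j<k. h j m / (real j - \<alpha> m) * b m ^ j) = h i m / (real i - \<alpha> m) * b m ^ i
          + (\<Sum>j\<in>{..<k} - {i}. h j m / (real j - \<alpha> m) * b m ^ j)"
          using ik by (intro sum.remove) auto
        finally show ?thesis unfolding g_def using ne by (simp add: distrib_left)
      qed
      have "(deriv ^^ i) (M m0) 0 = (deriv ^^ i) (\<lambda>u. F (u, m0)) 0"
      proof -
        have "\<forall>\<^sub>F u in nhds 0. M m0 u = F (u, m0)"
          by (rule eventually_mono[OF eventually_nhds_in_open[OF open_slice_fst[OF \<Omega>(1)]]]) (use z[OF m0] M in auto)
        then show ?thesis by (rule higher_deriv_cong_ev) simp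
      qed
      also have "\<dots> = fact i * h i m0"
        unfolding h_def by (rule deriv_iter_hadamard[OF \<Omega>(1,2) F z[OF m0]])
      finally show "g m0 = (deriv ^^ i) (M m0) 0 / fact i * b m0 ^ i" unfolding g_def i by simp
    qed
  qed
qed

text \<open>An open set on which the functions differ would contain a product neighbourhood, hence a
  point with irrational first coordinate.\<close>

lemma agree_on_irrational:
  fixes f g :: "real \<times> 'p::metric_space \<Rightarrow> real"
  assumes "open S" "continuous_on S f" "continuous_on S g"
    and eq: "\<And>m. m \<in> S \<Longrightarrow> fst m \<notin> \<rat> \<Longrightarrow> f m = g m" and m: "m \<in> S"
  shows "f m = g m"
proof (rule ccontr)
  assume ne: "f m \<noteq> g m"
  let ?Z = "S \<inter> (\<lambda>x. f x - g x) -` (- {0})"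
  have "open ?Z" by (rule continuous_open_preimage[OF continuous_on_diff[OF assms(2,3)] assms(1)]) auto
  moreover have "m \<in> ?Z" using ne m by simp
  ultimately obtain A B where AB: "open A" "open B" "m \<in> A \<times> B" "A \<times> B \<subseteq> ?Z"
    by (rule open_prod_elim)
  obtain x where x: "x \<in> A" "x \<notin> \<rat>"
    using open_minus_countable[OF countable_rat, of A] AB by auto
  have "(x, snd m) \<in> ?Z" using x AB by auto
  then show False using eq[of "(x, snd m)"] x(2) by auto
qed

text \<open>\<pi> reorders the coordinates into transverse, axial and parameter part. The quotient
  is considered where its denominator is nonzero, an open set containing the axis.\<close>

lemma quotient_domain:
  fixes N D :: "(real \<times> real) \<times> 'p::euclidean_space \<Rightarrow> real" and \<pi> :: "real \<times> (real \<times> 'p) \<Rightarrow> (real \<times> real) \<times> 'p"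
  assumes O: "open O'" and N: "smooth_on O' N" and D: "smooth_on O' D" and \<pi>: "smooth_on UNIV \<pi>"
  defines "T \<equiv> {z. \<pi> z \<in> O' \<and> D (\<pi> z) \<noteq> 0}"
  shows "open T" "smooth_on T (\<lambda>z. N (\<pi> z) / D (\<pi> z))"
proof -
  have "open (O' \<inter> D -` (- {0}))"
    by (rule continuous_open_preimage[OF smooth_on_continuous[OF D] O]) auto
  then have "open (\<pi> -` (O' \<inter> D -` (- {0})))"
    by (rule open_vimage) (rule smooth_on_continuous[OF \<pi>])
  moreover have "T = \<pi> -` (O' \<inter> D -` (- {0}))" unfolding T_def by auto
  ultimately show T: "open T" by simp
  have \<pi>T: "smooth_on T \<pi>" by (rule smooth_on_subset[OF \<pi>]) simp
  show "smooth_on T (\<lambda>z. N (\<pi> z) / D (\<pi> z))"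
    by (intro smooth_on_divide T smooth_on_compose[OF N O T \<pi>T] smooth_on_compose[OF D O T \<pi>T]) (auto simp: T_def)
qed

text \<open>\<open>x\<close> and \<open>y\<close> are the components of a section transverse to the axis \<open>x = 0\<close>, and \<open>Q\<close> is the
  slope \<open>x' y / (x y')\<close> of the field; the value \<open>S\<close> below becomes \<open>S\<^sub>1\<close> and \<open>S\<^sub>2\<close>.\<close>

lemma section_data:
  fixes Q :: "real \<times> (real \<times> 'p::euclidean_space) \<Rightarrow> real" and \<alpha> :: "'p \<Rightarrow> real" and x y :: "real \<times> 'p \<Rightarrow> real"
  assumes V: "open V" and \<alpha>: "smooth_on V \<alpha>" and \<rho>: "\<rho> > 0" and \<epsilon>: "\<epsilon> > 0"
    and x: "smooth_on ({-\<epsilon><..<\<epsilon>} \<times> V) x" and y: "smooth_on ({-\<epsilon><..<\<epsilon>} \<times> V) y"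
    and ypos: "\<And>m. m \<in> V \<Longrightarrow> y (0, m) > 0" and xpos: "\<And>m. m \<in> V \<Longrightarrow> deriv (\<lambda>s. x (s, m)) 0 > 0"
    and T: "open T" "\<And>u m. m \<in> V \<Longrightarrow> -\<rho> < u \<Longrightarrow> u < y (0, m) + \<rho> \<Longrightarrow> (0, (u, m)) \<in> T" and Q: "smooth_on T Q"
    and Q0: "\<And>m. m \<in> V \<Longrightarrow> Q (0, (0, m)) = - \<alpha> m" and m0: "m0 \<in> V"
    and L_def: "\<And>m u. L m u = exp (LBINT z=0..u. (Q (0, (z, m)) + \<alpha> m) / z)"
    and M_def: "\<And>m u. M m u = L m u * deriv (\<lambda>x. Q (x, (u, m))) 0"
    and A_def: "\<And>m. A m = mellin {-\<rho><..<y (0, m) + \<rho>} (M m) (\<alpha> m) (y (0, m))"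
    and S_def: "\<And>m. S m = (deriv ^^ 2) (\<lambda>s. x (s, m)) 0 / (2 * deriv (\<lambda>s. x (s, m)) 0)
    - deriv (\<lambda>s. y (s, m)) 0 / y (0, m) * Q (0, (y (0, m), m)) - deriv (\<lambda>s. x (s, m)) 0 / L m (y (0, m)) * A m"
  shows "\<alpha> m0 \<notin> range real \<Longrightarrow> extends_to UNIV S m0 (S m0)"
    "\<alpha> m0 = real i \<Longrightarrow> extends_to {m. \<alpha> m \<notin> range real} (\<lambda>m. (real i - \<alpha> m) * S m) m0
       (- (deriv (\<lambda>s. x (s, m0)) 0 / L m0 (y (0, m0)) * ((deriv ^^ i) (M m0) 0 / fact i * y (0, m0) ^ i)))"
    "\<alpha> m0 \<notin> range real \<Longrightarrow> \<exists>Y. smooth_on {-\<rho><..<y (0, m0) + \<rho>} Y \<and> Y (y (0, m0)) = A m0 \<and>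
       smooth_on {-\<rho><..<y (0, m0) + \<rho>} (L m0) \<and>
       (\<forall>u. -\<rho> < u \<longrightarrow> u < y (0, m0) + \<rho> \<longrightarrow> L m0 u > 0 \<and>
         (\<exists>d. (L m0 has_real_derivative d) (at u) \<and> u * d = L m0 u * (Q (0, (u, m0)) + \<alpha> m0)) \<and>
         u * deriv Y u - \<alpha> m0 * Y u = L m0 u * deriv (\<lambda>x. Q (x, (u, m0))) 0)"
proof -
  define b where "b m = y (0, m)" for m
  have b: "smooth_on V b"
    unfolding b_def using smooth_on_dsec[OF \<epsilon> V y, of 0] by simp
  \<comment> \<open>The axis interval ends at a point that moves with the parameter, so the domain
    is a tube over \<open>V\<close> rather than a product.\<close>
  define \<Omega> where "\<Omega> = {(u, m). m \<in> V \<and> -\<rho> < u \<and> u < b m + \<rho>}"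
  have \<Omega>i: "(u, m) \<in> \<Omega> \<longleftrightarrow> m \<in> V \<and> -\<rho> < u \<and> u < b m + \<rho>" for u m unfolding \<Omega>_def by auto
  have sl: "{u. (u, m) \<in> \<Omega>} = {-\<rho><..<b m + \<rho>}" if "m \<in> V" for m using that unfolding \<Omega>i by auto
  have \<Omega>o: "open \<Omega>"
  proof -
    have oU: "open ((UNIV :: real set) \<times> V)" using V by (intro open_Times) auto
    have "continuous_on (UNIV \<times> V) (\<lambda>z. fst z - b (snd z))"
      by (intro continuous_on_diff continuous_on_fst continuous_on_id
          continuous_on_compose2[OF smooth_on_continuous[OF b] continuous_on_snd[OF continuous_on_id]]) auto
    from continuous_open_preimage[OF this oU, of "{..<\<rho>}"]
    have "open ((UNIV \<times> V) \<inter> (\<lambda>z. fst z - b (snd z)) -` {..<\<rho>})" by simp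
    then have "open (((UNIV \<times> V) \<inter> (\<lambda>z. fst z - b (snd z)) -` {..<\<rho>}) \<inter> ({-\<rho><..} \<times> UNIV))"
      by (rule open_Int) (intro open_Times open_greaterThan open_UNIV)
    moreover have "\<Omega> = ((UNIV \<times> V) \<inter> (\<lambda>z. fst z - b (snd z)) -` {..<\<rho>}) \<inter> ({-\<rho><..} \<times> UNIV)"
      unfolding \<Omega>_def by auto
    ultimately show ?thesis by simp
  qed
  have \<Omega>s: "star_fst \<Omega>"
    unfolding star_fst_def
  proof (intro allI impI)
    fix u m and t :: real assume um: "(u, m) \<in> \<Omega>" and t: "t \<in> {0..1}"
    have bp: "b m > 0" using um ypos unfolding \<Omega>i b_def by auto
    have "-\<rho> < t * u \<and> t * u < b m + \<rho>"
    proof (cases "u \<ge> 0")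
      case True
      then have "0 \<le> t * u" "t * u \<le> u" using t by (auto intro: mult_left_le_one_le)
      then show ?thesis using um \<rho> unfolding \<Omega>i by linarith
    next
      case False
      have "t * (- u) \<le> - u" by (rule mult_left_le_one_le) (use False t in auto)
      then have "u \<le> t * u" by simp
      moreover have "t * u \<le> 0" using False t by (simp add: mult_nonneg_nonpos)
      moreover have "-\<rho> < u" using um unfolding \<Omega>i by simp
      ultimately show ?thesis using \<rho> bp by linarith
    qed
    then show "(t * u, m) \<in> \<Omega>" using um unfolding \<Omega>i by simp
  qed
  have \<Omega>V: "\<Omega> \<subseteq> UNIV \<times> V" unfolding \<Omega>_def by auto
  have \<Omega>T: "z \<in> \<Omega> \<Longrightarrow> (0, z) \<in> T" for z using T(2) unfolding \<Omega>_def b_def by auto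
  have \<Omega>0: "(0, m) \<in> \<Omega> \<Longrightarrow> Q (0, (0, m)) = - \<alpha> m" for m using Q0 unfolding \<Omega>i by auto
  obtain L' M' where LM: "smooth_on \<Omega> L'" "smooth_on \<Omega> M'"
    "\<And>u m. (u, m) \<in> \<Omega> \<Longrightarrow> exp (LBINT z=0..u. (Q (0, (z, m)) + \<alpha> m) / z) = L' (u, m)"
    "\<And>u m. (u, m) \<in> \<Omega> \<Longrightarrow> L' (u, m) * deriv (\<lambda>x. Q (x, (u, m))) 0 = M' (u, m)"
    "\<And>u m. (u, m) \<in> \<Omega> \<Longrightarrow> L' (u, m) > 0"
    "\<And>u m. (u, m) \<in> \<Omega> \<Longrightarrow> \<exists>d. ((\<lambda>u. L' (u, m)) has_real_derivative d) (at u) \<and> u * d = L' (u, m) * (Q (0, (u, m)) + \<alpha> m)"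
    by (rule axis_data[OF V \<alpha> \<Omega>o \<Omega>s \<Omega>V T(1) \<Omega>T Q \<Omega>0]; blast)
  have LL: "L m u = L' (u, m)" if "(u, m) \<in> \<Omega>" for u m unfolding L_def by (rule LM(3)[OF that])
  have MM: "M m u = M' (u, m)" if "(u, m) \<in> \<Omega>" for u m unfolding M_def LL[OF that] by (rule LM(4)[OF that])
  have b\<Omega>: "(b m, m) \<in> \<Omega>" if "m \<in> V" for m using that ypos[OF that] \<rho> unfolding \<Omega>i b_def by simp
  have A': "A m = mellin {u. (u, m) \<in> \<Omega>} (M m) (\<alpha> m) (b m)" if "m \<in> V" for m
    unfolding A_def sl[OF that] b_def ..
  \<comment> \<open>The only part of \<open>S\<close> that can have a pole is the transform;
    \<open>R\<close> and the factor \<open>c\<close> in front of the transform are smooth on all of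
    \<open>V\<close>.\<close>
  define R where "R m = (deriv ^^ 2) (\<lambda>s. x (s, m)) 0 / (2 * (deriv ^^ 1) (\<lambda>s. x (s, m)) 0)
    - (deriv ^^ 1) (\<lambda>s. y (s, m)) 0 / b m * Q (0, (b m, m))" for m
  define c where "c m = (deriv ^^ 1) (\<lambda>s. x (s, m)) 0 / L' (b m, m)" for m
  have R: "smooth_on V R"
    unfolding R_def
    by (intro smooth_on_diff smooth_on_divide smooth_on_mult smooth_on_const V b smooth_on_dsec[OF \<epsilon> V x] smooth_on_dsec[OF \<epsilon> V y]
        smooth_on_compose[OF Q T(1) V] smooth_on_Pair smooth_on_id)
      (use xpos ypos \<Omega>T b\<Omega> in \<open>force simp: b_def\<close>)+
  have c: "smooth_on V c"
    unfolding c_def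
    by (intro smooth_on_divide V b smooth_on_dsec[OF \<epsilon> V x] smooth_on_compose[OF LM(1) \<Omega>o V] smooth_on_Pair smooth_on_id)
      (use b\<Omega> LM(5) in \<open>force\<close>)+
  define A1 where "A1 m = mellin {u. (u, m) \<in> \<Omega>} (M m) (\<alpha> m) (b m)" for m
  have mp1: "extends_to UNIV A1 m0 (A1 m0)" if nr: "\<alpha> m0 \<notin> range real"
    unfolding A1_def by (rule mellin_param(1)[OF V \<Omega>o \<Omega>s \<Omega>V LM(2) \<alpha> b b\<Omega> MM m0 nr])
  have mp2: "\<exists>y. smooth_on {u. (u, m0) \<in> \<Omega>} y \<and>
       (\<forall>u. (u, m0) \<in> \<Omega> \<longrightarrow> u * deriv y u - \<alpha> m0 * y u = M m0 u) \<and> y (b m0) = A1 m0"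
    if nr: "\<alpha> m0 \<notin> range real"
    unfolding A1_def by (rule mellin_param(2)[OF V \<Omega>o \<Omega>s \<Omega>V LM(2) \<alpha> b b\<Omega> MM m0 nr])
  have mp3: "extends_to {m. \<alpha> m \<notin> range real} (\<lambda>m. (real i - \<alpha> m) * A1 m) m0
       ((deriv ^^ i) (M m0) 0 / fact i * b m0 ^ i)" if i: "\<alpha> m0 = real i"
    unfolding A1_def by (rule mellin_param(3)[OF V \<Omega>o \<Omega>s \<Omega>V LM(2) \<alpha> b b\<Omega> MM m0 i])
  have S: "S m = R m - c m * A1 m" if "m \<in> V" for m
    unfolding S_def R_def c_def A'[OF that] A1_def LL[OF b\<Omega>[OF that], symmetric] by (simp add: b_def)
  show "extends_to UNIV S m0 (S m0)" if nr: "\<alpha> m0 \<notin> range real"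
  proof -
    have "extends_to UNIV (\<lambda>m. R m - c m * A1 m) m0 (R m0 - c m0 * A1 m0)"
      by (intro extends_to_diff extends_to_mult extends_to_smooth[OF V m0] R c mp1[OF nr])
    then show ?thesis
      unfolding S[OF m0] by (rule extends_to_cong_open[OF V m0]) (simp add: S)
  qed
  show "extends_to {m. \<alpha> m \<notin> range real} (\<lambda>m. (real i - \<alpha> m) * S m) m0
       (- (deriv (\<lambda>s. x (s, m0)) 0 / L m0 (y (0, m0)) * ((deriv ^^ i) (M m0) 0 / fact i * y (0, m0) ^ i)))"
    if i: "\<alpha> m0 = real i"
  proof -
    have sm: "smooth_on V (\<lambda>m. (real i - \<alpha> m) * R m)"
      by (intro smooth_on_mult smooth_on_diff smooth_on_const V \<alpha> R)
    have "extends_to {m. \<alpha> m \<notin> range real} (\<lambda>m. (real i - \<alpha> m) * R m - c m * ((real i - \<alpha> m) * A1 m)) m0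
       ((real i - \<alpha> m0) * R m0 - c m0 * ((deriv ^^ i) (M m0) 0 / fact i * b m0 ^ i))"
      by (intro extends_to_diff extends_to_mult extends_to_smooth[OF V m0 sm] extends_to_smooth[OF V m0 c]
          mp3[OF i])
    moreover have "(real i - \<alpha> m0) * R m0 - c m0 * ((deriv ^^ i) (M m0) 0 / fact i * b m0 ^ i)
      = - (deriv (\<lambda>s. x (s, m0)) 0 / L m0 (y (0, m0)) * ((deriv ^^ i) (M m0) 0 / fact i * y (0, m0) ^ i))"
      unfolding c_def i LL[OF b\<Omega>[OF m0], symmetric] by (simp add: b_def)
    ultimately have "extends_to {m. \<alpha> m \<notin> range real} (\<lambda>m. (real i - \<alpha> m) * R m - c m * ((real i - \<alpha> m) * A1 m)) m0
       (- (deriv (\<lambda>s. x (s, m0)) 0 / L m0 (y (0, m0)) * ((deriv ^^ i) (M m0) 0 / fact i * y (0, m0) ^ i)))" by simp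
    then show ?thesis
      by (rule extends_to_cong_open[OF V m0]) (simp add: S algebra_simps)
  qed
  show "\<exists>Y. smooth_on {-\<rho><..<y (0, m0) + \<rho>} Y \<and> Y (y (0, m0)) = A m0 \<and>
       smooth_on {-\<rho><..<y (0, m0) + \<rho>} (L m0) \<and>
       (\<forall>u. -\<rho> < u \<longrightarrow> u < y (0, m0) + \<rho> \<longrightarrow> L m0 u > 0 \<and>
         (\<exists>d. (L m0 has_real_derivative d) (at u) \<and> u * d = L m0 u * (Q (0, (u, m0)) + \<alpha> m0)) \<and>
         u * deriv Y u - \<alpha> m0 * Y u = L m0 u * deriv (\<lambda>x. Q (x, (u, m0))) 0)"
    if nr: "\<alpha> m0 \<notin> range real"
  proof -
    let ?I = "{-\<rho><..<b m0 + \<rho>}"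
    have in\<Omega>: "(u, m0) \<in> \<Omega>" if "u \<in> ?I" for u using that m0 unfolding \<Omega>i by simp
    obtain Y where Y0: "smooth_on {u. (u, m0) \<in> \<Omega>} Y"
      "\<forall>u. (u, m0) \<in> \<Omega> \<longrightarrow> u * deriv Y u - \<alpha> m0 * Y u = M m0 u" "Y (b m0) = A1 m0"
      using mp2[OF nr] by blast
    have Y: "smooth_on ?I Y" "\<And>u. u \<in> ?I \<Longrightarrow> u * deriv Y u - \<alpha> m0 * Y u = M m0 u" "Y (b m0) = A m0"
      using Y0(1) unfolding sl[OF m0] by (simp, use Y0(2) in\<Omega> in blast, simp add: Y0(3) A'[OF m0] A1_def)
    have L'I: "smooth_on ?I (\<lambda>u. L' (u, m0))" using smooth_on_slice_fst[OF \<Omega>o LM(1), of m0] unfolding sl[OF m0] .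
    have LI: "smooth_on ?I (L m0)"
      by (rule smooth_on_cong[THEN iffD2, OF _ _ L'I]) (auto intro!: LL in\<Omega>)
    have main: "L m0 u > 0 \<and>
         (\<exists>d. (L m0 has_real_derivative d) (at u) \<and> u * d = L m0 u * (Q (0, (u, m0)) + \<alpha> m0)) \<and>
         u * deriv Y u - \<alpha> m0 * Y u = L m0 u * deriv (\<lambda>x. Q (x, (u, m0))) 0" if u: "u \<in> ?I" for u
    proof (intro conjI)
      show "L m0 u > 0" unfolding LL[OF in\<Omega>[OF u]] by (rule LM(5)[OF in\<Omega>[OF u]])
      obtain d where d: "((\<lambda>u. L' (u, m0)) has_real_derivative d) (at u)" "u * d = L' (u, m0) * (Q (0, (u, m0)) + \<alpha> m0)"
        using LM(6)[OF in\<Omega>[OF u]] by blast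
      have "(L m0 has_real_derivative d) (at u)"
        by (rule has_field_derivative_transform_within_open[OF d(1) _ u]) (auto simp: LL[OF in\<Omega>])
      then show "\<exists>d. (L m0 has_real_derivative d) (at u) \<and> u * d = L m0 u * (Q (0, (u, m0)) + \<alpha> m0)"
        using d(2) unfolding LL[OF in\<Omega>[OF u]] by blast
      show "u * deriv Y u - \<alpha> m0 * Y u = L m0 u * deriv (\<lambda>x. Q (x, (u, m0))) 0"
        using Y(2)[OF u] unfolding M_def .
    qed
    show ?thesis unfolding b_def[symmetric] using Y(1,3) LI main by (intro exI[of _ Y]) auto
  qed
qed

section \<open>The coefficients of the Dulac map\<close>

lemma res_1_0: "res 1 0 = {1 / real m |m. m \<ge> 1}"
proof (intro set_eqI iffI)
  fix l assume "l \<in> res 1 0"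
  then obtain i j where l: "0 < l" "(i, j) \<noteq> (1, 0)" "1 = real i + l * real j" unfolding res_def by auto
  have "j \<noteq> 0"
  proof
    assume "j = 0"
    then have "real i = 1" using l(3) by simp
    then show False using l(2) \<open>j = 0\<close> by simp
  qed
  then have "l * real j > 0" using l(1) by simp
  then have "i = 0" using l(3) by (cases i) auto
  then have "l = 1 / real j" using l(3) \<open>j \<noteq> 0\<close> by (simp add: field_simps)
  then show "l \<in> {1 / real m |m. m \<ge> 1}" using \<open>j \<noteq> 0\<close> by force
next
  fix l assume "l \<in> {1 / real m |m. m \<ge> 1}"
  then obtain m where "l = 1 / real m" "m \<ge> 1" by auto
  then have "0 < l \<and> (0::nat, m) \<noteq> (1, 0) \<and> real 1 + l * real 0 = real 0 + l * real m" by simp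
  then show "l \<in> res 1 0" unfolding res_def by blast
qed

lemma res_0_1: "res 0 1 = {real m |m. m \<ge> 1}"
proof (intro set_eqI iffI)
  fix l assume "l \<in> res 0 1"
  then obtain i j where l: "0 < l" "(i, j) \<noteq> (0, 1)" "l = real i + l * real j" unfolding res_def by auto
  have "j = 0"
  proof (rule ccontr)
    assume "j \<noteq> 0"
    then have "l * 1 \<le> l * real j" using l(1) by (intro mult_left_mono) auto
    then have "i = 0" using l(3) by linarith
    then have "j = 1" using l(1,3) by simp
    then show False using l(2) \<open>i = 0\<close> by simp
  qed
  then show "l \<in> {real m |m. m \<ge> 1}" using l by (auto intro!: exI[of _ i])
next
  fix l assume "l \<in> {real m |m. m \<ge> 1}"
  then obtain m where "l = real m" "m \<ge> 1" by auto
  then have "0 < l \<and> (m, 0::nat) \<noteq> (0, 1) \<and> real 0 + l * real 1 = real m + l * real 0" by simp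
  then show "l \<in> res 0 1" unfolding res_def by blast
qed

lemma res_1_1: "res 1 1 = {real m |m. m \<ge> 1} \<union> {1 / real m |m. m \<ge> 1}"
proof (intro set_eqI iffI)
  fix l assume "l \<in> res 1 1"
  then obtain i j where l: "0 < l" "(i, j) \<noteq> (1, 1)" "1 + l = real i + l * real j" unfolding res_def by auto
  show "l \<in> {real m |m. m \<ge> 1} \<union> {1 / real m |m. m \<ge> 1}"
  proof (cases "j = 0")
    case True
    then have "l = real i - 1" using l(3) by simp
    then have "l = real (i - 1)" "i - 1 \<ge> 1" using l(1) by (auto simp: of_nat_diff)
    then show ?thesis by blast
  next
    case False
    then obtain j' where j: "j = Suc j'" by (cases j) auto
    then have e: "1 = real i + l * real j'" using l(3) by (simp add: algebra_simps)
    have "j' \<noteq> 0"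
    proof
      assume "j' = 0"
      then have "real i = 1" using e by simp
      then show False using l(2) j \<open>j' = 0\<close> by simp
    qed
    then have "l * real j' > 0" using l(1) by simp
    then have "i = 0" using e by (cases i) auto
    then have "l = 1 / real j'" using e \<open>j' \<noteq> 0\<close> by (simp add: field_simps)
    then show ?thesis using \<open>j' \<noteq> 0\<close> by force
  qed
next
  fix l assume "l \<in> {real m |m. m \<ge> 1} \<union> {1 / real m |m. m \<ge> 1}"
  then consider m where "l = real m" "m \<ge> 1" | m where "l = 1 / real m" "m \<ge> 1" by auto
  then show "l \<in> res 1 1"
  proof cases
    case 1
    then have "0 < l \<and> (Suc m, 0::nat) \<noteq> (1, 1) \<and> real 1 + l * real 1 = real (Suc m) + l * real 0" by simp
    then show ?thesis unfolding res_def by blast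
  next
    case 2
    then have "0 < l" "l * real m = 1" by auto
    then have "0 < l \<and> (0::nat, Suc m) \<noteq> (1, 1) \<and> real 1 + l * real 1 = real 0 + l * real (Suc m)"
      by (simp add: distrib_left)
    then show ?thesis unfolding res_def by blast
  qed
qed

lemma finite_idx:
  assumes "l > 0"
  shows "finite (idx l L)"
proof (rule finite_subset)
  show "idx l L \<subseteq> {..nat \<lceil>L\<rceil>} \<times> {..nat \<lceil>L / l\<rceil>}"
  proof
    fix x assume "x \<in> idx l L"
    then obtain i j where x: "x = (i, j)" "real i + l * real j \<le> L" unfolding idx_def by auto
    have "0 \<le> l * real j" using assms by simp
    then have "real i \<le> L" "l * real j \<le> L" using x(2) by linarith+
    then have "real i \<le> L" "real j \<le> L / l" using assms by (auto simp: field_simps)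
    then have "i \<le> nat \<lceil>L\<rceil>" "j \<le> nat \<lceil>L / l\<rceil>" by linarith+
    then show "x \<in> {..nat \<lceil>L\<rceil>} \<times> {..nat \<lceil>L / l\<rceil>}" using x(1) by simp
  qed
qed simp

lemma irrational_not_res_upto:
  assumes "l \<notin> \<rat>"
  shows "l \<notin> res_upto L"
proof
  assume "l \<in> res_upto L"
  then obtain i j i' j' where l: "(i', j') \<noteq> (i, j)" "real i + l * real j = real i' + l * real j'"
    unfolding res_upto_def res_def by auto
  show False
  proof (cases "j = j'")
    case True
    then show False using l by auto
  next
    case False
    then have "l = (real i' - real i) / (real j - real j')" using l(2) by (simp add: field_simps)
    then show False using assms by simp
  qed
qed

lemma flat_at_bound:
  assumes "flat_at L \<psi> m"
  shows "\<exists>C s\<^sub>0. 0 < s\<^sub>0 \<and> (\<forall>s\<in>{0<..<s\<^sub>0}. \<bar>\<psi> (s, m)\<bar> \<le> C * s powr L)"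
proof -
  have "\<forall>k bs. set bs \<subseteq> Basis \<longrightarrow> (\<exists>V C s\<^sub>0. open V \<and> m \<in> V \<and> 0 < C \<and> 0 < s\<^sub>0 \<and>
      (\<forall>s\<in>{0<..<s\<^sub>0}. \<forall>m\<in>V. \<bar>partials (replicate k (1, 0) @ map (Pair 0) bs) \<psi> (s, m)\<bar> \<le> C * s powr (L - real k)))"
    using assms unfolding flat_at_def by (rule conjunct2)
  from this[THEN spec, of 0, THEN spec, of "[]"] show ?thesis by auto
qed

lemma inverse_nat_not_nat:
  assumes "i \<ge> 2"
  shows "1 / real i \<notin> range real"
proof
  assume "1 / real i \<in> range real"
  then obtain k where k: "1 / real i = real k" by auto
  have "0 < 1 / real i" "1 / real i < 1" using assms by auto
  then have "0 < k" "k < 1" unfolding k by auto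
  then show False by simp
qed

section \<open>The standing hypotheses and the data on the two sections\<close>

locale dulac_setting =
  fixes W :: "(real ^ 'n::finite) set"
    and U :: "(real \<times> real) set"
    and n :: "nat \<times> nat"
    and P\<^sub>1 P\<^sub>2 :: "real \<times> real \<Rightarrow> real \<times> (real ^ 'n) \<Rightarrow> real"
    and \<sigma>\<^sub>1 \<sigma>\<^sub>2 :: "real \<Rightarrow> real \<times> (real ^ 'n) \<Rightarrow> real \<times> real"
    and \<epsilon> \<rho> :: real
    and D :: "real \<Rightarrow> real \<times> (real ^ 'n) \<Rightarrow> real"
    and \<Delta> :: "nat \<Rightarrow> nat \<Rightarrow> real \<times> (real ^ 'n) \<Rightarrow> real"
  assumes W: "open W"
    and U: "open U" "(0, 0) \<in> U"
    and P_smooth: "smooth_on (U \<times> ({0<..} \<times> W)) (\<lambda>(x, m). P\<^sub>1 x m)"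
      "smooth_on (U \<times> ({0<..} \<times> W)) (\<lambda>(x, m). P\<^sub>2 x m)"
    and P1_pos: "\<And>x\<^sub>1 m. (x\<^sub>1, 0) \<in> U \<Longrightarrow> m \<in> {0<..} \<times> W \<Longrightarrow> P\<^sub>1 (x\<^sub>1, 0) m > 0"
    and P2_neg: "\<And>x\<^sub>2 m. (0, x\<^sub>2) \<in> U \<Longrightarrow> m \<in> {0<..} \<times> W \<Longrightarrow> P\<^sub>2 (0, x\<^sub>2) m < 0"
    and ratio: "\<And>m. m \<in> {0<..} \<times> W \<Longrightarrow> fst m = - P\<^sub>2 (0, 0) m / P\<^sub>1 (0, 0) m"
    and eps: "\<epsilon> > 0"
    and sec_smooth: "smooth_on ({-\<epsilon><..<\<epsilon>} \<times> ({0<..} \<times> W)) (\<lambda>(s, m). \<sigma>\<^sub>1 s m)"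
      "smooth_on ({-\<epsilon><..<\<epsilon>} \<times> ({0<..} \<times> W)) (\<lambda>(s, m). \<sigma>\<^sub>2 s m)"
    and sec_base: "\<And>m. m \<in> {0<..} \<times> W \<Longrightarrow> \<sigma>\<^sub>1 0 m \<in> {(0, x\<^sub>2) |x\<^sub>2. x\<^sub>2 > 0}"
      "\<And>m. m \<in> {0<..} \<times> W \<Longrightarrow> \<sigma>\<^sub>2 0 m \<in> {(x\<^sub>1, 0) |x\<^sub>1. x\<^sub>1 > 0}"
    and sec_transverse: "\<And>m. m \<in> {0<..} \<times> W \<Longrightarrow> transverse_at_axis P\<^sub>1 P\<^sub>2 \<sigma>\<^sub>1 m"
      "\<And>m. m \<in> {0<..} \<times> W \<Longrightarrow> transverse_at_axis P\<^sub>1 P\<^sub>2 \<sigma>\<^sub>2 m"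
    and sec_orient: "\<And>m. m \<in> {0<..} \<times> W \<Longrightarrow> dsec fst 1 \<sigma>\<^sub>1 m > 0"
      "\<And>m. m \<in> {0<..} \<times> W \<Longrightarrow> dsec snd 1 \<sigma>\<^sub>2 m > 0"
    and rho: "\<rho> > 0"
    and axes: "\<And>m. m \<in> {0<..} \<times> W \<Longrightarrow> {0} \<times> I\<^sub>1 \<rho> \<sigma>\<^sub>1 m \<union> I\<^sub>2 \<rho> \<sigma>\<^sub>2 m \<times> {0} \<subseteq> U"
    and dulac: "is_dulac_map W U n P\<^sub>1 P\<^sub>2 \<sigma>\<^sub>1 \<sigma>\<^sub>2 D"
    and Delta_smooth: "\<And>i j. smooth_on (({0<..} - res i j) \<times> W) (\<Delta> i j)"
    and expansion: "\<And>L l\<^sub>0. L > 0 \<Longrightarrow> l\<^sub>0 > 0 \<Longrightarrow> l\<^sub>0 \<notin> res_upto (L - l\<^sub>0) \<Longrightarrow>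
      flat_on L ({l\<^sub>0} \<times> W) (\<lambda>(s, m). D s m - s powr fst m *
        (\<Sum>(i, j)\<in>idx l\<^sub>0 (L - l\<^sub>0). \<Delta> i j m * s powr (real i + fst m * real j)))"
    and Delta00_pos: "\<And>m. m \<in> {0<..} \<times> W \<Longrightarrow> \<Delta> 0 0 m > 0"
begin

abbreviation V :: "(real \<times> (real ^ 'n)) set" where "V \<equiv> {0<..} \<times> W"

lemma open_V: "open V" by (rule open_Times[OF open_greaterThan W])

lemma section_components:
  "smooth_on ({-\<epsilon><..<\<epsilon>} \<times> V) (\<lambda>z. fst (\<sigma>\<^sub>1 (fst z) (snd z)))" "smooth_on ({-\<epsilon><..<\<epsilon>} \<times> V) (\<lambda>z. snd (\<sigma>\<^sub>1 (fst z) (snd z)))"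
  "smooth_on ({-\<epsilon><..<\<epsilon>} \<times> V) (\<lambda>z. fst (\<sigma>\<^sub>2 (fst z) (snd z)))" "smooth_on ({-\<epsilon><..<\<epsilon>} \<times> V) (\<lambda>z. snd (\<sigma>\<^sub>2 (fst z) (snd z)))"
proof -
  have o: "open ({-\<epsilon><..<\<epsilon>} \<times> V)" by (rule open_Times[OF open_greaterThanLessThan open_V])
  note s = sec_smooth[unfolded case_prod_beta']
  show "smooth_on ({-\<epsilon><..<\<epsilon>} \<times> V) (\<lambda>z. fst (\<sigma>\<^sub>1 (fst z) (snd z)))" by (rule smooth_on_fst[OF o s(1)])
  show "smooth_on ({-\<epsilon><..<\<epsilon>} \<times> V) (\<lambda>z. snd (\<sigma>\<^sub>1 (fst z) (snd z)))" by (rule smooth_on_snd[OF o s(1)])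
  show "smooth_on ({-\<epsilon><..<\<epsilon>} \<times> V) (\<lambda>z. fst (\<sigma>\<^sub>2 (fst z) (snd z)))" by (rule smooth_on_fst[OF o s(2)])
  show "smooth_on ({-\<epsilon><..<\<epsilon>} \<times> V) (\<lambda>z. snd (\<sigma>\<^sub>2 (fst z) (snd z)))" by (rule smooth_on_snd[OF o s(2)])
qed

lemma base_points:
  assumes "m \<in> V"
  shows "\<sigma>\<^sub>1 0 m = (0, dsec snd 0 \<sigma>\<^sub>1 m)" "dsec snd 0 \<sigma>\<^sub>1 m > 0"
    "\<sigma>\<^sub>2 0 m = (dsec fst 0 \<sigma>\<^sub>2 m, 0)" "dsec fst 0 \<sigma>\<^sub>2 m > 0"
  using sec_base[OF assms] by (auto simp: dsec_def)

lemma axes_in_U: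
  assumes "m \<in> V"
  shows "-\<rho> < u \<Longrightarrow> u < dsec snd 0 \<sigma>\<^sub>1 m + \<rho> \<Longrightarrow> (0, u) \<in> U"
    "-\<rho> < u \<Longrightarrow> u < dsec fst 0 \<sigma>\<^sub>2 m + \<rho> \<Longrightarrow> (u, 0) \<in> U"
  using axes[OF assms] unfolding I\<^sub>1_def I\<^sub>2_def by auto

lemma P_smooth': "smooth_on (U \<times> V) (\<lambda>z. P\<^sub>1 (fst z) (snd z))" "smooth_on (U \<times> V) (\<lambda>z. P\<^sub>2 (fst z) (snd z))"
  using P_smooth unfolding case_prod_beta' .

lemma open_UV: "open (U \<times> V)" by (rule open_Times[OF U(1) open_V])

lemma smooth_fst: "smooth_on V fst" "smooth_on V (\<lambda>m. 1 / fst m)"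
proof -
  show f: "smooth_on V fst" by (rule smooth_on_fst[OF open_V smooth_on_id])
  show "smooth_on V (\<lambda>m. 1 / fst m)"
    by (rule smooth_on_divide[OF open_V smooth_on_const f]) auto
qed

text \<open>On \<open>x\<^sub>1 = 0\<close> the relevant slope is the quotient of
  \<open>P\<^sub>1\<close> by \<open>P\<^sub>2\<close>, with value - 1/\<lambda> at the origin; this
  makes 1/\<lambda> the Mellin exponent and puts the poles at \<lambda> = 1/i.\<close>

lemma section_1:
  assumes m0: "m0 \<in> V"
  shows "1 / fst m0 \<notin> range real \<Longrightarrow> extends_to UNIV (S\<^sub>1 \<rho> P\<^sub>1 P\<^sub>2 \<sigma>\<^sub>1) m0 (S\<^sub>1 \<rho> P\<^sub>1 P\<^sub>2 \<sigma>\<^sub>1 m0)"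
    "1 / fst m0 = real i \<Longrightarrow> extends_to {m. 1 / fst m \<notin> range real} (\<lambda>m. (real i - 1 / fst m) * S\<^sub>1 \<rho> P\<^sub>1 P\<^sub>2 \<sigma>\<^sub>1 m) m0
       (- (dsec fst 1 \<sigma>\<^sub>1 m0 / L\<^sub>1 P\<^sub>1 P\<^sub>2 m0 (dsec snd 0 \<sigma>\<^sub>1 m0) *
         ((deriv ^^ i) (M\<^sub>1 P\<^sub>1 P\<^sub>2 m0) 0 / fact i * dsec snd 0 \<sigma>\<^sub>1 m0 ^ i)))"
    "1 / fst m0 \<notin> range real \<Longrightarrow> \<exists>Y. smooth_on {-\<rho><..<dsec snd 0 \<sigma>\<^sub>1 m0 + \<rho>} Y \<and>
       Y (dsec snd 0 \<sigma>\<^sub>1 m0) = mellin (I\<^sub>1 \<rho> \<sigma>\<^sub>1 m0) (M\<^sub>1 P\<^sub>1 P\<^sub>2 m0) (1 / fst m0) (dsec snd 0 \<sigma>\<^sub>1 m0) \<and>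
       smooth_on {-\<rho><..<dsec snd 0 \<sigma>\<^sub>1 m0 + \<rho>} (L\<^sub>1 P\<^sub>1 P\<^sub>2 m0) \<and>
       (\<forall>u. -\<rho> < u \<longrightarrow> u < dsec snd 0 \<sigma>\<^sub>1 m0 + \<rho> \<longrightarrow> L\<^sub>1 P\<^sub>1 P\<^sub>2 m0 u > 0 \<and>
         (\<exists>d. (L\<^sub>1 P\<^sub>1 P\<^sub>2 m0 has_real_derivative d) (at u) \<and>
           u * d = L\<^sub>1 P\<^sub>1 P\<^sub>2 m0 u * (P\<^sub>1 (0, u) m0 / P\<^sub>2 (0, u) m0 + 1 / fst m0)) \<and>
         u * deriv Y u - 1 / fst m0 * Y u = L\<^sub>1 P\<^sub>1 P\<^sub>2 m0 u * deriv (\<lambda>x. P\<^sub>1 (x, u) m0 / P\<^sub>2 (x, u) m0) 0)"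
proof -
  let ?pi = "\<lambda>z :: real \<times> (real \<times> (real \<times> (real ^ 'n))). ((fst z, fst (snd z)), snd (snd z))"
  let ?Q = "\<lambda>z. P\<^sub>1 (fst (?pi z)) (snd (?pi z)) / P\<^sub>2 (fst (?pi z)) (snd (?pi z))"
  define T where "T = {z. ?pi z \<in> U \<times> V \<and> P\<^sub>2 (fst (?pi z)) (snd (?pi z)) \<noteq> 0}"
  have pi: "smooth_on UNIV ?pi"
    by (intro smooth_on_Pair smooth_on_fst smooth_on_snd smooth_on_id open_UNIV)
  have T: "open T" "smooth_on T ?Q"
    unfolding T_def using quotient_domain[OF open_UV P_smooth' pi] by auto
  note sd = section_data[where Q = ?Q and T = T and \<alpha> = "\<lambda>m. 1 / fst m" and V = V
      and x = "\<lambda>z. fst (\<sigma>\<^sub>1 (fst z) (snd z))" and y = "\<lambda>z. snd (\<sigma>\<^sub>1 (fst z) (snd z))"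
      and L = "L\<^sub>1 P\<^sub>1 P\<^sub>2" and M = "M\<^sub>1 P\<^sub>1 P\<^sub>2" and S = "S\<^sub>1 \<rho> P\<^sub>1 P\<^sub>2 \<sigma>\<^sub>1"
      and A = "\<lambda>m. mellin (I\<^sub>1 \<rho> \<sigma>\<^sub>1 m) (M\<^sub>1 P\<^sub>1 P\<^sub>2 m) (1 / fst m) (dsec snd 0 \<sigma>\<^sub>1 m)",
      OF open_V smooth_fst(2) rho eps section_components(1,2) _ _ T(1) _ T(2) _ m0]
  have h1: "snd (\<sigma>\<^sub>1 (fst (0, m)) (snd (0, m))) > 0" if "m \<in> V" for m
    using base_points(2)[OF that] by (simp add: dsec_def)
  have h2: "deriv (\<lambda>s. fst (\<sigma>\<^sub>1 (fst (s, m)) (snd (s, m)))) 0 > 0" if "m \<in> V" for m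
    using sec_orient(1)[OF that] by (simp add: dsec_def)
  have h3: "(0, (u, m)) \<in> T" if "m \<in> V" "-\<rho> < u" "u < snd (\<sigma>\<^sub>1 (fst (0, m)) (snd (0, m))) + \<rho>" for u m
  proof -
    have "(0, u) \<in> U" using axes_in_U(1)[OF that(1,2)] that(3) by (simp add: dsec_def)
    then show ?thesis using P2_neg[of u m] that(1) unfolding T_def by (auto simp: less_le)
  qed
  have h4: "?Q (0, (0, m)) = - (1 / fst m)" if "m \<in> V" for m
    using ratio[OF that] by simp
  show "1 / fst m0 \<notin> range real \<Longrightarrow> extends_to UNIV (S\<^sub>1 \<rho> P\<^sub>1 P\<^sub>2 \<sigma>\<^sub>1) m0 (S\<^sub>1 \<rho> P\<^sub>1 P\<^sub>2 \<sigma>\<^sub>1 m0)"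
    by (rule sd(1)[OF h1 h2 h3 h4]) (auto simp: L\<^sub>1_def M\<^sub>1_def S\<^sub>1_def I\<^sub>1_def dsec_def Let_def)
  show "1 / fst m0 = real i \<Longrightarrow> extends_to {m. 1 / fst m \<notin> range real} (\<lambda>m. (real i - 1 / fst m) * S\<^sub>1 \<rho> P\<^sub>1 P\<^sub>2 \<sigma>\<^sub>1 m) m0
       (- (dsec fst 1 \<sigma>\<^sub>1 m0 / L\<^sub>1 P\<^sub>1 P\<^sub>2 m0 (dsec snd 0 \<sigma>\<^sub>1 m0) *
         ((deriv ^^ i) (M\<^sub>1 P\<^sub>1 P\<^sub>2 m0) 0 / fact i * dsec snd 0 \<sigma>\<^sub>1 m0 ^ i)))"
    using sd(2)[OF h1 h2 h3 h4, of i] by (simp add: L\<^sub>1_def M\<^sub>1_def S\<^sub>1_def I\<^sub>1_def dsec_def Let_def)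
  assume nr: "1 / fst m0 \<notin> range real"
  show "\<exists>Y. smooth_on {-\<rho><..<dsec snd 0 \<sigma>\<^sub>1 m0 + \<rho>} Y \<and>
       Y (dsec snd 0 \<sigma>\<^sub>1 m0) = mellin (I\<^sub>1 \<rho> \<sigma>\<^sub>1 m0) (M\<^sub>1 P\<^sub>1 P\<^sub>2 m0) (1 / fst m0) (dsec snd 0 \<sigma>\<^sub>1 m0) \<and>
       smooth_on {-\<rho><..<dsec snd 0 \<sigma>\<^sub>1 m0 + \<rho>} (L\<^sub>1 P\<^sub>1 P\<^sub>2 m0) \<and>
       (\<forall>u. -\<rho> < u \<longrightarrow> u < dsec snd 0 \<sigma>\<^sub>1 m0 + \<rho> \<longrightarrow> L\<^sub>1 P\<^sub>1 P\<^sub>2 m0 u > 0 \<and>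
         (\<exists>d. (L\<^sub>1 P\<^sub>1 P\<^sub>2 m0 has_real_derivative d) (at u) \<and>
           u * d = L\<^sub>1 P\<^sub>1 P\<^sub>2 m0 u * (P\<^sub>1 (0, u) m0 / P\<^sub>2 (0, u) m0 + 1 / fst m0)) \<and>
         u * deriv Y u - 1 / fst m0 * Y u = L\<^sub>1 P\<^sub>1 P\<^sub>2 m0 u * deriv (\<lambda>x. P\<^sub>1 (x, u) m0 / P\<^sub>2 (x, u) m0) 0)"
    using sd(3)[OF h1 h2 h3 h4 _ _ _ _ nr] by (simp add: L\<^sub>1_def M\<^sub>1_def S\<^sub>1_def I\<^sub>1_def dsec_def Let_def)
qed

text \<open>On the other axis the quotient is inverted and its value at the origin is - \<lambda>,
  so the exponent is \<lambda> itself. \<open>?pi\<close> now puts the axial coordinate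
  first.\<close>

lemma section_2:
  assumes m0: "m0 \<in> V"
  shows "fst m0 \<notin> range real \<Longrightarrow> extends_to UNIV (S\<^sub>2 \<rho> P\<^sub>1 P\<^sub>2 \<sigma>\<^sub>2) m0 (S\<^sub>2 \<rho> P\<^sub>1 P\<^sub>2 \<sigma>\<^sub>2 m0)"
    "fst m0 = real i \<Longrightarrow> extends_to {m. fst m \<notin> range real} (\<lambda>m. (real i - fst m) * S\<^sub>2 \<rho> P\<^sub>1 P\<^sub>2 \<sigma>\<^sub>2 m) m0
       (- (dsec snd 1 \<sigma>\<^sub>2 m0 / L\<^sub>2 P\<^sub>1 P\<^sub>2 m0 (dsec fst 0 \<sigma>\<^sub>2 m0) *
         ((deriv ^^ i) (M\<^sub>2 P\<^sub>1 P\<^sub>2 m0) 0 / fact i * dsec fst 0 \<sigma>\<^sub>2 m0 ^ i)))"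
    "fst m0 \<notin> range real \<Longrightarrow> \<exists>Y. smooth_on {-\<rho><..<dsec fst 0 \<sigma>\<^sub>2 m0 + \<rho>} Y \<and>
       Y (dsec fst 0 \<sigma>\<^sub>2 m0) = mellin (I\<^sub>2 \<rho> \<sigma>\<^sub>2 m0) (M\<^sub>2 P\<^sub>1 P\<^sub>2 m0) (fst m0) (dsec fst 0 \<sigma>\<^sub>2 m0) \<and>
       smooth_on {-\<rho><..<dsec fst 0 \<sigma>\<^sub>2 m0 + \<rho>} (L\<^sub>2 P\<^sub>1 P\<^sub>2 m0) \<and>
       (\<forall>u. -\<rho> < u \<longrightarrow> u < dsec fst 0 \<sigma>\<^sub>2 m0 + \<rho> \<longrightarrow> L\<^sub>2 P\<^sub>1 P\<^sub>2 m0 u > 0 \<and>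
         (\<exists>d. (L\<^sub>2 P\<^sub>1 P\<^sub>2 m0 has_real_derivative d) (at u) \<and>
           u * d = L\<^sub>2 P\<^sub>1 P\<^sub>2 m0 u * (P\<^sub>2 (u, 0) m0 / P\<^sub>1 (u, 0) m0 + fst m0)) \<and>
         u * deriv Y u - fst m0 * Y u = L\<^sub>2 P\<^sub>1 P\<^sub>2 m0 u * deriv (\<lambda>x. P\<^sub>2 (u, x) m0 / P\<^sub>1 (u, x) m0) 0)"
proof -
  let ?pi = "\<lambda>z :: real \<times> (real \<times> (real \<times> (real ^ 'n))). ((fst (snd z), fst z), snd (snd z))"
  let ?Q = "\<lambda>z. P\<^sub>2 (fst (?pi z)) (snd (?pi z)) / P\<^sub>1 (fst (?pi z)) (snd (?pi z))"
  define T where "T = {z. ?pi z \<in> U \<times> V \<and> P\<^sub>1 (fst (?pi z)) (snd (?pi z)) \<noteq> 0}"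
  have pi: "smooth_on UNIV ?pi"
    by (intro smooth_on_Pair smooth_on_fst smooth_on_snd smooth_on_id open_UNIV)
  have T: "open T" "smooth_on T ?Q"
    unfolding T_def using quotient_domain[OF open_UV P_smooth'(2,1) pi] by auto
  note sd = section_data[where Q = ?Q and T = T and \<alpha> = "\<lambda>m. fst m" and V = V
      and x = "\<lambda>z. snd (\<sigma>\<^sub>2 (fst z) (snd z))" and y = "\<lambda>z. fst (\<sigma>\<^sub>2 (fst z) (snd z))"
      and L = "L\<^sub>2 P\<^sub>1 P\<^sub>2" and M = "M\<^sub>2 P\<^sub>1 P\<^sub>2" and S = "S\<^sub>2 \<rho> P\<^sub>1 P\<^sub>2 \<sigma>\<^sub>2"
      and A = "\<lambda>m. mellin (I\<^sub>2 \<rho> \<sigma>\<^sub>2 m) (M\<^sub>2 P\<^sub>1 P\<^sub>2 m) (fst m) (dsec fst 0 \<sigma>\<^sub>2 m)",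
      OF open_V smooth_fst(1) rho eps section_components(4,3) _ _ T(1) _ T(2) _ m0]
  have h1: "fst (\<sigma>\<^sub>2 (fst (0, m)) (snd (0, m))) > 0" if "m \<in> V" for m
    using base_points(4)[OF that] by (simp add: dsec_def)
  have h2: "deriv (\<lambda>s. snd (\<sigma>\<^sub>2 (fst (s, m)) (snd (s, m)))) 0 > 0" if "m \<in> V" for m
    using sec_orient(2)[OF that] by (simp add: dsec_def)
  have h3: "(0, (u, m)) \<in> T" if "m \<in> V" "-\<rho> < u" "u < fst (\<sigma>\<^sub>2 (fst (0, m)) (snd (0, m))) + \<rho>" for u m
  proof -
    have "(u, 0) \<in> U" using axes_in_U(2)[OF that(1,2)] that(3) by (simp add: dsec_def)
    then show ?thesis using P1_pos[of u m] that(1) unfolding T_def by (auto simp: less_le)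
  qed
  have h4: "?Q (0, (0, m)) = - (fst m)" if "m \<in> V" for m
    using ratio[OF that] P1_pos[of 0 m] U(2) that by simp
  show "fst m0 \<notin> range real \<Longrightarrow> extends_to UNIV (S\<^sub>2 \<rho> P\<^sub>1 P\<^sub>2 \<sigma>\<^sub>2) m0 (S\<^sub>2 \<rho> P\<^sub>1 P\<^sub>2 \<sigma>\<^sub>2 m0)"
    by (rule sd(1)[OF h1 h2 h3 h4]) (auto simp: L\<^sub>2_def M\<^sub>2_def S\<^sub>2_def I\<^sub>2_def dsec_def Let_def)
  show "fst m0 = real i \<Longrightarrow> extends_to {m. fst m \<notin> range real} (\<lambda>m. (real i - fst m) * S\<^sub>2 \<rho> P\<^sub>1 P\<^sub>2 \<sigma>\<^sub>2 m) m0
       (- (dsec snd 1 \<sigma>\<^sub>2 m0 / L\<^sub>2 P\<^sub>1 P\<^sub>2 m0 (dsec fst 0 \<sigma>\<^sub>2 m0) *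
         ((deriv ^^ i) (M\<^sub>2 P\<^sub>1 P\<^sub>2 m0) 0 / fact i * dsec fst 0 \<sigma>\<^sub>2 m0 ^ i)))"
    using sd(2)[OF h1 h2 h3 h4, of i] by (simp add: L\<^sub>2_def M\<^sub>2_def S\<^sub>2_def I\<^sub>2_def dsec_def Let_def)
  assume nr: "fst m0 \<notin> range real"
  show "\<exists>Y. smooth_on {-\<rho><..<dsec fst 0 \<sigma>\<^sub>2 m0 + \<rho>} Y \<and>
       Y (dsec fst 0 \<sigma>\<^sub>2 m0) = mellin (I\<^sub>2 \<rho> \<sigma>\<^sub>2 m0) (M\<^sub>2 P\<^sub>1 P\<^sub>2 m0) (fst m0) (dsec fst 0 \<sigma>\<^sub>2 m0) \<and>
       smooth_on {-\<rho><..<dsec fst 0 \<sigma>\<^sub>2 m0 + \<rho>} (L\<^sub>2 P\<^sub>1 P\<^sub>2 m0) \<and>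
       (\<forall>u. -\<rho> < u \<longrightarrow> u < dsec fst 0 \<sigma>\<^sub>2 m0 + \<rho> \<longrightarrow> L\<^sub>2 P\<^sub>1 P\<^sub>2 m0 u > 0 \<and>
         (\<exists>d. (L\<^sub>2 P\<^sub>1 P\<^sub>2 m0 has_real_derivative d) (at u) \<and>
           u * d = L\<^sub>2 P\<^sub>1 P\<^sub>2 m0 u * (P\<^sub>2 (u, 0) m0 / P\<^sub>1 (u, 0) m0 + fst m0)) \<and>
         u * deriv Y u - fst m0 * Y u = L\<^sub>2 P\<^sub>1 P\<^sub>2 m0 u * deriv (\<lambda>x. P\<^sub>2 (u, x) m0 / P\<^sub>1 (u, x) m0) 0)"
    using sd(3)[OF h1 h2 h3 h4 _ _ _ _ nr] by (simp add: L\<^sub>2_def M\<^sub>2_def S\<^sub>2_def I\<^sub>2_def dsec_def Let_def)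
qed

text \<open>At one fixed parameter the invariant and the expansion are both statements about
  functions of \<open>s\<close> alone, and \<open>coefficient_relations\<close> compares
  them.\<close>

lemma coefficients_irrational:
  assumes m: "m \<in> V" and irr: "fst m \<notin> \<rat>"
  shows "\<Delta> 1 0 m = fst m * \<Delta> 0 0 m * S\<^sub>1 \<rho> P\<^sub>1 P\<^sub>2 \<sigma>\<^sub>1 m"
    "\<Delta> 0 1 m = - (\<Delta> 0 0 m)\<^sup>2 * S\<^sub>2 \<rho> P\<^sub>1 P\<^sub>2 \<sigma>\<^sub>2 m"
    "\<Delta> 1 1 m = - 2 * fst m * (\<Delta> 0 0 m)\<^sup>2 * S\<^sub>1 \<rho> P\<^sub>1 P\<^sub>2 \<sigma>\<^sub>1 m * S\<^sub>2 \<rho> P\<^sub>1 P\<^sub>2 \<sigma>\<^sub>2 m"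
proof -
  define t where "t = fst m"
  define A where "A = (\<lambda>x. P\<^sub>1 x m)"
  define B where "B = (\<lambda>x. P\<^sub>2 x m)"
  define a where "a = dsec fst 0 \<sigma>\<^sub>2 m"
  define b where "b = dsec snd 0 \<sigma>\<^sub>1 m"
  have t: "t > 0" "t \<notin> \<rat>" using m irr unfolding t_def by auto
  have nr: "1 / t \<notin> range real" "t \<notin> range real"
  proof -
    show "t \<notin> range real" using t(2) by (metis Rats_of_nat rangeE)
    show "1 / t \<notin> range real"
    proof
      assume "1 / t \<in> range real"
      then have "1 / t \<in> \<rat>" by auto
      from Rats_divide[OF Rats_1 this] show False using t(2) by simp
    qed
  qed
  obtain Y1 where Y1: "smooth_on {-\<rho><..<b + \<rho>} Y1"
    "Y1 b = mellin (I\<^sub>1 \<rho> \<sigma>\<^sub>1 m) (M\<^sub>1 P\<^sub>1 P\<^sub>2 m) (1 / t) b" "smooth_on {-\<rho><..<b + \<rho>} (L\<^sub>1 P\<^sub>1 P\<^sub>2 m)"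
    "\<And>u. -\<rho> < u \<Longrightarrow> u < b + \<rho> \<Longrightarrow> L\<^sub>1 P\<^sub>1 P\<^sub>2 m u > 0 \<and>
         (\<exists>d. (L\<^sub>1 P\<^sub>1 P\<^sub>2 m has_real_derivative d) (at u) \<and> u * d = L\<^sub>1 P\<^sub>1 P\<^sub>2 m u * (A (0, u) / B (0, u) + 1 / t)) \<and>
         u * deriv Y1 u - 1 / t * Y1 u = L\<^sub>1 P\<^sub>1 P\<^sub>2 m u * deriv (\<lambda>x. A (x, u) / B (x, u)) 0"
    using section_1(3)[OF m] nr(1) unfolding t_def A_def B_def b_def by blast
  obtain Y2 where Y2: "smooth_on {-\<rho><..<a + \<rho>} Y2"
    "Y2 a = mellin (I\<^sub>2 \<rho> \<sigma>\<^sub>2 m) (M\<^sub>2 P\<^sub>1 P\<^sub>2 m) t a" "smooth_on {-\<rho><..<a + \<rho>} (L\<^sub>2 P\<^sub>1 P\<^sub>2 m)"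
    "\<And>u. -\<rho> < u \<Longrightarrow> u < a + \<rho> \<Longrightarrow> L\<^sub>2 P\<^sub>1 P\<^sub>2 m u > 0 \<and>
         (\<exists>d. (L\<^sub>2 P\<^sub>1 P\<^sub>2 m has_real_derivative d) (at u) \<and> u * d = L\<^sub>2 P\<^sub>1 P\<^sub>2 m u * (B (u, 0) / A (u, 0) + t)) \<and>
         u * deriv Y2 u - t * Y2 u = L\<^sub>2 P\<^sub>1 P\<^sub>2 m u * deriv (\<lambda>x. B (u, x) / A (u, x)) 0"
    using section_2(3)[OF m] nr(2) unfolding t_def A_def B_def a_def by blast
  have AB: "smooth_on U A" "smooth_on U B"
    unfolding A_def B_def
    using smooth_on_compose[OF P_smooth'(1) open_UV U(1), of "\<lambda>x. (x, m)"] smooth_on_compose[OF P_smooth'(2) open_UV U(1), of "\<lambda>x. (x, m)"]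
      smooth_on_Pair[OF U(1) smooth_on_id smooth_on_const[of U m]] m by auto
  have oS: "open ({-\<epsilon><..<\<epsilon>} \<times> V)" by (rule open_Times[OF open_greaterThanLessThan open_V])
  have slice: "smooth_on {-\<epsilon><..<\<epsilon>} (\<lambda>s. f (s, m))" if "smooth_on ({-\<epsilon><..<\<epsilon>} \<times> V) f" for f :: "real \<times> (real \<times> (real ^ 'n)) \<Rightarrow> real"
    using smooth_on_slice_fst[OF oS that, of m] m by (simp add: greaterThanLessThan_def greaterThan_def lessThan_def Int_def)
  note sec = slice[OF section_components(1)] slice[OF section_components(2)] slice[OF section_components(3)] slice[OF section_components(4)]
  have dul: "\<forall>\<^sub>F \<delta> in at_right 0. \<forall>\<^sub>F s in at_right 0. D s m \<in> {0<..<\<delta>} \<and>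
      orbit_first_hit (\<lambda>z. (1 / (fst z ^ fst n * snd z ^ snd n)) *\<^sub>R (fst z * A z, snd z * B z))
        (U \<inter> {0<..} \<times> {0<..}) ((\<lambda>r. \<sigma>\<^sub>2 r m) ` {-\<delta><..<\<delta>}) (\<sigma>\<^sub>1 s m) (\<sigma>\<^sub>2 (D s m) m)"
  proof -
    have sf: "saddle_field n P\<^sub>1 P\<^sub>2 m = (\<lambda>z. (1 / (fst z ^ fst n * snd z ^ snd n)) *\<^sub>R (fst z * A z, snd z * B z))"
      by (simp add: fun_eq_iff saddle_field_def reg_field_def A_def B_def)
    have "\<forall>\<^sub>F \<delta> in at_right 0. \<forall>\<^sub>F (s, m) in at_right 0 \<times>\<^sub>F nhds m.
        D s m \<in> {0<..<\<delta>} \<and>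
        orbit_first_hit (saddle_field n P\<^sub>1 P\<^sub>2 m) (U \<inter> {0<..} \<times> {0<..})
          ((\<lambda>r. \<sigma>\<^sub>2 r m) ` {-\<delta><..<\<delta>}) (\<sigma>\<^sub>1 s m) (\<sigma>\<^sub>2 (D s m) m)"
      using dulac m unfolding is_dulac_map_def by blast
    then show ?thesis
    proof (rule eventually_mono)
      fix \<delta>
      assume "\<forall>\<^sub>F (s, m) in at_right 0 \<times>\<^sub>F nhds m.
        D s m \<in> {0<..<\<delta>} \<and>
        orbit_first_hit (saddle_field n P\<^sub>1 P\<^sub>2 m) (U \<inter> {0<..} \<times> {0<..})
          ((\<lambda>r. \<sigma>\<^sub>2 r m) ` {-\<delta><..<\<delta>}) (\<sigma>\<^sub>1 s m) (\<sigma>\<^sub>2 (D s m) m)"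
      then obtain Pf Pg where P: "eventually Pf (at_right 0)" "eventually Pg (nhds m)"
        "\<And>s m. Pf s \<Longrightarrow> Pg m \<Longrightarrow> D s m \<in> {0<..<\<delta>} \<and>
        orbit_first_hit (saddle_field n P\<^sub>1 P\<^sub>2 m) (U \<inter> {0<..} \<times> {0<..})
          ((\<lambda>r. \<sigma>\<^sub>2 r m) ` {-\<delta><..<\<delta>}) (\<sigma>\<^sub>1 s m) (\<sigma>\<^sub>2 (D s m) m)"
        unfolding eventually_prod_filter by auto
      \<comment> \<open>The Dulac condition holds for all parameters near \<open>m\<close>, in
        particular at \<open>m\<close> itself.\<close>
      have "Pg m" by (rule eventually_nhds_x_imp_x[OF P(2)])
      then show "\<forall>\<^sub>F s in at_right 0. D s m \<in> {0<..<\<delta>} \<and>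
        orbit_first_hit (\<lambda>z. (1 / (fst z ^ fst n * snd z ^ snd n)) *\<^sub>R (fst z * A z, snd z * B z))
          (U \<inter> {0<..} \<times> {0<..}) ((\<lambda>r. \<sigma>\<^sub>2 r m) ` {-\<delta><..<\<delta>}) (\<sigma>\<^sub>1 s m) (\<sigma>\<^sub>2 (D s m) m)"
        unfolding sf[symmetric] by (intro eventually_mono[OF P(1)] P(3))
    qed
  qed
  have d1: "dsec c 1 \<sigma> m = deriv (\<lambda>s. c (\<sigma> s m)) 0" "dsec c 2 \<sigma> m = deriv (deriv (\<lambda>s. c (\<sigma> s m))) 0" for c \<sigma>
    by (simp_all add: dsec_def numeral_2_eq_2)
  have "\<exists>G1 G2 s0 c. 0 < s0 \<and> smooth_on {-s0<..<s0} G1 \<and> smooth_on {-s0<..<s0} G2 \<and>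
    deriv G1 0 = t * S\<^sub>1 \<rho> P\<^sub>1 P\<^sub>2 \<sigma>\<^sub>1 m \<and> deriv G2 0 = S\<^sub>2 \<rho> P\<^sub>1 P\<^sub>2 \<sigma>\<^sub>2 m \<and>
    (\<forall>\<^sub>F s in at_right 0. \<bar>ln (D s m) + G2 (D s m) - (t * ln s + G1 s)\<bar> \<le> c * s powr (t + 2))"
  proof -
    have S1e: "S\<^sub>1 \<rho> P\<^sub>1 P\<^sub>2 \<sigma>\<^sub>1 m = deriv (deriv (\<lambda>s. fst (\<sigma>\<^sub>1 s m))) 0 / (2 * deriv (\<lambda>s. fst (\<sigma>\<^sub>1 s m)) 0)
       - deriv (\<lambda>s. snd (\<sigma>\<^sub>1 s m)) 0 / b * (A (0, b) / B (0, b)) - deriv (\<lambda>s. fst (\<sigma>\<^sub>1 s m)) 0 / L\<^sub>1 P\<^sub>1 P\<^sub>2 m b * Y1 b"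
      unfolding Y1(2) unfolding S\<^sub>1_def Let_def d1 A_def B_def b_def t_def ..
    have S2e: "S\<^sub>2 \<rho> P\<^sub>1 P\<^sub>2 \<sigma>\<^sub>2 m = deriv (deriv (\<lambda>s. snd (\<sigma>\<^sub>2 s m))) 0 / (2 * deriv (\<lambda>s. snd (\<sigma>\<^sub>2 s m)) 0)
       - deriv (\<lambda>s. fst (\<sigma>\<^sub>2 s m)) 0 / a * (B (a, 0) / A (a, 0)) - deriv (\<lambda>s. snd (\<sigma>\<^sub>2 s m)) 0 / L\<^sub>2 P\<^sub>1 P\<^sub>2 m a * Y2 a"
      unfolding Y2(2) unfolding S\<^sub>2_def Let_def d1 A_def B_def a_def t_def ..
    have n1: "L\<^sub>1 P\<^sub>1 P\<^sub>2 m u \<noteq> 0" if "-\<rho> < u" "u < b + \<rho>" for u using Y1(4)[OF that] by linarith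
    have n2: "L\<^sub>2 P\<^sub>1 P\<^sub>2 m u \<noteq> 0" if "-\<rho> < u" "u < a + \<rho>" for u using Y2(4)[OF that] by linarith
    show ?thesis
      unfolding S1e S2e
    proof (rule dulac_invariant[OF U(1) _ _ rho eps _ _ AB(1) _ AB(2) _ _ t(2)
          Y1(4)[THEN conjunct2, THEN conjunct1] Y1(3) n1 Y1(1) Y1(4)[THEN conjunct2, THEN conjunct2]
          Y2(4)[THEN conjunct2, THEN conjunct1] Y2(3) n2 Y2(1) Y2(4)[THEN conjunct2, THEN conjunct2] _ _ _ _ _ _ _ _ dul])
      show "a > 0" "b > 0" unfolding a_def b_def using base_points[OF m] by auto
      show "(x, 0) \<in> U" if "-\<rho> < x" "x < a + \<rho>" for x using axes_in_U(2)[OF m] that unfolding a_def by auto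
      show "(0, y) \<in> U" if "-\<rho> < y" "y < b + \<rho>" for y using axes_in_U(1)[OF m] that unfolding b_def by auto
      show "A (x, 0) > 0" if "(x, 0) \<in> U" for x unfolding A_def by (rule P1_pos[OF that m])
      show "B (0, y) < 0" if "(0, y) \<in> U" for y unfolding B_def by (rule P2_neg[OF that m])
      show "t = - B (0, 0) / A (0, 0)" unfolding t_def A_def B_def by (rule ratio[OF m])
      show "\<sigma>\<^sub>1 0 m = (0, b)" "\<sigma>\<^sub>2 0 m = (a, 0)" unfolding a_def b_def using base_points[OF m] by auto
      show "0 < deriv (\<lambda>s. fst (\<sigma>\<^sub>1 s m)) 0" "0 < deriv (\<lambda>s. snd (\<sigma>\<^sub>2 s m)) 0"
        using sec_orient[OF m] unfolding d1 by auto
      show "smooth_on {-\<epsilon><..<\<epsilon>} (\<lambda>s. fst (\<sigma>\<^sub>1 s m))" "smooth_on {-\<epsilon><..<\<epsilon>} (\<lambda>s. snd (\<sigma>\<^sub>1 s m))"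
        "smooth_on {-\<epsilon><..<\<epsilon>} (\<lambda>s. fst (\<sigma>\<^sub>2 s m))" "smooth_on {-\<epsilon><..<\<epsilon>} (\<lambda>s. snd (\<sigma>\<^sub>2 s m))"
        using sec by auto
    qed
  qed
  then obtain G1 G2 s0 c where G: "0 < s0" "smooth_on {-s0<..<s0} G1" "smooth_on {-s0<..<s0} G2"
    "deriv G1 0 = t * S\<^sub>1 \<rho> P\<^sub>1 P\<^sub>2 \<sigma>\<^sub>1 m" "deriv G2 0 = S\<^sub>2 \<rho> P\<^sub>1 P\<^sub>2 \<sigma>\<^sub>2 m"
    "\<forall>\<^sub>F s in at_right 0. \<bar>ln (D s m) + G2 (D s m) - (t * ln s + G1 s)\<bar> \<le> c * s powr (t + 2)"
    by blast
  \<comment> \<open>The expansion is taken to order \<open>2 * t + 2\<close>, that is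
    \<open>t + 2\<close> relative to the leading power; this contains the index (1, 1) of relative
    order \<open>t + 1\<close> and leaves a remainder beyond it.\<close>
  let ?S = "idx t (t + 2)"
  have e: "2 * t + 2 - t = t + 2" by simp
  have "flat_on (2 * t + 2) ({t} \<times> W) (\<lambda>(s, m). D s m - s powr fst m *
        (\<Sum>(i, j)\<in>idx t (2 * t + 2 - t). \<Delta> i j m * s powr (real i + fst m * real j)))"
    by (rule expansion) (use t irrational_not_res_upto in auto)
  then have "flat_at (2 * t + 2) (\<lambda>(s, m). D s m - s powr fst m *
        (\<Sum>(i, j)\<in>?S. \<Delta> i j m * s powr (real i + fst m * real j))) m"
    unfolding flat_on_def e by (rule bspec) (use m in \<open>auto simp: t_def\<close>)
  from flat_at_bound[OF this, unfolded case_prod_conv t_def[symmetric]] obtain C s1 where C: "0 < s1 \<and>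
    (\<forall>s\<in>{0<..<s1}. \<bar>D s m - s powr t * (\<Sum>(i, j)\<in>?S. \<Delta> i j m * s powr (real i + t * real j))\<bar>
       \<le> C * s powr (2 * t + 2))"
    by (elim exE) (rule that)
  have ex: "\<forall>\<^sub>F s in at_right 0. \<bar>D s m - s powr t * (\<Sum>(i, j)\<in>?S. \<Delta> i j m * s powr (real i + t * real j))\<bar>
      \<le> C * s powr (t + (t + 2))"
  proof -
    have "t + (t + 2) = 2 * t + 2" by simp
    then show ?thesis
      unfolding eventually_at_right_field
      by (intro exI[of _ s1] conjI allI impI C[THEN conjunct1]) (simp only: C[THEN conjunct2, THEN bspec] greaterThanLessThan_iff)
  qed
  have S4: "{(0, 0), (1, 0), (0, 1), (1, 1)} \<subseteq> ?S" unfolding idx_def using t by auto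
  note cr = coefficient_relations[where d = "\<lambda>i j. \<Delta> i j m" and D = "\<lambda>s. D s m",
      OF G(1-3) finite_idx[OF t(1)] S4 Delta00_pos[OF m] t _ G(6) ex]
  show "\<Delta> 1 0 m = fst m * \<Delta> 0 0 m * S\<^sub>1 \<rho> P\<^sub>1 P\<^sub>2 \<sigma>\<^sub>1 m"
    using cr(1) G(4) unfolding t_def by simp
  show "\<Delta> 0 1 m = - (\<Delta> 0 0 m)\<^sup>2 * S\<^sub>2 \<rho> P\<^sub>1 P\<^sub>2 \<sigma>\<^sub>2 m"
    using cr(2) G(5) by simp
  show "\<Delta> 1 1 m = - 2 * fst m * (\<Delta> 0 0 m)\<^sup>2 * S\<^sub>1 \<rho> P\<^sub>1 P\<^sub>2 \<sigma>\<^sub>1 m * S\<^sub>2 \<rho> P\<^sub>1 P\<^sub>2 \<sigma>\<^sub>2 m"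
    using cr(3) G(4,5) unfolding t_def by simp
qed

section \<open>Closed formulas for the coefficients off the resonances\<close>

abbreviation T\<^sub>1 where "T\<^sub>1 \<equiv> S\<^sub>1 \<rho> P\<^sub>1 P\<^sub>2 \<sigma>\<^sub>1"
abbreviation T\<^sub>2 where "T\<^sub>2 \<equiv> S\<^sub>2 \<rho> P\<^sub>1 P\<^sub>2 \<sigma>\<^sub>2"

text \<open>In terms of \<lambda>, the resonance sets of the three coefficients are given by
  \<lambda> or 1/\<lambda> being a natural number, the form in which the poles of the transforms
  appear. Allowing 0 in \<open>range real\<close> is harmless, as \<lambda> > 0.\<close>

lemma domains:
  "({0<..} - res 1 0) \<times> W = V \<inter> {m. 1 / fst m \<notin> range real}"
  "({0<..} - res 0 1) \<times> W = V \<inter> {m. fst m \<notin> range real}"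
  "({0<..} - res 1 1) \<times> W = V \<inter> {m. 1 / fst m \<notin> range real} \<inter> {m. fst m \<notin> range real}"
  "({0<..} - res 0 0) \<times> W = V"
proof -
  have gen: "({0<..} - A) \<times> W = V \<inter> {m. Q (fst m)}" if "\<And>l. l > 0 \<Longrightarrow> l \<in> A \<longleftrightarrow> \<not> Q l" for A Q
    using that by auto
  have inv: "l \<in> {1 / real m |m. m \<ge> 1} \<longleftrightarrow> 1 / l \<in> range real" if "l > 0" for l
  proof
    assume "1 / l \<in> range real"
    then obtain m where m: "1 / l = real m" by auto
    with that have "m \<noteq> 0" by (intro notI) simp
    then have "l = 1 / real m \<and> m \<ge> 1" using m that by (simp add: field_simps)
    then show "l \<in> {1 / real m |m. m \<ge> 1}" by blast
  qed auto
  have nat: "l \<in> {real m |m. m \<ge> 1} \<longleftrightarrow> l \<in> range real" if "l > 0" for l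
  proof
    assume "l \<in> range real"
    then obtain m where "l = real m" by auto
    then show "l \<in> {real m |m. m \<ge> 1}" using that by auto
  qed auto
  show "({0<..} - res 1 0) \<times> W = V \<inter> {m. 1 / fst m \<notin> range real}"
    by (rule gen[where Q = "\<lambda>l. 1 / l \<notin> range real"]) (simp only: res_1_0 inv not_not)
  show "({0<..} - res 0 1) \<times> W = V \<inter> {m. fst m \<notin> range real}"
    by (rule gen[where Q = "\<lambda>l. l \<notin> range real"]) (simp only: res_0_1 nat not_not)
  have "({0<..} - res 1 1) \<times> W = V \<inter> {m. 1 / fst m \<notin> range real \<and> fst m \<notin> range real}"
    by (rule gen[where Q = "\<lambda>l. 1 / l \<notin> range real \<and> l \<notin> range real"])
      (simp only: res_1_1 Un_iff inv nat de_Morgan_conj not_not disj_commute)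
  then show "({0<..} - res 1 1) \<times> W = V \<inter> {m. 1 / fst m \<notin> range real} \<inter> {m. fst m \<notin> range real}"
    by blast
  \<comment> \<open>For positive \<lambda> the number 0 has no second representation, so the leading
    coefficient is smooth everywhere.\<close>
  have "res 0 0 = {}" unfolding res_def by (auto simp: add_nonneg_eq_0_iff)
  then show "({0<..} - res 0 0) \<times> W = V" by simp
qed

lemma open_domains:
  "open (V \<inter> {m. 1 / fst m \<notin> range real})" "open (V \<inter> {m. fst m \<notin> range real})"
proof -
  have o: "open (- range real)" using closed_Nats unfolding Nats_def by auto
  show "open (V \<inter> {m. 1 / fst m \<notin> range real})" "open (V \<inter> {m. fst m \<notin> range real})"
    using continuous_open_preimage[OF smooth_on_continuous[OF smooth_fst(1)] open_V o]
      continuous_open_preimage[OF smooth_on_continuous[OF smooth_fst(2)] open_V o]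
    by (simp_all add: vimage_def)
qed

lemma continuous_T:
  "continuous_on (V \<inter> {m. 1 / fst m \<notin> range real}) T\<^sub>1" "continuous_on (V \<inter> {m. fst m \<notin> range real}) T\<^sub>2"
  using extends_to_imp(2)[OF section_1(1)] extends_to_imp(2)[OF section_2(1)]
  by (auto intro!: continuous_at_imp_continuous_on simp: isCont_def)

lemma smooth_Delta00: "smooth_on V (\<Delta> 0 0)"
  using Delta_smooth[of 0 0] unfolding domains .

text \<open>Rational nonresonant \<lambda> are reached by continuity: both sides are continuous on
  the open nonresonant set of the coefficient concerned and agree for irrational \<lambda>.\<close>

lemma coefficients:
  assumes m: "m \<in> V"
  shows "1 / fst m \<notin> range real \<Longrightarrow> \<Delta> 1 0 m = fst m * \<Delta> 0 0 m * T\<^sub>1 m"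
    "fst m \<notin> range real \<Longrightarrow> \<Delta> 0 1 m = - (\<Delta> 0 0 m)\<^sup>2 * T\<^sub>2 m"
    "1 / fst m \<notin> range real \<Longrightarrow> fst m \<notin> range real \<Longrightarrow> \<Delta> 1 1 m = - 2 * fst m * (\<Delta> 0 0 m)\<^sup>2 * T\<^sub>1 m * T\<^sub>2 m"
proof -
  let ?A = "V \<inter> {m. 1 / fst m \<notin> range real}" and ?B = "V \<inter> {m. fst m \<notin> range real}"
  have c0: "continuous_on X (\<Delta> 0 0)" if "X \<subseteq> V" for X
    by (rule continuous_on_subset[OF smooth_on_continuous[OF smooth_Delta00] that])
  note c = smooth_on_continuous[OF Delta_smooth[of 1 0, unfolded domains]]
    smooth_on_continuous[OF Delta_smooth[of 0 1, unfolded domains]]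
    smooth_on_continuous[OF Delta_smooth[of 1 1, unfolded domains]]
  note cf = continuous_on_fst[OF continuous_on_id]
  have cT: "continuous_on (?A \<inter> {m. fst m \<notin> range real}) T\<^sub>1" "continuous_on (?A \<inter> {m. fst m \<notin> range real}) T\<^sub>2"
    by (rule continuous_on_subset[OF continuous_T(1)], blast) (rule continuous_on_subset[OF continuous_T(2)], blast)
  have o: "open (?A \<inter> {m. fst m \<notin> range real})"
    using open_Int[OF open_domains] by (simp add: Int_ac)
  show "\<Delta> 1 0 m = fst m * \<Delta> 0 0 m * T\<^sub>1 m" if "1 / fst m \<notin> range real"
    by (rule agree_on_irrational[OF open_domains(1) c(1)])
      (use m that in \<open>auto intro!: continuous_intros cf c0 continuous_T coefficients_irrational simp del: One_nat_def\<close>)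
  show "\<Delta> 0 1 m = - (\<Delta> 0 0 m)\<^sup>2 * T\<^sub>2 m" if "fst m \<notin> range real"
    by (rule agree_on_irrational[OF open_domains(2) c(2)])
      (use m that in \<open>auto intro!: continuous_intros cf c0 continuous_T coefficients_irrational(2)[unfolded mult_minus_left] simp del: One_nat_def\<close>)
  show "\<Delta> 1 1 m = - 2 * fst m * (\<Delta> 0 0 m)\<^sup>2 * T\<^sub>1 m * T\<^sub>2 m" if "1 / fst m \<notin> range real" "fst m \<notin> range real"
    by (rule agree_on_irrational[OF o c(3)])
      (use m that in \<open>auto intro!: continuous_intros cf c0 cT coefficients_irrational(3)[unfolded mult_minus_left] simp del: One_nat_def\<close>)
qed

section \<open>Poles and residues\<close>

lemma pole_1:
  assumes m0: "m0 \<in> V" and i: "i \<ge> 1" "fst m0 = 1 / real i"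
  shows "extends_to (V \<inter> {m. 1 / fst m \<notin> range real}) (\<lambda>m. (fst m - fst m0) * T\<^sub>1 m) m0
    (- (dsec fst 1 \<sigma>\<^sub>1 m0 * dsec snd 0 \<sigma>\<^sub>1 m0 ^ i / (L\<^sub>1 P\<^sub>1 P\<^sub>2 m0 (dsec snd 0 \<sigma>\<^sub>1 m0) * real i ^ 2)
      * ((deriv ^^ i) (M\<^sub>1 P\<^sub>1 P\<^sub>2 m0) 0 / fact i)))"
proof -
  have "extends_to (V \<inter> {m. 1 / fst m \<notin> range real}) (\<lambda>m. (real i - 1 / fst m) * T\<^sub>1 m) m0
       (- (dsec fst 1 \<sigma>\<^sub>1 m0 / L\<^sub>1 P\<^sub>1 P\<^sub>2 m0 (dsec snd 0 \<sigma>\<^sub>1 m0) *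
         ((deriv ^^ i) (M\<^sub>1 P\<^sub>1 P\<^sub>2 m0) 0 / fact i * dsec snd 0 \<sigma>\<^sub>1 m0 ^ i)))"
    by (rule extends_to_mono[OF section_1(2)[OF m0]]) (use i in auto)
  moreover have "smooth_on V (\<lambda>m. fst m / real i)"
    by (intro smooth_on_divide open_V smooth_fst smooth_on_const) (use i in auto)
  ultimately have "extends_to (V \<inter> {m. 1 / fst m \<notin> range real})
      (\<lambda>m. fst m / real i * ((real i - 1 / fst m) * T\<^sub>1 m)) m0
      (fst m0 / real i * (- (dsec fst 1 \<sigma>\<^sub>1 m0 / L\<^sub>1 P\<^sub>1 P\<^sub>2 m0 (dsec snd 0 \<sigma>\<^sub>1 m0) *
         ((deriv ^^ i) (M\<^sub>1 P\<^sub>1 P\<^sub>2 m0) 0 / fact i * dsec snd 0 \<sigma>\<^sub>1 m0 ^ i))))"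
    by (intro extends_to_mult extends_to_smooth[OF open_V m0])
  then show ?thesis
  proof (rule extends_to_cong)
    show "fst m / real i * ((real i - 1 / fst m) * T\<^sub>1 m) = (fst m - fst m0) * T\<^sub>1 m"
      if "m \<in> V \<inter> {m. 1 / fst m \<notin> range real}" for m
    proof -
      \<comment> \<open>The transform has its pole in 1/\<lambda>; passing to \<lambda> - 1/i costs
        the factor \<lambda>/i, whose value 1/i^2 at the resonance appears in the residue.\<close>
      have "fst m / real i * (real i - 1 / fst m) = fst m - fst m0" using that i by (auto simp: field_simps)
      then show ?thesis by (simp only: mult.assoc[symmetric])
    qed
  qed (simp add: i(2) power2_eq_square mult_ac)
qed

text \<open>Here the exponent is \<lambda> itself, so the change from i - \<lambda> to \<lambda> - i
  only reverses the sign.\<close>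

lemma pole_2:
  assumes m0: "m0 \<in> V" and i: "fst m0 = real i"
  shows "extends_to (V \<inter> {m. fst m \<notin> range real}) (\<lambda>m. (fst m - fst m0) * T\<^sub>2 m) m0
    (dsec snd 1 \<sigma>\<^sub>2 m0 * dsec fst 0 \<sigma>\<^sub>2 m0 ^ i / L\<^sub>2 P\<^sub>1 P\<^sub>2 m0 (dsec fst 0 \<sigma>\<^sub>2 m0)
      * ((deriv ^^ i) (M\<^sub>2 P\<^sub>1 P\<^sub>2 m0) 0 / fact i))"
proof -
  have "extends_to (V \<inter> {m. fst m \<notin> range real}) (\<lambda>m. (real i - fst m) * T\<^sub>2 m) m0
       (- (dsec snd 1 \<sigma>\<^sub>2 m0 / L\<^sub>2 P\<^sub>1 P\<^sub>2 m0 (dsec fst 0 \<sigma>\<^sub>2 m0) *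
         ((deriv ^^ i) (M\<^sub>2 P\<^sub>1 P\<^sub>2 m0) 0 / fact i * dsec fst 0 \<sigma>\<^sub>2 m0 ^ i)))"
    by (rule extends_to_mono[OF section_2(2)[OF m0 i]]) auto
  from extends_to_mult[OF extends_to_smooth[OF open_V m0 smooth_on_const[of V "-1 :: real"]] this]
  show ?thesis by (rule extends_to_cong) (simp_all add: i algebra_simps)
qed

text \<open>Two powers of \<open>i\<close> in the denominator come from \<open>pole_1\<close>, the
  third from the factor \<lambda> in the formula for the coefficient.\<close>

lemma residue_10:
  assumes m0: "m0 \<in> V" and i: "i \<ge> 1" "fst m0 = 1 / real i"
  shows "extends_to (({0<..} - res 1 0) \<times> W) (\<lambda>m. (fst m - fst m0) * \<Delta> 1 0 m) m0
    (- (\<Delta> 0 0 m0 * dsec fst 1 \<sigma>\<^sub>1 m0 * dsec snd 0 \<sigma>\<^sub>1 m0 ^ i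
        / (L\<^sub>1 P\<^sub>1 P\<^sub>2 m0 (dsec snd 0 \<sigma>\<^sub>1 m0) * real i ^ 3)) * ((deriv ^^ i) (M\<^sub>1 P\<^sub>1 P\<^sub>2 m0) 0 / fact i))"
proof -
  have "smooth_on V (\<lambda>m. fst m * \<Delta> 0 0 m)" by (intro smooth_on_mult open_V smooth_fst smooth_Delta00)
  from extends_to_mult[OF extends_to_smooth[OF open_V m0 this] pole_1[OF assms]]
  show ?thesis unfolding domains
    by (rule extends_to_cong) (simp_all add: coefficients i(2) power2_eq_square power3_eq_cube mult_ac del: One_nat_def)
qed

lemma residue_01:
  assumes m0: "m0 \<in> V" and i: "fst m0 = real i"
  shows "extends_to (({0<..} - res 0 1) \<times> W) (\<lambda>m. (fst m - fst m0) * \<Delta> 0 1 m) m0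
    (- ((\<Delta> 0 0 m0)\<^sup>2 * dsec snd 1 \<sigma>\<^sub>2 m0 * dsec fst 0 \<sigma>\<^sub>2 m0 ^ i
        / L\<^sub>2 P\<^sub>1 P\<^sub>2 m0 (dsec fst 0 \<sigma>\<^sub>2 m0)) * ((deriv ^^ i) (M\<^sub>2 P\<^sub>1 P\<^sub>2 m0) 0 / fact i))"
proof -
  have "smooth_on V (\<lambda>m. (- 1) * (\<Delta> 0 0 m)\<^sup>2)"
    by (intro smooth_on_mult smooth_on_power smooth_on_const open_V smooth_Delta00)
  from extends_to_mult[OF extends_to_smooth[OF open_V m0 this] pole_2[OF assms]]
  show ?thesis unfolding domains
    by (rule extends_to_cong) (simp_all add: coefficients mult_ac del: One_nat_def)
qed

lemma smooth_prefactor_11: "smooth_on V (\<lambda>m. - 2 * fst m * (\<Delta> 0 0 m)\<^sup>2)"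
  by (intro smooth_on_mult smooth_on_power smooth_on_const open_V smooth_fst smooth_Delta00)

text \<open>For \<open>i \<ge> 2\<close> the number 1/i is not natural, so \<open>T\<^sub>2\<close>
  is regular at the resonance and enters with its value, while \<open>T\<^sub>1\<close> has the
  pole.\<close>

lemma residue_11_inverse:
  assumes m0: "m0 \<in> V" and i: "i \<ge> 2" "fst m0 = 1 / real i"
  shows "extends_to (({0<..} - res 1 1) \<times> W) (\<lambda>m. (fst m - fst m0) * \<Delta> 1 1 m) m0
    (2 * (\<Delta> 0 0 m0)\<^sup>2 * dsec fst 1 \<sigma>\<^sub>1 m0 * dsec snd 0 \<sigma>\<^sub>1 m0 ^ i
        / (L\<^sub>1 P\<^sub>1 P\<^sub>2 m0 (dsec snd 0 \<sigma>\<^sub>1 m0) * real i ^ 3)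
      * ((deriv ^^ i) (M\<^sub>1 P\<^sub>1 P\<^sub>2 m0) 0 / fact i) * T\<^sub>2 m0)"
proof -
  have nr: "fst m0 \<notin> range real" unfolding i(2) by (rule inverse_nat_not_nat[OF i(1)])
  have "extends_to (V \<inter> {m. 1 / fst m \<notin> range real} \<inter> {m. fst m \<notin> range real}) (\<lambda>m. (fst m - fst m0) * T\<^sub>1 m) m0
    (- (dsec fst 1 \<sigma>\<^sub>1 m0 * dsec snd 0 \<sigma>\<^sub>1 m0 ^ i / (L\<^sub>1 P\<^sub>1 P\<^sub>2 m0 (dsec snd 0 \<sigma>\<^sub>1 m0) * real i ^ 2)
      * ((deriv ^^ i) (M\<^sub>1 P\<^sub>1 P\<^sub>2 m0) 0 / fact i)))"
    by (rule extends_to_mono[OF pole_1[OF m0]]) (use i in auto)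
  from extends_to_mult[OF extends_to_smooth[OF open_V m0 smooth_prefactor_11]
    extends_to_mult[OF this extends_to_mono[OF section_2(1)[OF m0 nr] subset_UNIV]]]
  show ?thesis unfolding domains
    by (rule extends_to_cong) (simp_all add: coefficients i(2) power2_eq_square power3_eq_cube mult_ac del: One_nat_def)
qed

text \<open>The roles are reversed: \<open>T\<^sub>2\<close> has the pole, and
  \<open>T\<^sub>1\<close> is regular because 1/i is not natural.\<close>

lemma residue_11_nat:
  assumes m0: "m0 \<in> V" and i: "i \<ge> 2" "fst m0 = real i"
  shows "extends_to (({0<..} - res 1 1) \<times> W) (\<lambda>m. (fst m - fst m0) * \<Delta> 1 1 m) m0
    (- (2 * real i * (\<Delta> 0 0 m0)\<^sup>2 * dsec snd 1 \<sigma>\<^sub>2 m0 * dsec fst 0 \<sigma>\<^sub>2 m0 ^ i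
        / L\<^sub>2 P\<^sub>1 P\<^sub>2 m0 (dsec fst 0 \<sigma>\<^sub>2 m0))
      * ((deriv ^^ i) (M\<^sub>2 P\<^sub>1 P\<^sub>2 m0) 0 / fact i) * T\<^sub>1 m0)"
proof -
  have nr: "1 / fst m0 \<notin> range real" unfolding i(2) by (rule inverse_nat_not_nat[OF i(1)])
  have "extends_to (V \<inter> {m. 1 / fst m \<notin> range real} \<inter> {m. fst m \<notin> range real}) (\<lambda>m. (fst m - fst m0) * T\<^sub>2 m) m0
    (dsec snd 1 \<sigma>\<^sub>2 m0 * dsec fst 0 \<sigma>\<^sub>2 m0 ^ i / L\<^sub>2 P\<^sub>1 P\<^sub>2 m0 (dsec fst 0 \<sigma>\<^sub>2 m0)
      * ((deriv ^^ i) (M\<^sub>2 P\<^sub>1 P\<^sub>2 m0) 0 / fact i))"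
    by (rule extends_to_mono[OF pole_2[OF m0 i(2)]]) auto
  from extends_to_mult[OF extends_to_smooth[OF open_V m0 smooth_prefactor_11]
    extends_to_mult[OF this extends_to_mono[OF section_1(1)[OF m0 nr] subset_UNIV]]]
  show ?thesis unfolding domains
    by (rule extends_to_cong) (simp_all add: coefficients i(2) mult_ac del: One_nat_def)
qed

text \<open>At \<lambda> = 1 both factors have a simple pole, one factor \<lambda> - 1 being spent
  on each; the opposite signs of the two residues make the limit positive in front.\<close>

lemma residue_11_one:
  assumes m0: "m0 \<in> V" and i: "fst m0 = 1"
  shows "extends_to (({0<..} - res 1 1) \<times> W) (\<lambda>m. (fst m - 1)\<^sup>2 * \<Delta> 1 1 m) m0
    (2 * (\<Delta> 0 0 m0)\<^sup>2
       * (dsec fst 1 \<sigma>\<^sub>1 m0 * dsec snd 0 \<sigma>\<^sub>1 m0 * deriv (M\<^sub>1 P\<^sub>1 P\<^sub>2 m0) 0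
           / L\<^sub>1 P\<^sub>1 P\<^sub>2 m0 (dsec snd 0 \<sigma>\<^sub>1 m0))
       * (dsec snd 1 \<sigma>\<^sub>2 m0 * dsec fst 0 \<sigma>\<^sub>2 m0 * deriv (M\<^sub>2 P\<^sub>1 P\<^sub>2 m0) 0
           / L\<^sub>2 P\<^sub>1 P\<^sub>2 m0 (dsec fst 0 \<sigma>\<^sub>2 m0)))"
proof -
  let ?A = "V \<inter> {m. 1 / fst m \<notin> range real} \<inter> {m. fst m \<notin> range real}"
  have p1: "extends_to (V \<inter> {m. 1 / fst m \<notin> range real}) (\<lambda>m. (fst m - fst m0) * T\<^sub>1 m) m0
    (- (dsec fst 1 \<sigma>\<^sub>1 m0 * dsec snd 0 \<sigma>\<^sub>1 m0 ^ 1 / (L\<^sub>1 P\<^sub>1 P\<^sub>2 m0 (dsec snd 0 \<sigma>\<^sub>1 m0) * real 1 ^ 2)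
      * ((deriv ^^ 1) (M\<^sub>1 P\<^sub>1 P\<^sub>2 m0) 0 / fact 1)))"
    by (rule pole_1[OF m0]) (use i in auto)
  have p2: "extends_to (V \<inter> {m. fst m \<notin> range real}) (\<lambda>m. (fst m - fst m0) * T\<^sub>2 m) m0
    (dsec snd 1 \<sigma>\<^sub>2 m0 * dsec fst 0 \<sigma>\<^sub>2 m0 ^ 1 / L\<^sub>2 P\<^sub>1 P\<^sub>2 m0 (dsec fst 0 \<sigma>\<^sub>2 m0)
      * ((deriv ^^ 1) (M\<^sub>2 P\<^sub>1 P\<^sub>2 m0) 0 / fact 1))"
    by (rule pole_2[OF m0]) (use i in auto)
  have d: "(deriv ^^ 1) f = deriv f" for f :: "real \<Rightarrow> real" by simp
  have "?A \<subseteq> V \<inter> {m. 1 / fst m \<notin> range real}" "?A \<subseteq> V \<inter> {m. fst m \<notin> range real}" by blast+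
  from extends_to_mult[OF extends_to_smooth[OF open_V m0 smooth_prefactor_11]
    extends_to_mult[OF extends_to_mono[OF p1 this(1)] extends_to_mono[OF p2 this(2)]]]
  show ?thesis unfolding domains
    by (rule extends_to_cong) (simp_all add: coefficients i d power2_eq_square mult_ac del: One_nat_def)
qed

end

theorem proposition3p2:
  fixes W :: "(real ^ 'n) set"
    and U :: "(real \<times> real) set"
    and n :: "nat \<times> nat"
    and P\<^sub>1 P\<^sub>2 :: "real \<times> real \<Rightarrow> real \<times> (real ^ 'n) \<Rightarrow> real"
    and \<sigma>\<^sub>1 \<sigma>\<^sub>2 :: "real \<Rightarrow> real \<times> (real ^ 'n) \<Rightarrow> real \<times> real"
    and \<epsilon> \<rho> :: real
    and D :: "real \<Rightarrow> real \<times> (real ^ 'n) \<Rightarrow> real"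
    and \<Delta> :: "nat \<Rightarrow> nat \<Rightarrow> real \<times> (real ^ 'n) \<Rightarrow> real"
  assumes W: "open W"
    and U: "open U" "(0, 0) \<in> U"
    and P_smooth: "smooth_on (U \<times> ({0<..} \<times> W)) (\<lambda>(x, m). P\<^sub>1 x m)"
      "smooth_on (U \<times> ({0<..} \<times> W)) (\<lambda>(x, m). P\<^sub>2 x m)"
    and P1_pos: "\<And>x\<^sub>1 m. (x\<^sub>1, 0) \<in> U \<Longrightarrow> m \<in> {0<..} \<times> W \<Longrightarrow> P\<^sub>1 (x\<^sub>1, 0) m > 0"
    and P2_neg: "\<And>x\<^sub>2 m. (0, x\<^sub>2) \<in> U \<Longrightarrow> m \<in> {0<..} \<times> W \<Longrightarrow> P\<^sub>2 (0, x\<^sub>2) m < 0"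
    and ratio: "\<And>m. m \<in> {0<..} \<times> W \<Longrightarrow> fst m = - P\<^sub>2 (0, 0) m / P\<^sub>1 (0, 0) m"
    and eps: "\<epsilon> > 0"
    and sec_smooth: "smooth_on ({-\<epsilon><..<\<epsilon>} \<times> ({0<..} \<times> W)) (\<lambda>(s, m). \<sigma>\<^sub>1 s m)"
      "smooth_on ({-\<epsilon><..<\<epsilon>} \<times> ({0<..} \<times> W)) (\<lambda>(s, m). \<sigma>\<^sub>2 s m)"
    and sec_base: "\<And>m. m \<in> {0<..} \<times> W \<Longrightarrow> \<sigma>\<^sub>1 0 m \<in> {(0, x\<^sub>2) |x\<^sub>2. x\<^sub>2 > 0}"
      "\<And>m. m \<in> {0<..} \<times> W \<Longrightarrow> \<sigma>\<^sub>2 0 m \<in> {(x\<^sub>1, 0) |x\<^sub>1. x\<^sub>1 > 0}"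
    and sec_transverse: "\<And>m. m \<in> {0<..} \<times> W \<Longrightarrow> transverse_at_axis P\<^sub>1 P\<^sub>2 \<sigma>\<^sub>1 m"
      "\<And>m. m \<in> {0<..} \<times> W \<Longrightarrow> transverse_at_axis P\<^sub>1 P\<^sub>2 \<sigma>\<^sub>2 m"
    and sec_orient: "\<And>m. m \<in> {0<..} \<times> W \<Longrightarrow> dsec fst 1 \<sigma>\<^sub>1 m > 0"
      "\<And>m. m \<in> {0<..} \<times> W \<Longrightarrow> dsec snd 1 \<sigma>\<^sub>2 m > 0"
    and rho: "\<rho> > 0"
    and axes: "\<And>m. m \<in> {0<..} \<times> W \<Longrightarrow> {0} \<times> I\<^sub>1 \<rho> \<sigma>\<^sub>1 m \<union> I\<^sub>2 \<rho> \<sigma>\<^sub>2 m \<times> {0} \<subseteq> U"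
    and dulac: "is_dulac_map W U n P\<^sub>1 P\<^sub>2 \<sigma>\<^sub>1 \<sigma>\<^sub>2 D"
    and Delta_smooth: "\<And>i j. smooth_on (({0<..} - res i j) \<times> W) (\<Delta> i j)"
    and expansion: "\<And>L l\<^sub>0. L > 0 \<Longrightarrow> l\<^sub>0 > 0 \<Longrightarrow> l\<^sub>0 \<notin> res_upto (L - l\<^sub>0) \<Longrightarrow>
      flat_on L ({l\<^sub>0} \<times> W) (\<lambda>(s, m). D s m - s powr fst m *
        (\<Sum>(i, j)\<in>idx l\<^sub>0 (L - l\<^sub>0). \<Delta> i j m * s powr (real i + fst m * real j)))"
    and Delta00_pos: "\<And>m. m \<in> {0<..} \<times> W \<Longrightarrow> \<Delta> 0 0 m > 0"
  shows "res 1 0 = {1 / real m |m. m \<ge> 1} \<and>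
      res 0 1 = {real m |m. m \<ge> 1} \<and>
      res 1 1 = {real m |m. m \<ge> 1} \<union> {1 / real m |m. m \<ge> 1} \<and>
      (\<forall>l\<^sub>0\<in>res 1 0. \<forall>\<mu>\<^sub>0\<in>W. let m\<^sub>0 = (l\<^sub>0, \<mu>\<^sub>0) in
        extends_smoothly_at (({0<..} - res 1 0) \<times> W) (\<lambda>m. (fst m - l\<^sub>0) * \<Delta> 1 0 m) m\<^sub>0 \<and>
        (\<forall>i\<ge>1. l\<^sub>0 = 1 / real i \<longrightarrow>
          ((\<lambda>m. (fst m - l\<^sub>0) * \<Delta> 1 0 m) \<longlongrightarrow>
            - (\<Delta> 0 0 m\<^sub>0 * dsec fst 1 \<sigma>\<^sub>1 m\<^sub>0 * dsec snd 0 \<sigma>\<^sub>1 m\<^sub>0 ^ i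
                / (L\<^sub>1 P\<^sub>1 P\<^sub>2 m\<^sub>0 (dsec snd 0 \<sigma>\<^sub>1 m\<^sub>0) * real i ^ 3))
              * ((deriv ^^ i) (M\<^sub>1 P\<^sub>1 P\<^sub>2 m\<^sub>0) 0 / fact i))
          (at m\<^sub>0 within ({0<..} - res 1 0) \<times> W))) \<and>
      (\<forall>l\<^sub>0\<in>res 0 1. \<forall>\<mu>\<^sub>0\<in>W. let m\<^sub>0 = (l\<^sub>0, \<mu>\<^sub>0) in
        extends_smoothly_at (({0<..} - res 0 1) \<times> W) (\<lambda>m. (fst m - l\<^sub>0) * \<Delta> 0 1 m) m\<^sub>0 \<and>
        (\<forall>i\<ge>1. l\<^sub>0 = real i \<longrightarrow>
          ((\<lambda>m. (fst m - l\<^sub>0) * \<Delta> 0 1 m) \<longlongrightarrow>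
            - ((\<Delta> 0 0 m\<^sub>0)\<^sup>2 * dsec snd 1 \<sigma>\<^sub>2 m\<^sub>0 * dsec fst 0 \<sigma>\<^sub>2 m\<^sub>0 ^ i
                / L\<^sub>2 P\<^sub>1 P\<^sub>2 m\<^sub>0 (dsec fst 0 \<sigma>\<^sub>2 m\<^sub>0))
              * ((deriv ^^ i) (M\<^sub>2 P\<^sub>1 P\<^sub>2 m\<^sub>0) 0 / fact i))
          (at m\<^sub>0 within ({0<..} - res 0 1) \<times> W))) \<and>
      (\<forall>l\<^sub>0\<in>res 1 1 - {1}. \<forall>\<mu>\<^sub>0\<in>W. let m\<^sub>0 = (l\<^sub>0, \<mu>\<^sub>0) in
        extends_smoothly_at (({0<..} - res 1 1) \<times> W) (\<lambda>m. (fst m - l\<^sub>0) * \<Delta> 1 1 m) m\<^sub>0 \<and>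
        (\<forall>i\<ge>2. l\<^sub>0 = 1 / real i \<longrightarrow>
          ((\<lambda>m. (fst m - l\<^sub>0) * \<Delta> 1 1 m) \<longlongrightarrow>
            2 * (\<Delta> 0 0 m\<^sub>0)\<^sup>2 * dsec fst 1 \<sigma>\<^sub>1 m\<^sub>0 * dsec snd 0 \<sigma>\<^sub>1 m\<^sub>0 ^ i
                / (L\<^sub>1 P\<^sub>1 P\<^sub>2 m\<^sub>0 (dsec snd 0 \<sigma>\<^sub>1 m\<^sub>0) * real i ^ 3)
              * ((deriv ^^ i) (M\<^sub>1 P\<^sub>1 P\<^sub>2 m\<^sub>0) 0 / fact i) * S\<^sub>2 \<rho> P\<^sub>1 P\<^sub>2 \<sigma>\<^sub>2 m\<^sub>0)
          (at m\<^sub>0 within ({0<..} - res 1 1) \<times> W)) \<and>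
        (\<forall>i\<ge>2. l\<^sub>0 = real i \<longrightarrow>
          ((\<lambda>m. (fst m - l\<^sub>0) * \<Delta> 1 1 m) \<longlongrightarrow>
            - (2 * real i * (\<Delta> 0 0 m\<^sub>0)\<^sup>2 * dsec snd 1 \<sigma>\<^sub>2 m\<^sub>0 * dsec fst 0 \<sigma>\<^sub>2 m\<^sub>0 ^ i
                / L\<^sub>2 P\<^sub>1 P\<^sub>2 m\<^sub>0 (dsec fst 0 \<sigma>\<^sub>2 m\<^sub>0))
              * ((deriv ^^ i) (M\<^sub>2 P\<^sub>1 P\<^sub>2 m\<^sub>0) 0 / fact i) * S\<^sub>1 \<rho> P\<^sub>1 P\<^sub>2 \<sigma>\<^sub>1 m\<^sub>0)
          (at m\<^sub>0 within ({0<..} - res 1 1) \<times> W))) \<and>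
      (\<forall>\<mu>\<^sub>0\<in>W. let m\<^sub>0 = (1, \<mu>\<^sub>0) in
        extends_smoothly_at (({0<..} - res 1 1) \<times> W) (\<lambda>m. (fst m - 1)\<^sup>2 * \<Delta> 1 1 m) m\<^sub>0 \<and>
        ((\<lambda>m. (fst m - 1)\<^sup>2 * \<Delta> 1 1 m) \<longlongrightarrow>
          2 * (\<Delta> 0 0 m\<^sub>0)\<^sup>2
            * (dsec fst 1 \<sigma>\<^sub>1 m\<^sub>0 * dsec snd 0 \<sigma>\<^sub>1 m\<^sub>0 * deriv (M\<^sub>1 P\<^sub>1 P\<^sub>2 m\<^sub>0) 0
                / L\<^sub>1 P\<^sub>1 P\<^sub>2 m\<^sub>0 (dsec snd 0 \<sigma>\<^sub>1 m\<^sub>0))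
            * (dsec snd 1 \<sigma>\<^sub>2 m\<^sub>0 * dsec fst 0 \<sigma>\<^sub>2 m\<^sub>0 * deriv (M\<^sub>2 P\<^sub>1 P\<^sub>2 m\<^sub>0) 0
                / L\<^sub>2 P\<^sub>1 P\<^sub>2 m\<^sub>0 (dsec fst 0 \<sigma>\<^sub>2 m\<^sub>0)))
        (at m\<^sub>0 within ({0<..} - res 1 1) \<times> W))"
proof -
  interpret dulac_setting W U n P\<^sub>1 P\<^sub>2 \<sigma>\<^sub>1 \<sigma>\<^sub>2 \<epsilon> \<rho> D \<Delta>
    by (rule dulac_setting.intro; fact assms)
  have V: "(l, \<mu>) \<in> V" if "l > 0" "\<mu> \<in> W" for l \<mu> using that by simp
  have a: "let m\<^sub>0 = (l\<^sub>0, \<mu>\<^sub>0) in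
        extends_smoothly_at (({0<..} - res 1 0) \<times> W) (\<lambda>m. (fst m - l\<^sub>0) * \<Delta> 1 0 m) m\<^sub>0 \<and>
        (\<forall>i\<ge>1. l\<^sub>0 = 1 / real i \<longrightarrow>
          ((\<lambda>m. (fst m - l\<^sub>0) * \<Delta> 1 0 m) \<longlongrightarrow>
            - (\<Delta> 0 0 m\<^sub>0 * dsec fst 1 \<sigma>\<^sub>1 m\<^sub>0 * dsec snd 0 \<sigma>\<^sub>1 m\<^sub>0 ^ i
                / (L\<^sub>1 P\<^sub>1 P\<^sub>2 m\<^sub>0 (dsec snd 0 \<sigma>\<^sub>1 m\<^sub>0) * real i ^ 3))
              * ((deriv ^^ i) (M\<^sub>1 P\<^sub>1 P\<^sub>2 m\<^sub>0) 0 / fact i))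
          (at m\<^sub>0 within ({0<..} - res 1 0) \<times> W))" if "l\<^sub>0 \<in> res 1 0" "\<mu>\<^sub>0 \<in> W" for l\<^sub>0 \<mu>\<^sub>0
  proof -
    obtain i where i: "i \<ge> 1" "l\<^sub>0 = 1 / real i" using \<open>l\<^sub>0 \<in> res 1 0\<close> unfolding res_1_0 by blast
    then have "l\<^sub>0 > 0" by simp
    note r = residue_10[OF V[OF this \<open>\<mu>\<^sub>0 \<in> W\<close>], unfolded fst_conv]
    show ?thesis unfolding Let_def
      by (intro conjI allI impI extends_to_imp(1)[OF r[OF i]] extends_to_imp(2)[OF r])
  qed
  have b: "let m\<^sub>0 = (l\<^sub>0, \<mu>\<^sub>0) in
        extends_smoothly_at (({0<..} - res 0 1) \<times> W) (\<lambda>m. (fst m - l\<^sub>0) * \<Delta> 0 1 m) m\<^sub>0 \<and>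
        (\<forall>i\<ge>1. l\<^sub>0 = real i \<longrightarrow>
          ((\<lambda>m. (fst m - l\<^sub>0) * \<Delta> 0 1 m) \<longlongrightarrow>
            - ((\<Delta> 0 0 m\<^sub>0)\<^sup>2 * dsec snd 1 \<sigma>\<^sub>2 m\<^sub>0 * dsec fst 0 \<sigma>\<^sub>2 m\<^sub>0 ^ i
                / L\<^sub>2 P\<^sub>1 P\<^sub>2 m\<^sub>0 (dsec fst 0 \<sigma>\<^sub>2 m\<^sub>0))
              * ((deriv ^^ i) (M\<^sub>2 P\<^sub>1 P\<^sub>2 m\<^sub>0) 0 / fact i))
          (at m\<^sub>0 within ({0<..} - res 0 1) \<times> W))" if "l\<^sub>0 \<in> res 0 1" "\<mu>\<^sub>0 \<in> W" for l\<^sub>0 \<mu>\<^sub>0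
  proof -
    obtain i where i: "i \<ge> 1" "l\<^sub>0 = real i" using \<open>l\<^sub>0 \<in> res 0 1\<close> unfolding res_0_1 by blast
    then have "l\<^sub>0 > 0" by simp
    note r = residue_01[OF V[OF this \<open>\<mu>\<^sub>0 \<in> W\<close>], unfolded fst_conv]
    show ?thesis unfolding Let_def
      by (intro conjI allI impI extends_to_imp(1)[OF r[OF i(2)]] extends_to_imp(2)[OF r])
  qed
  have c: "let m\<^sub>0 = (l\<^sub>0, \<mu>\<^sub>0) in
        extends_smoothly_at (({0<..} - res 1 1) \<times> W) (\<lambda>m. (fst m - l\<^sub>0) * \<Delta> 1 1 m) m\<^sub>0 \<and>
        (\<forall>i\<ge>2. l\<^sub>0 = 1 / real i \<longrightarrow>
          ((\<lambda>m. (fst m - l\<^sub>0) * \<Delta> 1 1 m) \<longlongrightarrow>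
            2 * (\<Delta> 0 0 m\<^sub>0)\<^sup>2 * dsec fst 1 \<sigma>\<^sub>1 m\<^sub>0 * dsec snd 0 \<sigma>\<^sub>1 m\<^sub>0 ^ i
                / (L\<^sub>1 P\<^sub>1 P\<^sub>2 m\<^sub>0 (dsec snd 0 \<sigma>\<^sub>1 m\<^sub>0) * real i ^ 3)
              * ((deriv ^^ i) (M\<^sub>1 P\<^sub>1 P\<^sub>2 m\<^sub>0) 0 / fact i) * S\<^sub>2 \<rho> P\<^sub>1 P\<^sub>2 \<sigma>\<^sub>2 m\<^sub>0)
          (at m\<^sub>0 within ({0<..} - res 1 1) \<times> W)) \<and>
        (\<forall>i\<ge>2. l\<^sub>0 = real i \<longrightarrow>
          ((\<lambda>m. (fst m - l\<^sub>0) * \<Delta> 1 1 m) \<longlongrightarrow>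
            - (2 * real i * (\<Delta> 0 0 m\<^sub>0)\<^sup>2 * dsec snd 1 \<sigma>\<^sub>2 m\<^sub>0 * dsec fst 0 \<sigma>\<^sub>2 m\<^sub>0 ^ i
                / L\<^sub>2 P\<^sub>1 P\<^sub>2 m\<^sub>0 (dsec fst 0 \<sigma>\<^sub>2 m\<^sub>0))
              * ((deriv ^^ i) (M\<^sub>2 P\<^sub>1 P\<^sub>2 m\<^sub>0) 0 / fact i) * S\<^sub>1 \<rho> P\<^sub>1 P\<^sub>2 \<sigma>\<^sub>1 m\<^sub>0)
          (at m\<^sub>0 within ({0<..} - res 1 1) \<times> W))" if l: "l\<^sub>0 \<in> res 1 1 - {1}" "\<mu>\<^sub>0 \<in> W" for l\<^sub>0 \<mu>\<^sub>0
  proof -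
    obtain i where i: "i \<ge> 1" "l\<^sub>0 = real i \<or> l\<^sub>0 = 1 / real i" using l(1) unfolding res_1_1 by blast
    then have "l\<^sub>0 > 0" by auto
    note r = residue_11_inverse[OF V[OF this l(2)], unfolded fst_conv]
      residue_11_nat[OF V[OF \<open>l\<^sub>0 > 0\<close> l(2)], unfolded fst_conv]
    \<comment> \<open>Both descriptions of a resonance give \<lambda> = 1 for \<open>i = 1\<close>,
      the double pole treated separately.\<close>
    have "i \<ge> 2" using i l(1) by (cases "i = 1") auto
    then have "extends_smoothly_at (({0<..} - res 1 1) \<times> W) (\<lambda>m. (fst m - l\<^sub>0) * \<Delta> 1 1 m) (l\<^sub>0, \<mu>\<^sub>0)"
      using i(2) extends_to_imp(1)[OF r(1)] extends_to_imp(1)[OF r(2)] by blast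
    then show ?thesis unfolding Let_def
      by (intro conjI allI impI extends_to_imp(2)[OF r(1)] extends_to_imp(2)[OF r(2)])
  qed
  have d: "let m\<^sub>0 = (1, \<mu>\<^sub>0) in
        extends_smoothly_at (({0<..} - res 1 1) \<times> W) (\<lambda>m. (fst m - 1)\<^sup>2 * \<Delta> 1 1 m) m\<^sub>0 \<and>
        ((\<lambda>m. (fst m - 1)\<^sup>2 * \<Delta> 1 1 m) \<longlongrightarrow>
          2 * (\<Delta> 0 0 m\<^sub>0)\<^sup>2
            * (dsec fst 1 \<sigma>\<^sub>1 m\<^sub>0 * dsec snd 0 \<sigma>\<^sub>1 m\<^sub>0 * deriv (M\<^sub>1 P\<^sub>1 P\<^sub>2 m\<^sub>0) 0
                / L\<^sub>1 P\<^sub>1 P\<^sub>2 m\<^sub>0 (dsec snd 0 \<sigma>\<^sub>1 m\<^sub>0))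
            * (dsec snd 1 \<sigma>\<^sub>2 m\<^sub>0 * dsec fst 0 \<sigma>\<^sub>2 m\<^sub>0 * deriv (M\<^sub>2 P\<^sub>1 P\<^sub>2 m\<^sub>0) 0
                / L\<^sub>2 P\<^sub>1 P\<^sub>2 m\<^sub>0 (dsec fst 0 \<sigma>\<^sub>2 m\<^sub>0)))
        (at m\<^sub>0 within ({0<..} - res 1 1) \<times> W)" if "\<mu>\<^sub>0 \<in> W" for \<mu>\<^sub>0
    unfolding Let_def using extends_to_imp[OF residue_11_one[OF V[OF zero_less_one that] fst_conv]] by (rule conjI)
  show ?thesis
    by (intro conjI ballI res_1_0 res_0_1 res_1_1 a b c d)
qed

end
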